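(* Let $G$ be a graph with $n$ vertices and treewidth $w$ whose edge arrival functions are continuous and piecewise linear, and let $s,d$ be two terminal vertices. Then the end-to-end arrival function $A_{(s,d)}$ can be computed in $n^{O(\log^2 w)}$ time.
   Context: Each edge $uv$ of the undirected graph carries arrival functions $A_{uv},A_{vu}:\mathbb{R}^+\cup\{\infty\}\to\mathbb{R}^+\cup\{\infty\}$: departing $u$ at time $t$ along $uv$ one arrives at $v$ at time $A_{uv}(t)$ (value $\infty$ meaning not traversable). They satisfy $A_{uv}(t)\ge t$ and are nondecreasing (FIFO). The arrival function of a path is the composition of its edges' arrival functions in order; $A_{(s,d)}(t)$ is the minimum over all $s$-to-$d$ paths $P$ of $A_P(t)$, the end-to-end arrival function. Computing it means producing its piecewise linear representation (list of breakpoints and linear pieces).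
   Formalization: The time bound is (1+K)·n^{O(log² w)}, K being the total number of breakpoints of the edge arrival functions, and w ≤ 1 is read as w = 2; without this the bound fails (one edge with many breakpoints, or w = 1 where the exponent is 0). *)

theory Defs
  imports
    Complex_Main
    "HOL-Library.Extended_Nonnegative_Real"
    "Graph_Theory.Graph_Theory"
begin

section \<open>Treewidth\<close>

text \<open>
  A simple undirected graph is a \<^locale>\<open>pair_graph\<close>: finite, loop-free, and with both
  arcs \<open>(u, v)\<close> and \<open>(v, u)\<close> for every edge \<open>uv\<close>.

  The constant \<open>Digraph_Component.tree\<close> is not usable here: it only forbids directed
  cycles, so that every edge of a symmetric digraph is a cycle of length 2, while an acyclic
  orientation of a triangle counts as a tree.
\<close>

definition undirected_tree :: "'a pair_pre_digraph \<Rightarrow> bool" where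
  "undirected_tree T \<longleftrightarrow>
     pair_graph T \<and> Digraph_Component.connected (with_proj T) \<and>
     \<not> (\<exists>p. pre_digraph.cycle (with_proj T) p \<and> 3 \<le> length p)"

definition tree_decomposition ::
  "'a pair_pre_digraph \<Rightarrow> 'b pair_pre_digraph \<Rightarrow> ('b \<Rightarrow> 'a set) \<Rightarrow> bool" where
  "tree_decomposition G T X \<longleftrightarrow>
     undirected_tree T \<and>
     (\<Union>x\<in>pverts T. X x) = pverts G \<and>
     (\<forall>(u, v)\<in>parcs G. \<exists>x\<in>pverts T. u \<in> X x \<and> v \<in> X x) \<and>
     (\<forall>v\<in>pverts G.
        Digraph_Component.connected (with_proj T \<restriction> {x \<in> pverts T. v \<in> X x}))"

definition decomposition_width :: "'b pair_pre_digraph \<Rightarrow> ('b \<Rightarrow> 'a set) \<Rightarrow> nat" where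
  "decomposition_width T X = Max ((\<lambda>x. card (X x)) ` pverts T) - 1"

text \<open>Trees are finite, so natural numbers suffice as nodes of the decomposition tree.\<close>

definition treewidth :: "'a pair_pre_digraph \<Rightarrow> nat" where
  "treewidth G = (LEAST w. \<exists>(T :: nat pair_pre_digraph) X.
     tree_decomposition G T X \<and> decomposition_width T X = w)"


section \<open>Arrival functions\<close>

definition arrival_function :: "(ennreal \<Rightarrow> ennreal) \<Rightarrow> bool" where
  "arrival_function f \<longleftrightarrow> (\<forall>t. t \<le> f t) \<and> mono f"

text \<open>
  \<open>A (u, v)\<close> is the arrival function of the edge \<open>uv\<close> when traversed from \<open>u\<close> to \<open>v\<close>, and
  \<open>fold A p\<close> composes the functions along \<open>p\<close>, the first arc of \<open>p\<close> being applied first.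
  The set of paths is finite, so the infimum is a minimum, except that it is \<open>\<infinity>\<close> if there is
  no path.
\<close>

definition end_to_end ::
  "'a pair_pre_digraph \<Rightarrow> ('a \<times> 'a \<Rightarrow> ennreal \<Rightarrow> ennreal) \<Rightarrow> 'a \<Rightarrow> 'a \<Rightarrow> ennreal \<Rightarrow> ennreal" where
  "end_to_end G A s d t = (INF p\<in>{p. pre_digraph.apath (with_proj G) s p d}. fold A p t)"


section \<open>Piecewise linear representations\<close>

text \<open>
  A piece \<open>(x, Some (a, b))\<close> starts at time \<open>x\<close> and has the values \<open>a * t + b\<close>; a piece
  \<open>(x, None)\<close> is constantly \<open>\<infinity>\<close>.
\<close>

type_synonym piece = "real \<times> (real \<times> real) option"

fun linear_value :: "(real \<times> real) option \<Rightarrow> real \<Rightarrow> ereal" where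
  "linear_value (Some (a, b)) t = ereal (a * t + b)"
| "linear_value None t = \<infinity>"

text \<open>
  A piece extends from its start to the start of the next piece, the last one to infinity.
  Adjacent pieces are different, so that every start other than \<open>0\<close> is a genuine breakpoint and
  the list is determined by \<open>f\<close>. Only finite times are mentioned: arrival functions
  always map \<open>\<infinity>\<close> to \<open>\<infinity>\<close>. The values are compared in \<^typ>\<open>ereal\<close> because
  \<^const>\<open>ennreal\<close> would truncate negative values of a piece to \<open>0\<close>.
\<close>

definition pl_representation :: "(ennreal \<Rightarrow> ennreal) \<Rightarrow> piece list \<Rightarrow> bool" where
  "pl_representation f ps \<longleftrightarrow>
     ps \<noteq> [] \<and> fst (hd ps) = 0 \<and>
     sorted_wrt (<) (map fst ps) \<and> distinct_adj (map snd ps) \<and>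
     (\<forall>i<length ps. \<forall>t\<ge>fst (ps ! i). (Suc i < length ps \<longrightarrow> t < fst (ps ! Suc i)) \<longrightarrow>
        enn2ereal (f (ennreal t)) = linear_value (snd (ps ! i)) t)"

definition num_breakpoints :: "piece list \<Rightarrow> nat" where
  "num_breakpoints ps = length ps - 1"


section \<open>The real RAM\<close>

text \<open>
  A real RAM has registers and random access memory for natural numbers, and the same for real
  numbers. On reals it has exact field arithmetic and comparison; on natural numbers
  only addition, truncated subtraction and comparison, so that numbers cannot
  grow faster than exponentially with the running time. There is no conversion (such as rounding)
  from reals to natural numbers. Literals are natural numbers, so that a program cannot contain
  an infinite amount of information.
\<close>

datatype nexp =
    NLit nat
  | NReg nat
  | NMem nexp
  | NAdd nexp nexp
  | NSub nexp nexp

datatype rexp =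
    RLit nat
  | RReg nat
  | RMem nexp
  | RAdd rexp rexp
  | RSub rexp rexp
  | RMul rexp rexp
  | RDiv rexp rexp

datatype bexp =
    NLess nexp nexp
  | RLess rexp rexp
  | BNot bexp
  | BAnd bexp bexp

datatype com =
    Skip
  | SetNReg nat nexp
  | SetNMem nexp nexp
  | SetRReg nat rexp
  | SetRMem nexp rexp
  | Seq com com
  | Cond bexp com com
  | Loop bexp com

record ram_state =
  nreg :: "nat \<Rightarrow> nat"
  nmem :: "nat \<Rightarrow> nat"
  rreg :: "nat \<Rightarrow> real"
  rmem :: "nat \<Rightarrow> real"

primrec nval :: "nexp \<Rightarrow> ram_state \<Rightarrow> nat" where
  "nval (NLit k) \<sigma> = k"
| "nval (NReg i) \<sigma> = nreg \<sigma> i"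
| "nval (NMem e) \<sigma> = nmem \<sigma> (nval e \<sigma>)"
| "nval (NAdd e1 e2) \<sigma> = nval e1 \<sigma> + nval e2 \<sigma>"
| "nval (NSub e1 e2) \<sigma> = nval e1 \<sigma> - nval e2 \<sigma>"

primrec rval :: "rexp \<Rightarrow> ram_state \<Rightarrow> real" where
  "rval (RLit k) \<sigma> = real k"
| "rval (RReg i) \<sigma> = rreg \<sigma> i"
| "rval (RMem e) \<sigma> = rmem \<sigma> (nval e \<sigma>)"
| "rval (RAdd e1 e2) \<sigma> = rval e1 \<sigma> + rval e2 \<sigma>"
| "rval (RSub e1 e2) \<sigma> = rval e1 \<sigma> - rval e2 \<sigma>"
| "rval (RMul e1 e2) \<sigma> = rval e1 \<sigma> * rval e2 \<sigma>"
| "rval (RDiv e1 e2) \<sigma> = rval e1 \<sigma> / rval e2 \<sigma>"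

primrec bval :: "bexp \<Rightarrow> ram_state \<Rightarrow> bool" where
  "bval (NLess e1 e2) \<sigma> \<longleftrightarrow> nval e1 \<sigma> < nval e2 \<sigma>"
| "bval (RLess e1 e2) \<sigma> \<longleftrightarrow> rval e1 \<sigma> < rval e2 \<sigma>"
| "bval (BNot b) \<sigma> \<longleftrightarrow> \<not> bval b \<sigma>"
| "bval (BAnd b1 b2) \<sigma> \<longleftrightarrow> bval b1 \<sigma> \<and> bval b2 \<sigma>"

text \<open>
  \<open>exec c \<sigma> k \<tau>\<close>: started in \<open>\<sigma>\<close>, the program \<open>c\<close> halts in \<open>\<tau>\<close> after \<open>k\<close> steps. An assignment
  or a test is one step; the expressions of a fixed program have bounded size, so this differs
  from counting single operations by a constant factor only.
\<close>

inductive exec :: "com \<Rightarrow> ram_state \<Rightarrow> nat \<Rightarrow> ram_state \<Rightarrow> bool" where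
  Skip: "exec Skip \<sigma> 1 \<sigma>"
| SetNReg: "exec (SetNReg i e) \<sigma> 1 (\<sigma>\<lparr>nreg := (nreg \<sigma>)(i := nval e \<sigma>)\<rparr>)"
| SetNMem: "exec (SetNMem a e) \<sigma> 1 (\<sigma>\<lparr>nmem := (nmem \<sigma>)(nval a \<sigma> := nval e \<sigma>)\<rparr>)"
| SetRReg: "exec (SetRReg i e) \<sigma> 1 (\<sigma>\<lparr>rreg := (rreg \<sigma>)(i := rval e \<sigma>)\<rparr>)"
| SetRMem: "exec (SetRMem a e) \<sigma> 1 (\<sigma>\<lparr>rmem := (rmem \<sigma>)(nval a \<sigma> := rval e \<sigma>)\<rparr>)"
| Seq: "exec c1 \<sigma> k1 \<rho> \<Longrightarrow> exec c2 \<rho> k2 \<tau> \<Longrightarrow> exec (Seq c1 c2) \<sigma> (k1 + k2) \<tau>"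
| CondTrue: "bval b \<sigma> \<Longrightarrow> exec c1 \<sigma> k \<tau> \<Longrightarrow> exec (Cond b c1 c2) \<sigma> (Suc k) \<tau>"
| CondFalse: "\<not> bval b \<sigma> \<Longrightarrow> exec c2 \<sigma> k \<tau> \<Longrightarrow> exec (Cond b c1 c2) \<sigma> (Suc k) \<tau>"
| LoopFalse: "\<not> bval b \<sigma> \<Longrightarrow> exec (Loop b c) \<sigma> 1 \<sigma>"
| LoopTrue: "bval b \<sigma> \<Longrightarrow> exec c \<sigma> k1 \<rho> \<Longrightarrow> exec (Loop b c) \<rho> k2 \<tau> \<Longrightarrow>
    exec (Loop b c) \<sigma> (Suc (k1 + k2)) \<tau>"

inductive_cases exec_SkipE: "exec Skip \<sigma> k \<tau>"
inductive_cases exec_SetNRegE: "exec (SetNReg i e) \<sigma> k \<tau>"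
inductive_cases exec_SetNMemE: "exec (SetNMem a e) \<sigma> k \<tau>"
inductive_cases exec_SetRRegE: "exec (SetRReg i e) \<sigma> k \<tau>"
inductive_cases exec_SetRMemE: "exec (SetRMem a e) \<sigma> k \<tau>"
inductive_cases exec_SeqE: "exec (Seq c1 c2) \<sigma> k \<tau>"
inductive_cases exec_CondE: "exec (Cond b c1 c2) \<sigma> k \<tau>"
inductive_cases exec_LoopE: "exec (Loop b c) \<sigma> k \<tau>"

lemma exec_deterministic:
  assumes "exec c \<sigma> k \<tau>" and "exec c \<sigma> k' \<tau>'"
  shows "k' = k \<and> \<tau>' = \<tau>"
  using assms
proof (induction arbitrary: k' \<tau>' rule: exec.induct)
  case Skip
  then show ?case by (auto elim: exec_SkipE)
next
  case SetNReg
  then show ?case by (auto elim: exec_SetNRegE)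
next
  case SetNMem
  then show ?case by (auto elim: exec_SetNMemE)
next
  case SetRReg
  then show ?case by (auto elim: exec_SetRRegE)
next
  case SetRMem
  then show ?case by (auto elim: exec_SetRMemE)
next
  case Seq
  from Seq.prems show ?case by (rule exec_SeqE) (use Seq.IH in blast)
next
  case CondTrue
  from CondTrue.prems show ?case by (rule exec_CondE) (use CondTrue.IH CondTrue.hyps in blast)+
next
  case CondFalse
  from CondFalse.prems show ?case by (rule exec_CondE) (use CondFalse.IH CondFalse.hyps in blast)+
next
  case LoopFalse
  from LoopFalse.prems show ?case by (rule exec_LoopE) (use LoopFalse.hyps in auto)
next
  case LoopTrue
  from LoopTrue.prems show ?case by (rule exec_LoopE) (use LoopTrue.IH LoopTrue.hyps in blast)+
qed


section \<open>Input and output\<close>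

text \<open>
  A list of pieces occupies one natural number for its length and one for each piece, which is
  \<open>1\<close> for a linear piece and \<open>0\<close> for an infinite one, and three real numbers for each piece: its
  start, slope and intercept.
\<close>

definition nat_code :: "piece list \<Rightarrow> nat list" where
  "nat_code ps = length ps # map (\<lambda>(x, q). case q of None \<Rightarrow> 0 | Some _ \<Rightarrow> 1) ps"

definition real_code :: "piece list \<Rightarrow> real list" where
  "real_code ps =
     concat (map (\<lambda>(x, q). case q of None \<Rightarrow> [x, 0, 0] | Some (a, b) \<Rightarrow> [x, a, b]) ps)"

text \<open>
  The graph, with vertices \<open>{..<n}\<close>, is given by its adjacency matrix, row by row. The
  entry for an arc is the representation of its arrival function, and the entry for a pair that
  is not an arc is the empty list of pieces (which represents no function).
\<close>

definition matrix_entries ::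
  "nat \<Rightarrow> nat pair_pre_digraph \<Rightarrow> (nat \<times> nat \<Rightarrow> piece list) \<Rightarrow> piece list list" where
  "matrix_entries n G P =
     map (\<lambda>e. if e \<in> parcs G then P e else []) (List.product [0..<n] [0..<n])"

definition memory_of :: "'a::zero list \<Rightarrow> nat \<Rightarrow> 'a" where
  "memory_of xs i = (if i < length xs then xs ! i else 0)"

definition input_state ::
  "nat \<Rightarrow> nat pair_pre_digraph \<Rightarrow> (nat \<times> nat \<Rightarrow> piece list) \<Rightarrow> nat \<Rightarrow> nat \<Rightarrow> ram_state" where
  "input_state n G P s d =
     \<lparr>nreg = (\<lambda>_. 0),
      nmem = memory_of ([n, s, d] @ concat (map nat_code (matrix_entries n G P))),
      rreg = (\<lambda>_. 0),
      rmem = memory_of (concat (map real_code (matrix_entries n G P)))\<rparr>"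

definition outputs :: "ram_state \<Rightarrow> piece list \<Rightarrow> bool" where
  "outputs \<sigma> ps \<longleftrightarrow>
     (\<forall>i<length (nat_code ps). nmem \<sigma> i = nat_code ps ! i) \<and>
     (\<forall>i<length (real_code ps). rmem \<sigma> i = real_code ps ! i)"

end

theory Submission
  imports Defs
begin

text \<open>
  Two estimates are combined. Computing earliest arrivals among \<open>N\<close> terminals by repeated doubling
  of the number of edges on a walk multiplies the number of linear pieces by \<open>O(N\<^sup>3)\<close> in each of
  \<open>O(log N)\<close> rounds, since a composition adds the numbers of pieces and the minimum of two
  piecewise linear functions at most doubles their total. A tree decomposition of width \<open>w\<close> yields
  a balanced separator of at most \<open>w + 1\<close> vertices, so that an earliest arrival is one among
  \<open>w + 3\<close> terminals with respect to the earliest arrivals inside the two sides. Recursion to depth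
  \<open>O(log n)\<close> bounds the number of pieces of every earliest arrival function by
  \<open>n\<close> to the power \<open>O(log\<^sup>2 w)\<close> times the number of input breakpoints.

  The algorithm sweeps the departure time from \<open>0\<close> upwards. At the current time, Dijkstra's
  algorithm on pairs (value, slope), ordered lexicographically, finds the lines that the earliest
  arrival functions follow immediately afterwards. They stay valid until the next event, at which
  an edge passes to its next linear piece or an edge that is not tight becomes tight. Every event
  is a breakpoint of an earliest arrival function or a time at which such a function reaches an
  input breakpoint, so the estimate above bounds the number of events.
\<close>

section \<open>Piecewise affine functions\<close>

text \<open>The program never sees a tree decomposition: treewidth enters through the bound on the
  number of events, so no decomposition has to be computed. For this bound a function is described
  by a finite set of exceptional times off which it is affine; what happens at these times is left
  open, which makes composition and minimum easy to count. Continuity of the input enters through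
  one fact: an edge is traversable either at all finite times or never. Edges of the second kind are
  dropped, and a vertex that is reachable at one finite time is reachable at all of them, so that
  the sweep only handles real lines. Earliest arrivals are compared through feasible potentials: a
  labelling of the vertices by times that no edge violates bounds every walk from below. This
  replaces arguments about optimal walks and also certifies the lines found by the sweep. The time
  for scanning pieces is amortised: the piece in use of an edge is remembered from one event to the
  next and only advances.\<close>

definition affine_off :: "real set \<Rightarrow> (real \<Rightarrow> real) \<Rightarrow> bool" where
  "affine_off S h \<longleftrightarrow>
     (\<forall>a b. 0 \<le> a \<longrightarrow> {a<..<b} \<inter> S = {} \<longrightarrow> (\<exists>\<alpha> \<beta>. \<forall>t\<in>{a<..<b}. h t = \<alpha> * t + \<beta>))"

lemma affine_offD:
  assumes "affine_off S h" "0 \<le> a" "{a<..<b} \<inter> S = {}"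
  obtains \<alpha> \<beta> where "\<And>t. a < t \<Longrightarrow> t < b \<Longrightarrow> h t = \<alpha> * t + \<beta>"
proof -
  have "\<exists>\<alpha> \<beta>. \<forall>t\<in>{a<..<b}. h t = \<alpha> * t + \<beta>"
    using assms by (auto simp: affine_off_def)
  with that show ?thesis by auto
qed

text \<open>The new breakpoints are preimages of those of \<open>h'\<close>. One preimage per point
  suffices: a value attained inside an open interval on which \<open>h\<close> strictly increases
  has no preimage elsewhere, because \<open>h\<close> is nondecreasing. Where \<open>h\<close> is
  constant, so is the composition.\<close>

lemma affine_off_comp:
  assumes h: "affine_off S h" and h': "affine_off S' h'" and fin: "finite S" "finite S'"
    and nonneg: "\<And>t. 0 \<le> t \<Longrightarrow> 0 \<le> h t" and mono: "\<And>x y. 0 \<le> x \<Longrightarrow> x \<le> y \<Longrightarrow> h x \<le> h y"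
  obtains S'' where "finite S''" "card S'' \<le> card S + card S'" "affine_off S'' (\<lambda>t. h' (h t))"
proof -
  \<comment> \<open>Positivity places the chosen preimage where \<open>h\<close> is known to be
    monotone.\<close>
  define c where "c y = (SOME p. 0 < p \<and> h p = y)" for y
  define S'' where "S'' = S \<union> c ` S'"
  have "card S'' \<le> card S + card S'"
    unfolding S''_def using card_Un_le[of S "c ` S'"] card_image_le[OF fin(2), of c] by linarith
  moreover have "\<exists>\<alpha> \<beta>. \<forall>t\<in>{a<..<b}. h' (h t) = \<alpha> * t + \<beta>"
    if a: "0 \<le> a" and disj: "{a<..<b} \<inter> S'' = {}" for a b
  proof (cases "a < b")
    case True
    obtain \<alpha> \<beta> where lin: "\<And>t. a < t \<Longrightarrow> t < b \<Longrightarrow> h t = \<alpha> * t + \<beta>"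
      using affine_offD[OF h a, of b] disj S''_def by blast
    show ?thesis
    proof (cases "\<alpha> = 0")
      case True
      with lin show ?thesis by (intro exI[of _ 0] exI[of _ "h' \<beta>"]) auto
    next
      case False
      obtain p q where pq: "a < p" "p < q" "q < b" using \<open>a < b\<close> dense by meson
      have "\<alpha> * p \<le> \<alpha> * q" using mono[of p q] lin[of p] lin[of q] pq a by auto
      with pq False have \<alpha>: "\<alpha> > 0" by (metis linorder_not_less mult_le_cancel_left_neg order_less_le)
      \<comment> \<open>The maximum with \<open>0\<close> is needed because
        \<open>affine_off\<close> only speaks about intervals with a nonnegative left end.\<close>
      define lo where "lo = max 0 (\<alpha> * a + \<beta>)"
      have range: "lo < h t \<and> h t < \<alpha> * b + \<beta>" if t: "a < t" "t < b" for t
      proof -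
        have "0 \<le> h ((a + t) / 2)" using a t by (intro nonneg) auto
        also have "\<dots> < h t" using lin[of t] lin[of "(a+t)/2"] t \<alpha> by auto
        finally show ?thesis using \<alpha> t lin[of t] by (auto simp: lo_def)
      qed
      have "{lo<..<\<alpha> * b + \<beta>} \<inter> S' = {}"
      proof (rule equals0I)
        fix y assume "y \<in> {lo<..<\<alpha> * b + \<beta>} \<inter> S'"
        then have y: "y \<in> S'" "lo < y" "y < \<alpha> * b + \<beta>" by auto
        define p where "p = (y - \<beta>) / \<alpha>"
        have py: "\<alpha> * p + \<beta> = y" using \<alpha> by (simp add: p_def)
        have p: "a < p" "p < b"
          using y \<alpha> by (auto simp: lo_def p_def field_simps)
        have hp: "h p = y" using lin[OF p] py by simp
        have "0 < c y \<and> h (c y) = y"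
          unfolding c_def by (rule someI[of _ p]) (use hp p a in auto)
        moreover have "c y \<notin> {a<..<b}" using disj y(1) by (auto simp: S''_def)
        ultimately have q: "0 < c y" "h (c y) = y" "c y \<le> a \<or> b \<le> c y" by auto
        from q(3) show False
        proof
          assume "c y \<le> a"
          then have "h (c y) \<le> h ((a + p) / 2)" using q p by (intro mono) auto
          with q lin[of "(a+p)/2"] p \<alpha> py have "\<alpha> * p \<le> \<alpha> * ((a+p)/2)" by auto
          with \<alpha> p show False by auto
        next
          assume "b \<le> c y"
          then have "h ((b + p) / 2) \<le> h (c y)" using q p a by (intro mono) auto
          with q lin[of "(b+p)/2"] p \<alpha> py have "\<alpha> * ((b+p)/2) \<le> \<alpha> * p" by auto
          with \<alpha> p show False by auto
        qed
      qed
      then obtain \<alpha>' \<beta>' where lin': "\<And>t. lo < t \<Longrightarrow> t < \<alpha> * b + \<beta> \<Longrightarrow> h' t = \<alpha>' * t + \<beta>'"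
        using affine_offD[OF h', of lo "\<alpha> * b + \<beta>"] by (auto simp: lo_def)
      have "h' (h t) = (\<alpha>' * \<alpha>) * t + (\<alpha>' * \<beta> + \<beta>')" if "t \<in> {a<..<b}" for t
        using lin'[of "h t"] range[of t] lin[of t] that by (auto simp: algebra_simps)
      then show ?thesis by blast
    qed
  qed auto
  moreover have "finite S''" using fin by (simp add: S''_def)
  ultimately show ?thesis using that[of S''] by (auto simp: affine_off_def)
qed

text \<open>Between neighbouring points of the union \<open>U\<close> of all breakpoints the
  functions are affine, so two of them agree at most once or throughout. Adding one crossing per gap
  and ordered pair of indices gives at most \<open>N * k' + (N * k' + 1) * (N * N)\<close> points,
  where \<open>k'\<close> is \<open>k - 1\<close>.\<close>

lemma affine_off_Min:
  fixes h :: "'i \<Rightarrow> real \<Rightarrow> real"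
  assumes I: "finite I" "I \<noteq> {}"
    and S: "\<And>i. i \<in> I \<Longrightarrow> finite (S i)" "\<And>i. i \<in> I \<Longrightarrow> card (S i) < k"
    and h: "\<And>i. i \<in> I \<Longrightarrow> affine_off (S i) (h i)"
  obtains S' where "finite S'" "card S' < 2 * card I ^ 3 * k"
    "affine_off S' (\<lambda>t. Min ((\<lambda>i. h i t) ` I))"
proof -
  define N where "N = card I"
  have N: "N > 0" using I by (auto simp: N_def card_gt_0_iff)
  obtain k' where k: "k = Suc k'" using S(2) I(2) by (metis all_not_in_conv less_nat_zero_code not0_implies_Suc)
  define U where "U = (\<Union>i\<in>I. S i)"
  define V where "V = insert 0 U"
  \<comment> \<open>A gap of \<open>U\<close> is named by its left end \<open>\<sigma>\<close>, with
    \<open>0\<close> as the end of the first gap. Hence the crossing chosen by \<open>c\<close> does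
    not depend on the interval that is examined later.\<close>
  define gap where "gap \<sigma> p \<longleftrightarrow> \<sigma> < p \<and> (\<exists>b>p. {\<sigma><..<b} \<inter> U = {})" for \<sigma> p
  define c where "c = (\<lambda>(\<sigma>, i, j). SOME p. gap \<sigma> p \<and> h i p = h j p)"
  define C where "C = c ` (V \<times> I \<times> I)"
  define S' where "S' = U \<union> C"
  have finU: "finite U" using I S by (auto simp: U_def)
  have cardU: "card U \<le> N * k'"
    unfolding U_def N_def using card_UN_le[OF I(1), of S] sum_bounded_above[of I "\<lambda>i. card (S i)" k'] S(2) k
    by (force intro: order_trans)
  have "card V \<le> N * k' + 1" unfolding V_def using finU cardU by (auto simp: card_insert_if)
  then have "card V * (N * N) \<le> (N * k' + 1) * (N * N)" by (rule mult_right_mono) simp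
  then have "card C \<le> (N * k' + 1) * (N * N)"
    using card_image_le[of "V \<times> I \<times> I" c] finU I by (auto simp: C_def card_cartesian_product N_def V_def)
  then have "card S' \<le> N * k' + (N * k' + 1) * (N * N)"
    using card_Un_le[of U C] cardU by (auto simp: S'_def)
  also have "\<dots> < 2 * N ^ 3 * k"
  proof -
    have "N * 1 \<le> N * (N * N)" using N by (intro mult_left_mono) auto
    then have "N * k' \<le> N ^ 3 * k'" by (simp add: power3_eq_cube mult.assoc)
    moreover have "N * N \<le> N ^ 3" using N by (simp add: power3_eq_cube)
    moreover have "N ^ 3 > 0" using N by simp
    moreover have "N * k' + (N * k' + 1) * (N * N) = N * k' + N ^ 3 * k' + N * N"
      by (simp add: algebra_simps power3_eq_cube)
    moreover have "2 * N ^ 3 * k = 2 * (N ^ 3 * k') + 2 * N ^ 3" by (simp add: k)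
    ultimately show ?thesis by linarith
  qed
  finally have "card S' < 2 * card I ^ 3 * k" by (simp add: N_def)
  moreover have "finite S'" using finU I by (auto simp: S'_def C_def V_def)
  moreover have "\<exists>\<alpha> \<beta>. \<forall>t\<in>{a<..<b}. Min ((\<lambda>i. h i t) ` I) = \<alpha> * t + \<beta>"
    if a: "0 \<le> a" and disj: "{a<..<b} \<inter> S' = {}" for a b
  proof (cases "a < b")
    case True
    \<comment> \<open>The left end of the gap of \<open>U\<close> that contains the given
      interval.\<close>
    define \<sigma> where "\<sigma> = Max {x \<in> V. 0 \<le> x \<and> x \<le> a}"
    have fV: "finite {x \<in> V. 0 \<le> x \<and> x \<le> a}" using finU by (simp add: V_def)
    have "\<sigma> \<in> {x \<in> V. 0 \<le> x \<and> x \<le> a}"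
      unfolding \<sigma>_def by (rule Max_in[OF fV]) (use a in \<open>auto simp: V_def\<close>)
    then have \<sigma>: "\<sigma> \<in> V" "0 \<le> \<sigma>" "\<sigma> \<le> a" by auto
    have gapU: "{\<sigma><..<b} \<inter> U = {}"
    proof (rule equals0I)
      fix x assume "x \<in> {\<sigma><..<b} \<inter> U"
      then have x: "x \<in> U" "\<sigma> < x" "x < b" by auto
      show False
      proof (cases "x \<le> a")
        case True
        then have "x \<le> \<sigma>" unfolding \<sigma>_def using x \<sigma> by (intro Max_ge[OF fV]) (auto simp: V_def)
        with x show False by simp
      next
        case False
        with x have "x \<in> {a<..<b} \<inter> S'" by (auto simp: S'_def)
        with disj show False by simp
      qed
    qed
    have lin: "\<exists>\<alpha> \<beta>. \<forall>t. \<sigma> < t \<longrightarrow> t < c \<longrightarrow> h i t = \<alpha> * t + \<beta>"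
      if "i \<in> I" "{\<sigma><..<c} \<inter> U = {}" for i c
    proof -
      have "{\<sigma><..<c} \<inter> S i = {}" using that by (auto simp: U_def)
      from affine_offD[OF h[OF that(1)] \<sigma>(2) this] show ?thesis by metis
    qed
    \<comment> \<open>The crossing chosen for this gap is one of the excluded points, so a crossing
      inside the interval is a second one, and two affine functions that agree twice are
      equal.\<close>
    have ident: "h i t = h j t"
      if ij: "i \<in> I" "j \<in> I" and p: "a < p" "p < b" "h i p = h j p" and t: "a < t" "t < b" for i j p t
    proof -
      define q where "q = c (\<sigma>, i, j)"
      have "gap \<sigma> q \<and> h i q = h j q"
        unfolding q_def c_def prod.case
        by (rule someI[of _ p]) (use p \<sigma> gapU in \<open>auto simp: gap_def\<close>)
      then obtain b' where q: "\<sigma> < q" "q < b'" "{\<sigma><..<b'} \<inter> U = {}" "h i q = h j q"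
        by (auto simp: gap_def)
      have "q \<in> C" using \<sigma> ij by (auto simp: C_def q_def)
      then have qp: "q \<noteq> p" using disj p by (auto simp: S'_def)
      \<comment> \<open>The chosen crossing may lie beyond \<open>b\<close>, so the gap is widened
        until it contains both crossings.\<close>
      have dis: "{\<sigma><..<max b b'} \<inter> U = {}" using gapU q by (auto simp: max_def split: if_splits)
      obtain \<alpha> \<beta> where 1: "\<And>t. \<sigma> < t \<Longrightarrow> t < max b b' \<Longrightarrow> h i t = \<alpha> * t + \<beta>"
        using lin[OF ij(1) dis] by blast
      obtain \<alpha>' \<beta>' where 2: "\<And>t. \<sigma> < t \<Longrightarrow> t < max b b' \<Longrightarrow> h j t = \<alpha>' * t + \<beta>'"
        using lin[OF ij(2) dis] by blast
      have "\<alpha> * q + \<beta> = \<alpha>' * q + \<beta>'" using 1[of q] 2[of q] q by auto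
      moreover have "\<alpha> * p + \<beta> = \<alpha>' * p + \<beta>'" using 1[of p] 2[of p] p \<sigma> by auto
      ultimately have "(\<alpha> - \<alpha>') * (q - p) = 0" by (simp add: algebra_simps)
      with qp have "\<alpha> = \<alpha>'" by auto
      with \<open>\<alpha> * q + \<beta> = \<alpha>' * q + \<beta>'\<close> have "\<beta> = \<beta>'" by simp
      with \<open>\<alpha> = \<alpha>'\<close> show ?thesis using 1[of t] 2[of t] t \<sigma> by auto
    qed
    define m where "m = (a + b) / 2"
    have m: "a < m" "m < b" using True by (auto simp: m_def)
    have "Min ((\<lambda>i. h i m) ` I) \<in> (\<lambda>i. h i m) ` I" using I by (intro Min_in) auto
    then obtain i0 where i0: "i0 \<in> I" "h i0 m = Min ((\<lambda>i. h i m) ` I)" by auto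
    have i0m: "h i0 m \<le> h j m" if "j \<in> I" for j using that I i0(2) by simp
    \<comment> \<open>An index that is minimal at the midpoint is minimal on the whole interval:
      otherwise the affine difference \<open>g\<close> changes sign, and its root is a crossing, at
      which \<open>ident\<close> applies.\<close>
    have le: "h i0 t \<le> h j t" if j: "j \<in> I" and t: "a < t" "t < b" for j t
    proof (rule ccontr)
      assume neg: "\<not> h i0 t \<le> h j t"
      obtain \<alpha> \<beta> where 1: "\<And>t. \<sigma> < t \<Longrightarrow> t < b \<Longrightarrow> h i0 t = \<alpha> * t + \<beta>"
        using lin[OF i0(1) gapU] by blast
      obtain \<alpha>' \<beta>' where 2: "\<And>t. \<sigma> < t \<Longrightarrow> t < b \<Longrightarrow> h j t = \<alpha>' * t + \<beta>'"
        using lin[OF j gapU] by blast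
      define g where "g x = (\<alpha>' - \<alpha>) * x + (\<beta>' - \<beta>)" for x
      have hg: "h j x - h i0 x = g x" if "a < x" "x < b" for x
        using 1[of x] 2[of x] that \<sigma> by (auto simp: g_def algebra_simps)
      have gt: "g t < 0" using neg hg[OF t] by auto
      have gm: "g m > 0"
        using i0m[OF j] hg[OF m] hg[OF t] gt ident[OF i0(1) j m _ t] by (cases "g m = 0") auto
      define x where "x = t + (m - t) * (- g t / (g m - g t))"
      define r where "r = - g t / (g m - g t)"
      have r: "0 < r" "r < 1" using gt gm by (auto simp: r_def field_simps)
      have xr: "x = t + (m - t) * r" by (simp add: x_def r_def)
      have "g x = g t + r * (g m - g t)" by (simp add: g_def xr algebra_simps)
      also have "\<dots> = 0" using gt gm by (simp add: r_def)
      finally have gx: "g x = 0" .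
      have "x = (1 - r) * t + r * m" by (simp add: xr algebra_simps)
      moreover have "(1 - r) * a + r * a < (1 - r) * t + r * m" "(1 - r) * t + r * m < (1 - r) * b + r * b"
        using r t m by (intro add_strict_mono mult_strict_left_mono; simp)+
      ultimately have "a < x" "x < b" by (auto simp: algebra_simps)
      with gx hg[of x] ident[OF i0(1) j, of x t] t have "h i0 t = h j t" by auto
      with neg show False by simp
    qed
    obtain \<alpha> \<beta> where 1: "\<And>t. \<sigma> < t \<Longrightarrow> t < b \<Longrightarrow> h i0 t = \<alpha> * t + \<beta>"
      using lin[OF i0(1) gapU] by blast
    have "Min ((\<lambda>i. h i t) ` I) = \<alpha> * t + \<beta>" if "t \<in> {a<..<b}" for t
    proof -
      have "Min ((\<lambda>i. h i t) ` I) = h i0 t"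
        by (rule Min_eqI) (use I i0 le that in auto)
      then show ?thesis using 1[of t] that \<sigma> by auto
    qed
    then show ?thesis by blast
  qed auto
  ultimately show ?thesis using that[of S'] by (auto simp: affine_off_def)
qed

text \<open>The bound \<open>k\<close> counts pieces, hence the strict inequality for the number of breakpoints.\<close>

definition pieces :: "nat \<Rightarrow> (ennreal \<Rightarrow> ennreal) \<Rightarrow> bool" where
  "pieces k f \<longleftrightarrow> (\<forall>t. f t = \<infinity>) \<or>
     (arrival_function f \<and> (\<forall>t<\<infinity>. f t < \<infinity>) \<and>
      (\<exists>S. finite S \<and> card S < k \<and> affine_off S (\<lambda>t. enn2real (f (ennreal t)))))"

lemma pieces_mono: "pieces k f \<Longrightarrow> k \<le> l \<Longrightarrow> pieces l f"
  unfolding pieces_def using order_less_le_trans by blast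

lemma arrival_ge: "arrival_function f \<Longrightarrow> t \<le> f t"
  by (simp add: arrival_function_def)

lemma arrival_mono: "arrival_function f \<Longrightarrow> x \<le> y \<Longrightarrow> f x \<le> f y"
  by (simp add: arrival_function_def monoD)

lemma arrival_inf: "arrival_function f \<Longrightarrow> f top = top"
  using arrival_ge[of f top] by (simp add: top_unique)

lemma pieces_arrival: "pieces k f \<Longrightarrow> arrival_function f"
proof (unfold pieces_def, elim disjE)
  assume "\<forall>t. f t = \<infinity>"
  then have "f = (\<lambda>_. \<infinity>)" by auto
  then show "arrival_function f" by (simp add: arrival_function_def mono_def)
qed auto

lemma pieces_id: "0 < k \<Longrightarrow> pieces k (\<lambda>t. t)"
proof -
  have "\<forall>t\<in>{a<..<b}. enn2real (ennreal t) = 1 * t + 0" if "0 \<le> a" for a b :: real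
    using that by auto
  then have "affine_off {} (\<lambda>t. enn2real (ennreal t))"
    unfolding affine_off_def by blast
  then show "0 < k \<Longrightarrow> pieces k (\<lambda>t. t)"
    unfolding pieces_def arrival_function_def by (auto simp: mono_def intro!: exI[of _ "{}"])
qed

lemma pieces_comp:
  assumes f: "pieces k f" and g: "pieces l g"
  shows "pieces (k + l) (\<lambda>t. g (f t))"
proof -
  note af = pieces_arrival[OF f] pieces_arrival[OF g]
  consider "\<forall>t. f t = \<infinity>" | "\<forall>t. g t = \<infinity>" | "\<not> (\<forall>t. f t = \<infinity>)" "\<not> (\<forall>t. g t = \<infinity>)" by blast
  then show ?thesis
  proof cases
    case 3
    then obtain S S' where
      S: "finite S" "card S < k" "affine_off S (\<lambda>t. enn2real (f (ennreal t)))" and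
      S': "finite S'" "card S' < l" "affine_off S' (\<lambda>t. enn2real (g (ennreal t)))" and
      fin: "\<forall>t<\<infinity>. f t < \<infinity>" "\<forall>t<\<infinity>. g t < \<infinity>"
      using f g unfolding pieces_def by blast
    have ft: "f (ennreal t) < top" for t using fin(1) by simp
    obtain S'' where S'': "finite S''" "card S'' \<le> card S + card S'"
      "affine_off S'' (\<lambda>t. enn2real (g (ennreal (enn2real (f (ennreal t))))))"
      by (rule affine_off_comp[OF S(3) S'(3) S(1) S'(1)])
        (auto intro!: enn2real_mono arrival_mono[OF af(1)] ennreal_leI ft)
    have "ennreal (enn2real (f (ennreal t))) = f (ennreal t)" for t
      using fin(1) by (simp add: ennreal_enn2real)
    with S'' S S' have "\<exists>S. finite S \<and> card S < k + l \<and> affine_off S (\<lambda>t. enn2real (g (f (ennreal t))))"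
      by (intro exI[of _ S'']) auto
    moreover have "arrival_function (\<lambda>t. g (f t))"
      using af unfolding arrival_function_def mono_def by (meson order_trans)
    ultimately show ?thesis using fin unfolding pieces_def by blast
  qed (auto simp: pieces_def arrival_inf[OF af(2)])
qed

lemma INF_finite_attained:
  fixes f :: "'i \<Rightarrow> 'b::complete_linorder"
  assumes "finite I" "I \<noteq> {}"
  obtains i where "i \<in> I" "(INF i\<in>I. f i) = f i"
proof -
  have "Min (f ` I) \<in> f ` I" using assms by (intro Min_in) auto
  moreover have "Min (f ` I) = (INF i\<in>I. f i)" using assms by (intro Min_Inf) auto
  ultimately show ?thesis using that by auto
qed

lemma arrival_INF:
  assumes "\<And>i. i \<in> I \<Longrightarrow> arrival_function (f i)"
  shows "arrival_function (\<lambda>t. INF i\<in>I. f i t)"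
  using assms unfolding arrival_function_def mono_def
  by (auto intro!: INF_greatest intro: INF_lower2)

lemma pieces_INF:
  assumes I: "finite I" "card I \<le> N" and f: "\<And>i. i \<in> I \<Longrightarrow> pieces k (f i)"
  shows "pieces (2 * N ^ 3 * k) (\<lambda>t. INF i\<in>I. f i t)"
proof -
  \<comment> \<open>\<open>enn2real\<close> maps infinity to \<open>0\<close>, so the constantly
    infinite members have to be removed before turning to minima of real functions.\<close>
  define J where "J = {i \<in> I. \<not> (\<forall>t. f i t = \<infinity>)}"
  have INF: "(INF i\<in>I. f i t) = (INF i\<in>J. f i t)" for t
  proof (rule antisym)
    show "(INF i\<in>J. f i t) \<le> (INF i\<in>I. f i t)"
    proof (rule INF_greatest)
      fix i assume "i \<in> I"
      then show "(INF i\<in>J. f i t) \<le> f i t"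
        by (cases "i \<in> J") (auto simp: J_def intro: INF_lower)
    qed
  qed (auto simp: J_def intro: INF_superset_mono)
  show ?thesis
  proof (cases "J = {}")
    case True
    then show ?thesis by (simp add: pieces_def INF)
  next
    case False
    have J: "finite J" "card J \<le> N" "J \<subseteq> I" using I card_mono[of I J] by (auto simp: J_def)
    have fin: "f i t < \<infinity>" if "i \<in> J" "t < \<infinity>" for i t
      using f[of i] that unfolding J_def pieces_def by blast
    have "\<forall>i\<in>J. \<exists>S. finite S \<and> card S < k \<and> affine_off S (\<lambda>t. enn2real (f i (ennreal t)))"
      using f unfolding J_def pieces_def by blast
    then obtain S where "\<forall>i\<in>J. finite (S i) \<and> card (S i) < k \<and>
        affine_off (S i) (\<lambda>t. enn2real (f i (ennreal t)))"
      by (rule bchoice[THEN exE])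
    then have S: "\<And>i. i \<in> J \<Longrightarrow> finite (S i)" "\<And>i. i \<in> J \<Longrightarrow> card (S i) < k"
      "\<And>i. i \<in> J \<Longrightarrow> affine_off (S i) (\<lambda>t. enn2real (f i (ennreal t)))" by auto
    obtain S' where S': "finite S'" "card S' < 2 * card J ^ 3 * k"
      "affine_off S' (\<lambda>t. Min ((\<lambda>i. enn2real (f i (ennreal t))) ` J))"
      by (rule affine_off_Min[OF J(1) False S])
    have "Min ((\<lambda>i. enn2real (f i (ennreal t))) ` J) = enn2real (INF i\<in>J. f i (ennreal t))" for t
    proof -
      obtain i where i: "i \<in> J" "(INF i\<in>J. f i (ennreal t)) = f i (ennreal t)"
        by (rule INF_finite_attained[OF J(1) False])
      show ?thesis
      proof (rule Min_eqI)
        fix y assume "y \<in> (\<lambda>i. enn2real (f i (ennreal t))) ` J"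
        then obtain j where j: "j \<in> J" "y = enn2real (f j (ennreal t))" by auto
        show "enn2real (INF i\<in>J. f i (ennreal t)) \<le> y"
          unfolding j(2) by (rule enn2real_mono[OF INF_lower]) (use j fin in auto)
      qed (use i J in auto)
    qed
    with S' have "affine_off S' (\<lambda>t. enn2real (INF i\<in>J. f i (ennreal t)))" by simp
    moreover have "card S' < 2 * N ^ 3 * k"
    proof (rule order_less_le_trans[OF S'(2)])
      have "card J ^ 3 \<le> N ^ 3" using J by (intro power_mono) auto
      then show "2 * card J ^ 3 * k \<le> 2 * N ^ 3 * k" by simp
    qed
    moreover have "arrival_function (\<lambda>t. INF i\<in>J. f i t)"
      by (rule arrival_INF) (use f J pieces_arrival in blast)
    moreover have "(INF i\<in>J. f i t) < \<infinity>" if "t < \<infinity>" for t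
      using False fin that by (meson INF_lower all_not_in_conv order_le_less_trans)
    ultimately show ?thesis unfolding pieces_def INF using S'(1) by blast
  qed
qed

section \<open>Walks and distances\<close>

fun walk :: "('a \<times> 'a) set \<Rightarrow> 'a \<Rightarrow> ('a \<times> 'a) list \<Rightarrow> 'a \<Rightarrow> bool" where
  "walk E u [] v \<longleftrightarrow> u = v"
| "walk E u (e # p) v \<longleftrightarrow> e \<in> E \<and> fst e = u \<and> walk E (snd e) p v"

text \<open>Walks may repeat vertices and edges, which makes them closed under concatenation.
  Agreement with simple paths is only established for the final statement.\<close>

definition earliest ::
  "('a \<times> 'a) set \<Rightarrow> ('a \<times> 'a \<Rightarrow> ennreal \<Rightarrow> ennreal) \<Rightarrow> 'a \<Rightarrow> 'a \<Rightarrow> ennreal \<Rightarrow> ennreal" where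
  "earliest E A u v t = (INF p\<in>{p. walk E u p v}. fold A p t)"

lemma walk_append: "walk E u (p @ q) w \<longleftrightarrow> (\<exists>v. walk E u p v \<and> walk E v q w)"
  by (induction p arbitrary: u) auto

lemma walk_set: "walk E u p v \<Longrightarrow> set p \<subseteq> E"
  by (induction p arbitrary: u) auto

lemma walk_mono: "walk E u p v \<Longrightarrow> set p \<subseteq> E' \<Longrightarrow> walk E' u p v"
  by (induction p arbitrary: u) auto

locale fifo =
  fixes E :: "('a \<times> 'a) set" and A :: "'a \<times> 'a \<Rightarrow> ennreal \<Rightarrow> ennreal"
  assumes arrival: "e \<in> E \<Longrightarrow> arrival_function (A e)" and finite_E: "finite E"
begin

lemma fold_mono: "set p \<subseteq> E \<Longrightarrow> x \<le> y \<Longrightarrow> fold A p x \<le> fold A p y"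
  by (induction p arbitrary: x y) (auto simp: arrival arrival_mono)

lemma fold_ge: "set p \<subseteq> E \<Longrightarrow> x \<le> fold A p x"
proof (induction p arbitrary: x)
  case (Cons e p)
  have "x \<le> A e x" using Cons.prems by (auto intro: arrival_ge arrival)
  also have "\<dots> \<le> fold A p (A e x)" using Cons by auto
  finally show ?case by simp
qed simp

text \<open>By FIFO, being earlier at a vertex never hurts, so the part between two departures from
  the same vertex can be cut out. Only the tails become distinct; the end vertex may still occur
  among them.\<close>

lemma shortcut:
  assumes "walk E u p v"
  shows "\<exists>q. walk E u q v \<and> set q \<subseteq> set p \<and> distinct (map fst q) \<and> (\<forall>t. fold A q t \<le> fold A p t)"
  using assms
proof (induction "length p" arbitrary: p rule: less_induct)
  case less
  show ?case
  proof (cases "distinct (map fst p)")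
    case False
    then obtain xs ys zs y where dec: "map fst p = xs @ [y] @ ys @ [y] @ zs"
      using not_distinct_decomp by blast
    obtain X P1 where P1: "p = X @ P1" "map fst P1 = y # ys @ [y] @ zs"
      using dec by (auto simp: map_eq_append_conv)
    obtain e Q where Q: "P1 = e # Q" "fst e = y" "map fst Q = ys @ [y] @ zs"
      using P1(2) by (auto simp: map_eq_Cons_conv)
    obtain Y P2 where P2: "Q = Y @ P2" "map fst P2 = y # zs"
      using Q(3) by (auto simp: map_eq_append_conv)
    obtain e' Z where Z: "P2 = e' # Z" "fst e' = y" using P2(2) by (auto simp: map_eq_Cons_conv)
    have p: "p = X @ e # Y @ e' # Z" "fst e' = fst e" using P1 Q P2 Z by auto
    have w: "walk E u (X @ e' # Z) v" using less.prems p by (auto simp: walk_append)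
    have sub: "set p \<subseteq> E" using less.prems by (rule walk_set)
    have le: "fold A (X @ e' # Z) t \<le> fold A p t" for t
    proof -
      have "fold A X t \<le> fold A (e # Y) (fold A X t)" using sub p by (intro fold_ge) auto
      then have "fold A (e' # Z) (fold A X t) \<le> fold A (e' # Z) (fold A (e # Y) (fold A X t))"
        using sub p by (intro fold_mono) auto
      then show ?thesis by (simp add: p)
    qed
    obtain q where "walk E u q v" "set q \<subseteq> set (X @ e' # Z)" "distinct (map fst q)"
      "\<And>t. fold A q t \<le> fold A (X @ e' # Z) t"
      using less.hyps[OF _ w] p by auto
    then show ?thesis using le p by (intro exI[of _ q]) (auto intro: order_trans)
  qed (use less in blast)
qed

text \<open>There may be infinitely many walks, but \<open>shortcut\<close> confines the infimum to
  lists without repetition over the finite set \<open>E\<close>.\<close>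

lemma earliest_attained:
  assumes "walk E u p v"
  obtains q where "walk E u q v" "earliest E A u v t = fold A q t"
proof -
  define Q where "Q = {q. walk E u q v \<and> distinct (map fst q)}"
  have "Q \<subseteq> {q. set q \<subseteq> E \<and> length q \<le> card E}"
  proof (safe)
    fix q assume "q \<in> Q"
    then have q: "walk E u q v" "distinct q" by (auto simp: Q_def distinct_map)
    show "length q \<le> card E"
      using card_mono[OF finite_E walk_set[OF q(1)]] distinct_card[OF q(2)] by simp
    fix e assume "e \<in> set q"
    then show "e \<in> E" using walk_set[OF q(1)] by auto
  qed
  moreover have "finite {q. set q \<subseteq> E \<and> length q \<le> card E}"
    by (rule finite_lists_length_le[OF finite_E])
  ultimately have "finite Q" by (rule finite_subset)
  moreover have "Q \<noteq> {}" using shortcut[OF assms] by (auto simp: Q_def)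
  ultimately obtain q where q: "q \<in> Q" "(INF q\<in>Q. fold A q t) = fold A q t"
    by (rule INF_finite_attained)
  have "earliest E A u v t = (INF q\<in>Q. fold A q t)"
  proof (rule antisym)
    show "(INF q\<in>Q. fold A q t) \<le> earliest E A u v t"
      unfolding earliest_def
    proof (rule INF_greatest)
      fix p assume "p \<in> {p. walk E u p v}"
      then obtain q where "q \<in> Q" "fold A q t \<le> fold A p t" using shortcut by (fastforce simp: Q_def)
      then show "(INF q\<in>Q. fold A q t) \<le> fold A p t" by (rule INF_lower2)
    qed
  qed (auto simp: earliest_def Q_def intro: INF_superset_mono)
  with q that show ?thesis by (auto simp: Q_def)
qed

lemma earliest_le: "walk E u p v \<Longrightarrow> earliest E A u v t \<le> fold A p t"
  unfolding earliest_def by (rule INF_lower) simp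

lemma earliest_empty: "\<nexists>p. walk E u p v \<Longrightarrow> earliest E A u v t = \<infinity>"
  by (simp add: earliest_def)

lemma arrival_earliest: "arrival_function (earliest E A u v)"
proof -
  have "arrival_function (fold A p)" if "walk E u p v" for p
    using walk_set[OF that] by (auto simp: arrival_function_def mono_def intro: fold_mono fold_ge)
  moreover have "earliest E A u v = (\<lambda>t. INF p\<in>{p. walk E u p v}. fold A p t)"
    by (simp add: fun_eq_iff earliest_def)
  ultimately show ?thesis
    using arrival_INF[of "{p. walk E u p v}" "fold A"] by simp
qed

lemma earliest_self: "earliest E A u u t = t"
  using earliest_le[of u "[]" u t] arrival_ge[OF arrival_earliest[of u u], of t]
  by (simp add: antisym)

text \<open>The inner infimum is replaced by one optimal walk, to which every walk from
  \<open>v\<close> is appended. Attainment matters here: the edge functions are merely monotone and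
  need not commute with infima.\<close>

lemma earliest_triangle: "earliest E A u w t \<le> earliest E A v w (earliest E A u v t)"
proof (cases "\<exists>p. walk E u p v")
  case True
  then obtain p0 where "walk E u p0 v" by blast
  from earliest_attained[OF this, of t]
  obtain p where p: "walk E u p v" "earliest E A u v t = fold A p t" .
  show ?thesis unfolding p(2)
    unfolding earliest_def[of E A v w]
  proof (rule INF_greatest)
    fix q assume "q \<in> {q. walk E v q w}"
    then have "walk E u (p @ q) w" using p by (auto simp: walk_append)
    from earliest_le[OF this, of t] show "earliest E A u w t \<le> fold A q (fold A p t)" by simp
  qed
next
  case False
  then show ?thesis by (simp add: earliest_empty arrival_inf[OF arrival_earliest])
qed

lemma earliest_edge: "(u, v) \<in> E \<Longrightarrow> earliest E A u v t \<le> A (u, v) t"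
  using earliest_le[of u "[(u, v)]" v t] by simp

text \<open>Weak duality for shortest paths: monotonicity carries the inequality of a feasible
  potential from edge to edge. Since \<open>earliest\<close> from a fixed vertex is itself feasible,
  two such functions are proved equal by using each as a potential for the other.\<close>

lemma potential_le_fold:
  assumes "\<And>u v. (u, v) \<in> E \<Longrightarrow> \<psi> v \<le> A (u, v) (\<psi> u)" and "walk E u p v" and "\<psi> u \<le> t"
  shows "\<psi> v \<le> fold A p t"
  using assms(2,3)
proof (induction p arbitrary: u t)
  case (Cons e p)
  have "\<psi> (snd e) \<le> A e (\<psi> u)" using assms(1)[of "fst e" "snd e"] Cons.prems by auto
  also have "\<dots> \<le> A e t" using Cons.prems by (auto intro: arrival_mono[OF arrival])
  finally show ?case using Cons.IH[of "snd e" "A e t"] Cons.prems by simp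
qed auto

lemma potential_le_earliest:
  assumes "\<And>u v. (u, v) \<in> E \<Longrightarrow> \<psi> v \<le> A (u, v) (\<psi> u)" and "\<psi> u \<le> t"
  shows "\<psi> v \<le> earliest E A u v t"
  unfolding earliest_def using assms by (auto intro!: INF_greatest potential_le_fold[of \<psi> u])

end

section \<open>Earliest arrivals among few terminals by repeated doubling\<close>

fun doubling ::
  "'a set \<Rightarrow> ('a \<times> 'a \<Rightarrow> ennreal \<Rightarrow> ennreal) \<Rightarrow> nat \<Rightarrow> 'a \<Rightarrow> 'a \<Rightarrow> ennreal \<Rightarrow> ennreal" where
  "doubling H g 0 i j t = (if i = j then t else g (i, j) t)"
| "doubling H g (Suc k) i j t = (INF m\<in>H. doubling H g k m j (doubling H g k i m t))"

text \<open>Each round contributes a factor \<open>2\<close> for the composition and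
  \<open>2 * N ^ 3\<close> for the minimum over the midpoints.\<close>

lemma pieces_doubling:
  assumes "finite H" "card H \<le> N" "0 < k" and g: "\<And>e. e \<in> H \<times> H \<Longrightarrow> pieces k (g e)"
    and "i \<in> H" "j \<in> H"
  shows "pieces ((4 * N ^ 3) ^ K * k) (doubling H g K i j)"
  using assms(5,6)
proof (induction K arbitrary: i j)
  case 0
  have "doubling H g 0 i j = (if i = j then \<lambda>t. t else g (i, j))" by (auto simp: fun_eq_iff)
  then show ?case using 0 g pieces_id[OF \<open>0 < k\<close>] by auto
next
  case (Suc K)
  have "pieces (2 * N ^ 3 * ((4 * N ^ 3) ^ K * k + (4 * N ^ 3) ^ K * k))
      (\<lambda>t. INF m\<in>H. doubling H g K m j (doubling H g K i m t))"
    using Suc by (intro pieces_INF assms(1,2) pieces_comp) auto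
  moreover have "doubling H g (Suc K) i j = (\<lambda>t. INF m\<in>H. doubling H g K m j (doubling H g K i m t))"
    by (simp add: fun_eq_iff)
  ultimately show ?case by (simp add: algebra_simps)
qed

text \<open>A walk with distinct tails has at most \<open>card H\<close> edges, so halving it
  \<open>K\<close> times leaves at most one edge. The identity for \<open>i = j\<close> at level
  \<open>0\<close> absorbs walks that have become empty.\<close>

lemma earliest_eq_doubling:
  assumes H: "finite H" "card H \<le> 2 ^ K"
    and g: "\<And>e. e \<in> H \<times> H \<Longrightarrow> arrival_function (g e)" and ij: "i \<in> H" "j \<in> H"
  shows "earliest (H \<times> H) g i j = doubling H g K i j"
proof
  fix t
  interpret fifo "H \<times> H" g by unfold_locales (use H g in auto)
  have arr: "arrival_function (doubling H g k i j)" if "i \<in> H" "j \<in> H" for i j k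
    using that
  proof (induction k arbitrary: i j)
    case 0
    have "doubling H g 0 i j = (if i = j then \<lambda>t. t else g (i, j))" by (auto simp: fun_eq_iff)
    then show ?case using 0 g by (auto simp: arrival_function_def mono_def)
  next
    case (Suc k)
    have "arrival_function (\<lambda>t. INF m\<in>H. doubling H g k m j (doubling H g k i m t))"
    proof (rule arrival_INF)
      fix m assume "m \<in> H"
      with Suc have 1: "arrival_function (doubling H g k m j)" "arrival_function (doubling H g k i m)"
        by auto
      show "arrival_function (\<lambda>t. doubling H g k m j (doubling H g k i m t))"
        unfolding arrival_function_def mono_def
        using arrival_ge[OF 1(1)] arrival_ge[OF 1(2)] arrival_mono[OF 1(1)] arrival_mono[OF 1(2)]
        by (blast intro: order_trans)
    qed
    moreover have "doubling H g (Suc k) i j = (\<lambda>t. INF m\<in>H. doubling H g k m j (doubling H g k i m t))"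
      by (simp add: fun_eq_iff)
    ultimately show ?case by simp
  qed
  have ge: "earliest (H \<times> H) g i j t \<le> doubling H g k i j t" if "i \<in> H" "j \<in> H" for i j k t
    using that
  proof (induction k arbitrary: i j t)
    case 0
    then show ?case by (auto simp: earliest_self intro: earliest_edge)
  next
    case (Suc k)
    have "earliest (H \<times> H) g i j t \<le> doubling H g k m j (doubling H g k i m t)" if "m \<in> H" for m
    proof -
      have "earliest (H \<times> H) g i j t \<le> earliest (H \<times> H) g m j (earliest (H \<times> H) g i m t)"
        by (rule earliest_triangle)
      also have "\<dots> \<le> earliest (H \<times> H) g m j (doubling H g k i m t)"
        by (rule arrival_mono[OF arrival_earliest]) (use Suc that in auto)
      also have "\<dots> \<le> doubling H g k m j (doubling H g k i m t)" using Suc that by auto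
      finally show ?thesis .
    qed
    then show ?case by (auto intro: INF_greatest)
  qed
  have le: "doubling H g k i j t \<le> fold g p t"
    if "walk (H \<times> H) i p j" "length p \<le> 2 ^ k" "i \<in> H" "j \<in> H" for i j k p t
    using that
  proof (induction k arbitrary: i j p t)
    case 0
    show ?case
    proof (cases p)
      case (Cons e q)
      with 0 have "q = []" by (cases q) auto
      with Cons 0 show ?thesis
        by (cases e) (auto intro: arrival_ge[OF g])
    qed (use 0 in auto)
  next
    case (Suc k)
    obtain m where m: "walk (H \<times> H) i (take (2 ^ k) p) m" "walk (H \<times> H) m (drop (2 ^ k) p) j"
      using Suc.prems(1) walk_append[of "H \<times> H" i "take (2 ^ k) p" "drop (2 ^ k) p" j] by auto
    have mH: "m \<in> H"
      using m(2) Suc.prems by (cases "drop (2 ^ k) p") auto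
    have "doubling H g (Suc k) i j t \<le> doubling H g k m j (doubling H g k i m t)"
      using mH by (auto intro: INF_lower)
    also have "\<dots> \<le> doubling H g k m j (fold g (take (2 ^ k) p) t)"
      by (rule arrival_mono[OF arr]) (use Suc m mH in auto)
    also have "\<dots> \<le> fold g (drop (2 ^ k) p) (fold g (take (2 ^ k) p) t)"
      by (rule Suc.IH) (use Suc.prems m mH in auto)
    also have "\<dots> = fold g p t"
      using fold_append[of g "take (2 ^ k) p" "drop (2 ^ k) p"] by simp
    finally show ?case .
  qed
  show "earliest (H \<times> H) g i j t = doubling H g K i j t"
  proof (rule antisym)
    show "doubling H g K i j t \<le> earliest (H \<times> H) g i j t"
      unfolding earliest_def
    proof (rule INF_greatest)
      fix p assume "p \<in> {p. walk (H \<times> H) i p j}"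
      then obtain q where q: "walk (H \<times> H) i q j" "distinct (map fst q)" "fold g q t \<le> fold g p t"
        using shortcut by blast
      have "length q = card (set (map fst q))" using q(2) by (metis distinct_card length_map)
      also have "\<dots> \<le> card H" using walk_set[OF q(1)] by (intro card_mono H) auto
      finally have "length q \<le> 2 ^ K" using H by simp
      from le[OF q(1) this ij, of t] q(3) show "doubling H g K i j t \<le> fold g p t" by simp
    qed
  qed (rule ge[OF ij])
qed

lemma pieces_earliest_complete:
  assumes H: "finite H" "card H \<le> 2 ^ K" and k: "0 < k"
    and g: "\<And>e. e \<in> H \<times> H \<Longrightarrow> pieces k (g e)" and ij: "i \<in> H" "j \<in> H"
  shows "pieces ((4 * (2 ^ K) ^ 3) ^ K * k) (earliest (H \<times> H) g i j)"
proof -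
  have "arrival_function (g e)" if "e \<in> H \<times> H" for e using g[OF that] by (rule pieces_arrival)
  from earliest_eq_doubling[OF H this ij] show ?thesis
    using pieces_doubling[OF H k g ij] by simp
qed

lemma earliest_mono_edges: "E' \<subseteq> E \<Longrightarrow> earliest E A u v t \<le> earliest E' A u v t"
  unfolding earliest_def by (rule INF_superset_mono) (auto dest: walk_set intro: walk_mono)

text \<open>Missing edges become constantly infinite, so that the bound for complete digraphs
  applies to an induced subgraph.\<close>

lemma earliest_complete:
  assumes "fifo E A" and W: "finite W"
  defines "g \<equiv> \<lambda>e. if e \<in> E then A e else (\<lambda>_. \<infinity>)"
  shows "earliest (E \<inter> W \<times> W) A i j = earliest (W \<times> W) g i j"
proof
  fix t
  interpret fifo E A by fact
  interpret w: fifo "E \<inter> W \<times> W" A by unfold_locales (auto simp: arrival finite_E)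
  interpret c: fifo "W \<times> W" g
    by unfold_locales (auto simp: g_def arrival W, auto simp: arrival_function_def mono_def)
  show "earliest (E \<inter> W \<times> W) A i j t = earliest (W \<times> W) g i j t"
  proof (rule antisym)
    show "earliest (E \<inter> W \<times> W) A i j t \<le> earliest (W \<times> W) g i j t"
    proof (rule c.potential_le_earliest)
      fix u v assume uv: "(u, v) \<in> W \<times> W"
      show "earliest (E \<inter> W \<times> W) A i v t \<le> g (u, v) (earliest (E \<inter> W \<times> W) A i u t)"
      proof (cases "(u, v) \<in> E")
        case True
        have "earliest (E \<inter> W \<times> W) A i v t
            \<le> earliest (E \<inter> W \<times> W) A u v (earliest (E \<inter> W \<times> W) A i u t)"
          by (rule w.earliest_triangle)
        also have "\<dots> \<le> A (u, v) (earliest (E \<inter> W \<times> W) A i u t)"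
          by (rule w.earliest_edge) (use True uv in auto)
        finally show ?thesis using True by (simp add: g_def)
      qed (simp add: g_def)
    qed (simp add: w.earliest_self)
    show "earliest (W \<times> W) g i j t \<le> earliest (E \<inter> W \<times> W) A i j t"
    proof (rule w.potential_le_earliest)
      fix u v assume uv: "(u, v) \<in> E \<inter> W \<times> W"
      have "earliest (W \<times> W) g i v t \<le> earliest (W \<times> W) g u v (earliest (W \<times> W) g i u t)"
        by (rule c.earliest_triangle)
      also have "\<dots> \<le> g (u, v) (earliest (W \<times> W) g i u t)"
        by (rule c.earliest_edge) (use uv in auto)
      finally show "earliest (W \<times> W) g i v t \<le> A (u, v) (earliest (W \<times> W) g i u t)"
        using uv by (simp add: g_def)
    qed (simp add: c.earliest_self)
  qed
qed

text \<open>
  A walk in \<open>W1 \<union> W2\<close> splits at its visits of the separator \<open>W1 \<inter> W2\<close> into segments inside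
  \<open>W1\<close> or \<open>W2\<close>. Since arbitrary terminals \<open>i\<close> and \<open>j\<close> are allowed, no bookkeeping of
  boundaries is needed when this is iterated.
\<close>

lemma earliest_separator:
  assumes "fifo E A" and W: "finite W" "W = W1 \<union> W2" and ij: "i \<in> W" "j \<in> W"
    and sep: "E \<inter> W \<times> W \<subseteq> W1 \<times> W1 \<union> W2 \<times> W2"
  defines "H \<equiv> insert i (insert j (W1 \<inter> W2))"
  defines "g \<equiv> \<lambda>(a, b) t. min
      (if a \<in> W1 \<and> b \<in> W1 then earliest (E \<inter> W1 \<times> W1) A a b t else \<infinity>)
      (if a \<in> W2 \<and> b \<in> W2 then earliest (E \<inter> W2 \<times> W2) A a b t else \<infinity>)"
  shows "earliest (E \<inter> W \<times> W) A i j = earliest (H \<times> H) g i j"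
proof
  fix t
  interpret fifo E A by fact
  have fifo: "fifo (E \<inter> X \<times> X) A" for X by unfold_locales (auto simp: arrival finite_E)
  interpret w: fifo "E \<inter> W \<times> W" A by (rule fifo)
  interpret c: fifo "H \<times> H" g
  proof unfold_locales
    fix e
    have 1: "arrival_function (earliest (E \<inter> X \<times> X) A a b)" for X a b
      by (rule fifo.arrival_earliest[OF fifo])
    have "(INF l\<in>{W1, W2}. if fst e \<in> l \<and> snd e \<in> l then earliest (E \<inter> l \<times> l) A (fst e) (snd e) t else \<infinity>)
        = g e t" for t
      by (simp add: g_def case_prod_beta inf_min)
    then have "g e = (\<lambda>t. INF l\<in>{W1, W2}.
        if fst e \<in> l \<and> snd e \<in> l then earliest (E \<inter> l \<times> l) A (fst e) (snd e) t else \<infinity>)"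
      by (simp add: fun_eq_iff)
    moreover have "arrival_function \<dots>"
    proof (rule arrival_INF)
      fix l
      show "arrival_function (\<lambda>t. if fst e \<in> l \<and> snd e \<in> l
          then earliest (E \<inter> l \<times> l) A (fst e) (snd e) t else \<infinity>)"
        using 1 by (auto simp: arrival_function_def mono_def)
    qed
    ultimately show "arrival_function (g e)" by simp
  qed (use W in \<open>auto simp: H_def\<close>)
  have g_le: "g (a, b) y \<le> earliest (E \<inter> l \<times> l) A a b y" if "l \<in> {W1, W2}" "a \<in> l" "b \<in> l" for a b l y
    using that by (auto simp: g_def)
  let ?F = "earliest (H \<times> H) g"
  have F_step: "?F i b t \<le> earliest (E \<inter> l \<times> l) A a b (?F i a t)"
    if "l \<in> {W1, W2}" "a \<in> l" "b \<in> l" "a \<in> H" "b \<in> H" for a b l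
  proof -
    have "?F i b t \<le> ?F a b (?F i a t)" by (rule c.earliest_triangle)
    also have "\<dots> \<le> g (a, b) (?F i a t)" using that by (intro c.earliest_edge) auto
    also have "\<dots> \<le> earliest (E \<inter> l \<times> l) A a b (?F i a t)" by (rule g_le) (use that in auto)
    finally show ?thesis .
  qed
  \<comment> \<open>Here \<open>x\<close> is the terminal at which the walk last changed sides and
    \<open>l\<close> is the side in which it has remained since. An edge that does not lie in
    \<open>l\<close> starts in both sides, hence in the separator, and its tail becomes the new
    \<open>x\<close>.\<close>
  have inv: "\<exists>x\<in>H. \<exists>l\<in>{W1, W2}. x \<in> l \<and> v \<in> l \<and>
      earliest (E \<inter> l \<times> l) A x v (?F i x t) \<le> fold A p t"
    if "walk (E \<inter> W \<times> W) i p v" for p v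
    using that
  proof (induction p arbitrary: v rule: rev_induct)
    case Nil
    then have "v = i" by simp
    obtain l where l: "l \<in> {W1, W2}" "i \<in> l" using ij W by auto
    have "earliest (E \<inter> l \<times> l) A i i (?F i i t) = t"
      by (simp add: c.earliest_self fifo.earliest_self[OF fifo])
    then show ?case using \<open>v = i\<close> l by (intro bexI[of _ i] bexI[of _ l]) (auto simp: H_def)
  next
    case (snoc e p)
    then obtain u where u: "walk (E \<inter> W \<times> W) i p u" "e = (u, v)" "(u, v) \<in> E \<inter> W \<times> W"
      by (cases e) (auto simp: walk_append)
    obtain x l where x: "x \<in> H" "l \<in> {W1, W2}" "x \<in> l" "u \<in> l"
      "earliest (E \<inter> l \<times> l) A x u (?F i x t) \<le> fold A p t"
      using snoc.IH[OF u(1)] by blast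
    obtain l' where l': "l' \<in> {W1, W2}" "u \<in> l'" "v \<in> l'" using sep u(3) by blast
    have Amono: "y \<le> fold A p t \<Longrightarrow> A (u, v) y \<le> fold A (p @ [e]) t" for y
      using arrival_mono[OF arrival[of "(u, v)"]] u by simp
    show ?case
    proof (cases "l' = l")
      case True
      interpret l: fifo "E \<inter> l \<times> l" A by (rule fifo)
      have "earliest (E \<inter> l \<times> l) A x v (?F i x t)
          \<le> earliest (E \<inter> l \<times> l) A u v (earliest (E \<inter> l \<times> l) A x u (?F i x t))"
        by (rule l.earliest_triangle)
      also have "\<dots> \<le> A (u, v) (earliest (E \<inter> l \<times> l) A x u (?F i x t))"
        by (rule l.earliest_edge) (use u l' True in auto)
      also have "\<dots> \<le> fold A (p @ [e]) t" by (rule Amono) (rule x)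
      finally show ?thesis using x l' True by blast
    next
      case False
      then have uH: "u \<in> H" using x l' by (auto simp: H_def)
      interpret l: fifo "E \<inter> l' \<times> l'" A by (rule fifo)
      have "?F i u t \<le> fold A p t" using F_step[of l x u] x uH by auto
      then have "A (u, v) (?F i u t) \<le> fold A (p @ [e]) t" by (rule Amono)
      moreover have "earliest (E \<inter> l' \<times> l') A u v (?F i u t) \<le> A (u, v) (?F i u t)"
        by (rule l.earliest_edge) (use u l' in auto)
      ultimately show ?thesis using uH l' by (meson order_trans)
    qed
  qed
  show "earliest (E \<inter> W \<times> W) A i j t = earliest (H \<times> H) g i j t"
  proof (rule antisym)
    show "?F i j t \<le> earliest (E \<inter> W \<times> W) A i j t"
      unfolding earliest_def[of "E \<inter> W \<times> W"]
    proof (rule INF_greatest)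
      fix p assume "p \<in> {p. walk (E \<inter> W \<times> W) i p j}"
      then obtain x l where x: "x \<in> H" "l \<in> {W1, W2}" "x \<in> l" "j \<in> l"
        "earliest (E \<inter> l \<times> l) A x j (?F i x t) \<le> fold A p t"
        using inv by blast
      have "j \<in> H" by (simp add: H_def)
      from F_step[OF x(2-4) x(1) this] x(5) show "?F i j t \<le> fold A p t" by (rule order_trans)
    qed
    show "earliest (E \<inter> W \<times> W) A i j t \<le> ?F i j t"
    proof (rule c.potential_le_earliest)
      fix u v assume "(u, v) \<in> H \<times> H"
      let ?\<psi> = "\<lambda>v. earliest (E \<inter> W \<times> W) A i v t"
      have "?\<psi> v \<le> earliest (E \<inter> l \<times> l) A u v (?\<psi> u)" if "l \<subseteq> W" for l
      proof -
        have "?\<psi> v \<le> earliest (E \<inter> W \<times> W) A u v (?\<psi> u)" by (rule w.earliest_triangle)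
        also have "\<dots> \<le> earliest (E \<inter> l \<times> l) A u v (?\<psi> u)"
          by (rule earliest_mono_edges) (use that in auto)
        finally show ?thesis .
      qed
      then show "?\<psi> v \<le> g (u, v) (?\<psi> u)" using W by (auto simp: g_def)
    qed (simp add: w.earliest_self)
  qed
qed

section \<open>Balanced separators\<close>

text \<open>The quantification over \<open>W\<close> makes the property hereditary, as the recursion
  requires. Grouping components of at most half the size yields the ratio \<open>2 / 3\<close>; the
  separator belongs to both sides, hence the summand \<open>3 * c\<close>.\<close>

definition balanced_separators :: "nat \<Rightarrow> 'a set \<Rightarrow> ('a \<times> 'a) set \<Rightarrow> bool" where
  "balanced_separators c V E \<longleftrightarrow>
     (\<forall>W\<subseteq>V. \<exists>W1 W2. W = W1 \<union> W2 \<and> card (W1 \<inter> W2) \<le> c \<and>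
        E \<inter> W \<times> W \<subseteq> W1 \<times> W1 \<union> W2 \<times> W2 \<and>
        3 * card W1 \<le> 2 * card W + 3 * c \<and> 3 * card W2 \<le> 2 * card W + 3 * c)"

text \<open>As long as \<open>card W \<ge> 6 * c\<close>, a side has at most
  \<open>2 / 3 * card W + c \<le> 5 / 6 * card W\<close> vertices, so the recursion depth for size
  \<open>6 * c * (6 / 5) ^ l\<close> is \<open>l\<close>. A level costs
  \<open>16 = 2 * 2 ^ 3\<close> for the minimum over the two sides and the factor of the complete
  digraph on at most \<open>c + 2 \<le> 2 ^ K\<close> terminals. At the bottom all of
  \<open>W\<close> serves as the set of terminals.\<close>

lemma pieces_earliest_separators:
  fixes c K l :: nat
  assumes "fifo E A" and V: "finite V" "balanced_separators c V E" and k: "0 < k"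
    and A: "\<And>e. e \<in> E \<Longrightarrow> pieces k (A e)" and c: "1 \<le> c" "6 * c \<le> 2 ^ K"
    and "W \<subseteq> V" "real (card W) \<le> 6 * c * (6 / 5) ^ l" "i \<in> W" "j \<in> W"
  shows "pieces ((16 * (4 * (2 ^ K) ^ 3) ^ K) ^ Suc l * k) (earliest (E \<inter> W \<times> W) A i j)"
  using assms(8-)
proof (induction l arbitrary: W i j)
  case 0
  define g where "g e = (if e \<in> E then A e else (\<lambda>_. \<infinity>))" for e
  have W: "finite W" using 0 V finite_subset by blast
  have "card W \<le> 2 ^ K" using 0 c by (simp flip: of_nat_mult of_nat_le_iff)
  moreover have "pieces k (g e)" for e using A by (auto simp: g_def) (simp add: pieces_def)
  ultimately have "pieces ((4 * (2 ^ K) ^ 3) ^ K * k) (earliest (W \<times> W) g i j)"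
    using W k 0 by (intro pieces_earliest_complete) auto
  then show ?case
    unfolding earliest_complete[OF assms(1) W] g_def
    by (rule pieces_mono) simp
next
  case (Suc l)
  let ?C = "(4 * (2 ^ K) ^ 3) ^ K :: nat"
  let ?X = "(16 * ?C) ^ Suc l * k"
  have W: "finite W" using Suc V finite_subset by blast
  show ?case
  proof (cases "real (card W) \<le> 6 * c * (6 / 5) ^ l")
    case True
    from Suc.IH[OF Suc.prems(1) True Suc.prems(3,4)] show ?thesis
      by (rule pieces_mono) (simp add: mult_le_mono)
  next
    case False
    obtain W1 W2 where sep: "W = W1 \<union> W2" "card (W1 \<inter> W2) \<le> c"
        "E \<inter> W \<times> W \<subseteq> W1 \<times> W1 \<union> W2 \<times> W2"
        "3 * card W1 \<le> 2 * card W + 3 * c" "3 * card W2 \<le> 2 * card W + 3 * c"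
      using V(2) Suc.prems(1) unfolding balanced_separators_def by meson
    have "6 * real c * 1 \<le> 6 * real c * (6 / 5) ^ l" by (intro mult_left_mono) auto
    with False have big: "6 * real c \<le> real (card W)" by simp
    have small: "real (card X) \<le> 6 * c * (6 / 5) ^ l" if "3 * card X \<le> 2 * card W + 3 * c" for X :: "'a set"
    proof -
      have "3 * real (card X) \<le> 2 * real (card W) + 3 * real c" using that by linarith
      with big have "real (card X) \<le> 5 / 6 * real (card W)" by linarith
      also have "\<dots> \<le> 5 / 6 * (6 * c * (6 / 5) ^ Suc l)" using Suc.prems(2) by (intro mult_left_mono) auto
      finally show ?thesis by simp
    qed
    define H where "H = insert i (insert j (W1 \<inter> W2))"
    define g where "g = (\<lambda>(a, b) t. min
      (if a \<in> W1 \<and> b \<in> W1 then earliest (E \<inter> W1 \<times> W1) A a b t else \<infinity>)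
      (if a \<in> W2 \<and> b \<in> W2 then earliest (E \<inter> W2 \<times> W2) A a b t else \<infinity>))"
    have eq: "earliest (E \<inter> W \<times> W) A i j = earliest (H \<times> H) g i j"
      unfolding H_def g_def by (rule earliest_separator) (use assms(1) W sep Suc.prems in auto)
    have g: "pieces (16 * ?X) (g e)" for e
    proof -
      define f where "f l = (if fst e \<in> l \<and> snd e \<in> l then earliest (E \<inter> l \<times> l) A (fst e) (snd e) else (\<lambda>_. \<infinity>))" for l
      have f: "pieces ?X (f l)" if "l \<in> {W1, W2}" for l
      proof (cases "fst e \<in> l \<and> snd e \<in> l")
        case True
        have "l \<subseteq> V" using \<open>l \<in> {W1, W2}\<close> sep Suc.prems by auto
        moreover have "3 * card l \<le> 2 * card W + 3 * c" using \<open>l \<in> {W1, W2}\<close> sep by auto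
        ultimately show ?thesis using Suc.IH[OF _ small] True by (simp add: f_def)
      next
        case False
        then have "f l = (\<lambda>_. \<infinity>)" by (auto simp: f_def)
        then show ?thesis by (simp add: pieces_def)
      qed
      have "pieces (2 * 2 ^ 3 * ?X) (\<lambda>t. INF l\<in>{W1, W2}. f l t)"
        using f card_insert_le_m1[of 2 "{W2}" W1] by (intro pieces_INF) auto
      moreover have "g e = (\<lambda>t. INF l\<in>{W1, W2}. f l t)"
        by (cases "fst e \<in> W1 \<and> snd e \<in> W1"; cases "fst e \<in> W2 \<and> snd e \<in> W2")
          (auto simp: g_def f_def case_prod_beta inf_min fun_eq_iff)
      ultimately show ?thesis by simp
    qed
    have "card H \<le> Suc (Suc c)"
      unfolding H_def using sep(2) by (intro order_trans[OF card_insert_le_m1]) (auto intro!: card_insert_le_m1)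
    then have "card H \<le> 2 ^ K" using c by linarith
    moreover have "finite H" using W sep by (auto simp: H_def)
    moreover have "0 < 16 * ?X" using k by simp
    ultimately have "pieces (?C * (16 * ?X)) (earliest (H \<times> H) g i j)"
      by (intro pieces_earliest_complete g) (auto simp: H_def)
    then show ?thesis unfolding eq by (rule pieces_mono) (simp add: algebra_simps)
  qed
qed

section \<open>Rooting the decomposition tree\<close>

lemma connected_closed:
  assumes conn: "Digraph_Component.connected G" and C: "x \<in> C" "x \<in> verts G"
    and closed: "\<And>e. e \<in> arcs G \<Longrightarrow> tail G e \<in> C \<longleftrightarrow> head G e \<in> C"
  shows "verts G \<subseteq> C"
proof
  fix y assume y: "y \<in> verts G"
  have "(x, y) \<in> rtrancl_on (verts G) (parcs (mk_symmetric G))"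
    using conn C y unfolding Digraph_Component.connected_def strongly_connected_def reachable_def by auto
  then show "y \<in> C"
  proof (induction rule: rtrancl_on_induct)
    case (step y z)
    then show ?case using closed by (auto simp: parcs_mk_symmetric)
  qed (use C in auto)
qed

text \<open>Consecutive edges are linked, so the edge at which the list is cut starts where the kept
  part ends.\<close>

lemma walk_takeWhile: "walk E u q v \<Longrightarrow> walk E u (takeWhile (\<lambda>e. fst e \<noteq> v) q) v"
  by (induction q arbitrary: u) auto

lemma pawalk_verts_walk: "walk E u p v \<Longrightarrow> pawalk_verts u p = map fst p @ [v]"
  by (induction p arbitrary: u) auto

lemma pcas_walk: "walk E u p v \<Longrightarrow> pcas u p v"
  by (induction p arbitrary: u) auto

inductive descendant :: "(nat \<Rightarrow> nat) \<Rightarrow> nat \<Rightarrow> nat \<Rightarrow> bool" for par i where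
  descendant_self: "descendant par i i"
| descendant_up: "0 < k \<Longrightarrow> descendant par i (par k) \<Longrightarrow> descendant par i k"

lemma descendant_le:
  assumes "\<And>k. 0 < k \<Longrightarrow> par k < k" and "descendant par i k"
  shows "i \<le> k"
  using assms(2) by induction (use assms(1) in \<open>auto intro: order_trans less_imp_le\<close>)

lemma descendant_parent: "descendant par i k \<Longrightarrow> k \<noteq> i \<Longrightarrow> 0 < k \<and> descendant par i (par k)"
  by (cases rule: descendant.cases) auto

lemma descendant_0: "(\<And>k. 0 < k \<Longrightarrow> par k < k) \<Longrightarrow> descendant par 0 k"
proof (induction k rule: less_induct)
  case (less k)
  then show ?case by (cases "k = 0") (auto intro: descendant.intros)
qed

text \<open>
  The nodes of the decomposition tree are numbered such that parents precede their children; a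
  set of nodes is connected if it contains the parents of all its nodes but the first.
\<close>

lemma tree_decomposition_parents:
  fixes G :: "'a pair_pre_digraph" and T :: "'b pair_pre_digraph"
  assumes "tree_decomposition G T X"
  obtains N :: nat and Y :: "nat \<Rightarrow> 'a set" and par :: "nat \<Rightarrow> nat"
  where "0 < N" "\<And>i. i < N \<Longrightarrow> Y i \<in> X ` pverts T" "\<And>i. N \<le> i \<Longrightarrow> Y i = {}"
    "(\<Union>i. Y i) = pverts G"
    "\<And>u v. (u, v) \<in> parcs G \<Longrightarrow> \<exists>i. u \<in> Y i \<and> v \<in> Y i"
    "\<And>i. 0 < i \<Longrightarrow> par i < i"
    "\<And>v i j. v \<in> Y i \<Longrightarrow> v \<in> Y j \<Longrightarrow> j < i \<Longrightarrow> v \<in> Y (par i)"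
proof -
  from assms have tree: "undirected_tree T" and cover: "(\<Union>x\<in>pverts T. X x) = pverts G"
    and edges: "\<And>u v. (u, v) \<in> parcs G \<Longrightarrow> \<exists>x\<in>pverts T. u \<in> X x \<and> v \<in> X x"
    and conn: "\<And>v. v \<in> pverts G \<Longrightarrow>
        Digraph_Component.connected (with_proj T \<restriction> {x \<in> pverts T. v \<in> X x})"
    by (auto simp: tree_decomposition_def)
  from tree have "pair_graph T" and connT: "Digraph_Component.connected (with_proj T)"
    and acyclic: "\<And>p. pre_digraph.cycle (with_proj T) p \<Longrightarrow> length p < 3"
    by (auto simp: undirected_tree_def not_le)
  interpret pair_graph T by fact
  have sym: "(y, x) \<in> parcs T" if "(x, y) \<in> parcs T" for x y
    using that pair_sym_arcs by (auto simp: symmetric_def dest: symD)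
  have inT: "x \<in> pverts T" "y \<in> pverts T" if "(x, y) \<in> parcs T" for x y
    using that arc_fst_in_verts[of "(x, y)"] arc_snd_in_verts[of "(x, y)"] by auto
  have neT: "pverts T \<noteq> {}"
    using connT by (auto simp: Digraph_Component.connected_def strongly_connected_def)
  \<comment> \<open>The tree is grown from a root: every later node has an earlier neighbour, which
    will be its parent. Connectedness supplies an arc leaving the nodes listed so far.\<close>
  define grown where "grown xs \<longleftrightarrow> distinct xs \<and> set xs \<subseteq> pverts T \<and>
    (\<forall>i<length xs. 0 < i \<longrightarrow> (\<exists>j<i. (xs ! j, xs ! i) \<in> parcs T))" for xs
  have "\<exists>xs. grown xs \<and> length xs = Suc k" if "Suc k \<le> card (pverts T)" for k
    using that
  proof (induction k)
    case 0
    obtain r where "r \<in> pverts T" using neT by auto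
    then show ?case by (intro exI[of _ "[r]"]) (auto simp: grown_def)
  next
    case (Suc k)
    then obtain xs where xs: "grown xs" "length xs = Suc k" by auto
    then have "card (set xs) < card (pverts T)" using Suc by (simp add: grown_def distinct_card)
    then have "\<not> pverts T \<subseteq> set xs" by (metis card_mono List.finite_set linorder_not_less)
    moreover obtain r where "r \<in> set xs" using xs(2) by (cases xs) auto
    ultimately obtain e where "e \<in> parcs T" "\<not> (fst e \<in> set xs \<longleftrightarrow> snd e \<in> set xs)"
      using connected_closed[OF connT, of r "set xs"] xs by (auto simp: grown_def)
    then obtain y z where yz: "(y, z) \<in> parcs T" "y \<in> set xs" "z \<notin> set xs"
      using sym by (cases e) auto
    have "grown (xs @ [z])"
    proof -
      have "\<exists>j<i. ((xs @ [z]) ! j, (xs @ [z]) ! i) \<in> parcs T" if i: "i < length (xs @ [z])" "0 < i" for i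
      proof (cases "i < length xs")
        case True
        then obtain j where "j < i" "(xs ! j, xs ! i) \<in> parcs T" using xs(1) i by (auto simp: grown_def)
        then show ?thesis using True by (intro exI[of _ j]) (auto simp: nth_append)
      next
        case False
        then have "i = length xs" using i by auto
        moreover obtain j where "j < length xs" "xs ! j = y" using yz(2) by (auto simp: in_set_conv_nth)
        ultimately show ?thesis using yz by (intro exI[of _ j]) (auto simp: nth_append)
      qed
      then show ?thesis using xs(1) yz inT unfolding grown_def by auto
    qed
    then show ?case using xs by (intro exI[of _ "xs @ [z]"]) auto
  qed
  from this[of "card (pverts T) - 1"] neT pair_finite_verts
  obtain xs where xs: "grown xs" "length xs = card (pverts T)"
    by (metis Suc_pred' card_gt_0_iff order_refl)
  define N where "N = length xs"
  have N: "0 < N" using xs neT pair_finite_verts by (simp add: N_def card_gt_0_iff)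
  have dist: "distinct xs" and sub: "set xs \<subseteq> pverts T"
    and ex_par: "\<And>i. i < N \<Longrightarrow> 0 < i \<Longrightarrow> \<exists>j<i. (xs ! j, xs ! i) \<in> parcs T"
    using xs(1) by (auto simp: grown_def N_def)
  have set_xs: "set xs = pverts T"
    by (rule card_subset_eq[OF pair_finite_verts sub]) (use xs dist in \<open>simp add: distinct_card\<close>)
  \<comment> \<open>Two earlier neighbours would be joined by a simple path inside the prefix, and
    together with \<open>xs ! i\<close> this closes a cycle of length at least
    \<open>3\<close>.\<close>
  have unique: "j = j'"
    if i: "i < N" and j: "j < i" "(xs ! j, xs ! i) \<in> parcs T" and j': "j' < i" "(xs ! j', xs ! i) \<in> parcs T"
    for i j j'
  proof (rule ccontr)
    assume ne: "j \<noteq> j'"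
    define F where "F = parcs T \<inter> set (take i xs) \<times> set (take i xs)"
    have pre: "xs ! a \<in> set (take i xs)" if "a < i" for a
      using nth_mem[of a "take i xs"] that i by (simp add: N_def)
    have inF: "(xs ! a, xs ! b) \<in> F" if "(xs ! a, xs ! b) \<in> parcs T" "a < i" "b < i" for a b
      using that pre by (simp add: F_def)
    have reach: "\<exists>p q. walk F (xs ! 0) p (xs ! a) \<and> walk F (xs ! a) q (xs ! 0)" if "a < i" for a
      using that
    proof (induction a rule: less_induct)
      case (less a)
      show ?case
      proof (cases "a = 0")
        case False
        then obtain b where b: "b < a" "(xs ! b, xs ! a) \<in> parcs T"
          using ex_par[of a] less.prems i by auto
        obtain p q where "walk F (xs ! 0) p (xs ! b)" "walk F (xs ! b) q (xs ! 0)"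
          using less.IH[OF b(1)] b less.prems by auto
        then have "walk F (xs ! 0) (p @ [(xs ! b, xs ! a)]) (xs ! a)" "walk F (xs ! a) ((xs ! a, xs ! b) # q) (xs ! 0)"
          using inF[OF b(2)] inF[OF sym[OF b(2)]] b less.prems by (auto simp: walk_append)
        then show ?thesis by blast
      qed (auto intro: exI[of _ "[]"])
    qed
    obtain p0 where "walk F (xs ! j) p0 (xs ! j')"
      using reach[OF j(1)] reach[OF j'(1)] walk_append by metis
    \<comment> \<open>The arrival functions are identities, since only the removal of repetitions by
      \<open>shortcut\<close> is wanted.\<close>
    interpret F: fifo F "\<lambda>_ t. t"
      by unfold_locales (auto simp: arrival_function_def mono_def F_def)
    obtain q0 where q0: "walk F (xs ! j) q0 (xs ! j')" "distinct (map fst q0)"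
      using F.shortcut[OF \<open>walk F (xs ! j) p0 (xs ! j')\<close>] by blast
    \<comment> \<open>\<open>shortcut\<close> leaves open whether the end vertex is visited earlier;
      cutting at its first visit makes the cycle simple.\<close>
    define q where "q = takeWhile (\<lambda>e. fst e \<noteq> xs ! j') q0"
    have q: "walk F (xs ! j) q (xs ! j')" using q0(1) unfolding q_def by (rule walk_takeWhile)
    have dq: "distinct (map fst q)" using q0(2) unfolding q_def
      by (metis distinct_append map_append takeWhile_dropWhile_id)
    have nq: "xs ! j' \<notin> set (map fst q)" by (auto simp: q_def dest: set_takeWhileD)
    have "xs ! j \<noteq> xs ! j'" using ne i j j' dist by (auto simp: N_def nth_eq_iff_index_eq)
    then have "q \<noteq> []" using q by auto
    have xi: "xs ! i \<notin> set (take i xs)"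
      using dist i by (auto simp: N_def in_set_conv_nth nth_eq_iff_index_eq)
    define p where "p = (xs ! i, xs ! j) # q @ [(xs ! j', xs ! i)]"
    have "walk (parcs T) (xs ! j) q (xs ! j')"
      by (rule walk_mono[OF q]) (use walk_set[OF q] in \<open>auto simp: F_def\<close>)
    then have w: "walk (parcs T) (xs ! i) p (xs ! i)"
      using sym j j' by (auto simp: p_def walk_append)
    have "pre_digraph.awalk (with_proj T) (xs ! i) p (xs ! i)"
      unfolding pre_digraph.awalk_def using walk_set[OF w] pcas_walk[OF w] i sub
      by (auto simp: N_def cas_with_proj_eq)
    moreover have "distinct (tl (pawalk_verts (xs ! i) p))"
    proof -
      have "set (map fst q) \<subseteq> set (take i xs)" using walk_set[OF q] by (auto simp: F_def)
      then show ?thesis unfolding pawalk_verts_walk[OF w]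
        using dq nq xi pre[OF j'(1)] by (auto simp: p_def)
    qed
    ultimately have "pre_digraph.cycle (with_proj T) p"
      unfolding pre_digraph.cycle_def by (auto simp: awalk_verts_with_proj_eq p_def intro!: exI[of _ "xs ! i"])
    from acyclic[OF this] \<open>q \<noteq> []\<close> show False by (cases q) (auto simp: p_def)
  qed
  define par where "par i = (if i < N then (SOME j. j < i \<and> (xs ! j, xs ! i) \<in> parcs T) else 0)" for i
  have par: "par i < i \<and> (xs ! par i, xs ! i) \<in> parcs T" if "0 < i" "i < N" for i
    using someI_ex[OF ex_par[OF that(2,1)]] that by (simp add: par_def)
  have par_less: "par i < i" if "0 < i" for i using par[OF that] that by (cases "i < N") (auto simp: par_def)
  have par_eq: "j = par i" if "j < i" "i < N" "(xs ! j, xs ! i) \<in> parcs T" for i j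
  proof -
    have "0 < i" using that by simp
    from par[OF this that(2)] show ?thesis using unique[OF that(2,1,3)] by blast
  qed
  define Y where "Y i = (if i < N then X (xs ! i) else {})" for i
  have "v \<in> Y (par i)" if v: "v \<in> Y i" "v \<in> Y j" "j < i" for v i j
  proof (rule ccontr)
    assume contr: "v \<notin> Y (par i)"
    have ij: "i < N" "j < N" using v by (auto simp: Y_def split: if_splits)
    let ?S = "{x \<in> pverts T. v \<in> X x}"
    have "xs ! i \<in> pverts T" using ij sub by (auto simp: N_def)
    then have "v \<in> pverts G" using v ij cover by (auto simp: Y_def)
    \<comment> \<open>The nodes of the subtree of \<open>i\<close>. If the bag of the parent misses
      \<open>v\<close>, no tree edge between bags containing \<open>v\<close> leaves this subtree.
      Connectedness of these bags then puts \<open>j\<close> below \<open>i\<close>, against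
      \<open>j < i\<close>.\<close>
    define C where "C = (\<lambda>k. xs ! k) ` {k. k < N \<and> descendant par i k}"
    have idx: "\<exists>k<N. x = xs ! k" if "x \<in> pverts T" for x
      using that set_xs by (metis N_def in_set_conv_nth)
    have memC: "xs ! k \<in> C \<longleftrightarrow> descendant par i k" if "k < N" for k
      using that dist by (auto simp: C_def N_def nth_eq_iff_index_eq)
    have "?S \<subseteq> C"
    proof -
      have "verts (with_proj T \<restriction> ?S) \<subseteq> C"
      proof (rule connected_closed[OF conn])
        show "v \<in> pverts G" by fact
        show "xs ! i \<in> C" using memC ij by (simp add: descendant_self)
        show "xs ! i \<in> verts (with_proj T \<restriction> ?S)" using v ij sub by (auto simp: Y_def N_def)
        fix e assume "e \<in> arcs (with_proj T \<restriction> ?S)"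
        then obtain y z where yz: "e = (y, z)" "(y, z) \<in> parcs T" "y \<in> ?S" "z \<in> ?S"
          by (cases e) auto
        obtain k l where "k < N" "y = xs ! k" "l < N" "z = xs ! l"
          using idx[of y] idx[of z] yz by auto
        with yz have kl: "k < N" "l < N" "e = (xs ! k, xs ! l)" "e \<in> parcs T" "v \<in> Y k" "v \<in> Y l"
          by (auto simp: Y_def)
        have up: "descendant par i k \<longleftrightarrow> descendant par i l"
          if kl: "k < l" "l < N" "(xs ! k, xs ! l) \<in> parcs T" "v \<in> Y k" for k l
        proof -
          have k: "k = par l" by (rule par_eq) (use kl in auto)
          then have "l \<noteq> i" using contr kl by auto
          then show ?thesis using descendant_parent[of par i l] k kl by (auto intro: descendant_up)
        qed
        have "k \<noteq> l" using kl no_loops[of e] by auto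
        then have "descendant par i k \<longleftrightarrow> descendant par i l"
        proof (cases "k < l")
          case True
          from up[OF this kl(2)] kl show ?thesis by simp
        next
          case False
          then have "l < k" using \<open>k \<noteq> l\<close> by simp
          from up[OF this kl(1)] kl sym[of "xs ! k" "xs ! l"] show ?thesis by simp
        qed
        then show "tail (with_proj T \<restriction> ?S) e \<in> C \<longleftrightarrow> head (with_proj T \<restriction> ?S) e \<in> C"
          using memC kl by simp
      qed
      then show ?thesis by simp
    qed
    moreover have "xs ! j \<in> ?S" using v ij sub by (auto simp: Y_def N_def)
    ultimately have "descendant par i j" using memC ij by auto
    from descendant_le[OF par_less this] v show False by simp
  qed
  moreover have "(\<Union>i. Y i) = pverts G"
  proof
    have "Y i \<subseteq> pverts G" for i
    proof (cases "i < N")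
      case True
      then have "xs ! i \<in> pverts T" using sub by (auto simp: N_def)
      then show ?thesis using cover True by (auto simp: Y_def)
    qed (simp add: Y_def)
    then show "(\<Union>i. Y i) \<subseteq> pverts G" by blast
    show "pverts G \<subseteq> (\<Union>i. Y i)"
    proof
      fix v assume "v \<in> pverts G"
      then obtain x where "x \<in> set xs" "v \<in> X x" using cover set_xs by auto
      then obtain k where "k < N" "x = xs ! k" by (auto simp: N_def in_set_conv_nth)
      with \<open>v \<in> X x\<close> have "v \<in> Y k" by (simp add: Y_def)
      then show "v \<in> (\<Union>i. Y i)" by blast
    qed
  qed
  moreover have "\<exists>i. u \<in> Y i \<and> v \<in> Y i" if uv: "(u, v) \<in> parcs G" for u v
  proof -
    obtain x where x: "x \<in> set xs" "u \<in> X x" "v \<in> X x" using edges[OF uv] set_xs by auto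
    obtain k where "k < N" "x = xs ! k" using x(1) by (auto simp: N_def in_set_conv_nth)
    with x show ?thesis by (intro exI[of _ k]) (simp add: Y_def)
  qed
  moreover have "Y i \<in> X ` pverts T" if "i < N" for i
  proof -
    have "xs ! i \<in> pverts T" using that sub by (auto simp: N_def)
    then show ?thesis using that by (simp add: Y_def)
  qed
  moreover have "Y i = {}" if "N \<le> i" for i using that by (simp add: Y_def)
  ultimately show ?thesis
    using that[of N Y par, OF N _ _ _ _ par_less] by blast
qed

text \<open>Let \<open>k\<close> be the first key at which the keys up to \<open>k\<close> collect a
  third of \<open>m\<close>. If they collect at most two thirds, they form one part. Otherwise the
  keys before \<open>k\<close> have at most a third, so \<open>k\<close> alone has more than a
  third, and at most half by assumption, and forms a part by itself.\<close>

lemma balanced_partition: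
  fixes key :: "'a \<Rightarrow> nat"
  assumes U: "finite U" "card U \<le> m" and fiber: "\<And>k. 2 * card {v \<in> U. key v = k} \<le> m"
  obtains K where "3 * card {v \<in> U. key v \<in> K} \<le> 2 * m" "3 * card {v \<in> U. key v \<notin> K} \<le> 2 * m"
proof (cases "\<exists>k. m \<le> 3 * card {v \<in> U. key v \<le> k}")
  case False
  obtain b where "\<forall>v\<in>U. key v \<le> b" using U(1) finite_nat_set_iff_bounded_le[of "key ` U"] by auto
  then have 1: "{v \<in> U. key v \<in> UNIV} = {v \<in> U. key v \<le> b}" by auto
  have 2: "3 * card {v \<in> U. key v \<le> b} < m" using False by (simp add: not_le)
  show ?thesis by (rule that[of UNIV]) (use 1 2 in auto)
next
  case True
  define k where "k = (LEAST k. m \<le> 3 * card {v \<in> U. key v \<le> k})"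
  have k: "m \<le> 3 * card {v \<in> U. key v \<le> k}" unfolding k_def using True by (rule LeastI_ex)
  have less: "3 * card {v \<in> U. key v < k} \<le> m"
  proof (cases k)
    case (Suc k')
    then have "\<not> m \<le> 3 * card {v \<in> U. key v \<le> k'}" using not_less_Least[of k' "\<lambda>k. m \<le> 3 * card {v \<in> U. key v \<le> k}"]
      by (simp add: k_def)
    then show ?thesis by (simp add: Suc less_Suc_eq_le)
  qed simp
  have split: "card {v \<in> U. P v} + card {v \<in> U. \<not> P v} = card U" for P
  proof -
    have "card U = card ({v \<in> U. P v} \<union> {v \<in> U. \<not> P v})" by (rule arg_cong[of _ _ card]) auto
    also have "\<dots> = card {v \<in> U. P v} + card {v \<in> U. \<not> P v}"
      by (rule card_Un_disjoint) (use U in auto)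
    finally show ?thesis by simp
  qed
  have "{v \<in> U. key v \<le> k} = {v \<in> U. key v < k} \<union> {v \<in> U. key v = k}" by auto
  then have sum: "card {v \<in> U. key v \<le> k} = card {v \<in> U. key v < k} + card {v \<in> U. key v = k}"
    using U by (subst card_Un_disjoint[symmetric]) auto
  show ?thesis
  proof (cases "3 * card {v \<in> U. key v \<le> k} \<le> 2 * m")
    case True
    show ?thesis
      by (rule that[of "{..k}"]) (use True k split[of "\<lambda>v. key v \<le> k"] U in auto)
  next
    case False
    show ?thesis
      by (rule that[of "{k}"]) (use False less sum fiber[of k] split[of "\<lambda>v. key v = k"] U in auto)
  qed
qed

text \<open>
  \<open>branch par x k\<close> names the component of the tree without \<open>x\<close> that contains \<open>k\<close>: the child
  of \<open>x\<close> above \<open>k\<close>, or \<open>0\<close> if \<open>k\<close> is not below \<open>x\<close>.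
\<close>

fun branch :: "(nat \<Rightarrow> nat) \<Rightarrow> nat \<Rightarrow> nat \<Rightarrow> nat" where
  "branch par x k =
     (if k \<le> x then 0 else if par k = x then k else if par k < k then branch par x (par k) else 0)"

declare branch.simps [simp del]

lemma branch_descendant:
  "branch par x k \<noteq> 0 \<Longrightarrow> x < branch par x k \<and> descendant par (branch par x k) k"
proof (induction par x k rule: branch.induct)
  case (1 par x k)
  show ?case
  proof (cases "k \<le> x \<or> par k = x \<or> \<not> par k < k")
    case True
    with 1(2) show ?thesis
      by (auto simp: branch.simps[of par x k] intro: descendant_self split: if_splits)
  next
    case False
    then have "branch par x k = branch par x (par k)" by (simp add: branch.simps[of par x k])
    with 1 False show ?thesis by (auto intro: descendant_up)
  qed
qed

lemma descendant_branch:
  assumes par: "\<And>k. 0 < k \<Longrightarrow> par k < k" and "descendant par x k" "k \<noteq> x"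
  shows "branch par x k \<noteq> 0"
  using assms(2,3)
proof induction
  case (descendant_up k)
  have "x < k" using descendant_le[OF par descendant_up.hyps(2)] par[OF descendant_up.hyps(1)] by simp
  then show ?case using descendant_up par[of k] by (cases "par k = x") (auto simp: branch.simps[of par x k])
qed simp

text \<open>A centroid argument. Every vertex of \<open>W\<close> is charged to its first bag. The
  node \<open>x\<close> has at least half of the charges below it, but none of its children has more
  than half. Without the bag of \<open>x\<close>, the vertices fall into groups of at most half of
  \<open>W\<close>, one for each component of the tree without \<open>x\<close>, and
  \<open>balanced_partition\<close> merges these groups.\<close>

lemma tree_decomposition_separators:
  fixes G :: "'a pair_pre_digraph"
  assumes "tree_decomposition G T X" and fin: "finite (pverts G)"
    and c: "\<And>x. x \<in> pverts T \<Longrightarrow> card (X x) \<le> c"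
  shows "balanced_separators c (pverts G) (parcs G)"
  unfolding balanced_separators_def
proof (intro allI impI)
  fix W assume "W \<subseteq> pverts G"
  obtain N :: nat and Y :: "nat \<Rightarrow> 'a set" and par :: "nat \<Rightarrow> nat" where Y: "0 < N" "\<And>i. i < N \<Longrightarrow> Y i \<in> X ` pverts T" "\<And>i. N \<le> i \<Longrightarrow> Y i = {}"
    "(\<Union>i. Y i) = pverts G" "\<And>u v. (u, v) \<in> parcs G \<Longrightarrow> \<exists>i. u \<in> Y i \<and> v \<in> Y i"
    and par: "\<And>i. 0 < i \<Longrightarrow> par i < i"
    and Ypar: "\<And>v i j. v \<in> Y i \<Longrightarrow> v \<in> Y j \<Longrightarrow> j < i \<Longrightarrow> v \<in> Y (par i)"
  proof (rule tree_decomposition_parents[OF assms(1)], goal_cases)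
    case (1 N Y par)
    show ?case by (rule 1(1)[OF 1(2-8)])
  qed
  have W: "finite W" using fin \<open>W \<subseteq> pverts G\<close> finite_subset by blast
  define r where "r v = (LEAST i. v \<in> Y i)" for v
  have r: "v \<in> Y (r v)" if "v \<in> W" for v
    unfolding r_def by (rule LeastI_ex) (use that Y(4) \<open>W \<subseteq> pverts G\<close> in blast)
  have r_le: "r v \<le> i" if "v \<in> Y i" for v i unfolding r_def using that by (rule Least_le)
  have rN: "r v < N" if "v \<in> W" for v using r[OF that] Y(3) by (cases "r v < N") auto
  define below where "below x = {v \<in> W. descendant par x (r v)}" for x
  \<comment> \<open>Children have larger numbers than their parents, so maximality leaves at most
    half of \<open>W\<close> below each child of \<open>x\<close>. The root \<open>0\<close> shows
    that the set is nonempty.\<close>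
  define x where "x = Max {x. x < N \<and> card W \<le> 2 * card (below x)}"
  have "below 0 = W" using descendant_0[OF par] by (auto simp: below_def)
  then have "x \<in> {x. x < N \<and> card W \<le> 2 * card (below x)}"
    unfolding x_def by (intro Max_in) (use Y(1) in auto)
  then have x: "x < N" "card W \<le> 2 * card (below x)" by auto
  have above: "2 * card (below k) \<le> card W" if "x < k" for k
  proof (cases "k < N")
    case True
    have "k \<notin> {x. x < N \<and> card W \<le> 2 * card (below x)}"
    proof
      assume k: "k \<in> {x. x < N \<and> card W \<le> 2 * card (below x)}"
      have "k \<le> x" unfolding x_def by (rule Max_ge) (use k in auto)
      with that show False by simp
    qed
    then show ?thesis using True by auto
  next
    case False
    have "\<not> descendant par k (r v)" if "v \<in> W" for v
      using descendant_le[OF par, of k "r v"] rN[OF that] False by auto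
    then have "below k = {}" by (auto simp: below_def)
    then show ?thesis by simp
  qed
  define U where "U = W - Y x"
  define key where "key v = branch par x (r v)" for v
  have U: "finite U" "card U \<le> card W" using W by (auto simp: U_def intro: card_mono)
  have fiber: "2 * card {v \<in> U. key v = k} \<le> card W" for k
  proof (cases "k = 0")
    case True
    have "{v \<in> U. key v = k} \<subseteq> W - below x"
    proof
      fix v assume v: "v \<in> {v \<in> U. key v = k}"
      then have "r v \<noteq> x" using r by (auto simp: U_def)
      then show "v \<in> W - below x" using descendant_branch[OF par, of x "r v"] v True
        by (auto simp: U_def key_def below_def)
    qed
    then have "card {v \<in> U. key v = k} \<le> card (W - below x)" using W by (intro card_mono) auto
    also have "\<dots> = card W - card (below x)" using W by (intro card_Diff_subset) (auto simp: below_def)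
    finally show ?thesis using x(2) by linarith
  next
    case False
    show ?thesis
    proof (cases "{v \<in> U. key v = k} = {}")
      case ne: False
      then have "x < k" using branch_descendant[of par x] False by (auto simp: key_def)
      have "{v \<in> U. key v = k} \<subseteq> below k"
        using branch_descendant[of par x] False by (auto simp: key_def below_def U_def)
      then have "card {v \<in> U. key v = k} \<le> card (below k)" using W by (intro card_mono) (auto simp: below_def)
      with above[OF \<open>x < k\<close>] show ?thesis by simp
    next
      case True
      show ?thesis unfolding True by simp
    qed
  qed
  obtain K where K: "3 * card {v \<in> U. key v \<in> K} \<le> 2 * card W" "3 * card {v \<in> U. key v \<notin> K} \<le> 2 * card W"
    by (rule balanced_partition[OF U fiber])
  \<comment> \<open>Climbing from any bag of \<open>v\<close> to its first bag passes only through
    bags of \<open>v\<close>, hence never through \<open>x\<close>. So all bags of \<open>v\<close>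
    lie in one component, and an edge whose ends avoid the bag of \<open>x\<close> stays within one
    group.\<close>
  have comp: "branch par x i = key v" if "v \<in> Y i" "v \<notin> Y x" for v i
    using that(1)
  proof (induction i rule: less_induct)
    case (less i)
    show ?case
    proof (cases "i = r v")
      case False
      then have ri: "r v < i" using r_le[OF less.prems] by simp
      have "v \<in> Y (r v)" using less.prems unfolding r_def by (rule LeastI)
      then have vp: "v \<in> Y (par i)" using Ypar[OF less.prems _ ri] by simp
      then have "par i \<noteq> x" "i \<noteq> x" using that less.prems by auto
      moreover have "par i < i" using par ri by simp
      ultimately have "branch par x i = branch par x (par i)"
        by (auto simp: branch.simps[of par x i]) (auto simp: branch.simps[of par x "par i"])
      then show ?thesis using less.IH[OF \<open>par i < i\<close> vp] by simp
    qed (simp add: key_def)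
  qed
  define W1 where "W1 = {v \<in> U. key v \<in> K} \<union> (W \<inter> Y x)"
  define W2 where "W2 = {v \<in> U. key v \<notin> K} \<union> (W \<inter> Y x)"
  have "Y x \<in> X ` pverts T" using Y(2) x by simp
  then have cY: "card (Y x) \<le> c" using c by auto
  have "Y x \<subseteq> pverts G" unfolding Y(4)[symmetric] by (rule UN_upper) simp
  then have "finite (Y x)" using fin by (rule finite_subset)
  from card_mono[OF this Int_lower2] cY have S: "card (W \<inter> Y x) \<le> c" by (rule order_trans)
  have "W = W1 \<union> W2" by (auto simp: W1_def W2_def U_def)
  moreover have "card (W1 \<inter> W2) \<le> c"
  proof -
    have "W1 \<inter> W2 = W \<inter> Y x" by (auto simp: W1_def W2_def U_def)
    with S show ?thesis by simp
  qed
  moreover have "parcs G \<inter> W \<times> W \<subseteq> W1 \<times> W1 \<union> W2 \<times> W2"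
  proof
    fix e assume "e \<in> parcs G \<inter> W \<times> W"
    then obtain u v where e: "e = (u, v)" "(u, v) \<in> parcs G" "u \<in> W" "v \<in> W" by auto
    show "e \<in> W1 \<times> W1 \<union> W2 \<times> W2"
    proof (cases "u \<in> Y x \<or> v \<in> Y x")
      case False
      obtain i where i: "u \<in> Y i" "v \<in> Y i" using Y(5)[OF e(2)] by blast
      have "key u = key v" using comp[OF i(1)] comp[OF i(2)] False by simp
      then show ?thesis using e False by (auto simp: W1_def W2_def U_def)
    qed (use e in \<open>auto simp: W1_def W2_def U_def\<close>)
  qed
  moreover have "3 * card W1 \<le> 2 * card W + 3 * c"
    using card_Un_le[of "{v \<in> U. key v \<in> K}" "W \<inter> Y x"] K(1) S unfolding W1_def by linarith
  moreover have "3 * card W2 \<le> 2 * card W + 3 * c"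
    using card_Un_le[of "{v \<in> U. key v \<notin> K}" "W \<inter> Y x"] K(2) S unfolding W2_def by linarith
  ultimately show "\<exists>W1 W2. W = W1 \<union> W2 \<and> card (W1 \<inter> W2) \<le> c \<and>
      parcs G \<inter> W \<times> W \<subseteq> W1 \<times> W1 \<union> W2 \<times> W2 \<and>
      3 * card W1 \<le> 2 * card W + 3 * c \<and> 3 * card W2 \<le> 2 * card W + 3 * c" by blast
qed

lemma treewidth_separators:
  assumes "pair_graph G"
  shows "balanced_separators (treewidth G + 1) (pverts G) (parcs G)"
proof -
  interpret pair_graph G by fact
  \<comment> \<open>A single bag with all vertices shows that the minimum in
    \<open>treewidth\<close> is taken over a nonempty set.\<close>
  define T0 :: "nat pair_pre_digraph" where "T0 = \<lparr>pverts = {0}, parcs = {}\<rparr>"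
  have "tree_decomposition G T0 (\<lambda>_. pverts G)"
  proof -
    have "pair_graph T0" by unfold_locales (auto simp: T0_def symmetric_def)
    moreover have "Digraph_Component.connected (with_proj T0)"
      by (auto simp: Digraph_Component.connected_def strongly_connected_def T0_def reachable_def)
    moreover have "\<not> pre_digraph.cycle (with_proj T0) p" for p
      by (auto simp: pre_digraph.cycle_def pre_digraph.awalk_def T0_def)
    ultimately have "undirected_tree T0" by (auto simp: undirected_tree_def)
    moreover have "Digraph_Component.connected (with_proj T0 \<restriction> {x \<in> pverts T0. v \<in> pverts G})"
      if "v \<in> pverts G" for v
      using that by (auto simp: Digraph_Component.connected_def strongly_connected_def T0_def reachable_def)
    moreover have "\<forall>(u, v)\<in>parcs G. \<exists>x\<in>pverts T0. u \<in> pverts G \<and> v \<in> pverts G"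
      using arc_fst_in_verts arc_snd_in_verts by (force simp: T0_def)
    ultimately show ?thesis by (auto simp: tree_decomposition_def T0_def)
  qed
  then have "\<exists>w (T :: nat pair_pre_digraph) X. tree_decomposition G T X \<and> decomposition_width T X = w" by blast
  then have "\<exists>(T :: nat pair_pre_digraph) X. tree_decomposition G T X \<and> decomposition_width T X = treewidth G"
    unfolding treewidth_def by (rule LeastI_ex)
  then obtain T :: "nat pair_pre_digraph" and X
    where T: "tree_decomposition G T X" "decomposition_width T X = treewidth G" by blast
  have "finite (pverts T)"
    using T(1) by (auto simp: tree_decomposition_def undirected_tree_def pair_graph_def pair_digraph_def
      pair_fin_digraph_def pair_fin_digraph_axioms_def)
  have "card (X x) \<le> treewidth G + 1" if "x \<in> pverts T" for x
  proof -
    have "card (X x) \<le> Max ((\<lambda>x. card (X x)) ` pverts T)"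
      using that \<open>finite (pverts T)\<close> by (intro Max_ge) auto
    then show ?thesis using T(2) by (simp add: decomposition_width_def)
  qed
  then show ?thesis by (rule tree_decomposition_separators[OF T(1) pair_finite_verts])
qed

text \<open>The constant is \<open>2916 = 324 * 9\<close>. Since
  \<open>6 * (w + 1) \<le> 16 * max 2 w\<close>, one has \<open>K \<le> 5 + L \<le> 6 * L\<close>,
  so a level costs \<open>2 ^ e\<close> with
  \<open>e \<le> 9 * K\<^sup>2 \<le> 324 * L\<^sup>2\<close>. There are
  \<open>4 * m + 1 \<le> 9 * log 2 n\<close> such factors. Both estimates use that the logarithms
  are at least \<open>1\<close>, by \<open>max 2\<close> and by \<open>2 \<le> n\<close>.\<close>

lemma pieces_earliest_treewidth:
  fixes G :: "'a pair_pre_digraph"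
  assumes "pair_graph G" and n: "n = card (pverts G)" "2 \<le> n" and k: "0 < k"
    and A: "\<And>e. e \<in> parcs G \<Longrightarrow> pieces k (A e)" and uv: "u \<in> pverts G" "v \<in> pverts G"
  obtains p where "pieces p (earliest (parcs G) A u v)"
    "real p \<le> real k * real n powr (2916 * (log 2 (real (max 2 (treewidth G))))\<^sup>2)"
proof -
  interpret pair_graph G by fact
  define w where "w = treewidth G"
  define L where "L = log 2 (real (max 2 w))"
  have L: "1 \<le> L" unfolding L_def by (subst le_log_iff) auto
  define K where "K = nat \<lceil>log 2 (real (6 * (w + 1)))\<rceil>"
  have "log 2 (real (6 * (w + 1))) \<ge> 0" by (subst zero_le_log_cancel_iff) auto
  then have K: "log 2 (real (6 * (w + 1))) \<le> real K" "real K \<le> log 2 (real (6 * (w + 1))) + 1"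
    unfolding K_def by linarith+
  have "real (6 * (w + 1)) \<le> 2 powr real K"
    using K(1) by (subst (asm) log_le_iff) auto
  then have K1: "6 * (w + 1) \<le> 2 ^ K" by (simp add: powr_realpow flip: of_nat_le_iff[where 'a=real])
  then have "K \<noteq> 0" by (cases K) auto
  have "log 2 (real (6 * (w + 1))) \<le> log 2 (16 * real (max 2 w))"
    by (subst log_le_cancel_iff) (auto simp: max_def)
  also have "\<dots> = log 2 (2 ^ 4) + L" unfolding L_def by (subst log_mult) auto
  also have "\<dots> = 4 + L" by (subst log_pow_cancel) auto
  finally have KL: "real K \<le> 6 * L" using K(2) L by linarith
  define e where "e = 4 + (2 + 3 * K) * K"
  have C: "16 * (4 * (2 ^ K) ^ 3) ^ K = (2 :: nat) ^ e"
  proof -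
    have "4 * (2 ^ K) ^ 3 = (2 :: nat) ^ (2 + 3 * K)"
      by (simp only: power_add power_mult[symmetric] mult.commute[of 3]) simp
    then show ?thesis by (simp only: e_def power_add power_mult) simp
  qed
  have "e \<le> 9 * (K * K)"
  proof -
    have "1 * 1 \<le> K * K" "1 * K \<le> K * K" using \<open>K \<noteq> 0\<close> by (intro mult_le_mono; simp)+
    moreover have "e = 4 + 2 * K + 3 * (K * K)" by (simp add: e_def algebra_simps)
    ultimately show ?thesis by linarith
  qed
  then have "real e \<le> real (9 * (K * K))" by (simp only: of_nat_le_iff)
  then have "real e \<le> 9 * (real K * real K)" by simp
  also have "\<dots> \<le> 9 * ((6 * L) * (6 * L))" using KL L by (intro mult_left_mono mult_mono) auto
  finally have e: "real e \<le> 324 * L\<^sup>2" by (simp add: power2_eq_square)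
  define m where "m = nat \<lceil>log 2 (real n)\<rceil>"
  have n1: "1 \<le> log 2 (real n)" using n by (subst le_log_iff) auto
  then have m: "log 2 (real n) \<le> real m" "real m \<le> log 2 (real n) + 1" unfolding m_def by linarith+
  have "real n \<le> 2 powr real m" using m(1) n by (subst (asm) log_le_iff) auto
  then have "real n \<le> 2 ^ m" by (simp add: powr_realpow)
  \<comment> \<open>Four levels double the admissible size, since
    \<open>(6 / 5) ^ 4 > 2\<close>.\<close>
  also have "(2 :: real) ^ m \<le> ((6 / 5) ^ 4) ^ m" by (intro power_mono) (auto simp: power4_eq_xxxx)
  also have "\<dots> = 1 * (6 / 5) ^ (4 * m)" by (simp add: power_mult)
  also have "\<dots> \<le> 6 * real (w + 1) * (6 / 5) ^ (4 * m)" by (intro mult_right_mono) auto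
  finally have nm: "real (card (pverts G)) \<le> 6 * real (w + 1) * (6 / 5) ^ (4 * m)" using n by simp
  have fifo: "fifo (parcs G) A"
    by unfold_locales (use A pieces_arrival pair_finite_arcs in auto)
  have sub: "parcs G \<inter> pverts G \<times> pverts G = parcs G"
  proof -
    have "a \<in> pverts G \<and> b \<in> pverts G" if "(a, b) \<in> parcs G" for a b
      using arc_fst_in_verts[OF that] arc_snd_in_verts[OF that] by simp
    then show ?thesis by auto
  qed
  let ?p = "(2 ^ e) ^ Suc (4 * m) * k"
  have "pieces ((16 * (4 * (2 ^ K) ^ 3) ^ K) ^ Suc (4 * m) * k)
      (earliest (parcs G \<inter> pverts G \<times> pverts G) A u v)"
    by (rule pieces_earliest_separators[OF fifo pair_finite_verts treewidth_separators[OF assms(1)] k A _ _ order_refl])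
      (use K1 nm uv in \<open>auto simp: w_def\<close>)
  then have p: "pieces ?p (earliest (parcs G) A u v)" unfolding C sub .
  have "real ?p = real k * 2 powr real (e * Suc (4 * m))"
  proof -
    have "(2 :: real) powr real (e * Suc (4 * m)) = 2 ^ (e * Suc (4 * m))"
      by (rule powr_realpow) simp
    then show ?thesis
      by (simp only: of_nat_mult[of _ k] of_nat_power of_nat_numeral power_mult mult.commute[of _ "real k"])
  qed
  also have "\<dots> \<le> real k * 2 powr ((324 * L\<^sup>2) * (9 * log 2 (real n)))"
  proof (intro mult_left_mono powr_mono)
    have "real (Suc (4 * m)) \<le> 9 * log 2 (real n)" using m n1 by simp
    then show "real (e * Suc (4 * m)) \<le> (324 * L\<^sup>2) * (9 * log 2 (real n))"
      unfolding of_nat_mult using e by (intro mult_mono) auto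
  qed auto
  also have "2 powr ((324 * L\<^sup>2) * (9 * log 2 (real n))) = (2 powr log 2 (real n)) powr (2916 * L\<^sup>2)"
    by (simp add: powr_powr mult_ac)
  also have "\<dots> = real n powr (2916 * L\<^sup>2)" using n by simp
  finally show ?thesis using that[OF p] by (simp add: L_def w_def)
qed

section \<open>The sweep over departure times\<close>

text \<open>
  Edge \<open>k < m\<close> leads from \<open>eu k\<close> to \<open>ev k\<close>, and its arrival function \<open>f k\<close> has the value
  \<open>pa k i * y + pb k i\<close> on the piece that starts at \<open>px k i\<close>.
\<close>

locale pl_network =
  fixes n m s :: nat and eu ev len :: "nat \<Rightarrow> nat" and px pa pb :: "nat \<Rightarrow> nat \<Rightarrow> real"
    and f :: "nat \<Rightarrow> real \<Rightarrow> real" and D :: "nat \<Rightarrow> real \<Rightarrow> ennreal"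
  assumes s: "s < n"
    and eu: "k < m \<Longrightarrow> eu k < n" and ev: "k < m \<Longrightarrow> ev k < n"
    and len: "k < m \<Longrightarrow> 0 < len k" and px0: "k < m \<Longrightarrow> px k 0 = 0"
    and px_less: "k < m \<Longrightarrow> i < j \<Longrightarrow> j < len k \<Longrightarrow> px k i < px k j"
    and f_eq: "k < m \<Longrightarrow> i < len k \<Longrightarrow> px k i \<le> y \<Longrightarrow> (Suc i < len k \<Longrightarrow> y < px k (Suc i)) \<Longrightarrow>
        f k y = pa k i * y + pb k i"
    and f_mono: "k < m \<Longrightarrow> 0 \<le> x \<Longrightarrow> x \<le> y \<Longrightarrow> f k x \<le> f k y"
    and f_ge: "k < m \<Longrightarrow> 0 \<le> x \<Longrightarrow> x \<le> f k x"
    and D_s: "0 \<le> t \<Longrightarrow> D s t = ennreal t"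
    and D_edge: "k < m \<Longrightarrow> 0 \<le> t \<Longrightarrow> 0 \<le> x \<Longrightarrow> D (eu k) t \<le> ennreal x \<Longrightarrow> D (ev k) t \<le> ennreal (f k x)"
    and D_lower: "0 \<le> t \<Longrightarrow> s \<in> R \<Longrightarrow> g s \<le> t \<Longrightarrow> (\<And>v. v \<in> R \<Longrightarrow> 0 \<le> g v) \<Longrightarrow>
        (\<And>k. k < m \<Longrightarrow> eu k \<in> R \<Longrightarrow> ev k \<in> R \<and> g (ev k) \<le> f k (g (eu k))) \<Longrightarrow>
        (if v \<in> R then ennreal (g v) else \<infinity>) \<le> D v t"
    and D_mono: "0 \<le> t \<Longrightarrow> t \<le> t' \<Longrightarrow> D v t \<le> D v t'"
begin

lemma px_nonneg: "k < m \<Longrightarrow> i < len k \<Longrightarrow> 0 \<le> px k i"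
  using px_less[of k 0 i] px0[of k] by (cases i) auto

lemma piece_extends:
  assumes "Suc i < len k \<longrightarrow> y < px k (Suc i)"
  obtains y' where "y < y'" "Suc i < len k \<longrightarrow> y' < px k (Suc i)"
proof (cases "Suc i < len k")
  case True
  then show ?thesis using assms dense that by meson
next
  case False
  then show ?thesis using that[of "y + 1"] by simp
qed

lemma slope_nonneg:
  assumes k: "k < m" "i < len k" and y: "px k i \<le> y" "Suc i < len k \<longrightarrow> y < px k (Suc i)"
  shows "0 \<le> pa k i"
proof -
  obtain y' where y': "y < y'" "Suc i < len k \<longrightarrow> y' < px k (Suc i)"
    by (rule piece_extends[OF y(2)])
  have "f k y \<le> f k y'" using f_mono[of k y y'] px_nonneg[OF k] k y y' by linarith
  then have "pa k i * y \<le> pa k i * y'" using f_eq[of k i y] f_eq[of k i y'] k y y' by auto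
  then show ?thesis using y'(1) by (metis linorder_not_less mult_le_cancel_left_neg order_less_imp_not_less order_le_less)
qed

section \<open>Dijkstra's algorithm on germs of lines\<close>

abbreviation line :: "(nat \<Rightarrow> real) \<Rightarrow> (nat \<Rightarrow> real) \<Rightarrow> nat \<Rightarrow> real \<Rightarrow> real" where
  "line la lb v t \<equiv> la v * t + lb v"

abbreviation cand_a :: "(nat \<Rightarrow> real) \<Rightarrow> (nat \<Rightarrow> nat) \<Rightarrow> nat \<Rightarrow> real" where
  "cand_a la cu k \<equiv> pa k (cu k) * la (eu k)"

abbreviation cand_b :: "(nat \<Rightarrow> real) \<Rightarrow> (nat \<Rightarrow> nat) \<Rightarrow> nat \<Rightarrow> real" where
  "cand_b lb cu k \<equiv> pa k (cu k) * lb (eu k) + pb k (cu k)"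

text \<open>Equivalently, the first line is at most the second on some interval that starts at
  \<open>t\<close>.\<close>

definition germ_le :: "real \<Rightarrow> real \<Rightarrow> real \<Rightarrow> real \<Rightarrow> real \<Rightarrow> bool" where
  "germ_le t a b a' b' \<longleftrightarrow> a * t + b < a' * t + b' \<or> (a * t + b = a' * t + b' \<and> a \<le> a')"

lemma germ_le_trans: "germ_le t a b a' b' \<Longrightarrow> germ_le t a' b' a'' b'' \<Longrightarrow> germ_le t a b a'' b''"
  by (auto simp: germ_le_def)

lemma germ_le_refl: "germ_le t a b a b"
  by (auto simp: germ_le_def)

definition bracket :: "real \<Rightarrow> (nat \<Rightarrow> real) \<Rightarrow> (nat \<Rightarrow> real) \<Rightarrow> (nat \<Rightarrow> nat) \<Rightarrow> nat \<Rightarrow> bool" where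
  "bracket t la lb cu k \<longleftrightarrow> cu k < len k \<and> px k (cu k) \<le> line la lb (eu k) t \<and>
     (Suc (cu k) < len k \<longrightarrow> line la lb (eu k) t < px k (Suc (cu k)))"

text \<open>Travel times may vanish, so a cycle of edges could satisfy all equations and justify its
  own labels. The inductive form demands a derivation from the source, hence a walk that realises
  the label.\<close>

inductive tight ::
  "nat set \<Rightarrow> (nat \<Rightarrow> real) \<Rightarrow> (nat \<Rightarrow> real) \<Rightarrow> (nat \<Rightarrow> nat) \<Rightarrow> nat \<Rightarrow> bool"
  for Q la lb cu where
  source: "la s = 1 \<Longrightarrow> lb s = 0 \<Longrightarrow> tight Q la lb cu s"
| edge: "k \<in> Q \<Longrightarrow> tight Q la lb cu (eu k) \<Longrightarrow> la (ev k) = cand_a la cu k \<Longrightarrow>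
    lb (ev k) = cand_b lb cu k \<Longrightarrow> tight Q la lb cu (ev k)"

text \<open>Along the derivation of \<open>tight\<close>, the lines are arrival times of an actual
  walk as long as every edge on it stays in its piece. Slopes are nonnegative, so checking the end
  of the piece at \<open>\<tau>\<close> covers all times from \<open>t\<close> on.\<close>

lemma tight_upper:
  assumes "tight Q la lb cu v" and t: "0 \<le> t" "t \<le> \<tau>"
    and Q: "\<And>k. k \<in> Q \<Longrightarrow> k < m \<and> bracket t la lb cu k \<and>
      (Suc (cu k) < len k \<longrightarrow> line la lb (eu k) \<tau> < px k (Suc (cu k)))"
  shows "0 \<le> la v \<and> t \<le> line la lb v t \<and> \<tau> \<le> line la lb v \<tau> \<and> D v \<tau> \<le> ennreal (line la lb v \<tau>)"
  using assms(1)
proof induction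
  case source
  then show ?case using t D_s[of \<tau>] by simp
next
  case (edge k)
  let ?y = "line la lb (eu k)"
  have k: "k < m" "cu k < len k" "px k (cu k) \<le> ?y t" "Suc (cu k) < len k \<longrightarrow> ?y t < px k (Suc (cu k))"
    "Suc (cu k) < len k \<longrightarrow> ?y \<tau> < px k (Suc (cu k))"
    using Q[OF edge.hyps(1)] by (auto simp: bracket_def)
  have y: "?y t \<le> ?y \<tau>" using edge.IH t by (simp add: mult_left_mono)
  have eq: "line la lb (ev k) x = f k (?y x)" if "x \<in> {t, \<tau>}" for x
  proof -
    have "f k (?y x) = pa k (cu k) * ?y x + pb k (cu k)"
      by (rule f_eq) (use k y that in auto)
    then show ?thesis using edge.hyps by (simp add: algebra_simps)
  qed
  have "0 \<le> la (ev k)"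
    using slope_nonneg[OF k(1-4)] edge by simp
  moreover have "t \<le> line la lb (ev k) t"
    using eq[of t] f_ge[OF k(1), of "?y t"] edge.IH t by simp
  moreover have "\<tau> \<le> line la lb (ev k) \<tau>"
    using eq[of \<tau>] f_ge[OF k(1), of "?y \<tau>"] edge.IH t by simp
  moreover have "D (ev k) \<tau> \<le> ennreal (f k (?y \<tau>))"
    using D_edge[OF k(1), of \<tau> "?y \<tau>"] edge.IH t by simp
  ultimately show ?case using eq[of \<tau>] by simp
qed

text \<open>The invariant of one Dijkstra run: \<open>S\<close> holds the final vertices,
  \<open>L\<close> the labelled ones and \<open>Q\<close> the relaxed edges. The last clause
  concerns pointers inherited from earlier departure times: they may lag behind the piece in use,
  but as \<open>D\<close> is nondecreasing they are never ahead of it.\<close>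

definition inv ::
  "real \<Rightarrow> nat set \<Rightarrow> nat set \<Rightarrow> (nat \<Rightarrow> real) \<Rightarrow> (nat \<Rightarrow> real) \<Rightarrow> (nat \<Rightarrow> nat) \<Rightarrow> nat set \<Rightarrow> bool" where
  "inv t S L la lb cu Q \<longleftrightarrow>
     Q \<subseteq> {k. k < m \<and> eu k \<in> S} \<and> S \<inter> L = {} \<and> S \<union> L \<subseteq> {..<n} \<and>
     s \<in> S \<and> la s = 1 \<and> lb s = 0 \<and>
     (\<forall>v\<in>S \<union> L. tight Q la lb cu v) \<and>
     (\<forall>k\<in>Q. ev k \<in> S \<union> L \<and> bracket t la lb cu k \<and>
        germ_le t (la (ev k)) (lb (ev k)) (cand_a la cu k) (cand_b lb cu k)) \<and>
     (\<forall>x\<in>S. \<forall>v\<in>L. germ_le t (la x) (lb x) (la v) (lb v)) \<and>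
     (\<forall>k<m. k \<notin> Q \<longrightarrow> cu k < len k \<and> ennreal (px k (cu k)) \<le> D (eu k) t)"

lemma invD:
  assumes "inv t S L la lb cu Q"
  shows "k \<in> Q \<Longrightarrow> k < m" "k \<in> Q \<Longrightarrow> eu k \<in> S" "S \<inter> L = {}" "S \<union> L \<subseteq> {..<n}" "s \<in> S"
    "v \<in> S \<union> L \<Longrightarrow> tight Q la lb cu v"
    "k \<in> Q \<Longrightarrow> ev k \<in> S \<union> L" "k \<in> Q \<Longrightarrow> bracket t la lb cu k"
    "k \<in> Q \<Longrightarrow> germ_le t (la (ev k)) (lb (ev k)) (cand_a la cu k) (cand_b lb cu k)"
    "x \<in> S \<Longrightarrow> v \<in> L \<Longrightarrow> germ_le t (la x) (lb x) (la v) (lb v)"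
    "k < m \<Longrightarrow> k \<notin> Q \<Longrightarrow> cu k < len k" "k < m \<Longrightarrow> k \<notin> Q \<Longrightarrow> ennreal (px k (cu k)) \<le> D (eu k) t"
    "la s = 1" "lb s = 0"
  using assms unfolding inv_def by blast+

lemma inv_upper:
  assumes "inv t S L la lb cu Q" "v \<in> S \<union> L" "0 \<le> t"
  shows "0 \<le> la v" "t \<le> line la lb v t" "D v t \<le> ennreal (line la lb v t)"
proof -
  have "k < m \<and> bracket t la lb cu k \<and>
      (Suc (cu k) < len k \<longrightarrow> line la lb (eu k) t < px k (Suc (cu k)))" if "k \<in> Q" for k
    using invD(1,8)[OF assms(1) that] by (simp add: bracket_def)
  from tight_upper[OF invD(6)[OF assms(1,2)] assms(3) order_refl this]
  show "0 \<le> la v" "t \<le> line la lb v t" "D v t \<le> ennreal (line la lb v t)" by auto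
qed

lemma inv_start:
  assumes "la s = 1" "lb s = 0" "\<And>k. k < m \<Longrightarrow> cu k < len k \<and> ennreal (px k (cu k)) \<le> D (eu k) t"
  shows "inv t {s} {} la lb cu {}"
  unfolding inv_def using assms s by (auto intro: tight.source)

lemma inv_finalise:
  assumes "inv t S L la lb cu Q" "u \<in> L" "\<And>v. v \<in> L \<Longrightarrow> germ_le t (la u) (lb u) (la v) (lb v)"
  shows "inv t (insert u S) (L - {u}) la lb cu Q"
proof -
  have eq: "insert u S \<union> (L - {u}) = S \<union> L" using assms(2) by auto
  show ?thesis
    using assms unfolding inv_def eq by auto
qed

lemma inv_unlinked:
  assumes "inv t S L la lb cu Q" "k < m" "k \<notin> Q" "eu k \<in> S" "0 \<le> t"
  shows "px k (cu k) \<le> line la lb (eu k) t"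
proof -
  have "ennreal (px k (cu k)) \<le> ennreal (line la lb (eu k) t)"
    using invD(12)[OF assms(1-3)] inv_upper(3)[OF assms(1) _ assms(5), of "eu k"] assms(4)
    by (auto intro: order_trans)
  moreover have "t \<le> line la lb (eu k) t"
    using inv_upper(2)[OF assms(1) _ assms(5), of "eu k"] assms(4) by auto
  ultimately show ?thesis using assms(5) by (simp add: ennreal_le_iff)
qed

text \<open>The counterpart of nonnegative edge lengths. If the travel time is positive, the value
  increases. If it vanishes, \<open>f k\<close> lies on or above the identity to the right of this
  point, so the current piece has slope at least \<open>1\<close> and the slope of the line does not
  drop.\<close>

lemma fifo_germ:
  assumes "k < m" "bracket t la lb cu k" "0 \<le> la (eu k)"
  shows "germ_le t (la (eu k)) (lb (eu k)) (cand_a la cu k) (cand_b lb cu k)"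
proof -
  let ?y = "line la lb (eu k) t"
  have k: "cu k < len k" "px k (cu k) \<le> ?y" "Suc (cu k) < len k \<longrightarrow> ?y < px k (Suc (cu k))"
    using assms(2) by (auto simp: bracket_def)
  have y0: "0 \<le> ?y" using px_nonneg[OF assms(1) k(1)] k by simp
  have fy: "f k ?y = pa k (cu k) * ?y + pb k (cu k)" by (rule f_eq) (use assms k in auto)
  have val: "cand_a la cu k * t + cand_b lb cu k = f k ?y" unfolding fy by (simp add: algebra_simps)
  show ?thesis
  proof (cases "?y < f k ?y")
    case False
    then have eq: "f k ?y = ?y" using f_ge[OF assms(1) y0] by simp
    obtain y' where y': "?y < y'" "Suc (cu k) < len k \<longrightarrow> y' < px k (Suc (cu k))"
      by (rule piece_extends[OF k(3)])
    have "y' \<le> f k y'" using f_ge[OF assms(1)] y' y0 by simp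
    moreover have "f k y' = pa k (cu k) * y' + pb k (cu k)" by (rule f_eq) (use assms k y' in auto)
    moreover have "0 \<le> (a - 1) * (y' - y)" if "y' \<le> a * y' + b" "a * y + b = y" for a b y :: real
    proof -
      have "(a - 1) * (y' - y) = (a * y' + b - y') - (a * y + b - y)" by (simp add: algebra_simps)
      then show ?thesis using that by simp
    qed
    ultimately have "0 \<le> (pa k (cu k) - 1) * (y' - ?y)" using eq unfolding fy by metis
    then have "1 \<le> pa k (cu k)" using y'(1) by (simp add: zero_le_mult_iff)
    then have "la (eu k) \<le> cand_a la cu k" using mult_right_mono[of 1 "pa k (cu k)" "la (eu k)"] assms(3) by simp
    then show ?thesis using eq val unfolding germ_le_def by auto
  qed (use val in \<open>auto simp: germ_le_def\<close>)
qed

lemma tight_cong: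
  assumes "tight Q la lb cu v" "Q \<subseteq> Q'"
    and "\<And>k. k \<in> Q \<Longrightarrow> cu' k = cu k \<and> la' (eu k) = la (eu k) \<and> lb' (eu k) = lb (eu k)"
    and "la' v = la v" "lb' v = lb v"
  shows "tight Q' la' lb' cu' v"
  using assms(1,4,5)
proof induction
  case source
  then show ?case by (intro tight.source) auto
next
  case (edge k)
  have k: "cu' k = cu k" "la' (eu k) = la (eu k)" "lb' (eu k) = lb (eu k)"
    using assms(3)[OF edge.hyps(1)] by auto
  show ?case
    by (rule tight.edge) (use edge k assms(2) in auto)
qed

text \<open>Relaxation without improvement. For a head that is already final, the required
  inequality follows from \<open>fifo_germ\<close>, because the tail has the largest germ among the
  final vertices.\<close>

lemma inv_keep:
  assumes inv: "inv t S L la lb cu Q" and t: "0 \<le> t"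
    and k: "k < m" "k \<notin> Q" "eu k \<in> S" and top: "\<And>x. x \<in> S \<Longrightarrow> germ_le t (la x) (lb x) (la (eu k)) (lb (eu k))"
    and c: "bracket t la lb (cu(k := c)) k"
    and v: "ev k \<in> S \<or> (ev k \<in> L \<and> germ_le t (la (ev k)) (lb (ev k)) (pa k c * la (eu k)) (pa k c * lb (eu k) + pb k c))"
  shows "inv t S L la lb (cu(k := c)) (insert k Q)"
proof -
  let ?cu = "cu(k := c)"
  have la0: "0 \<le> la (eu k)" using inv_upper(1)[OF inv _ t, of "eu k"] k by simp
  have "germ_le t (la (eu k)) (lb (eu k)) (cand_a la ?cu k) (cand_b lb ?cu k)"
    by (rule fifo_germ[OF k(1) c la0])
  then have new: "germ_le t (la (ev k)) (lb (ev k)) (cand_a la ?cu k) (cand_b lb ?cu k)"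
    using v top[of "ev k"] germ_le_trans by auto
  have old: "?cu j = cu j" if "j \<in> Q" for j using that k by auto
  have tight: "tight (insert k Q) la lb ?cu v" if "v \<in> S \<union> L" for v
    by (rule tight_cong[OF invD(6)[OF inv that]]) (use old in auto)
  have br: "bracket t la lb ?cu j" if "j \<in> Q" for j
    using invD(8)[OF inv that] old[OF that] by (simp add: bracket_def)
  show ?thesis
    unfolding inv_def
  proof (intro conjI ballI allI impI)
    fix j assume j: "j \<in> insert k Q"
    show "ev j \<in> S \<union> L" using j v invD(7)[OF inv] by auto
    show "bracket t la lb ?cu j" using j c br by auto
    show "germ_le t (la (ev j)) (lb (ev j)) (cand_a la ?cu j) (cand_b lb ?cu j)"
    proof (cases "j = k")
      case False
      then show ?thesis using j invD(9)[OF inv, of j] old[of j] by simp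
    qed (use new in simp)
  next
    fix j assume "j < m" "j \<notin> insert k Q"
    then show "?cu j < len j" "ennreal (px j (?cu j)) \<le> D (eu j) t"
      using invD(11,12)[OF inv, of j] by auto
  qed (use invD(1-5,10,13,14)[OF inv] k tight in auto)
qed

text \<open>Only the label of a vertex outside \<open>S\<close> changes, while relaxed edges have
  their tails in \<open>S\<close>, so the derivations of all other labels survive. By
  \<open>fifo_germ\<close> the new label is not below that of the tail, hence not below any final
  one.\<close>

lemma inv_relax:
  assumes inv: "inv t S L la lb cu Q" and t: "0 \<le> t"
    and k: "k < m" "k \<notin> Q" "eu k \<in> S" and top: "\<And>x. x \<in> S \<Longrightarrow> germ_le t (la x) (lb x) (la (eu k)) (lb (eu k))"
    and c: "bracket t la lb (cu(k := c)) k"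
    and a: "a = pa k c * la (eu k)" and b: "b = pa k c * lb (eu k) + pb k c"
    and v: "ev k \<notin> S" "ev k \<in> L \<Longrightarrow> germ_le t a b (la (ev k)) (lb (ev k))"
  shows "inv t S (insert (ev k) L) (la(ev k := a)) (lb(ev k := b)) (cu(k := c)) (insert k Q)"
proof -
  let ?cu = "cu(k := c)" and ?la = "la(ev k := a)" and ?lb = "lb(ev k := b)"
  have la0: "0 \<le> la (eu k)" using inv_upper(1)[OF inv _ t, of "eu k"] k by simp
  have "germ_le t (la (eu k)) (lb (eu k)) (cand_a la ?cu k) (cand_b lb ?cu k)"
    by (rule fifo_germ[OF k(1) c la0])
  then have new: "germ_le t (la (eu k)) (lb (eu k)) a b" by (simp add: a b)
  have SL: "?la x = la x" "?lb x = lb x" if "x \<in> S" for x using that v(1) by auto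
  have old: "?cu j = cu j" "?la (eu j) = la (eu j)" "?lb (eu j) = lb (eu j)" if "j \<in> Q" for j
    using that k SL invD(2)[OF inv that] by auto
  have tight: "tight (insert k Q) ?la ?lb ?cu x" if x: "x \<in> S \<union> insert (ev k) L" for x
  proof (cases "x = ev k")
    case True
    have "eu k \<noteq> ev k" using k v by auto
    have "tight (insert k Q) ?la ?lb ?cu (eu k)"
      by (rule tight_cong[OF invD(6)[OF inv, of "eu k"]]) (use old k SL \<open>eu k \<noteq> ev k\<close> in auto)
    then have "tight (insert k Q) ?la ?lb ?cu (ev k)"
      by (rule tight.edge[rotated]) (use k SL a b in auto)
    then show ?thesis using True by simp
  next
    case False
    show ?thesis
      by (rule tight_cong[OF invD(6)[OF inv, of x]]) (use old x False in auto)
  qed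
  have br: "bracket t ?la ?lb ?cu j" if "j \<in> insert k Q" for j
  proof (cases "j = k")
    case True
    then show ?thesis using c SL[OF k(3)] by (simp add: bracket_def)
  next
    case False
    then show ?thesis using that invD(8)[OF inv, of j] old[of j] by (simp add: bracket_def)
  qed
  show ?thesis
    unfolding inv_def
  proof (intro conjI ballI allI impI)
    fix j assume j: "j \<in> insert k Q"
    show "ev j \<in> S \<union> insert (ev k) L" using j invD(7)[OF inv, of j] by auto
    show "bracket t ?la ?lb ?cu j" using j by (rule br)
    show "germ_le t (?la (ev j)) (?lb (ev j)) (cand_a ?la ?cu j) (cand_b ?lb ?cu j)"
    proof (cases "j = k")
      case True
      then show ?thesis using SL[OF k(3)] by (simp add: a b germ_le_refl)
    next
      case False
      then have jQ: "j \<in> Q" using j by simp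
      have "germ_le t (?la (ev j)) (?lb (ev j)) (la (ev j)) (lb (ev j))"
      proof (cases "ev j = ev k")
        case True
        then show ?thesis using v invD(7)[OF inv jQ] by auto
      qed (auto simp: germ_le_refl)
      from germ_le_trans[OF this invD(9)[OF inv jQ]] show ?thesis using old[OF jQ] False by simp
    qed
  next
    fix j assume "j < m" "j \<notin> insert k Q"
    then show "?cu j < len j" "ennreal (px j (?cu j)) \<le> D (eu j) t"
      using invD(11,12)[OF inv, of j] by auto
  next
    fix x w assume x: "x \<in> S" "w \<in> insert (ev k) L"
    show "germ_le t (?la x) (?lb x) (?la w) (?lb w)"
    proof (cases "w = ev k")
      case True
      then show ?thesis using germ_le_trans[OF top[OF x(1)] new] SL[OF x(1)] by simp
    next
      case False
      then show ?thesis using invD(10)[OF inv x(1), of w] x SL[OF x(1)] by simp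
    qed
  qed (use invD(1-5,13,14)[OF inv] k tight v ev in auto)
qed

section \<open>Validity of the lines between two events\<close>

definition solved :: "real \<Rightarrow> nat set \<Rightarrow> (nat \<Rightarrow> real) \<Rightarrow> (nat \<Rightarrow> real) \<Rightarrow> (nat \<Rightarrow> nat) \<Rightarrow> bool" where
  "solved t S la lb cu \<longleftrightarrow> 0 \<le> t \<and> inv t S {} la lb cu {k. k < m \<and> eu k \<in> S}"

text \<open>The second kind is the time at which the candidate of an edge comes down to the line of
  its head. A line of slope \<open>0\<close> never leaves its piece, and a candidate that is at
  least as steep as the line of its head never undercuts it, so all denominators are
  positive.\<close>

definition events :: "nat set \<Rightarrow> (nat \<Rightarrow> real) \<Rightarrow> (nat \<Rightarrow> real) \<Rightarrow> (nat \<Rightarrow> nat) \<Rightarrow> real set" where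
  "events S la lb cu =
     {(px k (Suc (cu k)) - lb (eu k)) / la (eu k) | k.
        k < m \<and> eu k \<in> S \<and> Suc (cu k) < len k \<and> 0 < la (eu k)} \<union>
     {(cand_b lb cu k - lb (ev k)) / (la (ev k) - cand_a la cu k) | k.
        k < m \<and> eu k \<in> S \<and> cand_a la cu k < la (ev k)}"

text \<open>Progress of the sweep: \<open>bracket\<close> is strict at the upper end, and a
  candidate that is less steep but not smaller as a germ must be strictly larger in value.\<close>

lemma events_after:
  assumes "solved t S la lb cu" "x \<in> events S la lb cu"
  shows "t < x"
proof -
  have inv: "inv t S {} la lb cu {k. k < m \<and> eu k \<in> S}" using assms by (simp add: solved_def)
  consider k where "x = (px k (Suc (cu k)) - lb (eu k)) / la (eu k)" "k < m" "eu k \<in> S" "Suc (cu k) < len k" "0 < la (eu k)"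
    | k where "x = (cand_b lb cu k - lb (ev k)) / (la (ev k) - cand_a la cu k)" "k < m" "eu k \<in> S"
        "cand_a la cu k < la (ev k)"
    using assms(2) by (auto simp: events_def)
  then show ?thesis
  proof cases
    case 1
    then have "line la lb (eu k) t < px k (Suc (cu k))" using invD(8)[OF inv, of k] by (simp add: bracket_def)
    moreover have "line la lb (eu k) x = px k (Suc (cu k))" using 1 by (simp add: field_simps)
    ultimately have "la (eu k) * t < la (eu k) * x" by simp
    then show ?thesis using 1(5) by simp
  next
    case 2
    then have "line la lb (ev k) t < cand_a la cu k * t + cand_b lb cu k"
      using invD(9)[OF inv, of k] by (auto simp: germ_le_def)
    then have "t * (la (ev k) - cand_a la cu k) < cand_b lb cu k - lb (ev k)" by (simp add: algebra_simps)
    then show ?thesis unfolding 2(1) using 2(4) by (subst pos_less_divide_eq) auto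
  qed
qed

text \<open>Tight walks give the upper bounds. Until the first event, the lines on \<open>S\<close>
  together with infinity elsewhere form a feasible potential, and \<open>D_lower\<close> turns it
  into the matching lower bounds.\<close>

lemma solved_exact:
  assumes sol: "solved t S la lb cu" and \<tau>: "t \<le> \<tau>" "\<And>x. x \<in> events S la lb cu \<Longrightarrow> \<tau> < x"
  shows "v \<in> S \<Longrightarrow> D v \<tau> = ennreal (line la lb v \<tau>)" "v \<in> S \<Longrightarrow> \<tau> \<le> line la lb v \<tau>"
    "v \<notin> S \<Longrightarrow> D v \<tau> = \<infinity>"
proof -
  have t: "0 \<le> t" and inv: "inv t S {} la lb cu {k. k < m \<and> eu k \<in> S}"
    using sol by (simp_all add: solved_def)
  note la0 = inv_upper(1)[OF inv _ t, simplified]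
  have next_piece: "line la lb (eu k) \<tau> < px k (Suc (cu k))"
    if k: "k < m" "eu k \<in> S" "Suc (cu k) < len k" for k
  proof (cases "la (eu k) = 0")
    case True
    then show ?thesis using invD(8)[OF inv, of k] k by (simp add: bracket_def)
  next
    case False
    then have "0 < la (eu k)" using la0[OF k(2)] by simp
    then have "(px k (Suc (cu k)) - lb (eu k)) / la (eu k) \<in> events S la lb cu"
      using k by (auto simp: events_def)
    from \<tau>(2)[OF this] \<open>0 < la (eu k)\<close> show ?thesis by (simp add: field_simps)
  qed
  have up: "0 \<le> la v \<and> t \<le> line la lb v t \<and> \<tau> \<le> line la lb v \<tau> \<and> D v \<tau> \<le> ennreal (line la lb v \<tau>)"
    if "v \<in> S" for v
    by (rule tight_upper[OF invD(6)[OF inv] t \<tau>(1)])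
      (use that invD(8)[OF inv] next_piece in auto)
  have f_line: "f k (line la lb (eu k) \<tau>) = cand_a la cu k * \<tau> + cand_b lb cu k" if k: "k < m" "eu k \<in> S" for k
  proof -
    have br: "cu k < len k" "px k (cu k) \<le> line la lb (eu k) t"
      using invD(8)[OF inv, of k] k by (auto simp: bracket_def)
    have "line la lb (eu k) t \<le> line la lb (eu k) \<tau>"
      using la0[OF k(2)] \<tau>(1) by (simp add: mult_left_mono)
    then have "f k (line la lb (eu k) \<tau>) = pa k (cu k) * line la lb (eu k) \<tau> + pb k (cu k)"
      using k br next_piece by (intro f_eq) auto
    then show ?thesis by (simp add: algebra_simps)
  qed
  have feasible: "ev k \<in> S \<and> line la lb (ev k) \<tau> \<le> f k (line la lb (eu k) \<tau>)"
    if k: "k < m" "eu k \<in> S" for k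
  proof
    show "ev k \<in> S" using invD(7)[OF inv, of k] k by simp
    have germ: "germ_le t (la (ev k)) (lb (ev k)) (cand_a la cu k) (cand_b lb cu k)"
      using invD(9)[OF inv, of k] k by simp
    show "line la lb (ev k) \<tau> \<le> f k (line la lb (eu k) \<tau>)"
      unfolding f_line[OF k]
    proof (cases "cand_a la cu k < la (ev k)")
      case True
      then have "(cand_b lb cu k - lb (ev k)) / (la (ev k) - cand_a la cu k) \<in> events S la lb cu"
        using k by (auto simp: events_def)
      from \<tau>(2)[OF this] True show "line la lb (ev k) \<tau> \<le> cand_a la cu k * \<tau> + cand_b lb cu k"
        by (simp add: field_simps)
    next
      case False
      then have "la (ev k) * (\<tau> - t) \<le> cand_a la cu k * (\<tau> - t)" using \<tau>(1) by (intro mult_right_mono) auto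
      then show "line la lb (ev k) \<tau> \<le> cand_a la cu k * \<tau> + cand_b lb cu k"
        using germ by (auto simp: germ_le_def algebra_simps)
    qed
  qed
  have sS: "s \<in> S" using invD(5)[OF inv] by simp
  have las: "line la lb s \<tau> \<le> \<tau>" using invD(13,14)[OF inv] by simp
  have low: "(if v \<in> S then ennreal (line la lb v \<tau>) else \<infinity>) \<le> D v \<tau>" for v
    by (rule D_lower[of \<tau> S "\<lambda>v. line la lb v \<tau>"]) (use t \<tau> sS las up feasible in \<open>auto intro: order_trans\<close>)
  show "v \<in> S \<Longrightarrow> D v \<tau> = ennreal (line la lb v \<tau>)" using up[of v] low[of v] by (auto intro: antisym)
  show "v \<in> S \<Longrightarrow> \<tau> \<le> line la lb v \<tau>" using up by simp
  show "v \<notin> S \<Longrightarrow> D v \<tau> = \<infinity>" using low[of v] by (simp add: top_unique)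
qed

lemma solved_now:
  assumes "solved t S la lb cu"
  shows "v \<in> S \<Longrightarrow> D v t = ennreal (line la lb v t)" "v \<notin> S \<Longrightarrow> D v t = \<infinity>"
  using solved_exact[OF assms order_refl] events_after[OF assms] by auto

text \<open>This makes the pointers left by one run admissible for the next run, at a later
  time.\<close>

lemma solved_pointers:
  assumes sol: "solved t S la lb cu" and "t \<le> t'" "k < m"
  shows "cu k < len k \<and> ennreal (px k (cu k)) \<le> D (eu k) t'"
proof -
  have t: "0 \<le> t" and inv: "inv t S {} la lb cu {k. k < m \<and> eu k \<in> S}"
    using sol by (simp_all add: solved_def)
  have "cu k < len k \<and> ennreal (px k (cu k)) \<le> D (eu k) t"
  proof (cases "eu k \<in> S")
    case True
    then show ?thesis using invD(8)[OF inv, of k] solved_now(1)[OF sol True] assms(3)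
      by (simp add: bracket_def ennreal_leI)
  next
    case False
    then show ?thesis using invD(11,12)[OF inv, of k] assms(3) by simp
  qed
  then show ?thesis using D_mono[OF t assms(2), of "eu k"] by (auto intro: order_trans)
qed

text \<open>The supremum is the time at which the earliest arrival at the tail of edge
  \<open>k\<close> reaches the start of piece \<open>i\<close>; piece \<open>0\<close> starts at
  time \<open>0\<close> and is left out. If the set is empty or unbounded, the value means nothing,
  which is harmless for an upper bound on the cardinality.\<close>

definition critical :: "(nat \<Rightarrow> real set) \<Rightarrow> real set" where
  "critical BP = (\<Union>v<n. BP v) \<union>
     (\<lambda>(k, i). Sup {\<tau>. 0 \<le> \<tau> \<and> D (eu k) \<tau> < ennreal (px k i)}) ` (SIGMA k:{..<m}. {1..<len k})"

lemma card_critical: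
  assumes "\<And>v. v < n \<Longrightarrow> finite (BP v)" "\<And>v. v < n \<Longrightarrow> card (BP v) \<le> b"
  shows "finite (critical BP)" "card (critical BP) \<le> n * b + (\<Sum>k<m. len k - 1)"
proof -
  let ?I = "SIGMA k:{..<m}. {1..<len k}" and ?g = "\<lambda>(k, i). Sup {\<tau>. 0 \<le> \<tau> \<and> D (eu k) \<tau> < ennreal (px k i)}"
  show "finite (critical BP)" using assms(1) by (auto simp: critical_def)
  have "card (\<Union>v<n. BP v) \<le> (\<Sum>v<n. card (BP v))" by (rule card_UN_le) simp
  also have "\<dots> \<le> of_nat (card {..<n}) * b" by (rule sum_bounded_above) (use assms(2) in auto)
  finally have 1: "card (\<Union>v<n. BP v) \<le> n * b" by simp
  have "card (?g ` ?I) \<le> card ?I" by (rule card_image_le) auto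
  also have "\<dots> = (\<Sum>k<m. len k - 1)" by (subst card_SigmaI) auto
  finally show "card (critical BP) \<le> n * b + (\<Sum>k<m. len k - 1)"
    unfolding critical_def using 1 card_Un_le[of "\<Union>v<n. BP v" "?g ` ?I"] by linarith
qed

text \<open>A point outside a finite set has a window free of breakpoints. The affine function on
  this window agrees with the given line at two times before \<open>x\<close>, hence also after
  \<open>x\<close>. The condition \<open>x - \<tau> < y - x\<close> makes the window symmetric about
  \<open>x\<close>.\<close>

lemma affine_off_line:
  assumes D: "affine_off B (\<lambda>\<tau>. enn2real (D v \<tau>))" and B: "finite B" "x \<notin> B"
    and x: "0 \<le> t" "t < x" and line: "\<And>\<tau>. t \<le> \<tau> \<Longrightarrow> \<tau> < x \<Longrightarrow> D v \<tau> = ennreal (a * \<tau> + b) \<and> 0 \<le> a * \<tau> + b"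
  shows "\<exists>y>x. \<forall>\<tau>. t < \<tau> \<longrightarrow> x - \<tau> < y - x \<longrightarrow> \<tau> < y \<longrightarrow> enn2real (D v \<tau>) = a * \<tau> + b"
proof -
  have "open (- B)" using finite_imp_closed[OF B(1)] by (simp add: open_Compl)
  then obtain e where e: "0 < e" "\<And>z. \<bar>z - x\<bar> < e \<Longrightarrow> z \<notin> B"
    using B(2) by (auto simp: open_dist dist_real_def)
  define l where "l = max t (x - e)"
  have "{l<..<x + e} \<inter> B = {}" using e by (auto simp: l_def)
  moreover have "0 \<le> l" using x by (simp add: l_def)
  ultimately obtain \<alpha> \<beta> where ab: "\<And>\<tau>. l < \<tau> \<Longrightarrow> \<tau> < x + e \<Longrightarrow> enn2real (D v \<tau>) = \<alpha> * \<tau> + \<beta>"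
    using affine_offD[OF D] by blast
  have "l < x" using x e by (simp add: l_def)
  then obtain p q where pq: "l < p" "p < q" "q < x" using dense by meson
  have val: "\<alpha> * \<tau> + \<beta> = a * \<tau> + b" if "l < \<tau>" "\<tau> < x" for \<tau>
    using ab[of \<tau>] line[of \<tau>] that e by (auto simp: l_def)
  have "\<alpha> * p + \<beta> = a * p + b" "\<alpha> * q + \<beta> = a * q + b" using val pq by auto
  then have "(\<alpha> - a) * (q - p) = 0" by (simp add: algebra_simps)
  then have "\<alpha> = a" using pq by simp
  moreover have "\<beta> = b" using val[of p] pq \<open>\<alpha> = a\<close> by simp
  ultimately have "enn2real (D v \<tau>) = a * \<tau> + b" if "t < \<tau>" "x - \<tau> < e" "\<tau> < x + e" for \<tau>
    using ab[of \<tau>] that by (simp add: l_def)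
  then show ?thesis using e(1) by (intro exI[of _ "x + e"]) simp
qed

text \<open>
  Only finitely many times can be the end of a sweep interval: unless an edge function changes its
  piece there, some earliest arrival function has a breakpoint.
\<close>

lemma next_event_critical:
  assumes sol: "solved t S la lb cu" and x: "x \<in> events S la lb cu" "\<And>y. y \<in> events S la lb cu \<Longrightarrow> x \<le> y"
    and BP: "\<And>v. v < n \<Longrightarrow> finite (BP v)"
      "\<And>v. v < n \<Longrightarrow> D v 0 < \<infinity> \<Longrightarrow> affine_off (BP v) (\<lambda>\<tau>. enn2real (D v \<tau>))"
    and finD: "\<And>v \<tau>. v < n \<Longrightarrow> 0 \<le> \<tau> \<Longrightarrow> D v 0 < \<infinity> \<Longrightarrow> D v \<tau> < \<infinity>"
  shows "x \<in> critical BP"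
proof (rule ccontr)
  assume notin: "x \<notin> critical BP"
  have t: "0 \<le> t" and inv: "inv t S {} la lb cu {k. k < m \<and> eu k \<in> S}"
    using sol by (simp_all add: solved_def)
  have tx: "t < x" by (rule events_after[OF sol x(1)])
  have exact: "D v \<tau> = ennreal (line la lb v \<tau>) \<and> 0 \<le> line la lb v \<tau>"
    if "v \<in> S" "t \<le> \<tau>" "\<tau> < x" for v \<tau>
  proof -
    have "\<tau> < y" if "y \<in> events S la lb cu" for y using x(2)[OF that] \<open>\<tau> < x\<close> by simp
    from solved_exact(1,2)[OF sol \<open>t \<le> \<tau>\<close> this \<open>v \<in> S\<close>] show ?thesis using t \<open>t \<le> \<tau>\<close> by auto
  qed
  have Sn: "v < n" if "v \<in> S" for v using that invD(4)[OF inv] by auto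
  have D0: "D v 0 < \<infinity>" if "v \<in> S" for v
    using D_mono[OF order_refl t, of v] exact[OF that order_refl tx] by (auto simp: le_less_trans)
  \<comment> \<open>A piece event is one of the suprema in \<open>critical\<close>: before
    \<open>x\<close> the line stays strictly below the start of the next piece and tends to it, and
    after \<open>x\<close> monotonicity keeps \<open>D\<close> from falling below.\<close>
  have hit: "False" if k: "k < m" "eu k \<in> S" "Suc (cu k) < len k" "0 < la (eu k)"
      "x = (px k (Suc (cu k)) - lb (eu k)) / la (eu k)" for k
  proof -
    have lx: "line la lb (eu k) x = px k (Suc (cu k))" using k by (simp add: field_simps)
    have "Sup {\<tau>. 0 \<le> \<tau> \<and> D (eu k) \<tau> < ennreal (px k (Suc (cu k)))} = x"
    proof (rule cSup_eq_non_empty)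
      show "{\<tau>. 0 \<le> \<tau> \<and> D (eu k) \<tau> < ennreal (px k (Suc (cu k)))} \<noteq> {}"
      proof -
        have "line la lb (eu k) t < px k (Suc (cu k))" using k tx lx[symmetric] by simp
        then have "D (eu k) t < ennreal (px k (Suc (cu k)))"
          using exact[OF k(2) order_refl tx] by (simp add: ennreal_lessI)
        then show ?thesis using t by blast
      qed
      fix \<tau> assume \<tau>: "\<tau> \<in> {\<tau>. 0 \<le> \<tau> \<and> D (eu k) \<tau> < ennreal (px k (Suc (cu k)))}"
      show "\<tau> \<le> x"
      proof (rule ccontr)
        assume "\<not> \<tau> \<le> x"
        have fin: "D (eu k) \<tau> < \<infinity>" using finD[OF Sn[OF k(2)] _ D0[OF k(2)]] \<tau> by auto
        define r where "r = enn2real (D (eu k) \<tau>)"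
        have r: "D (eu k) \<tau> = ennreal r" "0 \<le> r" using fin by (auto simp: r_def)
        have "r < line la lb (eu k) x" using \<tau> r unfolding lx by (auto simp: ennreal_less_iff)
        have "\<exists>\<rho>. t \<le> \<rho> \<and> \<rho> < x \<and> r < line la lb (eu k) \<rho>"
        proof -
          \<comment> \<open>Halfway between \<open>x\<close> and the time at which the line takes
            the value \<open>r\<close>, but not before \<open>t\<close>.\<close>
          define \<rho> where "\<rho> = max t ((x + (r - lb (eu k)) / la (eu k)) / 2)"
          have "(r - lb (eu k)) / la (eu k) < x" using \<open>r < _\<close> k(4) by (simp add: field_simps)
          moreover have "c < max t ((x + c) / 2)" if "c < x" for c
            using that by (auto simp: less_max_iff_disj)
          ultimately have "\<rho> < x" "(r - lb (eu k)) / la (eu k) < \<rho>"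
            using tx unfolding \<rho>_def by (simp, blast)
          then show ?thesis using k(4) by (intro exI[of _ \<rho>]) (auto simp: \<rho>_def field_simps)
        qed
        then obtain \<rho> where \<rho>: "t \<le> \<rho>" "\<rho> < x" "r < line la lb (eu k) \<rho>" by blast
        have "ennreal (line la lb (eu k) \<rho>) \<le> ennreal r"
          using D_mono[of \<rho> \<tau> "eu k"] exact[OF k(2) \<rho>(1,2)] r \<rho> t \<open>\<not> \<tau> \<le> x\<close> by auto
        then show False using \<rho>(3) r(2) by (simp add: ennreal_le_iff)
      qed
    next
      fix y assume y: "\<And>\<tau>. \<tau> \<in> {\<tau>. 0 \<le> \<tau> \<and> D (eu k) \<tau> < ennreal (px k (Suc (cu k)))} \<Longrightarrow> \<tau> \<le> y"
      show "x \<le> y"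
      proof (rule dense_le_bounded[OF tx])
        fix \<tau> assume \<tau>: "t < \<tau>" "\<tau> < x"
        have "line la lb (eu k) \<tau> < px k (Suc (cu k))" using k(4) \<tau> unfolding lx[symmetric] by simp
        then have "D (eu k) \<tau> < ennreal (px k (Suc (cu k)))"
          using exact[OF k(2), of \<tau>] \<tau> by (simp add: ennreal_lessI)
        then show "\<tau> \<le> y" using y[of \<tau>] \<tau> t by simp
      qed
    qed
    then have "x \<in> critical BP"
      using k unfolding critical_def by (intro UnI2 image_eqI[of _ _ "(k, Suc (cu k))"]) auto
    with notin show False by simp
  qed
  have near: "\<exists>y>x. \<forall>\<tau>. t < \<tau> \<longrightarrow> x - \<tau> < y - x \<longrightarrow> \<tau> < y \<longrightarrow> enn2real (D v \<tau>) = line la lb v \<tau>"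
    if vS: "v \<in> S" for v
  proof -
    have "x \<notin> BP v" using notin Sn[OF vS] by (auto simp: critical_def)
    show ?thesis
      by (rule affine_off_line[OF BP(2)[OF Sn[OF vS] D0[OF vS]] BP(1)[OF Sn[OF vS]] \<open>x \<notin> BP v\<close> t tx
            exact[OF vS]])
  qed
  consider k where "k < m" "eu k \<in> S" "Suc (cu k) < len k" "0 < la (eu k)" "x = (px k (Suc (cu k)) - lb (eu k)) / la (eu k)"
    | k where "x = (cand_b lb cu k - lb (ev k)) / (la (ev k) - cand_a la cu k)" "k < m" "eu k \<in> S"
        "cand_a la cu k < la (ev k)"
    using x(1) by (auto simp: events_def)
  then show False
  proof cases
    case 2
    let ?u = "eu k" and ?v = "ev k"
    have vS: "?v \<in> S" using invD(7)[OF inv, of k] 2 by simp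
    obtain y where y: "x < y" "\<And>\<tau>. t < \<tau> \<Longrightarrow> x - \<tau> < y - x \<Longrightarrow> \<tau> < y \<Longrightarrow> enn2real (D ?u \<tau>) = line la lb ?u \<tau>"
      using near[OF 2(3)] by blast
    obtain z where z: "x < z" "\<And>\<tau>. t < \<tau> \<Longrightarrow> x - \<tau> < z - x \<Longrightarrow> \<tau> < z \<Longrightarrow> enn2real (D ?v \<tau>) = line la lb ?v \<tau>"
      using near[OF vS] by blast
    have la0: "0 \<le> la ?u" using inv_upper(1)[OF inv _ t, of ?u] 2 by simp
    have br: "cu k < len k" "px k (cu k) \<le> line la lb ?u t"
        "Suc (cu k) < len k \<longrightarrow> line la lb ?u t < px k (Suc (cu k))"
      using invD(8)[OF inv, of k] 2 by (auto simp: bracket_def)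
    \<comment> \<open>The edge remains in its piece a little beyond \<open>x\<close>: its piece
      event is not before \<open>x\<close> by minimality and not equal to \<open>x\<close> by
      \<open>hit\<close>.\<close>
    have "\<exists>w>x. Suc (cu k) < len k \<longrightarrow> (\<forall>\<tau>. x < \<tau> \<longrightarrow> \<tau> < w \<longrightarrow> line la lb ?u \<tau> < px k (Suc (cu k)))"
    proof (cases "la ?u = 0 \<or> \<not> Suc (cu k) < len k")
      case True
      then show ?thesis using br(3) by (intro exI[of _ "x + 1"]) auto
    next
      case False
      then have pos: "0 < la ?u" "Suc (cu k) < len k" using la0 by auto
      let ?w = "(px k (Suc (cu k)) - lb ?u) / la ?u"
      have "?w \<in> events S la lb cu" using 2 pos by (auto simp: events_def)
      then have "x \<le> ?w" by (rule x(2))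
      moreover have "x \<noteq> ?w" using hit[OF 2(2,3) pos(2,1)] by blast
      ultimately show ?thesis using pos by (intro exI[of _ ?w]) (auto simp: field_simps)
    qed
    then obtain w where w: "x < w"
      "Suc (cu k) < len k \<Longrightarrow> x < \<tau> \<Longrightarrow> \<tau> < w \<Longrightarrow> line la lb ?u \<tau> < px k (Suc (cu k))" for \<tau> by blast
    \<comment> \<open>Just after \<open>x\<close> both ends of the edge would still follow their old
      lines, but there the line of the head exceeds the candidate, which contradicts
      \<open>D_edge\<close>.\<close>
    define \<tau> where "\<tau> = (x + min y (min z w)) / 2"
    have \<tau>: "x < \<tau>" "\<tau> < y" "\<tau> < z" "\<tau> < w" using y(1) z(1) w(1) by (auto simp: \<tau>_def)
    have Du: "D ?u \<tau> = ennreal (line la lb ?u \<tau>)" "0 \<le> line la lb ?u \<tau>"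
      using y(2)[of \<tau>] \<tau> tx t finD[OF Sn[OF 2(3)] _ D0[OF 2(3)], of \<tau>] ennreal_enn2real[of "D ?u \<tau>"]
        enn2real_nonneg[of "D ?u \<tau>"] by auto
    have "D ?v \<tau> \<le> ennreal (f k (line la lb ?u \<tau>))"
      by (rule D_edge) (use 2 Du \<tau> tx t in auto)
    then have "enn2real (D ?v \<tau>) \<le> f k (line la lb ?u \<tau>)"
      using f_ge[OF 2(2) Du(2)] Du(2) by (intro enn2real_leI) auto
    also have "\<dots> = pa k (cu k) * line la lb ?u \<tau> + pb k (cu k)"
    proof (rule f_eq)
      have "la ?u * t \<le> la ?u * \<tau>" using la0 tx \<tau> by (intro mult_left_mono) auto
      then show "px k (cu k) \<le> line la lb ?u \<tau>" using br(2) by simp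
    qed (use 2 br w(2)[of \<tau>] \<tau> in auto)
    finally have "line la lb ?v \<tau> \<le> cand_a la cu k * \<tau> + cand_b lb cu k"
      using z(2)[of \<tau>] \<tau> tx by (simp add: algebra_simps)
    then have "\<tau> * (la ?v - cand_a la cu k) \<le> cand_b lb cu k - lb ?v" by (simp add: algebra_simps)
    then have "\<tau> \<le> x" unfolding 2(1) using 2(4) by (subst pos_le_divide_eq) auto
    with \<tau>(1) show False by simp
  qed (use hit in blast)
qed

end

section \<open>Weakest preconditions with running time\<close>

definition wp :: "com \<Rightarrow> (nat \<Rightarrow> ram_state \<Rightarrow> bool) \<Rightarrow> ram_state \<Rightarrow> bool" where
  "wp c Q \<sigma> \<longleftrightarrow> (\<exists>k \<tau>. exec c \<sigma> k \<tau> \<and> Q k \<tau>)"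

lemma wp_mono: "wp c Q \<sigma> \<Longrightarrow> (\<And>k \<tau>. Q k \<tau> \<Longrightarrow> Q' k \<tau>) \<Longrightarrow> wp c Q' \<sigma>"
  unfolding wp_def by blast

definition set_nreg :: "nat \<Rightarrow> nat \<Rightarrow> ram_state \<Rightarrow> ram_state" where
  "set_nreg r v \<sigma> = \<sigma>\<lparr>nreg := (nreg \<sigma>)(r := v)\<rparr>"

definition set_rreg :: "nat \<Rightarrow> real \<Rightarrow> ram_state \<Rightarrow> ram_state" where
  "set_rreg r v \<sigma> = \<sigma>\<lparr>rreg := (rreg \<sigma>)(r := v)\<rparr>"

text \<open>
  Eight arrays of natural numbers are interleaved from the address in register \<open>0\<close> on, and eight
  arrays of reals from the address in register \<open>2\<close> on, so that they can grow without bounds and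
  indexing needs addition only.
\<close>

definition narr :: "ram_state \<Rightarrow> nat \<Rightarrow> nat \<Rightarrow> nat" where
  "narr \<sigma> j i = (if j < 8 then nmem \<sigma> (nreg \<sigma> 0 + 8 * i + j) else 0)"

definition rarr :: "ram_state \<Rightarrow> nat \<Rightarrow> nat \<Rightarrow> real" where
  "rarr \<sigma> j i = (if j < 8 then rmem \<sigma> (nreg \<sigma> 2 + 8 * i + j) else 0)"

definition set_narr :: "nat \<Rightarrow> nat \<Rightarrow> nat \<Rightarrow> ram_state \<Rightarrow> ram_state" where
  "set_narr j i v \<sigma> = \<sigma>\<lparr>nmem := (nmem \<sigma>)(nreg \<sigma> 0 + 8 * i + j := v)\<rparr>"

definition set_rarr :: "nat \<Rightarrow> nat \<Rightarrow> real \<Rightarrow> ram_state \<Rightarrow> ram_state" where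
  "set_rarr j i v \<sigma> = \<sigma>\<lparr>rmem := (rmem \<sigma>)(nreg \<sigma> 2 + 8 * i + j := v)\<rparr>"

definition times8 :: "nexp \<Rightarrow> nexp" where
  "times8 e = (let e2 = NAdd e e; e4 = NAdd e2 e2 in NAdd e4 e4)"

definition NArr :: "nat \<Rightarrow> nexp \<Rightarrow> nexp" where
  "NArr j e = NMem (NAdd (NAdd (NReg 0) (times8 e)) (NLit j))"

definition RArr :: "nat \<Rightarrow> nexp \<Rightarrow> rexp" where
  "RArr j e = RMem (NAdd (NAdd (NReg 2) (times8 e)) (NLit j))"

definition SetNArr :: "nat \<Rightarrow> nexp \<Rightarrow> nexp \<Rightarrow> com" where
  "SetNArr j e e' = SetNMem (NAdd (NAdd (NReg 0) (times8 e)) (NLit j)) e'"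

definition SetRArr :: "nat \<Rightarrow> nexp \<Rightarrow> rexp \<Rightarrow> com" where
  "SetRArr j e e' = SetRMem (NAdd (NAdd (NReg 2) (times8 e)) (NLit j)) e'"

definition BOr :: "bexp \<Rightarrow> bexp \<Rightarrow> bexp" where
  "BOr b c = BNot (BAnd (BNot b) (BNot c))"

definition NEq :: "nexp \<Rightarrow> nexp \<Rightarrow> bexp" where
  "NEq a b = BAnd (BNot (NLess a b)) (BNot (NLess b a))"

definition REq :: "rexp \<Rightarrow> rexp \<Rightarrow> bexp" where
  "REq a b = BAnd (BNot (RLess a b)) (BNot (RLess b a))"

lemma nval_times8 [simp]: "nval (times8 e) \<sigma> = 8 * nval e \<sigma>"
  by (simp add: times8_def Let_def)

lemma val_simps [simp]:
  "j < 8 \<Longrightarrow> nval (NArr j e) \<sigma> = narr \<sigma> j (nval e \<sigma>)"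
  "j < 8 \<Longrightarrow> rval (RArr j e) \<sigma> = rarr \<sigma> j (nval e \<sigma>)"
  "bval (BOr b c) \<sigma> \<longleftrightarrow> bval b \<sigma> \<or> bval c \<sigma>"
  "bval (NEq x y) \<sigma> \<longleftrightarrow> nval x \<sigma> = nval y \<sigma>"
  "bval (REq p q) \<sigma> \<longleftrightarrow> rval p \<sigma> = rval q \<sigma>"
  by (auto simp: NArr_def RArr_def narr_def rarr_def BOr_def NEq_def REq_def)

lemma set_simps [simp]:
  "nreg (set_nreg r v \<sigma>) = (nreg \<sigma>)(r := v)" "nreg (set_rreg r x \<sigma>) = nreg \<sigma>"
  "nreg (set_narr j i v \<sigma>) = nreg \<sigma>" "nreg (set_rarr j i x \<sigma>) = nreg \<sigma>"
  "rreg (set_nreg r v \<sigma>) = rreg \<sigma>" "rreg (set_rreg r x \<sigma>) = (rreg \<sigma>)(r := x)"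
  "rreg (set_narr j i v \<sigma>) = rreg \<sigma>" "rreg (set_rarr j i x \<sigma>) = rreg \<sigma>"
  "rmem (set_nreg r v \<sigma>) = rmem \<sigma>" "rmem (set_rreg r x \<sigma>) = rmem \<sigma>" "rmem (set_narr j i v \<sigma>) = rmem \<sigma>"
  "nmem (set_nreg r v \<sigma>) = nmem \<sigma>" "nmem (set_rreg r x \<sigma>) = nmem \<sigma>" "nmem (set_rarr j i x \<sigma>) = nmem \<sigma>"
  by (simp_all add: set_nreg_def set_rreg_def set_narr_def set_rarr_def)

lemma arr_simps [simp]:
  "r \<noteq> 0 \<Longrightarrow> narr (set_nreg r v \<sigma>) = narr \<sigma>" "narr (set_rreg r x \<sigma>) = narr \<sigma>"
  "narr (set_rarr j i x \<sigma>) = narr \<sigma>"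
  "r \<noteq> 2 \<Longrightarrow> rarr (set_nreg r v \<sigma>) = rarr \<sigma>" "rarr (set_rreg r x \<sigma>) = rarr \<sigma>"
  "rarr (set_narr j i v \<sigma>) = rarr \<sigma>"
  by (simp_all add: fun_eq_iff narr_def rarr_def)

lemma stride8:
  assumes j: "j < 8" "j' < 8"
  shows "b + 8 * i + j = b + 8 * i' + j' \<longleftrightarrow> i = i' \<and> j = (j' :: nat)"
proof
  assume eq: "b + 8 * i + j = b + 8 * i' + j'"
  from eq have "(8 * i + j) div 8 = (8 * i' + j') div 8" by simp
  with j have "i = i'" by simp
  with eq show "i = i' \<and> j = j'" by simp
qed simp

lemma narr_set_narr [simp]: "j < 8 \<Longrightarrow> narr (set_narr j i v \<sigma>) = (narr \<sigma>)(j := (narr \<sigma> j)(i := v))"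
  by (auto simp: fun_eq_iff narr_def set_narr_def stride8)

lemma rarr_set_rarr [simp]: "j < 8 \<Longrightarrow> rarr (set_rarr j i v \<sigma>) = (rarr \<sigma>)(j := (rarr \<sigma> j)(i := v))"
  by (auto simp: fun_eq_iff rarr_def set_rarr_def stride8)

lemma rmem_set_rarr [simp]: "a < nreg \<sigma> 2 \<Longrightarrow> rmem (set_rarr j i v \<sigma>) a = rmem \<sigma> a"
  by (simp add: set_rarr_def)

lemma wp_Skip: "wp Skip Q \<sigma> \<longleftrightarrow> Q 1 \<sigma>"
  unfolding wp_def by (auto elim!: exec_SkipE intro: exec.Skip[simplified])

lemma wp_SetNMem: "wp (SetNMem a e) Q \<sigma> \<longleftrightarrow> Q 1 (\<sigma>\<lparr>nmem := (nmem \<sigma>)(nval a \<sigma> := nval e \<sigma>)\<rparr>)"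
  unfolding wp_def by (auto elim!: exec_SetNMemE intro: exec.SetNMem[simplified])

lemma wp_SetRMem: "wp (SetRMem a e) Q \<sigma> \<longleftrightarrow> Q 1 (\<sigma>\<lparr>rmem := (rmem \<sigma>)(nval a \<sigma> := rval e \<sigma>)\<rparr>)"
  unfolding wp_def by (auto elim!: exec_SetRMemE intro: exec.SetRMem[simplified])

lemma wp_SetNReg: "wp (SetNReg r e) Q \<sigma> \<longleftrightarrow> Q 1 (set_nreg r (nval e \<sigma>) \<sigma>)"
  unfolding wp_def set_nreg_def by (auto elim!: exec_SetNRegE intro: exec.SetNReg[simplified])

lemma wp_SetRReg: "wp (SetRReg r x) Q \<sigma> \<longleftrightarrow> Q 1 (set_rreg r (rval x \<sigma>) \<sigma>)"
  unfolding wp_def set_rreg_def by (auto elim!: exec_SetRRegE intro: exec.SetRReg[simplified])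

lemma wp_SetNArr: "wp (SetNArr j a e) Q \<sigma> \<longleftrightarrow> Q 1 (set_narr j (nval a \<sigma>) (nval e \<sigma>) \<sigma>)"
  by (simp add: SetNArr_def wp_SetNMem set_narr_def)

lemma wp_SetRArr: "wp (SetRArr j a x) Q \<sigma> \<longleftrightarrow> Q 1 (set_rarr j (nval a \<sigma>) (rval x \<sigma>) \<sigma>)"
  by (simp add: SetRArr_def wp_SetRMem set_rarr_def)

lemma wp_Seq: "wp (Seq c d) Q \<sigma> \<longleftrightarrow> wp c (\<lambda>k. wp d (\<lambda>l. Q (k + l))) \<sigma>"
  unfolding wp_def by (blast elim: exec_SeqE intro: exec.Seq)

lemma wp_Cond: "wp (Cond b c d) Q \<sigma> \<longleftrightarrow>
    (if bval b \<sigma> then wp c (\<lambda>k. Q (Suc k)) \<sigma> else wp d (\<lambda>k. Q (Suc k)) \<sigma>)"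
  unfolding wp_def by (cases "bval b \<sigma>") (auto elim!: exec_CondE intro: exec.CondTrue exec.CondFalse)

lemmas wp_simps = wp_Skip wp_SetNReg wp_SetRReg wp_SetNArr wp_SetRArr wp_Seq wp_Cond

text \<open>The invariant receives the number of steps taken so far, so that time bounds can be
  amortised against the state, while \<open>\<mu>\<close> is responsible for termination alone. The
  last failing test accounts for \<open>Suc k\<close>.\<close>

lemma wp_Loop:
  fixes \<mu> :: "ram_state \<Rightarrow> nat"
  assumes init: "I 0 \<sigma>"
    and step: "\<And>k \<sigma>. I k \<sigma> \<Longrightarrow> bval b \<sigma> \<Longrightarrow> wp c (\<lambda>l \<tau>. I (Suc (k + l)) \<tau> \<and> \<mu> \<tau> < \<mu> \<sigma>) \<sigma>"
    and exit: "\<And>k \<sigma>. I k \<sigma> \<Longrightarrow> \<not> bval b \<sigma> \<Longrightarrow> Q (Suc k) \<sigma>"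
  shows "wp (Loop b c) Q \<sigma>"
proof -
  have "\<exists>l \<tau>. exec (Loop b c) \<sigma> l \<tau> \<and> Q (k + l) \<tau>" if "I k \<sigma>" for k \<sigma>
    using that
  proof (induction "\<mu> \<sigma>" arbitrary: k \<sigma> rule: less_induct)
    case less
    show ?case
    proof (cases "bval b \<sigma>")
      case True
      from step[OF less.prems True] obtain l \<rho>
        where \<rho>: "exec c \<sigma> l \<rho>" "I (Suc (k + l)) \<rho>" "\<mu> \<rho> < \<mu> \<sigma>" by (auto simp: wp_def)
      from less.hyps[OF \<rho>(3,2)] obtain l' \<tau>
        where \<tau>: "exec (Loop b c) \<rho> l' \<tau>" "Q (Suc (k + l) + l') \<tau>" by blast
      have "exec (Loop b c) \<sigma> (Suc (l + l')) \<tau>" by (rule exec.LoopTrue[OF True \<rho>(1) \<tau>(1)])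
      moreover have "Suc (k + l) + l' = k + Suc (l + l')" by simp
      ultimately show ?thesis using \<tau>(2) by metis
    next
      case False
      have "Q (k + 1) \<sigma>" using exit[OF less.prems False] by simp
      with exec.LoopFalse[OF False] show ?thesis by blast
    qed
  qed
  from this[OF init] show ?thesis unfolding wp_def by simp
qed

section \<open>The sweep as a program\<close>

text \<open>
  Registers for natural numbers: \<open>3 = n\<close>, \<open>4 = s\<close>, \<open>5 = d\<close>, \<open>6 = m\<close>, \<open>7\<close> number of output
  pieces, \<open>8\<close> current vertex, \<open>9\<close> current edge, \<open>10\<close> counter, \<open>11\<close> whether there is a next event,
  \<open>12\<close> head of the current edge, \<open>13\<close> whether the sweep continues.
  Registers for reals: \<open>0\<close> current time, \<open>2\<close> value of the current vertex, \<open>3, 4\<close> candidate line,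
  \<open>5, 6\<close> compared values, \<open>7\<close> next event, \<open>8\<close> candidate event.
  Arrays for natural numbers: \<open>0, 2\<close> tail and head of an edge, \<open>3\<close> address of its current piece,
  \<open>4\<close> end address of its pieces, \<open>5\<close> status of a vertex (\<open>1\<close> labelled, \<open>2\<close> final).
  Arrays for reals: \<open>0, 2\<close> line of a vertex, \<open>3, 4, 5\<close> output pieces.
\<close>

definition cur_mem :: "nat \<Rightarrow> rexp" where
  "cur_mem i = RMem (NAdd (NArr 3 (NReg 9)) (NLit i))"

definition lex_less :: "rexp \<Rightarrow> rexp \<Rightarrow> rexp \<Rightarrow> rexp \<Rightarrow> bexp" where
  "lex_less p q a b = BOr (RLess p q) (BAnd (BNot (RLess q p)) (RLess a b))"

definition advance_prog :: com where
  "advance_prog =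
     Loop (BAnd (NLess (NAdd (NArr 3 (NReg 9)) (NLit 3)) (NArr 4 (NReg 9)))
         (BNot (RLess (RReg 2) (cur_mem 3))))
       (SetNArr 3 (NReg 9) (NAdd (NArr 3 (NReg 9)) (NLit 3)))"

definition line_at :: "nexp \<Rightarrow> rexp" where
  "line_at e = RAdd (RMul (RArr 0 e) (RReg 0)) (RArr 2 e)"

definition relax_prog :: com where
  "relax_prog =
     Seq (SetRReg 3 (RMul (cur_mem 1) (RArr 0 (NReg 8))))
    (Seq (SetRReg 4 (RAdd (RMul (cur_mem 1) (RArr 2 (NReg 8))) (cur_mem 2)))
    (Seq (SetNReg 12 (NArr 2 (NReg 9)))
    (Seq (SetRReg 5 (RAdd (RMul (RReg 3) (RReg 0)) (RReg 4)))
    (Seq (SetRReg 6 (line_at (NReg 12)))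
    (Cond (BOr (NLess (NArr 5 (NReg 12)) (NLit 1))
        (BAnd (NLess (NArr 5 (NReg 12)) (NLit 2))
          (lex_less (RReg 5) (RReg 6) (RReg 3) (RArr 0 (NReg 12)))))
      (Seq (SetNArr 5 (NReg 12) (NLit 1))
      (Seq (SetRArr 0 (NReg 12) (RReg 3)) (SetRArr 2 (NReg 12) (RReg 4))))
      Skip)))))"

text \<open>All edges are scanned for those that leave the current vertex. This spares adjacency
  lists and costs only a polynomial factor.\<close>

definition edges_prog :: com where
  "edges_prog =
     Seq (SetNReg 9 (NLit 0))
    (Loop (NLess (NReg 9) (NReg 6))
      (Seq (Cond (NEq (NArr 0 (NReg 9)) (NReg 8)) (Seq advance_prog relax_prog) Skip)
        (SetNReg 9 (NAdd (NReg 9) (NLit 1)))))"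

text \<open>The number \<open>n\<close>, which is no vertex, stands in register \<open>8\<close> for
  the absence of a labelled vertex; the same value ends the loop of
  \<open>dijkstra_prog\<close>.\<close>

definition findmin_loop :: com where
  "findmin_loop =
     Loop (NLess (NReg 10) (NReg 3))
      (Seq (Cond (NEq (NArr 5 (NReg 10)) (NLit 1))
          (Seq (SetRReg 5 (line_at (NReg 10)))
            (Cond (BOr (NEq (NReg 8) (NReg 3))
                (lex_less (RReg 5) (RReg 6) (RArr 0 (NReg 10)) (RArr 0 (NReg 8))))
              (Seq (SetNReg 8 (NReg 10)) (SetRReg 6 (RReg 5)))
              Skip))
          Skip)
        (SetNReg 10 (NAdd (NReg 10) (NLit 1))))"

definition findmin_prog :: com where
  "findmin_prog =
     Seq (SetNReg 8 (NReg 3)) (Seq (SetNReg 10 (NLit 0)) (Seq findmin_loop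
    (Cond (NLess (NReg 8) (NReg 3)) (SetNArr 5 (NReg 8) (NLit 2)) Skip)))"

definition clear_prog :: com where
  "clear_prog =
     Seq (SetNReg 10 (NLit 0))
    (Loop (NLess (NReg 10) (NReg 3))
      (Seq (SetNArr 5 (NReg 10) (NLit 0)) (SetNReg 10 (NAdd (NReg 10) (NLit 1)))))"

definition dijkstra_prog :: com where
  "dijkstra_prog =
     Seq clear_prog
    (Seq (SetNArr 5 (NReg 4) (NLit 2))
    (Seq (SetRArr 0 (NReg 4) (RLit 1))
    (Seq (SetRArr 2 (NReg 4) (RLit 0))
    (Seq (SetNReg 8 (NReg 4))
    (Loop (NLess (NReg 8) (NReg 3))
      (Seq (SetRReg 2 (line_at (NReg 8))) (Seq edges_prog findmin_prog)))))))"

definition update_prog :: com where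
  "update_prog =
     Cond (BOr (NEq (NReg 11) (NLit 0)) (RLess (RReg 8) (RReg 7)))
       (Seq (SetNReg 11 (NLit 1)) (SetRReg 7 (RReg 8))) Skip"

definition piece_event_prog :: com where
  "piece_event_prog =
     Cond (BAnd (NLess (NAdd (NArr 3 (NReg 9)) (NLit 3)) (NArr 4 (NReg 9)))
         (RLess (RLit 0) (RArr 0 (NReg 8))))
       (Seq (SetRReg 8 (RDiv (RSub (cur_mem 3) (RArr 2 (NReg 8))) (RArr 0 (NReg 8)))) update_prog)
       Skip"

definition cross_event_prog :: com where
  "cross_event_prog =
     Seq (SetRReg 3 (RMul (cur_mem 1) (RArr 0 (NReg 8))))
    (Seq (SetRReg 4 (RAdd (RMul (cur_mem 1) (RArr 2 (NReg 8))) (cur_mem 2)))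
    (Cond (RLess (RReg 3) (RArr 0 (NReg 12)))
      (Seq (SetRReg 8 (RDiv (RSub (RReg 4) (RArr 2 (NReg 12))) (RSub (RArr 0 (NReg 12)) (RReg 3))))
        update_prog)
      Skip))"

definition next_prog :: com where
  "next_prog =
     Seq (SetNReg 11 (NLit 0)) (Seq (SetNReg 9 (NLit 0))
    (Loop (NLess (NReg 9) (NReg 6))
      (Seq (SetNReg 8 (NArr 0 (NReg 9)))
      (Seq (SetNReg 12 (NArr 2 (NReg 9)))
      (Seq (Cond (NLess (NLit 1) (NArr 5 (NReg 8))) (Seq piece_event_prog cross_event_prog) Skip)
        (SetNReg 9 (NAdd (NReg 9) (NLit 1))))))))"

lemma bval_lex_less [simp]: "bval (lex_less p q a b) \<sigma> \<longleftrightarrow>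
    rval p \<sigma> < rval q \<sigma> \<or> (\<not> rval q \<sigma> < rval p \<sigma> \<and> rval a \<sigma> < rval b \<sigma>)"
  by (simp add: lex_less_def)

lemma rval_line_at [simp]: "rval (line_at e) \<sigma> = rarr \<sigma> 0 (nval e \<sigma>) * rreg \<sigma> 0 + rarr \<sigma> 2 (nval e \<sigma>)"
  by (simp add: line_at_def)

lemma rval_cur_mem [simp]: "rval (cur_mem i) \<sigma> = rmem \<sigma> (narr \<sigma> 3 (nreg \<sigma> 9) + i)"
  by (simp add: cur_mem_def)

lemma set_narr_twice: "set_narr j i v (set_narr j i w \<sigma>) = set_narr j i v \<sigma>"
  by (simp add: set_narr_def)

lemma set_narr_same: "j < 8 \<Longrightarrow> narr \<sigma> j i = v \<Longrightarrow> set_narr j i v \<sigma> = \<sigma>"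
  by (auto simp: set_narr_def narr_def)

section \<open>Correctness and running time of one Dijkstra run\<close>

locale ram_network = pl_network +
  fixes d :: nat and off :: "nat \<Rightarrow> nat"
  assumes d: "d < n"
begin

text \<open>The part of the state that the sweep never changes. The pieces stay where the input
  stores them, below the address in register \<open>2\<close>, from which the arrays of reals grow
  upwards, so writing to these arrays preserves them.\<close>

definition network :: "ram_state \<Rightarrow> bool" where
  "network \<sigma> \<longleftrightarrow> nreg \<sigma> 3 = n \<and> nreg \<sigma> 4 = s \<and> nreg \<sigma> 5 = d \<and> nreg \<sigma> 6 = m \<and>
     (\<forall>k<m. narr \<sigma> 0 k = eu k \<and> narr \<sigma> 2 k = ev k \<and> narr \<sigma> 4 k = off k + 3 * len k \<and>
        off k + 3 * len k \<le> nreg \<sigma> 2 \<and>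
        (\<forall>i<len k. rmem \<sigma> (off k + 3 * i) = px k i \<and> rmem \<sigma> (off k + 3 * i + 1) = pa k i \<and>
           rmem \<sigma> (off k + 3 * i + 2) = pb k i))"

lemma network_simps [simp]:
  "6 < r \<Longrightarrow> network (set_nreg r v \<sigma>) \<longleftrightarrow> network \<sigma>"
  "network (set_rreg r x \<sigma>) \<longleftrightarrow> network \<sigma>"
  "j = 3 \<or> j = 5 \<Longrightarrow> network (set_narr j i v \<sigma>) \<longleftrightarrow> network \<sigma>"
  "network (set_rarr j i x \<sigma>) \<longleftrightarrow> network \<sigma>"
proof -
  show "6 < r \<Longrightarrow> network (set_nreg r v \<sigma>) \<longleftrightarrow> network \<sigma>"
    "network (set_rreg r x \<sigma>) \<longleftrightarrow> network \<sigma>"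
    "j = 3 \<or> j = 5 \<Longrightarrow> network (set_narr j i v \<sigma>) \<longleftrightarrow> network \<sigma>"
    by (auto simp: network_def)
  have "rmem (set_rarr j i x \<sigma>) a = rmem \<sigma> a"
    if "off k + 3 * len k \<le> nreg \<sigma> 2" "i' < len k" "a \<le> off k + 3 * i' + 2" for k i' a
    using that by simp
  then have "(off k + 3 * len k \<le> nreg \<sigma> 2 \<and> (\<forall>i'<len k. rmem (set_rarr j i x \<sigma>) (off k + 3 * i') = px k i' \<and>
        rmem (set_rarr j i x \<sigma>) (off k + 3 * i' + 1) = pa k i' \<and>
        rmem (set_rarr j i x \<sigma>) (off k + 3 * i' + 2) = pb k i')) \<longleftrightarrow>
      (off k + 3 * len k \<le> nreg \<sigma> 2 \<and> (\<forall>i'<len k. rmem \<sigma> (off k + 3 * i') = px k i' \<and>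
        rmem \<sigma> (off k + 3 * i' + 1) = pa k i' \<and> rmem \<sigma> (off k + 3 * i' + 2) = pb k i'))" for k
    by (intro conj_cong all_cong imp_cong refl arg_cong2[of _ _ _ _ "(=)"]) auto
  then show "network (set_rarr j i x \<sigma>) \<longleftrightarrow> network \<sigma>"
    unfolding network_def set_simps arr_simps by simp
qed

lemma networkD:
  assumes "network \<sigma>"
  shows "nreg \<sigma> 3 = n" "nreg \<sigma> 4 = s" "nreg \<sigma> 5 = d" "nreg \<sigma> 6 = m"
    "k < m \<Longrightarrow> narr \<sigma> 0 k = eu k" "k < m \<Longrightarrow> narr \<sigma> 2 k = ev k" "k < m \<Longrightarrow> narr \<sigma> 4 k = off k + 3 * len k"
    "k < m \<Longrightarrow> c < len k \<Longrightarrow> rmem \<sigma> (off k + 3 * c + 1) = pa k c"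
    "k < m \<Longrightarrow> c < len k \<Longrightarrow> rmem \<sigma> (off k + 3 * c + 2) = pb k c"
    "k < m \<Longrightarrow> Suc c < len k \<Longrightarrow> rmem \<sigma> (off k + 3 * c + 3) = px k (Suc c)"
proof -
  assume "k < m" "Suc c < len k"
  then have "rmem \<sigma> (off k + 3 * Suc c) = px k (Suc c)" using assms unfolding network_def by blast
  moreover have "off k + 3 * Suc c = off k + 3 * c + 3" by simp
  ultimately show "rmem \<sigma> (off k + 3 * c + 3) = px k (Suc c)" by metis
qed (use assms in \<open>unfold network_def, blast+\<close>)

definition keep :: "ram_state \<Rightarrow> ram_state \<Rightarrow> bool" where
  "keep \<rho> \<sigma> \<longleftrightarrow> network \<sigma> \<and> nreg \<sigma> 7 = nreg \<rho> 7 \<and> nreg \<sigma> 13 = nreg \<rho> 13 \<and> rreg \<sigma> 0 = rreg \<rho> 0 \<and>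
     rarr \<sigma> 3 = rarr \<rho> 3 \<and> rarr \<sigma> 4 = rarr \<rho> 4 \<and> rarr \<sigma> 5 = rarr \<rho> 5"

lemma keep_simps [simp]:
  "7 < r \<Longrightarrow> r \<noteq> 13 \<Longrightarrow> keep \<rho> (set_nreg r v \<sigma>) \<longleftrightarrow> keep \<rho> \<sigma>"
  "r \<noteq> 0 \<Longrightarrow> keep \<rho> (set_rreg r x \<sigma>) \<longleftrightarrow> keep \<rho> \<sigma>"
  "j = 3 \<or> j = 5 \<Longrightarrow> keep \<rho> (set_narr j i v \<sigma>) \<longleftrightarrow> keep \<rho> \<sigma>"
  "j = 0 \<or> j = 2 \<Longrightarrow> keep \<rho> (set_rarr j i x \<sigma>) \<longleftrightarrow> keep \<rho> \<sigma>"
  by (auto simp: keep_def)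

lemma keep_refl: "network \<sigma> \<Longrightarrow> keep \<sigma> \<sigma>"
  by (simp add: keep_def)

lemma keep_trans: "keep \<rho> \<sigma> \<Longrightarrow> keep \<sigma> \<tau> \<Longrightarrow> keep \<rho> \<tau>"
  by (simp add: keep_def)

lemma keep_network: "keep \<rho> \<sigma> \<Longrightarrow> network \<sigma>"
  by (simp add: keep_def)

definition cursors :: "ram_state \<Rightarrow> (nat \<Rightarrow> nat) \<Rightarrow> bool" where
  "cursors \<sigma> cu \<longleftrightarrow> (\<forall>k<m. narr \<sigma> 3 k = off k + 3 * cu k)"

lemma cursors_cong: "narr \<tau> 3 = narr \<sigma> 3 \<Longrightarrow> cursors \<tau> cu \<longleftrightarrow> cursors \<sigma> cu"
  by (simp add: cursors_def)

definition final :: "ram_state \<Rightarrow> nat set" where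
  "final \<sigma> = {v. v < n \<and> 2 \<le> narr \<sigma> 5 v}"

definition labelled :: "ram_state \<Rightarrow> nat set" where
  "labelled \<sigma> = {v. v < n \<and> narr \<sigma> 5 v = 1}"

lemma status_cong:
  "narr \<tau> 5 = narr \<sigma> 5 \<Longrightarrow> final \<tau> = final \<sigma>" "narr \<tau> 5 = narr \<sigma> 5 \<Longrightarrow> labelled \<tau> = labelled \<sigma>"
  by (simp_all add: final_def labelled_def)

text \<open>Each move of the pointer costs two steps, so the time is measured by the increase of the
  pointer. Pointers never move back, hence these terms telescope over the whole sweep. If the
  pointer does not move, the lower end of its piece is supplied by
  \<open>inv_unlinked\<close>.\<close>

lemma wp_advance:
  assumes net: "network \<sigma>" and k: "nreg \<sigma> 9 = k" "k < m" and c: "narr \<sigma> 3 k = off k + 3 * c" "c < len k"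
  shows "wp advance_prog (\<lambda>l \<tau>. \<exists>c'. c \<le> c' \<and> c' < len k \<and> \<tau> = set_narr 3 k (off k + 3 * c') \<sigma> \<and>
      (Suc c' < len k \<longrightarrow> rreg \<sigma> 2 < px k (Suc c')) \<and> (c' = c \<or> px k c' \<le> rreg \<sigma> 2) \<and>
      l + 2 * c \<le> 2 * c' + 1) \<sigma>"
  unfolding advance_prog_def
proof (rule wp_Loop[where I = "\<lambda>l \<tau>. \<exists>c'. c \<le> c' \<and> c' < len k \<and> \<tau> = set_narr 3 k (off k + 3 * c') \<sigma> \<and>
      (c' = c \<or> px k c' \<le> rreg \<sigma> 2) \<and> l + 2 * c \<le> 2 * c'" and
      \<mu> = "\<lambda>\<tau>. off k + 3 * len k - narr \<tau> 3 k"])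
  show "\<exists>c'. c \<le> c' \<and> c' < len k \<and> \<sigma> = set_narr 3 k (off k + 3 * c') \<sigma> \<and>
      (c' = c \<or> px k c' \<le> rreg \<sigma> 2) \<and> 0 + 2 * c \<le> 2 * c'"
    using c by (intro exI[of _ c]) (simp add: set_narr_same)
next
  fix l \<tau>
  assume "\<exists>c'. c \<le> c' \<and> c' < len k \<and> \<tau> = set_narr 3 k (off k + 3 * c') \<sigma> \<and>
      (c' = c \<or> px k c' \<le> rreg \<sigma> 2) \<and> l + 2 * c \<le> 2 * c'"
  then obtain c' where c': "c \<le> c'" "c' < len k" "\<tau> = set_narr 3 k (off k + 3 * c') \<sigma>" "l + 2 * c \<le> 2 * c'"
    "c' = c \<or> px k c' \<le> rreg \<sigma> 2" by blast
  have reg: "nreg \<tau> 9 = k" "narr \<tau> 3 k = off k + 3 * c'" "narr \<tau> 4 k = off k + 3 * len k" "rreg \<tau> 2 = rreg \<sigma> 2"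
    "rmem \<tau> = rmem \<sigma>"
    using c' k networkD(7)[OF net k(2)] by simp_all
  let ?b = "BAnd (NLess (NAdd (NArr 3 (NReg 9)) (NLit 3)) (NArr 4 (NReg 9))) (BNot (RLess (RReg 2) (cur_mem 3)))"
  have b: "bval ?b \<tau> \<longleftrightarrow> Suc c' < len k \<and> px k (Suc c') \<le> rreg \<sigma> 2"
    using networkD(10)[OF net k(2), of c'] by (auto simp: reg not_less)
  {
    assume "bval ?b \<tau>"
    then have b': "Suc c' < len k" "px k (Suc c') \<le> rreg \<sigma> 2" using b by auto
    have st: "set_narr 3 k (off k + 3 * c' + 3) \<tau> = set_narr 3 k (off k + 3 * Suc c') \<sigma>"
      by (simp add: c'(3) set_narr_twice add.commute add.left_commute)
    show "wp (SetNArr 3 (NReg 9) (NAdd (NArr 3 (NReg 9)) (NLit 3)))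
        (\<lambda>l' \<tau>'. (\<exists>c'. c \<le> c' \<and> c' < len k \<and> \<tau>' = set_narr 3 k (off k + 3 * c') \<sigma> \<and>
          (c' = c \<or> px k c' \<le> rreg \<sigma> 2) \<and> Suc (l + l') + 2 * c \<le> 2 * c') \<and>
          off k + 3 * len k - narr \<tau>' 3 k < off k + 3 * len k - narr \<tau> 3 k) \<tau>"
    proof (simp only: wp_simps, intro conjI exI[of _ "Suc c'"])
      show "set_narr 3 (nval (NReg 9) \<tau>) (nval (NAdd (NArr 3 (NReg 9)) (NLit 3)) \<tau>) \<tau> =
          set_narr 3 k (off k + 3 * Suc c') \<sigma>" using st by (simp add: reg)
    qed (use c' b' reg in auto)
  }
  {
    assume "\<not> bval ?b \<tau>"
    then show "\<exists>c'. c \<le> c' \<and> c' < len k \<and> \<tau> = set_narr 3 k (off k + 3 * c') \<sigma> \<and>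
      (Suc c' < len k \<longrightarrow> rreg \<sigma> 2 < px k (Suc c')) \<and> (c' = c \<or> px k c' \<le> rreg \<sigma> 2) \<and>
      Suc l + 2 * c \<le> 2 * c' + 1"
      using c' b by (intro exI[of _ c']) auto
  }
qed

lemma wp_relax:
  assumes net: "network \<sigma>" and k: "nreg \<sigma> 9 = k" "k < m" and c: "narr \<sigma> 3 k = off k + 3 * c" "c < len k"
  defines "u \<equiv> nreg \<sigma> 8" and "v \<equiv> ev k" and "t \<equiv> rreg \<sigma> 0" and "la \<equiv> rarr \<sigma> 0" and "lb \<equiv> rarr \<sigma> 2"
  defines "a \<equiv> pa k c * la u" and "b \<equiv> pa k c * lb u + pb k c"
  defines "\<sigma>' \<equiv> set_rreg 6 (la v * t + lb v) (set_rreg 5 (a * t + b) (set_nreg 12 v (set_rreg 4 b (set_rreg 3 a \<sigma>))))"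
  shows "wp relax_prog (\<lambda>l \<tau>. l \<le> 9 \<and> \<tau> =
      (if narr \<sigma> 5 v < 1 \<or> narr \<sigma> 5 v < 2 \<and>
          (a * t + b < la v * t + lb v \<or> \<not> la v * t + lb v < a * t + b \<and> a < la v)
       then set_rarr 2 v b (set_rarr 0 v a (set_narr 5 v 1 \<sigma>')) else \<sigma>')) \<sigma>"
    (is "wp _ (\<lambda>l \<tau>. _ \<and> \<tau> = (if ?P then ?\<tau> else _)) _")
proof -
  have mem: "rmem \<sigma> (off k + 3 * c + 1) = pa k c" "rmem \<sigma> (off k + 3 * c + 2) = pb k c" "narr \<sigma> 2 k = ev k"
    using networkD(6,8,9)[OF net k(2)] c(2) by simp_all
  have \<sigma>': "wp relax_prog Q \<sigma> \<longleftrightarrow> (if ?P then Q 9 ?\<tau> else Q 7 \<sigma>')" for Q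
  proof -
    have b: "bval (BOr (NLess (NArr 5 (NReg 12)) (NLit 1))
        (BAnd (NLess (NArr 5 (NReg 12)) (NLit 2)) (lex_less (RReg 5) (RReg 6) (RReg 3) (RArr 0 (NReg 12))))) \<sigma>' \<longleftrightarrow> ?P"
      by (simp add: \<sigma>'_def la_def)
    have eq: "wp relax_prog Q \<sigma> \<longleftrightarrow> wp (Cond (BOr (NLess (NArr 5 (NReg 12)) (NLit 1))
        (BAnd (NLess (NArr 5 (NReg 12)) (NLit 2)) (lex_less (RReg 5) (RReg 6) (RReg 3) (RArr 0 (NReg 12)))))
      (Seq (SetNArr 5 (NReg 12) (NLit 1)) (Seq (SetRArr 0 (NReg 12) (RReg 3)) (SetRArr 2 (NReg 12) (RReg 4))))
      Skip) (\<lambda>l. Q (5 + l)) \<sigma>'"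
      using mem c k unfolding relax_prog_def wp_Seq wp_SetRReg wp_SetNReg
      by (simp add: \<sigma>'_def a_def b_def la_def lb_def u_def v_def t_def numeral_eq_Suc)
    show ?thesis unfolding eq wp_Cond b
      by (auto simp: wp_Seq wp_SetNArr wp_SetRArr wp_Skip \<sigma>'_def)
  qed
  show ?thesis unfolding \<sigma>' by auto
qed

lemma sum_upd_cursor:
  assumes "k < m"
  shows "(\<Sum>j<m. (cu(k := c)) j) + cu k = (\<Sum>j<m. cu j) + (c :: nat)"
proof -
  have "(\<Sum>j<m. (cu(k := c)) j) = c + (\<Sum>j\<in>{..<m} - {k}. cu j)"
    using assms by (subst sum.remove[of _ k]) (auto intro!: sum.cong)
  moreover have "(\<Sum>j<m. cu j) = cu k + (\<Sum>j\<in>{..<m} - {k}. cu j)"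
    using assms by (subst sum.remove[of _ k]) auto
  ultimately show ?thesis by simp
qed

text \<open>The test in \<open>relax_prog\<close> decides between \<open>inv_keep\<close> and
  \<open>inv_relax\<close>. Final vertices keep their lines, so the value of the tail remains valid
  while its other edges are scanned.\<close>

lemma wp_edge:
  assumes net: "network \<sigma>" and k: "nreg \<sigma> 9 = k" "k < m" and cu: "cursors \<sigma> cu" and t: "0 \<le> rreg \<sigma> 0"
    and u: "nreg \<sigma> 8 = eu k" "eu k \<in> final \<sigma>" and y: "rreg \<sigma> 2 = line (rarr \<sigma> 0) (rarr \<sigma> 2) (eu k) (rreg \<sigma> 0)"
    and inv: "inv (rreg \<sigma> 0) (final \<sigma>) (labelled \<sigma>) (rarr \<sigma> 0) (rarr \<sigma> 2) cu Q" and kQ: "k \<notin> Q"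
    and top: "\<And>x. x \<in> final \<sigma> \<Longrightarrow>
      germ_le (rreg \<sigma> 0) (rarr \<sigma> 0 x) (rarr \<sigma> 2 x) (rarr \<sigma> 0 (eu k)) (rarr \<sigma> 2 (eu k))"
  shows "wp (Seq advance_prog relax_prog) (\<lambda>l \<tau>. \<exists>c. cu k \<le> c \<and> keep \<sigma> \<tau> \<and> cursors \<tau> (cu(k := c)) \<and>
      nreg \<tau> 8 = nreg \<sigma> 8 \<and> nreg \<tau> 9 = k \<and> rreg \<tau> 2 = rreg \<sigma> 2 \<and> final \<tau> = final \<sigma> \<and>
      inv (rreg \<sigma> 0) (final \<sigma>) (labelled \<tau>) (rarr \<tau> 0) (rarr \<tau> 2) (cu(k := c)) (insert k Q) \<and>
      (\<forall>x\<in>final \<sigma>. rarr \<tau> 0 x = rarr \<sigma> 0 x \<and> rarr \<tau> 2 x = rarr \<sigma> 2 x) \<and> l + 2 * cu k \<le> 2 * c + 10) \<sigma>"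
    (is "wp _ ?Q _")
  unfolding wp_Seq
proof (rule wp_mono[OF wp_advance[OF net k]])
  show "narr \<sigma> 3 k = off k + 3 * cu k" using cu k by (simp add: cursors_def)
  show "cu k < len k" using invD(11)[OF inv k(2) kQ] .
  fix l \<rho>
  assume "\<exists>c'\<ge>cu k. c' < len k \<and> \<rho> = set_narr 3 k (off k + 3 * c') \<sigma> \<and>
      (Suc c' < len k \<longrightarrow> rreg \<sigma> 2 < px k (Suc c')) \<and> (c' = cu k \<or> px k c' \<le> rreg \<sigma> 2) \<and>
      l + 2 * cu k \<le> 2 * c' + 1"
  then obtain c where c: "cu k \<le> c" "c < len k" "\<rho> = set_narr 3 k (off k + 3 * c) \<sigma>"
    "Suc c < len k \<longrightarrow> rreg \<sigma> 2 < px k (Suc c)" "c = cu k \<or> px k c \<le> rreg \<sigma> 2" "l + 2 * cu k \<le> 2 * c + 1"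
    by blast
  let ?t = "rreg \<sigma> 0" and ?la = "rarr \<sigma> 0" and ?lb = "rarr \<sigma> 2" and ?v = "ev k"
  define a where "a = pa k c * ?la (eu k)"
  define b where "b = pa k c * ?lb (eu k) + pb k c"
  have br: "bracket ?t ?la ?lb (cu(k := c)) k"
    using c inv_unlinked[OF inv k(2) kQ u(2) t] y by (auto simp: bracket_def)
  have net': "network \<rho>" using net c by simp
  have cur: "cursors (set_narr 3 k (off k + 3 * c) \<sigma>) (cu(k := c))"
    using cu by (auto simp: cursors_def)
  have vn: "?v < n" using ev k by simp
  show "wp relax_prog (\<lambda>l'. ?Q (l + l')) \<rho>"
  proof (rule wp_mono[OF wp_relax[OF net']])
    show "nreg \<rho> 9 = k" "k < m" "narr \<rho> 3 k = off k + 3 * c" "c < len k" using k c by simp_all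
    fix l' :: nat and \<tau>
    let ?upd = "narr \<sigma> 5 ?v < 1 \<or> narr \<sigma> 5 ?v < 2 \<and>
          (a * ?t + b < ?la ?v * ?t + ?lb ?v \<or> \<not> ?la ?v * ?t + ?lb ?v < a * ?t + b \<and> a < ?la ?v)"
    let ?\<sigma>' = "set_rreg 6 (?la ?v * ?t + ?lb ?v) (set_rreg 5 (a * ?t + b) (set_nreg 12 ?v (set_rreg 4 b (set_rreg 3 a \<rho>))))"
    assume "l' \<le> 9 \<and> \<tau> = (if narr \<rho> 5 (ev k) < 1 \<or> narr \<rho> 5 (ev k) < 2 \<and>
        (pa k c * rarr \<rho> 0 (nreg \<rho> 8) * rreg \<rho> 0 + (pa k c * rarr \<rho> 2 (nreg \<rho> 8) + pb k c)
          < rarr \<rho> 0 (ev k) * rreg \<rho> 0 + rarr \<rho> 2 (ev k) \<or>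
        \<not> rarr \<rho> 0 (ev k) * rreg \<rho> 0 + rarr \<rho> 2 (ev k)
          < pa k c * rarr \<rho> 0 (nreg \<rho> 8) * rreg \<rho> 0 + (pa k c * rarr \<rho> 2 (nreg \<rho> 8) + pb k c) \<and>
        pa k c * rarr \<rho> 0 (nreg \<rho> 8) < rarr \<rho> 0 (ev k))
      then set_rarr 2 (ev k) (pa k c * rarr \<rho> 2 (nreg \<rho> 8) + pb k c)
          (set_rarr 0 (ev k) (pa k c * rarr \<rho> 0 (nreg \<rho> 8)) (set_narr 5 (ev k) 1
            (set_rreg 6 (rarr \<rho> 0 (ev k) * rreg \<rho> 0 + rarr \<rho> 2 (ev k))
              (set_rreg 5 (pa k c * rarr \<rho> 0 (nreg \<rho> 8) * rreg \<rho> 0 + (pa k c * rarr \<rho> 2 (nreg \<rho> 8) + pb k c))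
                (set_nreg 12 (ev k) (set_rreg 4 (pa k c * rarr \<rho> 2 (nreg \<rho> 8) + pb k c)
                  (set_rreg 3 (pa k c * rarr \<rho> 0 (nreg \<rho> 8)) \<rho>)))))))
      else set_rreg 6 (rarr \<rho> 0 (ev k) * rreg \<rho> 0 + rarr \<rho> 2 (ev k))
              (set_rreg 5 (pa k c * rarr \<rho> 0 (nreg \<rho> 8) * rreg \<rho> 0 + (pa k c * rarr \<rho> 2 (nreg \<rho> 8) + pb k c))
                (set_nreg 12 (ev k) (set_rreg 4 (pa k c * rarr \<rho> 2 (nreg \<rho> 8) + pb k c)
                  (set_rreg 3 (pa k c * rarr \<rho> 0 (nreg \<rho> 8)) \<rho>)))))"
    moreover have "rarr \<rho> = rarr \<sigma>" "nreg \<rho> 8 = eu k" "rreg \<rho> = rreg \<sigma>" "narr \<rho> 5 = narr \<sigma> 5"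
      using c u by simp_all
    ultimately have l': "l' \<le> 9" and \<tau>: "\<tau> = (if ?upd
        then set_rarr 2 ?v b (set_rarr 0 ?v a (set_narr 5 ?v 1 ?\<sigma>')) else ?\<sigma>')"
      by (simp_all only: a_def b_def)
    have lt: "l + l' + 2 * cu k \<le> 2 * c + 10" using l' c by simp
    show "?Q (l + l') \<tau>"
    proof (cases ?upd)
      case False
      then have \<tau>': "\<tau> = ?\<sigma>'" using \<tau> by (simp only: if_False)
      have st: "final \<tau> = final \<sigma>" "labelled \<tau> = labelled \<sigma>"
        by (rule status_cong; simp add: \<tau>' c(3))+
      have "?v \<in> final \<sigma> \<or> (?v \<in> labelled \<sigma> \<and> germ_le ?t (?la ?v) (?lb ?v) a b)"
      proof (cases "2 \<le> narr \<sigma> 5 ?v")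
        case False
        then have "narr \<sigma> 5 ?v = 1" using \<open>\<not> ?upd\<close> by auto
        then show ?thesis using \<open>\<not> ?upd\<close> vn by (auto simp: labelled_def germ_le_def not_less)
      qed (use vn in \<open>simp add: final_def\<close>)
      then have "inv ?t (final \<sigma>) (labelled \<sigma>) ?la ?lb (cu(k := c)) (insert k Q)"
        unfolding a_def b_def by (intro inv_keep[OF inv t k(2) kQ u(2) top br])
      moreover have "keep \<sigma> \<tau>" "rarr \<tau> = rarr \<sigma>" "narr \<tau> = narr \<rho>" "nreg \<tau> 8 = nreg \<sigma> 8" "nreg \<tau> 9 = k" "rreg \<tau> 2 = rreg \<sigma> 2"
        using keep_refl[OF net] k by (simp_all add: \<tau>' c(3))
      moreover have "cursors \<tau> (cu(k := c))"
        using cur cursors_cong[of \<tau> \<rho>] \<open>narr \<tau> = narr \<rho>\<close> c(3) by simp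
      ultimately show ?thesis using c(1) lt st by (intro exI[of _ c]) simp
    next
      case True
      then have \<tau>': "\<tau> = set_rarr 2 ?v b (set_rarr 0 ?v a (set_narr 5 ?v 1 ?\<sigma>'))" using \<tau> by (simp only: if_True)
      have nf: "?v \<notin> final \<sigma>" using True by (auto simp: final_def)
      have "germ_le ?t a b (?la ?v) (?lb ?v)" if "?v \<in> labelled \<sigma>"
        using True that by (auto simp: labelled_def germ_le_def)
      then have "inv ?t (final \<sigma>) (insert ?v (labelled \<sigma>)) (?la(?v := a)) (?lb(?v := b)) (cu(k := c)) (insert k Q)"
        by (intro inv_relax[OF inv t k(2) kQ u(2) top br a_def b_def nf])
      moreover have n5: "narr \<tau> 5 = (narr \<sigma> 5)(?v := 1)" by (simp add: \<tau>' c(3))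
      have "final \<tau> = final \<sigma>" using nf by (auto simp: final_def n5)
      moreover have "labelled \<tau> = insert ?v (labelled \<sigma>)" using vn by (auto simp: labelled_def n5)
      moreover have "keep \<sigma> \<tau>" "rarr \<tau> 0 = ?la(?v := a)" "rarr \<tau> 2 = ?lb(?v := b)" "narr \<tau> 3 = narr \<rho> 3"
        "nreg \<tau> 8 = nreg \<sigma> 8" "nreg \<tau> 9 = k" "rreg \<tau> 2 = rreg \<sigma> 2"
        using keep_refl[OF net] k by (simp_all add: \<tau>' c(3))
      moreover have "cursors \<tau> (cu(k := c))"
        using cur cursors_cong[of \<tau> \<rho>] \<open>narr \<tau> 3 = narr \<rho> 3\<close> c(3) by simp
      moreover have "\<forall>x\<in>final \<sigma>. (?la(?v := a)) x = ?la x \<and> (?lb(?v := b)) x = ?lb x" using nf by auto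
      ultimately show ?thesis using c(1) lt by (intro exI[of _ c]) simp
    qed
  qed
qed

text \<open>The constant \<open>13\<close> consists of the \<open>10\<close> steps of
  \<open>wp_edge\<close> beyond the moves of the pointer and three steps for the two tests and the
  increment. During the loop, \<open>Q\<close> gains exactly those edges of the current vertex that
  have been scanned.\<close>

lemma wp_edges:
  assumes net: "network \<sigma>" and cu: "cursors \<sigma> cu" and t: "0 \<le> rreg \<sigma> 0"
    and u: "nreg \<sigma> 8 \<in> final \<sigma>" and y: "rreg \<sigma> 2 = line (rarr \<sigma> 0) (rarr \<sigma> 2) (nreg \<sigma> 8) (rreg \<sigma> 0)"
    and inv: "inv (rreg \<sigma> 0) (final \<sigma>) (labelled \<sigma>) (rarr \<sigma> 0) (rarr \<sigma> 2) cu
      {k. k < m \<and> eu k \<in> final \<sigma> \<and> eu k \<noteq> nreg \<sigma> 8}"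
    and top: "\<And>x. x \<in> final \<sigma> \<Longrightarrow>
      germ_le (rreg \<sigma> 0) (rarr \<sigma> 0 x) (rarr \<sigma> 2 x) (rarr \<sigma> 0 (nreg \<sigma> 8)) (rarr \<sigma> 2 (nreg \<sigma> 8))"
  shows "wp edges_prog (\<lambda>l \<tau>. \<exists>cu'. (\<forall>k. cu k \<le> cu' k) \<and> keep \<sigma> \<tau> \<and> cursors \<tau> cu' \<and> final \<tau> = final \<sigma> \<and>
      inv (rreg \<sigma> 0) (final \<sigma>) (labelled \<tau>) (rarr \<tau> 0) (rarr \<tau> 2) cu' {k. k < m \<and> eu k \<in> final \<sigma>} \<and>
      l + 2 * (\<Sum>k<m. cu k) \<le> 13 * m + 2 + 2 * (\<Sum>k<m. cu' k)) \<sigma>"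
  unfolding edges_prog_def wp_Seq wp_SetNReg
proof (rule wp_Loop[where \<mu> = "\<lambda>\<tau>. m - nreg \<tau> 9" and
    I = "\<lambda>l \<tau>. nreg \<tau> 9 \<le> m \<and> keep \<sigma> \<tau> \<and> nreg \<tau> 8 = nreg \<sigma> 8 \<and> rreg \<tau> 2 = rreg \<sigma> 2 \<and> final \<tau> = final \<sigma> \<and>
      (\<forall>x\<in>final \<sigma>. rarr \<tau> 0 x = rarr \<sigma> 0 x \<and> rarr \<tau> 2 x = rarr \<sigma> 2 x) \<and>
      (\<exists>cu'. (\<forall>k. cu k \<le> cu' k) \<and> cursors \<tau> cu' \<and>
        inv (rreg \<sigma> 0) (final \<sigma>) (labelled \<tau>) (rarr \<tau> 0) (rarr \<tau> 2) cu'
          {k. k < m \<and> eu k \<in> final \<sigma> \<and> (eu k \<noteq> nreg \<sigma> 8 \<or> k < nreg \<tau> 9)} \<and>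
        l + 2 * (\<Sum>k<m. cu k) \<le> 13 * nreg \<tau> 9 + 2 * (\<Sum>k<m. cu' k))"], goal_cases)
  case 1
  have st: "final (set_nreg 9 0 \<sigma>) = final \<sigma>" "labelled (set_nreg 9 0 \<sigma>) = labelled \<sigma>"
    "cursors (set_nreg 9 0 \<sigma>) cu = cursors \<sigma> cu"
    by (rule status_cong cursors_cong; simp)+
  show ?case using keep_refl[OF net] cu inv by (auto simp: st intro!: exI[of _ cu])
next
  case (2 l \<tau>)
  then obtain cu' where \<tau>: "nreg \<tau> 9 \<le> m" "keep \<sigma> \<tau>" "nreg \<tau> 8 = nreg \<sigma> 8" "rreg \<tau> 2 = rreg \<sigma> 2" "final \<tau> = final \<sigma>"
      "\<And>x. x \<in> final \<sigma> \<Longrightarrow> rarr \<tau> 0 x = rarr \<sigma> 0 x \<and> rarr \<tau> 2 x = rarr \<sigma> 2 x"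
    and cu': "\<And>k. cu k \<le> cu' k" "cursors \<tau> cu'"
      "inv (rreg \<sigma> 0) (final \<sigma>) (labelled \<tau>) (rarr \<tau> 0) (rarr \<tau> 2) cu'
          {k. k < m \<and> eu k \<in> final \<sigma> \<and> (eu k \<noteq> nreg \<sigma> 8 \<or> k < nreg \<tau> 9)}"
      "l + 2 * (\<Sum>k<m. cu k) \<le> 13 * nreg \<tau> 9 + 2 * (\<Sum>k<m. cu' k)"
    by blast
  let ?k = "nreg \<tau> 9" and ?u = "nreg \<sigma> 8"
  note net' = keep_network[OF \<tau>(2)]
  have t': "rreg \<tau> 0 = rreg \<sigma> 0" using \<tau>(2) by (simp add: keep_def)
  have k: "?k < m" using 2(2) networkD(4)[OF net'] by simp
  note eu_k = networkD(5)[OF net' k]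
  show ?case
  proof (cases "eu ?k = ?u")
    case False
    have Q: "{k. k < m \<and> eu k \<in> final \<sigma> \<and> (eu k \<noteq> ?u \<or> k < Suc ?k)} =
        {k. k < m \<and> eu k \<in> final \<sigma> \<and> (eu k \<noteq> ?u \<or> k < ?k)}" using False by (auto simp: less_Suc_eq)
    have st: "final (set_nreg 9 (Suc ?k) \<tau>) = final \<tau>" "labelled (set_nreg 9 (Suc ?k) \<tau>) = labelled \<tau>"
      "cursors (set_nreg 9 (Suc ?k) \<tau>) cu' = cursors \<tau> cu'"
      by (rule status_cong cursors_cong; simp)+
    have inv': "inv (rreg \<sigma> 0) (final \<sigma>) (labelled \<tau>) (rarr \<tau> 0) (rarr \<tau> 2) cu'
        {k. k < m \<and> eu k \<in> final \<sigma> \<and> (eu k \<noteq> ?u \<or> k < Suc ?k)}" unfolding Q by (rule cu'(3))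
    show ?thesis using False \<tau> cu'(1,2,4) inv' k
      by (auto simp: wp_simps eu_k st intro!: exI[of _ cu'])
  next
    case True
    have top': "germ_le (rreg \<tau> 0) (rarr \<tau> 0 x) (rarr \<tau> 2 x) (rarr \<tau> 0 (eu ?k)) (rarr \<tau> 2 (eu ?k))"
      if "x \<in> final \<tau>" for x
      using top[of x] that \<tau>(5) \<tau>(6)[of x] \<tau>(6)[OF u] True t' by simp
    have step: "wp (Seq advance_prog relax_prog) (\<lambda>l' \<rho>. \<exists>c. cu' ?k \<le> c \<and> keep \<tau> \<rho> \<and> cursors \<rho> (cu'(?k := c)) \<and>
      nreg \<rho> 8 = nreg \<tau> 8 \<and> nreg \<rho> 9 = ?k \<and> rreg \<rho> 2 = rreg \<tau> 2 \<and> final \<rho> = final \<tau> \<and>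
      inv (rreg \<tau> 0) (final \<tau>) (labelled \<rho>) (rarr \<rho> 0) (rarr \<rho> 2) (cu'(?k := c))
        (insert ?k {k. k < m \<and> eu k \<in> final \<sigma> \<and> (eu k \<noteq> ?u \<or> k < ?k)}) \<and>
      (\<forall>x\<in>final \<tau>. rarr \<rho> 0 x = rarr \<tau> 0 x \<and> rarr \<rho> 2 x = rarr \<tau> 2 x) \<and> l' + 2 * cu' ?k \<le> 2 * c + 10) \<tau>"
      by (rule wp_edge[OF net' refl k cu'(2)])
        (use t t' \<tau>(3-5) \<tau>(6)[OF u] u y cu'(3) True top' in auto)
    have Q: "insert ?k {k. k < m \<and> eu k \<in> final \<sigma> \<and> (eu k \<noteq> ?u \<or> k < ?k)} =
        {k. k < m \<and> eu k \<in> final \<sigma> \<and> (eu k \<noteq> ?u \<or> k < Suc ?k)}" using True u k by (auto simp: less_Suc_eq)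
    have eq: "bval (NEq (NArr 0 (NReg 9)) (NReg 8)) \<tau>" using True eu_k \<tau>(3) by simp
    show ?thesis
      unfolding wp_Seq[of "Cond _ _ _"] wp_Cond if_P[OF eq]
    proof (rule wp_mono[OF step])
      fix l' \<rho>
      assume "\<exists>c. cu' ?k \<le> c \<and> keep \<tau> \<rho> \<and> cursors \<rho> (cu'(?k := c)) \<and>
        nreg \<rho> 8 = nreg \<tau> 8 \<and> nreg \<rho> 9 = ?k \<and> rreg \<rho> 2 = rreg \<tau> 2 \<and> final \<rho> = final \<tau> \<and>
        inv (rreg \<tau> 0) (final \<tau>) (labelled \<rho>) (rarr \<rho> 0) (rarr \<rho> 2) (cu'(?k := c))
          (insert ?k {k. k < m \<and> eu k \<in> final \<sigma> \<and> (eu k \<noteq> ?u \<or> k < ?k)}) \<and>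
        (\<forall>x\<in>final \<tau>. rarr \<rho> 0 x = rarr \<tau> 0 x \<and> rarr \<rho> 2 x = rarr \<tau> 2 x) \<and> l' + 2 * cu' ?k \<le> 2 * c + 10"
      then obtain c where c: "cu' ?k \<le> c" "keep \<tau> \<rho>" "cursors \<rho> (cu'(?k := c))"
        "nreg \<rho> 8 = nreg \<tau> 8" "nreg \<rho> 9 = ?k" "rreg \<rho> 2 = rreg \<tau> 2" "final \<rho> = final \<tau>"
        "inv (rreg \<tau> 0) (final \<tau>) (labelled \<rho>) (rarr \<rho> 0) (rarr \<rho> 2) (cu'(?k := c))
          {k. k < m \<and> eu k \<in> final \<sigma> \<and> (eu k \<noteq> ?u \<or> k < Suc ?k)}"
        "\<forall>x\<in>final \<tau>. rarr \<rho> 0 x = rarr \<tau> 0 x \<and> rarr \<rho> 2 x = rarr \<tau> 2 x" "l' + 2 * cu' ?k \<le> 2 * c + 10"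
        unfolding Q by blast
      define cu2 where "cu2 = cu'(?k := c)"
      let ?\<rho> = "set_nreg 9 (Suc ?k) \<rho>"
      have st: "final ?\<rho> = final \<rho>" "labelled ?\<rho> = labelled \<rho>"
        "cursors ?\<rho> cu2 = cursors \<rho> cu2"
        by (rule status_cong cursors_cong; simp)+
      have "keep \<sigma> \<rho>" using keep_trans[OF \<tau>(2) c(2)] .
      moreover have "cu j \<le> cu2 j" for j using cu'(1)[of j] c(1) by (auto simp: cu2_def intro: order_trans)
      moreover have "Suc (l + (Suc l' + 1)) + 2 * (\<Sum>k<m. cu k) \<le> 13 * Suc ?k + 2 * (\<Sum>j<m. cu2 j)"
        using cu'(4) c(10) sum_upd_cursor[OF k, of cu' c] unfolding cu2_def by simp
      ultimately show "wp (SetNReg 9 (NAdd (NReg 9) (NLit 1)))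
          (\<lambda>l''. (\<lambda>l' \<tau>'. (nreg \<tau>' 9 \<le> m \<and> keep \<sigma> \<tau>' \<and> nreg \<tau>' 8 = ?u \<and> rreg \<tau>' 2 = rreg \<sigma> 2 \<and> final \<tau>' = final \<sigma> \<and>
            (\<forall>x\<in>final \<sigma>. rarr \<tau>' 0 x = rarr \<sigma> 0 x \<and> rarr \<tau>' 2 x = rarr \<sigma> 2 x) \<and>
            (\<exists>cu'. (\<forall>k. cu k \<le> cu' k) \<and> cursors \<tau>' cu' \<and>
              inv (rreg \<sigma> 0) (final \<sigma>) (labelled \<tau>') (rarr \<tau>' 0) (rarr \<tau>' 2) cu'
                {k. k < m \<and> eu k \<in> final \<sigma> \<and> (eu k \<noteq> ?u \<or> k < nreg \<tau>' 9)} \<and>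
              Suc (l + l') + 2 * (\<Sum>k<m. cu k) \<le> 13 * nreg \<tau>' 9 + 2 * (\<Sum>k<m. cu' k))) \<and>
            m - nreg \<tau>' 9 < m - ?k) (Suc l' + l'')) \<rho>"
        using c(2-9)[folded cu2_def] \<tau> k t' unfolding wp_SetNReg
        by (auto simp: st intro!: exI[of _ cu2])
    qed
  qed
next
  case (3 l \<tau>)
  then obtain cu' where \<tau>: "nreg \<tau> 9 \<le> m" "keep \<sigma> \<tau>" "final \<tau> = final \<sigma>"
    and cu': "\<forall>k. cu k \<le> cu' k" "cursors \<tau> cu'"
      "inv (rreg \<sigma> 0) (final \<sigma>) (labelled \<tau>) (rarr \<tau> 0) (rarr \<tau> 2) cu'
          {k. k < m \<and> eu k \<in> final \<sigma> \<and> (eu k \<noteq> nreg \<sigma> 8 \<or> k < nreg \<tau> 9)}"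
      "l + 2 * (\<Sum>k<m. cu k) \<le> 13 * nreg \<tau> 9 + 2 * (\<Sum>k<m. cu' k)"
    by blast
  have "nreg \<tau> 9 = m" using 3(2) networkD(4)[OF keep_network[OF \<tau>(2)]] \<tau>(1) by simp
  moreover have "{k. k < m \<and> eu k \<in> final \<sigma> \<and> (eu k \<noteq> nreg \<sigma> 8 \<or> k < m)} = {k. k < m \<and> eu k \<in> final \<sigma>}" by auto
  ultimately show ?case using \<tau> cu' by (intro exI[of _ cu']) simp
qed

lemma wp_clear:
  assumes net: "network \<sigma>"
  shows "wp clear_prog (\<lambda>l \<tau>. keep \<sigma> \<tau> \<and> narr \<tau> 3 = narr \<sigma> 3 \<and> (\<forall>v<n. narr \<tau> 5 v = 0) \<and> l \<le> 3 * n + 2) \<sigma>"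
  unfolding clear_prog_def wp_Seq wp_SetNReg
proof (rule wp_Loop[where \<mu> = "\<lambda>\<tau>. n - nreg \<tau> 10" and
    I = "\<lambda>l \<tau>. nreg \<tau> 10 \<le> n \<and> keep \<sigma> \<tau> \<and> narr \<tau> 3 = narr \<sigma> 3 \<and> (\<forall>v<nreg \<tau> 10. narr \<tau> 5 v = 0) \<and>
      l \<le> 3 * nreg \<tau> 10"], goal_cases)
  case 1
  then show ?case using keep_refl[OF net] by simp
next
  case (2 l \<tau>)
  then have "nreg \<tau> 10 < n" using networkD(1)[of \<tau>] by (auto simp: keep_def)
  then show ?case using 2 by (auto simp: wp_simps less_Suc_eq)
next
  case (3 l \<tau>)
  then have "nreg \<tau> 10 = n" using networkD(1)[of \<tau>] by (auto simp: keep_def)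
  then show ?case using 3 by auto
qed

lemma wp_findmin_loop:
  assumes net: "network \<sigma>" and i: "nreg \<sigma> 10 = 0" and b: "nreg \<sigma> 8 = n"
  shows "wp findmin_loop (\<lambda>l \<tau>. keep \<sigma> \<tau> \<and> rarr \<tau> = rarr \<sigma> \<and> narr \<tau> = narr \<sigma> \<and> l \<le> 8 * n + 1 \<and>
      ((nreg \<tau> 8 = n \<and> labelled \<sigma> = {}) \<or>
       (nreg \<tau> 8 \<in> labelled \<sigma> \<and> (\<forall>v\<in>labelled \<sigma>. germ_le (rreg \<sigma> 0)
          (rarr \<sigma> 0 (nreg \<tau> 8)) (rarr \<sigma> 2 (nreg \<tau> 8)) (rarr \<sigma> 0 v) (rarr \<sigma> 2 v))))) \<sigma>"
  unfolding findmin_loop_def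
proof (rule wp_Loop[where \<mu> = "\<lambda>\<tau>. n - nreg \<tau> 10" and
    I = "\<lambda>l \<tau>. nreg \<tau> 10 \<le> n \<and> keep \<sigma> \<tau> \<and> narr \<tau> = narr \<sigma> \<and> rarr \<tau> = rarr \<sigma> \<and> l \<le> 8 * nreg \<tau> 10 \<and>
      ((nreg \<tau> 8 = n \<and> (\<forall>v<nreg \<tau> 10. narr \<sigma> 5 v \<noteq> 1)) \<or>
       (nreg \<tau> 8 < n \<and> narr \<sigma> 5 (nreg \<tau> 8) = 1 \<and>
        rreg \<tau> 6 = line (rarr \<sigma> 0) (rarr \<sigma> 2) (nreg \<tau> 8) (rreg \<sigma> 0) \<and>
        (\<forall>v<nreg \<tau> 10. narr \<sigma> 5 v = 1 \<longrightarrow> germ_le (rreg \<sigma> 0)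
          (rarr \<sigma> 0 (nreg \<tau> 8)) (rarr \<sigma> 2 (nreg \<tau> 8)) (rarr \<sigma> 0 v) (rarr \<sigma> 2 v))))"], goal_cases)
  case 1
  then show ?case using keep_refl[OF net] i b by simp
next
  case (2 l \<tau>)
  let ?i = "nreg \<tau> 10" and ?b = "nreg \<tau> 8" and ?t = "rreg \<sigma> 0"
  have net': "network \<tau>" and t: "rreg \<tau> 0 = ?t" using 2 by (auto simp: keep_def)
  have n: "nreg \<tau> 3 = n" by (rule networkD(1)[OF net'])
  have i: "?i < n" using 2(2) n by simp
  consider "narr \<sigma> 5 ?i \<noteq> 1" | "narr \<sigma> 5 ?i = 1" "?b = n" | "narr \<sigma> 5 ?i = 1" "?b < n" using 2(1) by auto
  then show ?case
  proof cases
    case 1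
    then show ?thesis using 2(1) i n by (auto simp: wp_simps less_Suc_eq)
  next
    case c: 2
    then show ?thesis using 2(1) i n t
      by (auto simp: wp_simps less_Suc_eq germ_le_refl)
  next
    case 3
    then have b: "narr \<sigma> 5 ?b = 1" "rreg \<tau> 6 = line (rarr \<sigma> 0) (rarr \<sigma> 2) ?b ?t"
      "\<And>v. v < ?i \<Longrightarrow> narr \<sigma> 5 v = 1 \<Longrightarrow> germ_le ?t (rarr \<sigma> 0 ?b) (rarr \<sigma> 2 ?b) (rarr \<sigma> 0 v) (rarr \<sigma> 2 v)"
      using 2(1) by auto
    let ?lt = "line (rarr \<sigma> 0) (rarr \<sigma> 2) ?i ?t < line (rarr \<sigma> 0) (rarr \<sigma> 2) ?b ?t \<or>
      \<not> line (rarr \<sigma> 0) (rarr \<sigma> 2) ?b ?t < line (rarr \<sigma> 0) (rarr \<sigma> 2) ?i ?t \<and> rarr \<sigma> 0 ?i < rarr \<sigma> 0 ?b"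
    show ?thesis
    proof (cases ?lt)
      case True
      have "germ_le ?t (rarr \<sigma> 0 ?i) (rarr \<sigma> 2 ?i) (rarr \<sigma> 0 ?b) (rarr \<sigma> 2 ?b)"
        using True by (auto simp: germ_le_def)
      then have "germ_le ?t (rarr \<sigma> 0 ?i) (rarr \<sigma> 2 ?i) (rarr \<sigma> 0 v) (rarr \<sigma> 2 v)"
        if "v < Suc ?i" "narr \<sigma> 5 v = 1" for v
        using that b(3)[of v] germ_le_trans germ_le_refl by (cases "v = ?i") auto
      then show ?thesis using 2(1) 3 True b(2) i n t by (auto simp: wp_simps)
    next
      case False
      then have "germ_le ?t (rarr \<sigma> 0 ?b) (rarr \<sigma> 2 ?b) (rarr \<sigma> 0 ?i) (rarr \<sigma> 2 ?i)"
        by (auto simp: germ_le_def)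
      then have "germ_le ?t (rarr \<sigma> 0 ?b) (rarr \<sigma> 2 ?b) (rarr \<sigma> 0 v) (rarr \<sigma> 2 v)"
        if "v < Suc ?i" "narr \<sigma> 5 v = 1" for v
        using that b(3)[of v] by (cases "v = ?i") auto
      then show ?thesis using 2(1) 3 False b(1,2) i n t by (auto simp: wp_simps)
    qed
  qed
next
  case (3 l \<tau>)
  have "nreg \<tau> 10 = n" using 3 networkD(1)[of \<tau>] by (auto simp: keep_def)
  then show ?case using 3(1) by (auto simp: labelled_def)
qed

lemma wp_findmin:
  assumes net: "network \<sigma>"
  shows "wp findmin_prog (\<lambda>l \<tau>. keep \<sigma> \<tau> \<and> rarr \<tau> = rarr \<sigma> \<and> narr \<tau> 3 = narr \<sigma> 3 \<and> l \<le> 8 * n + 5 \<and>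
      ((nreg \<tau> 8 = n \<and> labelled \<sigma> = {} \<and> narr \<tau> 5 = narr \<sigma> 5) \<or>
       (nreg \<tau> 8 \<in> labelled \<sigma> \<and> narr \<tau> 5 = (narr \<sigma> 5)(nreg \<tau> 8 := 2) \<and>
        (\<forall>v\<in>labelled \<sigma>. germ_le (rreg \<sigma> 0)
          (rarr \<sigma> 0 (nreg \<tau> 8)) (rarr \<sigma> 2 (nreg \<tau> 8)) (rarr \<sigma> 0 v) (rarr \<sigma> 2 v))))) \<sigma>"
  unfolding findmin_prog_def wp_Seq wp_SetNReg
proof (rule wp_mono[OF wp_findmin_loop], goal_cases)
  case (4 l \<tau>)
  have lab: "labelled (set_nreg 10 (nval (NLit 0) (set_nreg 8 (nval (NReg 3) \<sigma>) \<sigma>)) (set_nreg 8 (nval (NReg 3) \<sigma>) \<sigma>)) = labelled \<sigma>"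
    by (rule status_cong) simp
  have net': "network \<tau>" using 4 by (auto simp: keep_def)
  have n: "nreg \<tau> 3 = n" by (rule networkD(1)[OF net'])
  have k: "keep \<sigma> \<tau>" using 4 net by (auto simp: keep_def)
  have "nreg \<tau> 8 < n" if "nreg \<tau> 8 \<in> labelled \<sigma>" using that by (simp add: labelled_def)
  then show ?case using 4 k n unfolding lab by (auto simp: wp_simps)
qed (use net networkD(1)[OF net] in simp_all)

lemma wp_dijkstra:
  assumes net: "network \<sigma>" and cu: "cursors \<sigma> cu" and t: "0 \<le> rreg \<sigma> 0"
    and ptr: "\<And>k. k < m \<Longrightarrow> cu k < len k \<and> ennreal (px k (cu k)) \<le> D (eu k) (rreg \<sigma> 0)"
  shows "wp dijkstra_prog (\<lambda>l \<tau>. \<exists>cu'. keep \<sigma> \<tau> \<and> cursors \<tau> cu' \<and>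
      solved (rreg \<sigma> 0) (final \<tau>) (rarr \<tau> 0) (rarr \<tau> 2) cu' \<and>
      l + 2 * (\<Sum>k<m. cu k) \<le> 13 * (n + 1) * (n + m + 1) + 2 * (\<Sum>k<m. cu' k)) \<sigma>"
  unfolding dijkstra_prog_def wp_Seq[of clear_prog]
proof (rule wp_mono[OF wp_clear[OF net]])
  fix l0 \<sigma>0
  assume \<sigma>0: "keep \<sigma> \<sigma>0 \<and> narr \<sigma>0 3 = narr \<sigma> 3 \<and> (\<forall>v<n. narr \<sigma>0 5 v = 0) \<and> l0 \<le> 3 * n + 2"
  define \<sigma>1 where "\<sigma>1 = set_nreg 8 s (set_rarr 2 s 0 (set_rarr 0 s 1 (set_narr 5 s 2 \<sigma>0)))"
  let ?t = "rreg \<sigma> 0"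
  \<comment> \<open>The cost of one vertex: \<open>13 * m + 2\<close> for its edges,
    \<open>8 * n + 5\<close> for the next minimum, and the loop test with one assignment.\<close>
  let ?T = "13 * m + 8 * n + 10"
  have s_reg: "nreg \<sigma>0 4 = s" using \<sigma>0 networkD(2) keep_network by blast
  have keep1: "keep \<sigma> \<sigma>1" using \<sigma>0 by (simp add: \<sigma>1_def)
  have cu1: "cursors \<sigma>1 cu" using cu cursors_cong[of \<sigma>1 \<sigma> cu] \<sigma>0 by (simp add: \<sigma>1_def)
  have st1: "final \<sigma>1 = {s}" "labelled \<sigma>1 = {}"
    using \<sigma>0 s by (auto simp: \<sigma>1_def final_def labelled_def)
  have inv1: "inv ?t {s} {} (rarr \<sigma>1 0) (rarr \<sigma>1 2) cu {}"
    by (rule inv_start) (use ptr in \<open>auto simp: \<sigma>1_def\<close>)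
  have empty: "{k. k < m \<and> eu k \<in> {s} \<and> eu k \<noteq> s} = {}" by auto
  have fin: "finite (final \<tau>)" "card (final \<tau>) \<le> n" for \<tau>
    using card_mono[of "{..<n}" "final \<tau>"] by (auto simp: final_def)
  \<comment> \<open>A vertex is charged after its edges have been scanned. The current vertex is
    final but not yet scanned, hence the subtraction of \<open>1\<close> in the time bound and the
    additional \<open>1\<close> in the measure.\<close>
  have "wp (Loop (NLess (NReg 8) (NReg 3)) (Seq (SetRReg 2 (line_at (NReg 8))) (Seq edges_prog findmin_prog)))
     (\<lambda>l \<tau>. \<exists>cu'. keep \<sigma> \<tau> \<and> cursors \<tau> cu' \<and> solved ?t (final \<tau>) (rarr \<tau> 0) (rarr \<tau> 2) cu' \<and>
      (l0 + (1 + (1 + (1 + (1 + l))))) + 2 * (\<Sum>k<m. cu k) \<le> 13 * (n + 1) * (n + m + 1) + 2 * (\<Sum>k<m. cu' k)) \<sigma>1"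
  proof (rule wp_Loop[where \<mu> = "\<lambda>\<tau>. (n - card (final \<tau>)) + (if nreg \<tau> 8 < n then 1 else 0)" and
    I = "\<lambda>l \<tau>. keep \<sigma> \<tau> \<and> (\<exists>cu'. cursors \<tau> cu' \<and>
      l + 2 * (\<Sum>k<m. cu k) \<le> ?T * (card (final \<tau>) - (if nreg \<tau> 8 < n then 1 else 0)) + 2 * (\<Sum>k<m. cu' k) \<and>
      ((nreg \<tau> 8 = n \<and> labelled \<tau> = {} \<and>
        inv ?t (final \<tau>) {} (rarr \<tau> 0) (rarr \<tau> 2) cu' {k. k < m \<and> eu k \<in> final \<tau>}) \<or>
       (nreg \<tau> 8 \<in> final \<tau> \<and>
        (\<forall>x\<in>final \<tau>. germ_le ?t (rarr \<tau> 0 x) (rarr \<tau> 2 x) (rarr \<tau> 0 (nreg \<tau> 8)) (rarr \<tau> 2 (nreg \<tau> 8))) \<and>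
        inv ?t (final \<tau>) (labelled \<tau>) (rarr \<tau> 0) (rarr \<tau> 2) cu'
          {k. k < m \<and> eu k \<in> final \<tau> \<and> eu k \<noteq> nreg \<tau> 8})))"], goal_cases)
    case 1
    have "nreg \<sigma>1 8 = s" by (simp add: \<sigma>1_def)
    then show ?case using keep1 cu1 inv1 s by (auto simp: st1 empty germ_le_refl intro!: exI[of _ cu])
  next
    case (2 l \<tau>)
    let ?u = "nreg \<tau> 8"
    have keep: "keep \<sigma> \<tau>" and net': "network \<tau>" and t': "rreg \<tau> 0 = ?t" using 2 by (auto simp: keep_def)
    have un: "?u < n" using 2(2) networkD(1)[OF net'] by simp
    with 2(1) obtain cu' where cu': "cursors \<tau> cu'"
      "l + 2 * (\<Sum>k<m. cu k) \<le> ?T * (card (final \<tau>) - 1) + 2 * (\<Sum>k<m. cu' k)"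
      and u: "?u \<in> final \<tau>"
      and top: "\<And>x. x \<in> final \<tau> \<Longrightarrow> germ_le ?t (rarr \<tau> 0 x) (rarr \<tau> 2 x) (rarr \<tau> 0 ?u) (rarr \<tau> 2 ?u)"
      and inv: "inv ?t (final \<tau>) (labelled \<tau>) (rarr \<tau> 0) (rarr \<tau> 2) cu' {k. k < m \<and> eu k \<in> final \<tau> \<and> eu k \<noteq> ?u}"
      by auto
    define \<rho> where "\<rho> = set_rreg 2 (line (rarr \<tau> 0) (rarr \<tau> 2) ?u ?t) \<tau>"
    have st: "final \<rho> = final \<tau>" "labelled \<rho> = labelled \<tau>" "cursors \<rho> cu' = cursors \<tau> cu'"
      by (rule status_cong cursors_cong; simp add: \<rho>_def)+
    have \<rho>: "network \<rho>" "rreg \<rho> 0 = ?t" "nreg \<rho> 8 = ?u" "rarr \<rho> = rarr \<tau>"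
      "rreg \<rho> 2 = line (rarr \<tau> 0) (rarr \<tau> 2) ?u ?t"
      using net' t' by (simp_all add: \<rho>_def)
    have edges: "wp edges_prog (\<lambda>l \<rho>'. \<exists>cu''. (\<forall>k. cu' k \<le> cu'' k) \<and> keep \<rho> \<rho>' \<and> cursors \<rho>' cu'' \<and> final \<rho>' = final \<rho> \<and>
      inv (rreg \<rho> 0) (final \<rho>) (labelled \<rho>') (rarr \<rho>' 0) (rarr \<rho>' 2) cu'' {k. k < m \<and> eu k \<in> final \<rho>} \<and>
      l + 2 * (\<Sum>k<m. cu' k) \<le> 13 * m + 2 + 2 * (\<Sum>k<m. cu'' k)) \<rho>"
      by (rule wp_edges[OF \<rho>(1)]) (use cu' u top inv t in \<open>auto simp: \<rho> st\<close>)
    have val: "rval (line_at (NReg 8)) \<tau> = line (rarr \<tau> 0) (rarr \<tau> 2) ?u ?t" using t' by simp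
    show ?case
      unfolding wp_Seq[of "SetRReg _ _"] wp_SetRReg val \<rho>_def[symmetric] wp_Seq[of edges_prog]
    proof (rule wp_mono[OF edges])
      fix l1 \<rho>'
      assume "\<exists>cu''. (\<forall>k. cu' k \<le> cu'' k) \<and> keep \<rho> \<rho>' \<and> cursors \<rho>' cu'' \<and> final \<rho>' = final \<rho> \<and>
        inv (rreg \<rho> 0) (final \<rho>) (labelled \<rho>') (rarr \<rho>' 0) (rarr \<rho>' 2) cu'' {k. k < m \<and> eu k \<in> final \<rho>} \<and>
        l1 + 2 * (\<Sum>k<m. cu' k) \<le> 13 * m + 2 + 2 * (\<Sum>k<m. cu'' k)"
      then obtain cu'' where e: "keep \<rho> \<rho>'" "cursors \<rho>' cu''" "final \<rho>' = final \<tau>"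
        "inv ?t (final \<tau>) (labelled \<rho>') (rarr \<rho>' 0) (rarr \<rho>' 2) cu'' {k. k < m \<and> eu k \<in> final \<tau>}"
        "l1 + 2 * (\<Sum>k<m. cu' k) \<le> 13 * m + 2 + 2 * (\<Sum>k<m. cu'' k)"
        unfolding \<rho> st by blast
      have keep': "keep \<sigma> \<rho>'" using keep e(1) by (simp add: \<rho>_def keep_def)
      have t'': "rreg \<rho>' 0 = ?t" using keep' by (simp add: keep_def)
      show "wp findmin_prog
        (\<lambda>l2. (\<lambda>l' \<tau>'. (keep \<sigma> \<tau>' \<and> (\<exists>cu'. cursors \<tau>' cu' \<and>
          Suc (l + l') + 2 * (\<Sum>k<m. cu k) \<le> ?T * (card (final \<tau>') - (if nreg \<tau>' 8 < n then 1 else 0)) + 2 * (\<Sum>k<m. cu' k) \<and>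
          ((nreg \<tau>' 8 = n \<and> labelled \<tau>' = {} \<and>
            inv ?t (final \<tau>') {} (rarr \<tau>' 0) (rarr \<tau>' 2) cu' {k. k < m \<and> eu k \<in> final \<tau>'}) \<or>
           (nreg \<tau>' 8 \<in> final \<tau>' \<and>
            (\<forall>x\<in>final \<tau>'. germ_le ?t (rarr \<tau>' 0 x) (rarr \<tau>' 2 x) (rarr \<tau>' 0 (nreg \<tau>' 8)) (rarr \<tau>' 2 (nreg \<tau>' 8))) \<and>
            inv ?t (final \<tau>') (labelled \<tau>') (rarr \<tau>' 0) (rarr \<tau>' 2) cu'
              {k. k < m \<and> eu k \<in> final \<tau>' \<and> eu k \<noteq> nreg \<tau>' 8})))) \<and>
          n - card (final \<tau>') + (if nreg \<tau>' 8 < n then 1 else 0) < n - card (final \<tau>) + (if ?u < n then 1 else 0))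
        (1 + (l1 + l2))) \<rho>'"
      proof (rule wp_mono[OF wp_findmin[OF keep_network[OF e(1)]]])
        fix l2 \<tau>'
        assume f: "keep \<rho>' \<tau>' \<and> rarr \<tau>' = rarr \<rho>' \<and> narr \<tau>' 3 = narr \<rho>' 3 \<and> l2 \<le> 8 * n + 5 \<and>
          ((nreg \<tau>' 8 = n \<and> labelled \<rho>' = {} \<and> narr \<tau>' 5 = narr \<rho>' 5) \<or>
           (nreg \<tau>' 8 \<in> labelled \<rho>' \<and> narr \<tau>' 5 = (narr \<rho>' 5)(nreg \<tau>' 8 := 2) \<and>
            (\<forall>v\<in>labelled \<rho>'. germ_le (rreg \<rho>' 0)
              (rarr \<rho>' 0 (nreg \<tau>' 8)) (rarr \<rho>' 2 (nreg \<tau>' 8)) (rarr \<rho>' 0 v) (rarr \<rho>' 2 v))))"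
        let ?S = "final \<tau>" and ?L = "labelled \<rho>'" and ?w = "nreg \<tau>' 8"
        have keep2: "keep \<sigma> \<tau>'" using keep_trans[OF keep'] f by blast
        have cu2: "cursors \<tau>' cu''" using e(2) f cursors_cong[of \<tau>' \<rho>'] by simp
        have c1: "1 \<le> card ?S" using u fin(1)[of \<tau>] by (metis card_0_eq empty_iff less_one not_le)
        have "?T * card ?S = ?T * (card ?S - 1) + ?T" using c1 by (cases "card ?S") auto
        then have time: "Suc (l + (1 + (l1 + l2))) + 2 * (\<Sum>k<m. cu k) \<le> ?T * card ?S + 2 * (\<Sum>k<m. cu'' k)"
          using cu'(2) e(5) f by linarith
        consider "?w = n" "?L = {}" "narr \<tau>' 5 = narr \<rho>' 5"
          | "?w \<in> ?L" "narr \<tau>' 5 = (narr \<rho>' 5)(?w := 2)"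
            "\<And>v. v \<in> ?L \<Longrightarrow> germ_le ?t (rarr \<rho>' 0 ?w) (rarr \<rho>' 2 ?w) (rarr \<rho>' 0 v) (rarr \<rho>' 2 v)"
          using f t'' by auto
        then show "(keep \<sigma> \<tau>' \<and> (\<exists>cu'. cursors \<tau>' cu' \<and>
          Suc (l + (1 + (l1 + l2))) + 2 * (\<Sum>k<m. cu k) \<le> ?T * (card (final \<tau>') - (if nreg \<tau>' 8 < n then 1 else 0)) + 2 * (\<Sum>k<m. cu' k) \<and>
          ((nreg \<tau>' 8 = n \<and> labelled \<tau>' = {} \<and>
            inv ?t (final \<tau>') {} (rarr \<tau>' 0) (rarr \<tau>' 2) cu' {k. k < m \<and> eu k \<in> final \<tau>'}) \<or>
           (nreg \<tau>' 8 \<in> final \<tau>' \<and>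
            (\<forall>x\<in>final \<tau>'. germ_le ?t (rarr \<tau>' 0 x) (rarr \<tau>' 2 x) (rarr \<tau>' 0 (nreg \<tau>' 8)) (rarr \<tau>' 2 (nreg \<tau>' 8))) \<and>
            inv ?t (final \<tau>') (labelled \<tau>') (rarr \<tau>' 0) (rarr \<tau>' 2) cu'
              {k. k < m \<and> eu k \<in> final \<tau>' \<and> eu k \<noteq> nreg \<tau>' 8})))) \<and>
          n - card (final \<tau>') + (if nreg \<tau>' 8 < n then 1 else 0) < n - card (final \<tau>) + (if ?u < n then 1 else 0)"
        proof cases
          case 1
          have "final \<tau>' = ?S" "labelled \<tau>' = {}" using status_cong[OF 1(3)] 1(2) e(3) by simp_all
          then show ?thesis using keep2 cu2 time 1(1) un e(4) f unfolding 1(2) by (auto intro!: exI[of _ cu''])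
        next
          case 2
          have wn: "?w < n" and w1: "narr \<rho>' 5 ?w = 1" using 2(1) by (auto simp: labelled_def)
          then have wS: "?w \<notin> ?S" unfolding e(3)[symmetric] by (simp add: final_def)
          have F: "final \<tau>' = insert ?w ?S" unfolding e(3)[symmetric] using wn by (auto simp: final_def 2(2))
          have L: "labelled \<tau>' = ?L - {?w}" by (auto simp: labelled_def 2(2))
          have card: "card (final \<tau>') = Suc (card ?S)" unfolding F using fin(1)[of \<tau>] wS by simp
          have inv2: "inv ?t (insert ?w ?S) (?L - {?w}) (rarr \<rho>' 0) (rarr \<rho>' 2) cu'' {k. k < m \<and> eu k \<in> ?S}"
            by (rule inv_finalise[OF e(4) 2(1,3)])
          have Q: "{k. k < m \<and> eu k \<in> insert ?w ?S \<and> eu k \<noteq> ?w} = {k. k < m \<and> eu k \<in> ?S}" using wS by auto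
          have top2: "germ_le ?t (rarr \<rho>' 0 x) (rarr \<rho>' 2 x) (rarr \<rho>' 0 ?w) (rarr \<rho>' 2 ?w)" if "x \<in> insert ?w ?S" for x
            using that invD(10)[OF e(4), of x ?w] 2(1) germ_le_refl by auto
          have "n - card (final \<tau>') + 1 < n - card ?S + 1" using fin(2)[of \<tau>'] card by simp
          moreover have "rarr \<tau>' = rarr \<rho>'" using f by simp
          ultimately show ?thesis using keep2 cu2 time wn un inv2 top2
            unfolding F L card[unfolded F] Q by (intro conjI exI[of _ cu'']) (auto simp: Q)
        qed
      qed
    qed
  next
    case (3 l \<tau>)
    have net': "network \<tau>" using 3 by (auto simp: keep_def)
    have un: "\<not> nreg \<tau> 8 < n" using 3(2) networkD(1)[OF net'] by simp
    then have "nreg \<tau> 8 \<notin> final \<tau>" by (simp add: final_def)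
    with 3(1) un obtain cu' where cu': "keep \<sigma> \<tau>" "cursors \<tau> cu'"
      "l + 2 * (\<Sum>k<m. cu k) \<le> ?T * card (final \<tau>) + 2 * (\<Sum>k<m. cu' k)"
      "inv ?t (final \<tau>) {} (rarr \<tau> 0) (rarr \<tau> 2) cu' {k. k < m \<and> eu k \<in> final \<tau>}"
      by auto
    have "?T * card (final \<tau>) \<le> ?T * n" using fin(2) by (intro mult_left_mono) auto
    moreover have "?T * n + 3 * n + 7 \<le> 13 * (n + 1) * (n + m + 1)" by (simp add: algebra_simps)
    ultimately have "l0 + (1 + (1 + (1 + (1 + Suc l)))) + 2 * (\<Sum>k<m. cu k) \<le> 13 * (n + 1) * (n + m + 1) + 2 * (\<Sum>k<m. cu' k)"
      using cu'(3) \<sigma>0 by linarith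
    then show ?case using cu' t by (auto simp: solved_def)
  qed
  then show "wp (Seq (SetNArr 5 (NReg 4) (NLit 2)) (Seq (SetRArr 0 (NReg 4) (RLit 1)) (Seq (SetRArr 2 (NReg 4) (RLit 0))
      (Seq (SetNReg 8 (NReg 4)) (Loop (NLess (NReg 8) (NReg 3)) (Seq (SetRReg 2 (line_at (NReg 8))) (Seq edges_prog findmin_prog)))))))
     (\<lambda>l \<tau>. \<exists>cu'. keep \<sigma> \<tau> \<and> cursors \<tau> cu' \<and> solved ?t (final \<tau>) (rarr \<tau> 0) (rarr \<tau> 2) cu' \<and>
      (l0 + l) + 2 * (\<Sum>k<m. cu k) \<le> 13 * (n + 1) * (n + m + 1) + 2 * (\<Sum>k<m. cu' k)) \<sigma>0"
    unfolding wp_Seq[of "SetNArr _ _ _"] wp_Seq[of "SetRArr _ _ _"] wp_Seq[of "SetNReg _ _"]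
      wp_SetNArr wp_SetRArr wp_SetNReg
    by (simp add: s_reg \<sigma>1_def)
qed

end

section \<open>Recording the pieces and searching for the next event\<close>

definition append_prog :: com where
  "append_prog =
     Cond (BOr (NEq (NReg 7) (NLit 0)) (BNot (BAnd
         (REq (RArr 0 (NReg 5)) (RArr 4 (NSub (NReg 7) (NLit 1))))
         (REq (RArr 2 (NReg 5)) (RArr 5 (NSub (NReg 7) (NLit 1)))))))
       (Seq (SetRArr 3 (NReg 7) (RReg 0))
       (Seq (SetRArr 4 (NReg 7) (RArr 0 (NReg 5)))
       (Seq (SetRArr 5 (NReg 7) (RArr 2 (NReg 5)))
         (SetNReg 7 (NAdd (NReg 7) (NLit 1))))))
       Skip"

text \<open>If \<open>d\<close> is not reached, the sweep stops without recording a piece: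
  reachability does not depend on the departure time. The piece is recorded before the next event is
  known, since its end is implied by the start of its successor.\<close>

definition sweep_body :: com where
  "sweep_body =
     Seq dijkstra_prog
       (Cond (NLess (NArr 5 (NReg 5)) (NLit 2)) (SetNReg 13 (NLit 0))
         (Seq append_prog (Seq next_prog
           (Cond (NEq (NReg 11) (NLit 0)) (SetNReg 13 (NLit 0)) (SetRReg 0 (RReg 7))))))"

definition sweep_prog :: com where
  "sweep_prog =
     Seq (SetRReg 0 (RLit 0)) (Seq (SetNReg 7 (NLit 0)) (Seq (SetNReg 13 (NLit 1))
       (Loop (NLess (NLit 0) (NReg 13)) sweep_body)))"

definition copy_loop :: com where
  "copy_loop =
     Loop (NLess (NReg 8) (NReg 7))
       (Seq (SetRMem (NReg 9) (RArr 3 (NReg 8)))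
       (Seq (SetRMem (NAdd (NReg 9) (NLit 1)) (RArr 4 (NReg 8)))
       (Seq (SetRMem (NAdd (NReg 9) (NLit 2)) (RArr 5 (NReg 8)))
       (Seq (SetNReg 9 (NAdd (NReg 9) (NLit 3)))
       (Seq (SetNReg 8 (NAdd (NReg 8) (NLit 1)))
         (SetNMem (NReg 8) (NLit 1)))))))"

definition copy_prog :: com where
  "copy_prog =
     Cond (NEq (NReg 7) (NLit 0))
       (Seq (SetNMem (NLit 0) (NLit 1)) (Seq (SetNMem (NLit 1) (NLit 0))
       (Seq (SetRMem (NLit 0) (RLit 0)) (Seq (SetRMem (NLit 1) (RLit 0)) (SetRMem (NLit 2) (RLit 0))))))
       (Seq (SetNMem (NLit 0) (NReg 7)) (Seq (SetNReg 8 (NLit 0)) (Seq (SetNReg 9 (NLit 0)) copy_loop)))"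

definition output_pieces :: "nat \<Rightarrow> (nat \<Rightarrow> real) \<Rightarrow> (nat \<Rightarrow> real) \<Rightarrow> (nat \<Rightarrow> real) \<Rightarrow> piece list" where
  "output_pieces oc ox oa ob =
     (if oc = 0 then [(0, None)] else map (\<lambda>i. (ox i, Some (oa i, ob i))) [0..<oc])"

lemma real_code_append: "real_code (ps @ qs) = real_code ps @ real_code qs"
  by (simp add: real_code_def)

lemma real_code_output:
  "length (real_code (map (\<lambda>i. (ox i, Some (oa i, ob i))) [0..<oc])) = 3 * oc \<and>
   (\<forall>j<oc. real_code (map (\<lambda>i. (ox i, Some (oa i, ob i))) [0..<oc]) ! (3 * j) = ox j \<and>
     real_code (map (\<lambda>i. (ox i, Some (oa i, ob i))) [0..<oc]) ! (3 * j + 1) = oa j \<and>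
     real_code (map (\<lambda>i. (ox i, Some (oa i, ob i))) [0..<oc]) ! (3 * j + 2) = ob j)"
proof (induction oc)
  case 0
  then show ?case by (simp add: real_code_def)
next
  case (Suc oc)
  let ?r = "real_code (map (\<lambda>i. (ox i, Some (oa i, ob i))) [0..<oc])"
  have eq: "real_code (map (\<lambda>i. (ox i, Some (oa i, ob i))) [0..<Suc oc]) = ?r @ [ox oc, oa oc, ob oc]"
    by (simp add: real_code_append) (simp add: real_code_def)
  have len: "length ?r = 3 * oc" using Suc by simp
  show ?case
    unfolding eq
  proof (intro conjI allI impI)
    fix j assume j: "j < Suc oc"
    consider "j < oc" | "j = oc" using j by linarith
    then have "(?r @ [ox oc, oa oc, ob oc]) ! (3 * j) = ox j \<and> (?r @ [ox oc, oa oc, ob oc]) ! (3 * j + 1) = oa j \<and>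
        (?r @ [ox oc, oa oc, ob oc]) ! (3 * j + 2) = ob j"
      by cases (use Suc len in \<open>auto simp: nth_append\<close>)
    then show "(?r @ [ox oc, oa oc, ob oc]) ! (3 * j) = ox j" "(?r @ [ox oc, oa oc, ob oc]) ! (3 * j + 1) = oa j"
      "(?r @ [ox oc, oa oc, ob oc]) ! (3 * j + 2) = ob j" by blast+
  qed (simp add: len)
qed

text \<open>
  The output overwrites the arrays from which it is copied, but it takes three cells per
  piece and the arrays take eight, so that no piece is overwritten before it is copied.
\<close>

lemma wp_copy_loop:
  assumes i: "nreg \<sigma> 8 = 0" "nreg \<sigma> 9 = 0" and oc: "nmem \<sigma> 0 = nreg \<sigma> 7"
  shows "wp copy_loop (\<lambda>l \<tau>. l \<le> 7 * nreg \<sigma> 7 + 1 \<and> nmem \<tau> 0 = nreg \<sigma> 7 \<and>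
      (\<forall>j<nreg \<sigma> 7. nmem \<tau> (Suc j) = 1 \<and> rmem \<tau> (3 * j) = rarr \<sigma> 3 j \<and> rmem \<tau> (3 * j + 1) = rarr \<sigma> 4 j \<and>
        rmem \<tau> (3 * j + 2) = rarr \<sigma> 5 j)) \<sigma>"
  unfolding copy_loop_def
proof (rule wp_Loop[where \<mu> = "\<lambda>\<tau>. nreg \<sigma> 7 - nreg \<tau> 8" and
    I = "\<lambda>l \<tau>. nreg \<tau> 7 = nreg \<sigma> 7 \<and> nreg \<tau> 2 = nreg \<sigma> 2 \<and> nreg \<tau> 8 \<le> nreg \<sigma> 7 \<and> nreg \<tau> 9 = 3 * nreg \<tau> 8 \<and>
      l \<le> 7 * nreg \<tau> 8 \<and> nmem \<tau> 0 = nreg \<sigma> 7 \<and>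
      (\<forall>a. nreg \<sigma> 2 + 8 * nreg \<tau> 8 \<le> a \<longrightarrow> rmem \<tau> a = rmem \<sigma> a) \<and>
      (\<forall>j<nreg \<tau> 8. nmem \<tau> (Suc j) = 1 \<and> rmem \<tau> (3 * j) = rarr \<sigma> 3 j \<and> rmem \<tau> (3 * j + 1) = rarr \<sigma> 4 j \<and>
        rmem \<tau> (3 * j + 2) = rarr \<sigma> 5 j)"], goal_cases)
  case 1
  then show ?case using i oc by simp
next
  case (2 l \<tau>)
  let ?i = "nreg \<tau> 8" and ?R = "nreg \<sigma> 2"
  have i: "?i < nreg \<sigma> 7" using 2 by simp
  have mem: "rmem \<tau> a = rmem \<sigma> a" if "?R + 8 * ?i \<le> a" for a using 2(1) that by blast
  have arr: "rmem \<tau> (?R + 8 * ?i + c) = rarr \<sigma> c ?i" if "c < 8" for c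
    using that mem[of "?R + 8 * ?i + c"] by (simp add: rarr_def)
  define \<tau>' where "\<tau>' = \<tau>\<lparr>
    rmem := (rmem \<tau>)(3 * ?i := rarr \<sigma> 3 ?i, 3 * ?i + 1 := rarr \<sigma> 4 ?i, 3 * ?i + 2 := rarr \<sigma> 5 ?i),
    nreg := (nreg \<tau>)(9 := 3 * ?i + 3, 8 := Suc ?i), nmem := (nmem \<tau>)(Suc ?i := 1)\<rparr>"
  have r: "nreg \<tau> 9 = 3 * ?i" "nreg \<tau> 2 = ?R" using 2(1) by auto
  have wp: "wp (Seq (SetRMem (NReg 9) (RArr 3 (NReg 8)))
       (Seq (SetRMem (NAdd (NReg 9) (NLit 1)) (RArr 4 (NReg 8)))
       (Seq (SetRMem (NAdd (NReg 9) (NLit 2)) (RArr 5 (NReg 8)))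
       (Seq (SetNReg 9 (NAdd (NReg 9) (NLit 3)))
       (Seq (SetNReg 8 (NAdd (NReg 8) (NLit 1)))
         (SetNMem (NReg 8) (NLit 1))))))) Q \<tau> \<longleftrightarrow> Q 6 \<tau>'" for Q
    using arr[of 3] arr[of 4] arr[of 5] r
    by (simp add: wp_Seq wp_SetRMem wp_SetNReg wp_SetNMem set_nreg_def \<tau>'_def rarr_def numeral_eq_Suc)
  have regs: "nreg \<tau>' 7 = nreg \<sigma> 7" "nreg \<tau>' 2 = ?R" "nreg \<tau>' 8 = Suc ?i" "nreg \<tau>' 9 = 3 * Suc ?i"
    "nmem \<tau>' 0 = nreg \<sigma> 7" using 2(1) by (simp_all add: \<tau>'_def)
  have keep: "rmem \<tau>' a = rmem \<sigma> a" if "?R + 8 * Suc ?i \<le> a" for a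
    using that mem[of a] by (auto simp: \<tau>'_def)
  have out: "nmem \<tau>' (Suc j) = 1 \<and> rmem \<tau>' (3 * j) = rarr \<sigma> 3 j \<and> rmem \<tau>' (3 * j + 1) = rarr \<sigma> 4 j \<and>
        rmem \<tau>' (3 * j + 2) = rarr \<sigma> 5 j" if "j < Suc ?i" for j
  proof (cases "j = ?i")
    case True
    then show ?thesis by (simp add: \<tau>'_def)
  next
    case False
    then have "j < ?i" using that by simp
    then have "nmem \<tau> (Suc j) = 1 \<and> rmem \<tau> (3 * j) = rarr \<sigma> 3 j \<and> rmem \<tau> (3 * j + 1) = rarr \<sigma> 4 j \<and>
        rmem \<tau> (3 * j + 2) = rarr \<sigma> 5 j" using 2(1) by blast
    with \<open>j < ?i\<close> show ?thesis by (simp add: \<tau>'_def)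
  qed
  show ?case unfolding wp using i keep out 2(1) by (simp only: regs) simp
next
  case (3 l \<tau>)
  then have "nreg \<tau> 8 = nreg \<sigma> 7" by simp
  then show ?case using 3(1) by auto
qed

lemma wp_copy:
  "wp copy_prog (\<lambda>l \<tau>. l \<le> 7 * nreg \<sigma> 7 + 6 \<and>
     outputs \<tau> (output_pieces (nreg \<sigma> 7) (rarr \<sigma> 3) (rarr \<sigma> 4) (rarr \<sigma> 5))) \<sigma>"
proof (cases "nreg \<sigma> 7 = 0")
  case True
  then show ?thesis
    by (simp add: copy_prog_def wp_simps wp_SetNMem wp_SetRMem outputs_def output_pieces_def nat_code_def
        real_code_def less_Suc_eq nth_Cons' numeral_3_eq_3)
next
  case False
  let ?oc = "nreg \<sigma> 7" and ?ox = "rarr \<sigma> 3" and ?oa = "rarr \<sigma> 4" and ?ob = "rarr \<sigma> 5"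
  let ?ps = "map (\<lambda>i. (?ox i, Some (?oa i, ?ob i))) [0..<?oc]"
  define \<rho> where "\<rho> = set_nreg 9 0 (set_nreg 8 0 (\<sigma>\<lparr>nmem := (nmem \<sigma>)(0 := ?oc)\<rparr>))"
  have \<rho>: "nreg \<rho> 8 = 0" "nreg \<rho> 9 = 0" "nmem \<rho> 0 = nreg \<rho> 7" "nreg \<rho> 7 = ?oc" "rarr \<rho> = rarr \<sigma>"
    by (simp_all add: \<rho>_def) (simp add: fun_eq_iff rarr_def set_nreg_def)
  have out: "outputs \<tau> ?ps"
    if \<tau>: "nmem \<tau> 0 = ?oc" "\<forall>j<?oc. nmem \<tau> (Suc j) = 1 \<and> rmem \<tau> (3 * j) = ?ox j \<and> rmem \<tau> (3 * j + 1) = ?oa j \<and>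
        rmem \<tau> (3 * j + 2) = ?ob j" for \<tau>
    unfolding outputs_def
  proof (intro conjI allI impI)
    fix i assume "i < length (nat_code ?ps)"
    then show "nmem \<tau> i = nat_code ?ps ! i" using \<tau> by (cases i) (auto simp: nat_code_def)
  next
    fix i assume "i < length (real_code ?ps)"
    then have "i < 3 * ?oc" using real_code_output[of ?ox ?oa ?ob ?oc] by simp
    then have "i div 3 < ?oc \<and> (i = 3 * (i div 3) \<or> i = 3 * (i div 3) + 1 \<or> i = 3 * (i div 3) + 2)"
      by linarith
    then obtain q where q: "q < ?oc" "i = 3 * q \<or> i = 3 * q + 1 \<or> i = 3 * q + 2" by blast
    have t: "rmem \<tau> (3 * q) = ?ox q" "rmem \<tau> (3 * q + 1) = ?oa q" "rmem \<tau> (3 * q + 2) = ?ob q"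
      using \<tau>(2) q(1) by blast+
    have r: "real_code ?ps ! (3 * q) = ?ox q" "real_code ?ps ! (3 * q + 1) = ?oa q"
      "real_code ?ps ! (3 * q + 2) = ?ob q"
      using real_code_output[of ?ox ?oa ?ob ?oc] q(1) by blast+
    show "rmem \<tau> i = real_code ?ps ! i"
      using q(2) by (elim disjE) (simp_all only: t r)
  qed
  have "wp copy_loop (\<lambda>l \<tau>. 4 + l \<le> 7 * ?oc + 6 \<and> outputs \<tau> ?ps) \<rho>"
    by (rule wp_mono[OF wp_copy_loop[OF \<rho>(1-3)]]) (use out in \<open>simp add: \<rho>(4,5)\<close>)
  then show ?thesis using False
    unfolding copy_prog_def wp_Cond wp_Seq wp_SetNMem wp_SetNReg
    by (simp add: output_pieces_def \<rho>_def)
qed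

context ram_network
begin

definition piece_ev :: "(nat \<Rightarrow> real) \<Rightarrow> (nat \<Rightarrow> real) \<Rightarrow> (nat \<Rightarrow> nat) \<Rightarrow> nat \<Rightarrow> real set" where
  "piece_ev la lb cu k = (if Suc (cu k) < len k \<and> 0 < la (eu k)
     then {(px k (Suc (cu k)) - lb (eu k)) / la (eu k)} else {})"

definition cross_ev :: "(nat \<Rightarrow> real) \<Rightarrow> (nat \<Rightarrow> real) \<Rightarrow> (nat \<Rightarrow> nat) \<Rightarrow> nat \<Rightarrow> real set" where
  "cross_ev la lb cu k = (if cand_a la cu k < la (ev k)
     then {(cand_b lb cu k - lb (ev k)) / (la (ev k) - cand_a la cu k)} else {})"

definition events_upto ::
  "nat set \<Rightarrow> (nat \<Rightarrow> real) \<Rightarrow> (nat \<Rightarrow> real) \<Rightarrow> (nat \<Rightarrow> nat) \<Rightarrow> nat \<Rightarrow> real set" where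
  "events_upto S la lb cu j = (\<Union>k\<in>{k. k < j \<and> eu k \<in> S}. piece_ev la lb cu k \<union> cross_ev la lb cu k)"

lemma events_upto_m: "events_upto S la lb cu m = events S la lb cu"
proof (intro set_eqI iffI)
  fix x assume "x \<in> events_upto S la lb cu m"
  then show "x \<in> events S la lb cu"
    by (auto simp: events_upto_def events_def piece_ev_def cross_ev_def split: if_splits)
next
  fix x assume "x \<in> events S la lb cu"
  then consider k where "k < m" "eu k \<in> S" "x \<in> piece_ev la lb cu k" | k where "k < m" "eu k \<in> S" "x \<in> cross_ev la lb cu k"
    by (auto simp: events_def piece_ev_def cross_ev_def)
  then show "x \<in> events_upto S la lb cu m" by cases (auto simp: events_upto_def)
qed

lemma events_upto_Suc:
  "events_upto S la lb cu (Suc j) = (if eu j \<in> S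
     then events_upto S la lb cu j \<union> piece_ev la lb cu j \<union> cross_ev la lb cu j else events_upto S la lb cu j)"
proof -
  have "{k. k < Suc j \<and> eu k \<in> S} = (if eu j \<in> S then insert j {k. k < j \<and> eu k \<in> S} else {k. k < j \<and> eu k \<in> S})"
    by (auto simp: less_Suc_eq)
  then show ?thesis by (auto simp: events_upto_def)
qed

definition min_ev :: "ram_state \<Rightarrow> real set \<Rightarrow> bool" where
  "min_ev \<sigma> E \<longleftrightarrow> (nreg \<sigma> 11 = 0 \<and> E = {}) \<or>
     (nreg \<sigma> 11 = 1 \<and> rreg \<sigma> 7 \<in> E \<and> (\<forall>y\<in>E. rreg \<sigma> 7 \<le> y))"

definition same_arrays :: "ram_state \<Rightarrow> ram_state \<Rightarrow> bool" where
  "same_arrays \<rho> \<sigma> \<longleftrightarrow> keep \<rho> \<sigma> \<and> narr \<sigma> = narr \<rho> \<and> rarr \<sigma> = rarr \<rho> \<and> nreg \<sigma> 8 = nreg \<rho> 8 \<and>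
     nreg \<sigma> 9 = nreg \<rho> 9 \<and> nreg \<sigma> 12 = nreg \<rho> 12"

lemma same_arrays_trans: "same_arrays \<rho> \<sigma> \<Longrightarrow> same_arrays \<sigma> \<tau> \<Longrightarrow> same_arrays \<rho> \<tau>"
  by (auto simp: same_arrays_def keep_def)

lemma wp_update:
  assumes net: "network \<sigma>" and E: "min_ev \<sigma> E"
  shows "wp update_prog (\<lambda>l \<tau>. l \<le> 3 \<and> same_arrays \<sigma> \<tau> \<and> min_ev \<tau> (insert (rreg \<sigma> 8) E)) \<sigma>"
  using E keep_refl[OF net] unfolding update_prog_def
  by (auto simp: wp_simps same_arrays_def min_ev_def not_less intro: order_trans less_imp_le)

lemma wp_piece_event:
  assumes net: "network \<sigma>" and k: "nreg \<sigma> 9 = k" "k < m" and c: "narr \<sigma> 3 k = off k + 3 * cu k"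
    and u: "nreg \<sigma> 8 = eu k" and E: "min_ev \<sigma> E"
  shows "wp piece_event_prog (\<lambda>l \<tau>. l \<le> 5 \<and> same_arrays \<sigma> \<tau> \<and>
      min_ev \<tau> (E \<union> piece_ev (rarr \<sigma> 0) (rarr \<sigma> 2) cu k)) \<sigma>"
proof -
  have b: "bval (BAnd (NLess (NAdd (NArr 3 (NReg 9)) (NLit 3)) (NArr 4 (NReg 9)))
      (RLess (RLit 0) (RArr 0 (NReg 8)))) \<sigma> \<longleftrightarrow> Suc (cu k) < len k \<and> 0 < rarr \<sigma> 0 (eu k)"
    using c u k networkD(7)[OF net k(2)] by auto
  show ?thesis
  proof (cases "Suc (cu k) < len k \<and> 0 < rarr \<sigma> 0 (eu k)")
    case True
    let ?x = "(px k (Suc (cu k)) - rarr \<sigma> 2 (eu k)) / rarr \<sigma> 0 (eu k)"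
    have x: "rval (RDiv (RSub (cur_mem 3) (RArr 2 (NReg 8))) (RArr 0 (NReg 8))) \<sigma> = ?x"
      using c u k networkD(10)[OF net k(2)] True by simp
    have net': "network (set_rreg 8 ?x \<sigma>)" and E': "min_ev (set_rreg 8 ?x \<sigma>) E" using net E by (simp_all add: min_ev_def)
    have eq: "E \<union> piece_ev (rarr \<sigma> 0) (rarr \<sigma> 2) cu k = insert ?x E" using True by (simp add: piece_ev_def)
    show ?thesis
      unfolding piece_event_prog_def wp_Cond b if_P[OF True] wp_Seq wp_SetRReg x eq
      by (rule wp_mono[OF wp_update[OF net' E']]) (auto simp: same_arrays_def keep_def)
  next
    case False
    then have "piece_ev (rarr \<sigma> 0) (rarr \<sigma> 2) cu k = {}" by (auto simp: piece_ev_def)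
    then show ?thesis
      unfolding piece_event_prog_def wp_Cond b if_not_P[OF False] wp_Skip
      using E keep_refl[OF net] by (simp add: same_arrays_def)
  qed
qed

lemma wp_cross_event:
  assumes net: "network \<sigma>" and k: "nreg \<sigma> 9 = k" "k < m" and c: "narr \<sigma> 3 k = off k + 3 * cu k" "cu k < len k"
    and u: "nreg \<sigma> 8 = eu k" "nreg \<sigma> 12 = ev k" and E: "min_ev \<sigma> E"
  shows "wp cross_event_prog (\<lambda>l \<tau>. l \<le> 7 \<and> same_arrays \<sigma> \<tau> \<and>
      min_ev \<tau> (E \<union> cross_ev (rarr \<sigma> 0) (rarr \<sigma> 2) cu k)) \<sigma>"
proof -
  let ?a = "cand_a (rarr \<sigma> 0) cu k" and ?b = "cand_b (rarr \<sigma> 2) cu k"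
  define \<rho> where "\<rho> = set_rreg 4 ?b (set_rreg 3 ?a \<sigma>)"
  have a: "rval (RMul (cur_mem 1) (RArr 0 (NReg 8))) \<sigma> = ?a"
    "rval (RAdd (RMul (cur_mem 1) (RArr 2 (NReg 8))) (cur_mem 2)) (set_rreg 3 ?a \<sigma>) = ?b"
    using c u k networkD(8,9)[OF net k(2) c(2)] by simp_all
  have b: "bval (RLess (RReg 3) (RArr 0 (NReg 12))) \<rho> \<longleftrightarrow> ?a < rarr \<sigma> 0 (ev k)"
    using u by (simp add: \<rho>_def)
  have \<rho>: "network \<rho>" "min_ev \<rho> E" "same_arrays \<sigma> \<rho>"
    using net E keep_refl[OF net] by (simp_all add: \<rho>_def min_ev_def same_arrays_def)
  show ?thesis
  proof (cases "?a < rarr \<sigma> 0 (ev k)")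
    case True
    let ?x = "(?b - rarr \<sigma> 2 (ev k)) / (rarr \<sigma> 0 (ev k) - ?a)"
    have x: "rval (RDiv (RSub (RReg 4) (RArr 2 (NReg 12))) (RSub (RArr 0 (NReg 12)) (RReg 3))) \<rho> = ?x"
      using u by (simp add: \<rho>_def)
    have net': "network (set_rreg 8 ?x \<rho>)" and E': "min_ev (set_rreg 8 ?x \<rho>) E" using \<rho> by (simp_all add: min_ev_def)
    have eq: "E \<union> cross_ev (rarr \<sigma> 0) (rarr \<sigma> 2) cu k = insert ?x E" using True by (simp add: cross_ev_def)
    show ?thesis
      unfolding cross_event_prog_def wp_Seq wp_SetRReg a \<rho>_def[symmetric] wp_Cond b if_P[OF True] x eq
      by (rule wp_mono[OF wp_update[OF net' E']]) (use \<rho>(3) in \<open>auto simp: same_arrays_def keep_def\<close>)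
  next
    case False
    then have "cross_ev (rarr \<sigma> 0) (rarr \<sigma> 2) cu k = {}" by (auto simp: cross_ev_def)
    then show ?thesis
      unfolding cross_event_prog_def wp_Seq wp_SetRReg a \<rho>_def[symmetric] wp_Cond b if_not_P[OF False] wp_Skip
      using \<rho> by simp
  qed
qed

lemma wp_next:
  assumes net: "network \<sigma>" and cu: "cursors \<sigma> cu" and len: "\<And>k. k < m \<Longrightarrow> cu k < len k"
  shows "wp next_prog (\<lambda>l \<tau>. keep \<sigma> \<tau> \<and> narr \<tau> = narr \<sigma> \<and> rarr \<tau> = rarr \<sigma> \<and>
      min_ev \<tau> (events (final \<sigma>) (rarr \<sigma> 0) (rarr \<sigma> 2) cu) \<and> l \<le> 17 * m + 3) \<sigma>"
  unfolding next_prog_def wp_Seq[of "SetNReg 11 _"] wp_Seq[of "SetNReg 9 (NLit 0)"] wp_SetNReg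
proof (rule wp_Loop[where \<mu> = "\<lambda>\<tau>. m - nreg \<tau> 9" and
    I = "\<lambda>l \<tau>. keep \<sigma> \<tau> \<and> narr \<tau> = narr \<sigma> \<and> rarr \<tau> = rarr \<sigma> \<and> nreg \<tau> 9 \<le> m \<and> l \<le> 17 * nreg \<tau> 9 \<and>
      min_ev \<tau> (events_upto (final \<sigma>) (rarr \<sigma> 0) (rarr \<sigma> 2) cu (nreg \<tau> 9))"], goal_cases)
  case 1
  then show ?case using keep_refl[OF net] by (simp add: min_ev_def events_upto_def)
next
  case (2 l \<tau>)
  let ?k = "nreg \<tau> 9" and ?la = "rarr \<sigma> 0" and ?lb = "rarr \<sigma> 2"
  let ?E = "events_upto (final \<sigma>) ?la ?lb cu"
  have \<tau>: "keep \<sigma> \<tau>" "narr \<tau> = narr \<sigma>" "rarr \<tau> = rarr \<sigma>" "l \<le> 17 * ?k" "min_ev \<tau> (?E ?k)" using 2 by auto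
  have net': "network \<tau>" using \<tau>(1) by (rule keep_network)
  have k: "?k < m" using 2 networkD(4)[OF net'] by simp
  define \<rho> where "\<rho> = set_nreg 12 (ev ?k) (set_nreg 8 (eu ?k) \<tau>)"
  have regs: "nval (NArr 0 (NReg 9)) \<tau> = eu ?k" "nval (NArr 2 (NReg 9)) (set_nreg 8 (eu ?k) \<tau>) = ev ?k"
    using networkD(5,6)[OF net' k] by simp_all
  have \<rho>: "network \<rho>" "nreg \<rho> 9 = ?k" "narr \<rho> 3 ?k = off ?k + 3 * cu ?k" "nreg \<rho> 8 = eu ?k" "nreg \<rho> 12 = ev ?k"
    "min_ev \<rho> (?E ?k)" "rarr \<rho> = rarr \<sigma>" "narr \<rho> = narr \<sigma>" "keep \<sigma> \<rho>"
    using net' \<tau> cu k by (simp_all add: \<rho>_def cursors_def min_ev_def)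
  have b: "bval (NLess (NLit 1) (NArr 5 (NReg 8))) \<rho> \<longleftrightarrow> eu ?k \<in> final \<sigma>"
    using \<rho>(4,8) eu[OF k] by (auto simp: final_def)
  have step: "wp (Cond (NLess (NLit 1) (NArr 5 (NReg 8))) (Seq piece_event_prog cross_event_prog) Skip)
      (\<lambda>l' \<tau>'. l' \<le> 13 \<and> same_arrays \<rho> \<tau>' \<and> min_ev \<tau>' (?E (Suc ?k))) \<rho>"
  proof (cases "eu ?k \<in> final \<sigma>")
    case False
    then show ?thesis
      unfolding wp_Cond b if_not_P[OF False] wp_Skip events_upto_Suc using \<rho> keep_refl[OF \<rho>(1)]
      by (simp add: same_arrays_def)
  next
    case True
    show ?thesis
      unfolding wp_Cond b if_P[OF True] wp_Seq
    proof (rule wp_mono[OF wp_piece_event[where cu = cu, OF \<rho>(1,2) k \<rho>(3,4,6)]])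
      fix l1 :: nat and \<rho>1
      assume 1: "l1 \<le> 5 \<and> same_arrays \<rho> \<rho>1 \<and> min_ev \<rho>1 (?E ?k \<union> piece_ev (rarr \<rho> 0) (rarr \<rho> 2) cu ?k)"
      then have s1: "network \<rho>1" "nreg \<rho>1 9 = ?k" "narr \<rho>1 3 ?k = off ?k + 3 * cu ?k" "nreg \<rho>1 8 = eu ?k"
        "nreg \<rho>1 12 = ev ?k" "rarr \<rho>1 = rarr \<sigma>"
        using \<rho> by (auto simp: same_arrays_def keep_def)
      have e1: "min_ev \<rho>1 (?E ?k \<union> piece_ev ?la ?lb cu ?k)" using 1 \<rho>(7) by simp
      show "wp cross_event_prog (\<lambda>l2 \<tau>'. Suc (l1 + l2) \<le> 13 \<and> same_arrays \<rho> \<tau>' \<and> min_ev \<tau>' (?E (Suc ?k))) \<rho>1"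
        by (rule wp_mono[OF wp_cross_event[where cu = cu, OF s1(1,2) k s1(3) len[OF k] s1(4,5) e1]])
          (use 1 s1(6) True same_arrays_trans[of \<rho> \<rho>1] in \<open>auto simp: events_upto_Suc\<close>)
    qed
  qed
  show ?case
    unfolding wp_Seq[of "SetNReg 8 _"] wp_Seq[of "SetNReg 12 _"] wp_Seq[of "Cond _ _ _"] wp_SetNReg regs \<rho>_def[symmetric]
  proof (rule wp_mono[OF step])
    fix l' :: nat and \<tau>'
    assume "l' \<le> 13 \<and> same_arrays \<rho> \<tau>' \<and> min_ev \<tau>' (?E (Suc ?k))"
    then have f: "l' \<le> 13" "keep \<rho> \<tau>'" "narr \<tau>' = narr \<sigma>" "rarr \<tau>' = rarr \<sigma>" "nreg \<tau>' 9 = ?k" "min_ev \<tau>' (?E (Suc ?k))"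
      using \<rho>(2,7,8) by (simp_all add: same_arrays_def)
    have "keep \<sigma> \<tau>'" by (rule keep_trans[OF \<rho>(9) f(2)])
    then show "(keep \<sigma> (set_nreg 9 (nval (NAdd (NReg 9) (NLit 1)) \<tau>') \<tau>') \<and>
        narr (set_nreg 9 (nval (NAdd (NReg 9) (NLit 1)) \<tau>') \<tau>') = narr \<sigma> \<and>
        rarr (set_nreg 9 (nval (NAdd (NReg 9) (NLit 1)) \<tau>') \<tau>') = rarr \<sigma> \<and>
        nreg (set_nreg 9 (nval (NAdd (NReg 9) (NLit 1)) \<tau>') \<tau>') 9 \<le> m \<and>
        Suc (l + (1 + (1 + (l' + 1)))) \<le> 17 * nreg (set_nreg 9 (nval (NAdd (NReg 9) (NLit 1)) \<tau>') \<tau>') 9 \<and>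
        min_ev (set_nreg 9 (nval (NAdd (NReg 9) (NLit 1)) \<tau>') \<tau>')
          (?E (nreg (set_nreg 9 (nval (NAdd (NReg 9) (NLit 1)) \<tau>') \<tau>') 9))) \<and>
        m - nreg (set_nreg 9 (nval (NAdd (NReg 9) (NLit 1)) \<tau>') \<tau>') 9 < m - ?k"
      using f k \<tau>(4) by (simp add: min_ev_def)
  qed
next
  case (3 l \<tau>)
  then have "nreg \<tau> 9 = m" using networkD(4)[of \<tau>] by (auto simp: keep_def)
  then show ?case using 3(1) by (simp add: events_upto_m)
qed

text \<open>The set \<open>X\<close> consists of the times covered so far. It may contain negative
  times, about which nothing is claimed because the first piece starts at \<open>0\<close>.\<close>

definition represents ::
  "nat \<Rightarrow> (nat \<Rightarrow> real) \<Rightarrow> (nat \<Rightarrow> real) \<Rightarrow> (nat \<Rightarrow> real) \<Rightarrow> real set \<Rightarrow> bool" where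
  "represents oc ox oa ob X \<longleftrightarrow> 0 < oc \<and> ox 0 = 0 \<and>
     (\<forall>i. Suc i < oc \<longrightarrow> ox i < ox (Suc i) \<and> (oa i \<noteq> oa (Suc i) \<or> ob i \<noteq> ob (Suc i))) \<and>
     (\<forall>i<oc. \<forall>x\<in>X. ox i \<le> x \<longrightarrow> (Suc i < oc \<longrightarrow> x < ox (Suc i)) \<longrightarrow>
        D d x = ennreal (oa i * x + ob i) \<and> 0 \<le> oa i * x + ob i)"

text \<open>The strict inequality for the last start keeps the starts strictly increasing when a
  piece is added at \<open>t\<close>. Nothing has been recorded only at the very beginning.\<close>

definition represents_before ::
  "nat \<Rightarrow> (nat \<Rightarrow> real) \<Rightarrow> (nat \<Rightarrow> real) \<Rightarrow> (nat \<Rightarrow> real) \<Rightarrow> real \<Rightarrow> bool" where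
  "represents_before oc ox oa ob t \<longleftrightarrow> (oc = 0 \<and> t = 0) \<or>
     (represents oc ox oa ob {..<t} \<and> ox (oc - 1) < t \<and> 0 < t)"

lemma represents_last:
  assumes "represents oc ox oa ob X" "j \<le> oc - 1"
  shows "ox j \<le> ox (oc - 1)"
  using assms(2)
proof (induction rule: inc_induct)
  case (step i)
  have "ox i < ox (Suc i)" using assms(1) step.hyps by (simp add: represents_def)
  with step.IH show ?case by simp
qed simp

text \<open>Many events do not concern \<open>d\<close>. If its line is unchanged, the last piece is
  prolonged; otherwise a new one starts at \<open>t\<close>. Thus neighbouring pieces differ, as
  \<open>pl_representation\<close> demands.\<close>

lemma represents_extend:
  assumes rep: "represents_before oc ox oa ob t" and X: "{..<t} \<subseteq> X"
    and ab: "\<And>x. x \<in> X \<Longrightarrow> t \<le> x \<Longrightarrow> D d x = ennreal (a * x + b) \<and> 0 \<le> a * x + b"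
  shows "0 < oc \<Longrightarrow> oa (oc - 1) = a \<Longrightarrow> ob (oc - 1) = b \<Longrightarrow> represents oc ox oa ob X"
    and "oc = 0 \<or> oa (oc - 1) \<noteq> a \<or> ob (oc - 1) \<noteq> b \<Longrightarrow>
      represents (Suc oc) (ox(oc := t)) (oa(oc := a)) (ob(oc := b)) X"
proof -
  {
    assume oc: "0 < oc" "oa (oc - 1) = a" "ob (oc - 1) = b"
    then have r: "represents oc ox oa ob {..<t}" using rep by (auto simp: represents_before_def)
    have "D d x = ennreal (oa i * x + ob i) \<and> 0 \<le> oa i * x + ob i"
      if i: "i < oc" and x: "x \<in> X" "ox i \<le> x" "Suc i < oc \<longrightarrow> x < ox (Suc i)" for i x
    proof (cases "x < t")
      case True
      then show ?thesis using r i x by (auto simp: represents_def)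
    next
      case False
      have last: "ox (oc - 1) < t" using rep oc by (auto simp: represents_before_def)
      have "\<not> Suc i < oc"
      proof
        assume "Suc i < oc"
        have "x < ox (Suc i)" using x(3) \<open>Suc i < oc\<close> by simp
        also have "\<dots> \<le> ox (oc - 1)" using \<open>Suc i < oc\<close> by (intro represents_last[OF r]) simp
        finally have "x < ox (oc - 1)" .
        with last False show False by simp
      qed
      then have "i = oc - 1" using i by simp
      then show ?thesis using ab[OF x(1)] False oc by auto
    qed
    then show "represents oc ox oa ob X" using r by (auto simp: represents_def)
  }
  {
    assume new: "oc = 0 \<or> oa (oc - 1) \<noteq> a \<or> ob (oc - 1) \<noteq> b"
    show "represents (Suc oc) (ox(oc := t)) (oa(oc := a)) (ob(oc := b)) X"
    proof (cases "oc = 0")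
      case True
      then show ?thesis using rep ab by (auto simp: represents_before_def represents_def)
    next
      case False
      then have r: "represents oc ox oa ob {..<t}" "ox (oc - 1) < t" using rep by (auto simp: represents_before_def)
      have adj: "(ox(oc := t)) i < (ox(oc := t)) (Suc i) \<and>
          ((oa(oc := a)) i \<noteq> (oa(oc := a)) (Suc i) \<or> (ob(oc := b)) i \<noteq> (ob(oc := b)) (Suc i))"
        if "Suc i < Suc oc" for i
      proof (cases "Suc i = oc")
        case True
        then have "i = oc - 1" by simp
        then show ?thesis using True r new by auto
      next
        case False
        then show ?thesis using r(1) that by (auto simp: represents_def)
      qed
      have val: "D d x = ennreal ((oa(oc := a)) i * x + (ob(oc := b)) i) \<and> 0 \<le> (oa(oc := a)) i * x + (ob(oc := b)) i"
        if i: "i < Suc oc" and x: "x \<in> X" "(ox(oc := t)) i \<le> x" "Suc i < Suc oc \<longrightarrow> x < (ox(oc := t)) (Suc i)" for i x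
      proof (cases "i = oc")
        case True
        then show ?thesis using ab x by auto
      next
        case False
        then have io: "i < oc" using i by simp
        have "x < t"
        proof (cases "Suc i = oc")
          case True
          then show ?thesis using x(3) io by auto
        next
          case False
          have "x < ox (Suc i)" using x(3) io False by auto
          also have "\<dots> \<le> ox (oc - 1)" using False io by (intro represents_last[OF r(1)]) auto
          also have "\<dots> < t" by (rule r(2))
          finally show ?thesis .
        qed
        then show ?thesis using r(1) io x False by (auto simp: represents_def split: if_splits)
      qed
      show ?thesis unfolding represents_def using r(1) False adj val by (auto simp: represents_def)
    qed
  }
qed

lemma wp_append:
  assumes net: "network \<sigma>" and rep: "represents_before (nreg \<sigma> 7) (rarr \<sigma> 3) (rarr \<sigma> 4) (rarr \<sigma> 5) (rreg \<sigma> 0)"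
    and X: "{..<rreg \<sigma> 0} \<subseteq> X"
    and ab: "\<And>x. x \<in> X \<Longrightarrow> rreg \<sigma> 0 \<le> x \<Longrightarrow> D d x = ennreal (line (rarr \<sigma> 0) (rarr \<sigma> 2) d x) \<and> 0 \<le> line (rarr \<sigma> 0) (rarr \<sigma> 2) d x"
  shows "wp append_prog (\<lambda>l \<tau>. l \<le> 5 \<and> network \<tau> \<and> rreg \<tau> = rreg \<sigma> \<and> nreg \<tau> 13 = nreg \<sigma> 13 \<and> narr \<tau> = narr \<sigma> \<and>
      rarr \<tau> 0 = rarr \<sigma> 0 \<and> rarr \<tau> 2 = rarr \<sigma> 2 \<and> nreg \<tau> 7 \<le> nreg \<sigma> 7 + 1 \<and>
      represents (nreg \<tau> 7) (rarr \<tau> 3) (rarr \<tau> 4) (rarr \<tau> 5) X \<and> rarr \<tau> 3 (nreg \<tau> 7 - 1) \<le> rreg \<sigma> 0) \<sigma>"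
proof -
  let ?oc = "nreg \<sigma> 7" and ?a = "rarr \<sigma> 0 d" and ?b = "rarr \<sigma> 2 d"
  have r5: "nreg \<sigma> 5 = d" by (rule networkD(3)[OF net])
  let ?new = "?oc = 0 \<or> rarr \<sigma> 4 (?oc - 1) \<noteq> ?a \<or> rarr \<sigma> 5 (?oc - 1) \<noteq> ?b"
  have b: "bval (BOr (NEq (NReg 7) (NLit 0)) (BNot (BAnd
         (REq (RArr 0 (NReg 5)) (RArr 4 (NSub (NReg 7) (NLit 1))))
         (REq (RArr 2 (NReg 5)) (RArr 5 (NSub (NReg 7) (NLit 1))))))) \<sigma> \<longleftrightarrow> ?new"
    by (auto simp: r5)
  show ?thesis
  proof (cases ?new)
    case True
    have "represents (Suc ?oc) ((rarr \<sigma> 3)(?oc := rreg \<sigma> 0)) ((rarr \<sigma> 4)(?oc := ?a)) ((rarr \<sigma> 5)(?oc := ?b)) X"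
      by (rule represents_extend(2)[OF rep X ab True])
    then show ?thesis
      unfolding append_prog_def wp_Cond b if_P[OF True] using net
      by (simp add: wp_simps r5)
  next
    case False
    then have oc: "0 < ?oc" "rarr \<sigma> 4 (?oc - 1) = ?a" "rarr \<sigma> 5 (?oc - 1) = ?b" by auto
    have "represents ?oc (rarr \<sigma> 3) (rarr \<sigma> 4) (rarr \<sigma> 5) X"
      by (rule represents_extend(1)[OF rep X ab oc])
    moreover have "rarr \<sigma> 3 (?oc - 1) \<le> rreg \<sigma> 0" using rep oc by (auto simp: represents_before_def)
    ultimately show ?thesis
      unfolding append_prog_def wp_Cond b if_not_P[OF False] wp_Skip using net by simp
  qed
qed

text \<open>Every round but the last moves to a new positive critical time by
  \<open>next_event_critical\<close>, so there are at most \<open>card (critical BP) + 1\<close>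
  rounds. The moves of the pointers are bounded separately, over the whole sweep, by
  \<open>2 * (\<Sum>k<m. len k - 1)\<close>.\<close>

lemma wp_sweep:
  fixes BP :: "nat \<Rightarrow> real set"
  assumes net: "network \<sigma>" and cu0: "cursors \<sigma> (\<lambda>_. 0)"
    and BP: "\<And>v. v < n \<Longrightarrow> finite (BP v)"
      "\<And>v. v < n \<Longrightarrow> D v 0 < \<infinity> \<Longrightarrow> affine_off (BP v) (\<lambda>\<tau>. enn2real (D v \<tau>))"
    and finD: "\<And>v \<tau>. v < n \<Longrightarrow> 0 \<le> \<tau> \<Longrightarrow> D v 0 < \<infinity> \<Longrightarrow> D v \<tau> < \<infinity>"
  shows "wp sweep_prog (\<lambda>l \<tau>.
      ((nreg \<tau> 7 = 0 \<and> (\<forall>x\<ge>0. D d x = \<infinity>)) \<or> represents (nreg \<tau> 7) (rarr \<tau> 3) (rarr \<tau> 4) (rarr \<tau> 5) UNIV) \<and>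
      nreg \<tau> 7 \<le> card (critical BP) + 1 \<and>
      l \<le> (13 * (n + 1) * (n + m + 1) + 17 * m + 15) * (card (critical BP) + 1) + 2 * (\<Sum>k<m. len k - 1) + 4) \<sigma>"
proof -
  define Z where "Z = critical BP"
  have Z: "finite Z" using BP(1) by (auto simp: Z_def critical_def)
  define crit where "crit t = card {z \<in> Z. 0 < z \<and> z \<le> t}" for t
  define T where "T = 13 * (n + 1) * (n + m + 1) + 17 * m + 15"
  define rep where "rep \<tau> X \<longleftrightarrow> represents (nreg \<tau> 7) (rarr \<tau> 3) (rarr \<tau> 4) (rarr \<tau> 5) X"
    for \<tau> :: ram_state and X
  define result where "result \<tau> \<longleftrightarrow> (nreg \<tau> 7 = 0 \<and> (\<forall>x\<ge>0. D d x = \<infinity>)) \<or> rep \<tau> UNIV" for \<tau>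
  define \<Phi> where "\<Phi> cu = (\<Sum>k<m. cu k)" for cu :: "nat \<Rightarrow> nat"
  \<comment> \<open>While the sweep runs, the completed rounds are charged to the critical times in
    \<open>{0<..t}\<close>. The round in which it stops reaches no new critical time and accounts
    for the \<open>+ 1\<close> in the second case.\<close>
  define I where "I l \<tau> \<longleftrightarrow> network \<tau> \<and> 0 \<le> rreg \<tau> 0 \<and> (\<exists>cu. cursors \<tau> cu \<and> (\<forall>k<m. cu k < len k) \<and>
    ((nreg \<tau> 13 = 1 \<and> (\<forall>k<m. ennreal (px k (cu k)) \<le> D (eu k) (rreg \<tau> 0)) \<and> nreg \<tau> 7 \<le> crit (rreg \<tau> 0) \<and>
       represents_before (nreg \<tau> 7) (rarr \<tau> 3) (rarr \<tau> 4) (rarr \<tau> 5) (rreg \<tau> 0) \<and>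
       l \<le> T * crit (rreg \<tau> 0) + 2 * \<Phi> cu) \<or>
     (nreg \<tau> 13 = 0 \<and> nreg \<tau> 7 \<le> crit (rreg \<tau> 0) + 1 \<and> result \<tau> \<and>
       l \<le> T * (crit (rreg \<tau> 0) + 1) + 2 * \<Phi> cu)))" for l \<tau>
  define \<mu> where "\<mu> \<tau> = (if nreg \<tau> 13 = 0 then 0 else 1 + card {z \<in> Z. rreg \<tau> 0 < z})"
    for \<tau> :: ram_state
  define \<sigma>1 where "\<sigma>1 = set_nreg 13 1 (set_nreg 7 0 (set_rreg 0 0 \<sigma>))"
  have "I 0 \<sigma>1"
    unfolding I_def
  proof (intro conjI exI[of _ "\<lambda>_. 0"] disjI1)
    show "cursors \<sigma>1 (\<lambda>_. 0)" using cu0 cursors_cong[of \<sigma>1 \<sigma>] by (simp add: \<sigma>1_def)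
  qed (use net len px0 in \<open>auto simp: \<sigma>1_def represents_before_def\<close>)
  moreover have "wp sweep_body (\<lambda>l' \<tau>'. I (Suc (l + l')) \<tau>' \<and> \<mu> \<tau>' < \<mu> \<tau>) \<tau>"
    if I: "I l \<tau>" and go: "bval (NLess (NLit 0) (NReg 13)) \<tau>" for l \<tau>
  proof -
    let ?t = "rreg \<tau> 0" and ?oc = "nreg \<tau> 7"
    obtain cu where net: "network \<tau>" and t: "0 \<le> ?t" and cu: "cursors \<tau> cu" "\<And>k. k < m \<Longrightarrow> cu k < len k"
        "\<And>k. k < m \<Longrightarrow> ennreal (px k (cu k)) \<le> D (eu k) ?t"
      and go1: "nreg \<tau> 13 = 1" and oc: "?oc \<le> crit ?t"
      and before: "represents_before ?oc (rarr \<tau> 3) (rarr \<tau> 4) (rarr \<tau> 5) ?t"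
      and l: "l \<le> T * crit ?t + 2 * \<Phi> cu"
      using I go unfolding I_def by auto
    show ?thesis
      unfolding sweep_body_def wp_Seq[of dijkstra_prog]
    proof (rule wp_mono[OF wp_dijkstra[OF net cu(1) t]])
      show "cu k < len k \<and> ennreal (px k (cu k)) \<le> D (eu k) ?t" if "k < m" for k using cu(2,3) that by simp
      fix l1 :: nat and \<rho>
      assume "\<exists>cu'. keep \<tau> \<rho> \<and> cursors \<rho> cu' \<and> solved ?t (final \<rho>) (rarr \<rho> 0) (rarr \<rho> 2) cu' \<and>
        l1 + 2 * (\<Sum>k<m. cu k) \<le> 13 * (n + 1) * (n + m + 1) + 2 * (\<Sum>k<m. cu' k)"
      then obtain cu' where \<rho>: "keep \<tau> \<rho>" "cursors \<rho> cu'"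
        and sol: "solved ?t (final \<rho>) (rarr \<rho> 0) (rarr \<rho> 2) cu'"
        and l1: "l1 + 2 * \<Phi> cu \<le> 13 * (n + 1) * (n + m + 1) + 2 * \<Phi> cu'"
        unfolding \<Phi>_def by blast
      let ?S = "final \<rho>" and ?la = "rarr \<rho> 0" and ?lb = "rarr \<rho> 2"
      let ?E = "events ?S ?la ?lb cu'"
      have net\<rho>: "network \<rho>" using \<rho>(1) by (rule keep_network)
      have regs: "rreg \<rho> 0 = ?t" "nreg \<rho> 7 = ?oc" "nreg \<rho> 13 = 1" "rarr \<rho> 3 = rarr \<tau> 3" "rarr \<rho> 4 = rarr \<tau> 4"
        "rarr \<rho> 5 = rarr \<tau> 5" using \<rho>(1) go1 by (simp_all add: keep_def)
      have len': "cu' k < len k" if "k < m" for k using solved_pointers[OF sol order_refl that] by simp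
      have b: "bval (NLess (NArr 5 (NReg 5)) (NLit 2)) \<rho> \<longleftrightarrow> d \<notin> ?S"
        using networkD(3)[OF net\<rho>] d by (auto simp: final_def)
      show "wp (Cond (NLess (NArr 5 (NReg 5)) (NLit 2)) (SetNReg 13 (NLit 0))
          (Seq append_prog (Seq next_prog (Cond (NEq (NReg 11) (NLit 0)) (SetNReg 13 (NLit 0)) (SetRReg 0 (RReg 7))))))
        (\<lambda>l2 \<tau>'. I (Suc (l + (l1 + l2))) \<tau>' \<and> \<mu> \<tau>' < \<mu> \<tau>) \<rho>"
      proof (cases "d \<in> ?S")
        case False
        have inf: "D d ?t = \<infinity>" by (rule solved_now(2)[OF sol False])
        have "\<not> D d 0 < \<infinity>" using finD[OF d t] inf by auto
        then have "D d 0 = \<infinity>" by (simp add: not_less top_unique)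
        then have all: "D d x = \<infinity>" if "0 \<le> x" for x using D_mono[OF order_refl that, of d] by (simp add: top_unique)
        have "?oc = 0"
        proof (rule ccontr)
          assume "?oc \<noteq> 0"
          then have r: "represents ?oc (rarr \<tau> 3) (rarr \<tau> 4) (rarr \<tau> 5) {..<?t}" "0 < ?t"
            using before by (auto simp: represents_before_def)
          then have "D d 0 = ennreal (rarr \<tau> 4 0 * 0 + rarr \<tau> 5 0)"
            unfolding represents_def by (metis (no_types, lifting) lessThan_iff order_refl)
          with \<open>D d 0 = \<infinity>\<close> show False by simp
        qed
        have "I (Suc (l + (l1 + Suc 1))) (set_nreg 13 0 \<rho>)"
          unfolding I_def
        proof (intro conjI exI[of _ cu'] disjI2)
          show "cursors (set_nreg 13 0 \<rho>) cu'" using \<rho>(2) cursors_cong[of "set_nreg 13 0 \<rho>" \<rho>] by simp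
          show "result (set_nreg 13 0 \<rho>)" using all \<open>?oc = 0\<close> regs by (simp add: result_def)
          show "Suc (l + (l1 + Suc 1)) \<le> T * (crit (rreg (set_nreg 13 0 \<rho>) 0) + 1) + 2 * \<Phi> cu'"
            using l l1 regs by (simp add: T_def algebra_simps)
        qed (use net\<rho> t regs len' \<open>?oc = 0\<close> in auto)
        then show ?thesis using False unfolding wp_Cond b wp_SetNReg by (simp add: \<mu>_def go1)
      next
        case True
        \<comment> \<open>All times before the next event; this set is everything if there is no
          event.\<close>
        define X where "X = {x. \<forall>y\<in>?E. x < y}"
        have after: "?t < y" if "y \<in> ?E" for y by (rule events_after[OF sol that])
        have X: "{..<rreg \<rho> 0} \<subseteq> X" using after by (auto simp: X_def regs intro: less_trans)
        have ab: "D d x = ennreal (line ?la ?lb d x) \<and> 0 \<le> line ?la ?lb d x" if x: "x \<in> X" "rreg \<rho> 0 \<le> x" for x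
        proof -
          have tx: "?t \<le> x" using x regs by simp
          have lt: "x < y" if "y \<in> ?E" for y using x(1) that by (simp add: X_def)
          show ?thesis
            using solved_exact(1)[OF sol tx lt True] solved_exact(2)[OF sol tx lt True] t tx by auto
        qed
        have before\<rho>: "represents_before (nreg \<rho> 7) (rarr \<rho> 3) (rarr \<rho> 4) (rarr \<rho> 5) (rreg \<rho> 0)"
          using before regs by simp
        have nb: "\<not> d \<notin> ?S" using True by simp
        show ?thesis
          unfolding wp_Cond[of "NLess (NArr 5 (NReg 5)) (NLit 2)"] b if_not_P[OF nb] wp_Seq
        proof (rule wp_mono[OF wp_append[OF net\<rho> before\<rho> X ab]])
          fix l2 :: nat and \<rho>2
          assume "l2 \<le> 5 \<and> network \<rho>2 \<and> rreg \<rho>2 = rreg \<rho> \<and> nreg \<rho>2 13 = nreg \<rho> 13 \<and> narr \<rho>2 = narr \<rho> \<and>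
            rarr \<rho>2 0 = ?la \<and> rarr \<rho>2 2 = ?lb \<and> nreg \<rho>2 7 \<le> nreg \<rho> 7 + 1 \<and>
            represents (nreg \<rho>2 7) (rarr \<rho>2 3) (rarr \<rho>2 4) (rarr \<rho>2 5) X \<and> rarr \<rho>2 3 (nreg \<rho>2 7 - 1) \<le> rreg \<rho> 0"
          then have l2: "l2 \<le> 5" and net2: "network \<rho>2"
            and r2: "rreg \<rho>2 0 = ?t" "nreg \<rho>2 13 = 1" "narr \<rho>2 = narr \<rho>" "rarr \<rho>2 0 = ?la" "rarr \<rho>2 2 = ?lb"
              "nreg \<rho>2 7 \<le> ?oc + 1" "rarr \<rho>2 3 (nreg \<rho>2 7 - 1) \<le> ?t"
            and rep2: "represents (nreg \<rho>2 7) (rarr \<rho>2 3) (rarr \<rho>2 4) (rarr \<rho>2 5) X"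
            using regs by simp_all
          have cu2: "cursors \<rho>2 cu'" using \<rho>(2) cursors_cong[of \<rho>2 \<rho>] r2(3) by simp
          have fin2: "final \<rho>2 = ?S" by (rule status_cong) (simp add: r2)
          show "wp next_prog (\<lambda>l3. wp (Cond (NEq (NReg 11) (NLit 0)) (SetNReg 13 (NLit 0)) (SetRReg 0 (RReg 7)))
              (\<lambda>l4 \<tau>'. I (Suc (l + (l1 + Suc (l2 + (l3 + l4))))) \<tau>' \<and> \<mu> \<tau>' < \<mu> \<tau>)) \<rho>2"
          proof (rule wp_mono[OF wp_next[OF net2 cu2 len']])
            fix l3 :: nat and \<rho>3
            assume "keep \<rho>2 \<rho>3 \<and> narr \<rho>3 = narr \<rho>2 \<and> rarr \<rho>3 = rarr \<rho>2 \<and>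
              min_ev \<rho>3 (events (final \<rho>2) (rarr \<rho>2 0) (rarr \<rho>2 2) cu') \<and> l3 \<le> 17 * m + 3"
            then have net3: "network \<rho>3" and r3: "rreg \<rho>3 0 = ?t" "nreg \<rho>3 13 = 1" "nreg \<rho>3 7 = nreg \<rho>2 7"
              "narr \<rho>3 = narr \<rho>2" "rarr \<rho>3 = rarr \<rho>2" and min: "min_ev \<rho>3 ?E" and l3: "l3 \<le> 17 * m + 3"
              using r2 fin2 by (auto simp: keep_def)
            have cu3: "cursors \<rho>3 cu'" using cu2 cursors_cong[of \<rho>3 \<rho>2] r3(4) by simp
            let ?time = "Suc (l + (l1 + Suc (l2 + (l3 + Suc 1))))"
            have time: "?time \<le> T * (crit ?t + 1) + 2 * \<Phi> cu'"
              using l l1 l2 l3 by (simp add: T_def algebra_simps)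
            show "wp (Cond (NEq (NReg 11) (NLit 0)) (SetNReg 13 (NLit 0)) (SetRReg 0 (RReg 7)))
              (\<lambda>l4 \<tau>'. I (Suc (l + (l1 + Suc (l2 + (l3 + l4))))) \<tau>' \<and> \<mu> \<tau>' < \<mu> \<tau>) \<rho>3"
            proof (cases "nreg \<rho>3 11 = 0")
              case none: True
              then have "?E = {}" using min by (auto simp: min_ev_def)
              then have XU: "X = UNIV" by (simp add: X_def)
              have "I ?time (set_nreg 13 0 \<rho>3)"
                unfolding I_def
              proof (intro conjI exI[of _ cu'] disjI2)
                show "cursors (set_nreg 13 0 \<rho>3) cu'" using cu3 cursors_cong[of "set_nreg 13 0 \<rho>3" \<rho>3] by simp
                show "result (set_nreg 13 0 \<rho>3)" using rep2 r3 unfolding result_def rep_def XU by simp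
              qed (use net3 t r3 r2 oc len' time in auto)
              then show ?thesis using none unfolding wp_Cond wp_SetNReg by (simp add: \<mu>_def go1)
            next
              case False
              let ?x = "rreg \<rho>3 7"
              have x: "?x \<in> ?E" "\<And>y. y \<in> ?E \<Longrightarrow> ?x \<le> y" using min False by (auto simp: min_ev_def)
              have tx: "?t < ?x" by (rule after[OF x(1)])
              have xZ: "?x \<in> Z" unfolding Z_def by (rule next_event_critical[OF sol x BP finD])
              have XU: "X = {..<?x}" using x by (auto simp: X_def intro: less_le_trans)
              have "{z \<in> Z. 0 < z \<and> z \<le> ?t} \<subseteq> {z \<in> Z. 0 < z \<and> z \<le> ?x}" using tx by auto
              moreover have "?x \<in> {z \<in> Z. 0 < z \<and> z \<le> ?x}" "?x \<notin> {z \<in> Z. 0 < z \<and> z \<le> ?t}"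
                using xZ tx t by auto
              ultimately have "{z \<in> Z. 0 < z \<and> z \<le> ?t} \<subset> {z \<in> Z. 0 < z \<and> z \<le> ?x}" by blast
              then have crit: "crit ?t < crit ?x" unfolding crit_def by (intro psubset_card_mono) (use Z in auto)
              have "{z \<in> Z. ?x < z} \<subseteq> {z \<in> Z. ?t < z}" using tx by auto
              moreover have "?x \<in> {z \<in> Z. ?t < z}" "?x \<notin> {z \<in> Z. ?x < z}" using xZ tx by auto
              ultimately have "{z \<in> Z. ?x < z} \<subset> {z \<in> Z. ?t < z}" by blast
              then have mu: "card {z \<in> Z. ?x < z} < card {z \<in> Z. ?t < z}" by (intro psubset_card_mono) (use Z in auto)
              have "I ?time (set_rreg 0 ?x \<rho>3)"
                unfolding I_def
              proof (intro conjI exI[of _ cu'] disjI1)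
                show "cursors (set_rreg 0 ?x \<rho>3) cu'" using cu3 cursors_cong[of "set_rreg 0 ?x \<rho>3" \<rho>3] by simp
                show "\<forall>k<m. ennreal (px k (cu' k)) \<le> D (eu k) (rreg (set_rreg 0 ?x \<rho>3) 0)"
                  using solved_pointers[OF sol less_imp_le[OF tx]] by simp
                show "represents_before (nreg (set_rreg 0 ?x \<rho>3) 7) (rarr (set_rreg 0 ?x \<rho>3) 3)
                    (rarr (set_rreg 0 ?x \<rho>3) 4) (rarr (set_rreg 0 ?x \<rho>3) 5) (rreg (set_rreg 0 ?x \<rho>3) 0)"
                  using rep2 r3 r2(7) tx t unfolding XU by (simp add: represents_before_def)
                have "T * (crit ?t + 1) \<le> T * crit ?x" using crit by (intro mult_left_mono) auto
                then show "?time \<le> T * crit (rreg (set_rreg 0 ?x \<rho>3) 0) + 2 * \<Phi> cu'" using time by simp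
              qed (use net3 t tx r3 r2 oc crit len' in auto)
              then show ?thesis using False mu r3 unfolding wp_Cond wp_SetRReg by (simp add: \<mu>_def go1)
            qed
          qed
        qed
      qed
    qed
  qed
  moreover have "result \<tau> \<and> nreg \<tau> 7 \<le> card Z + 1 \<and> Suc l + 3 \<le> T * (card Z + 1) + 2 * (\<Sum>k<m. len k - 1) + 4"
    if I: "I l \<tau>" and stop: "\<not> bval (NLess (NLit 0) (NReg 13)) \<tau>" for l \<tau>
  proof -
    obtain cu where cu: "\<And>k. k < m \<Longrightarrow> cu k < len k" and "nreg \<tau> 7 \<le> crit (rreg \<tau> 0) + 1" "result \<tau>"
      and l: "l \<le> T * (crit (rreg \<tau> 0) + 1) + 2 * \<Phi> cu"
      using I stop unfolding I_def by auto
    moreover have crit: "crit (rreg \<tau> 0) \<le> card Z" unfolding crit_def by (intro card_mono Z) auto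
    moreover have "\<Phi> cu \<le> (\<Sum>k<m. len k - 1)" unfolding \<Phi>_def by (intro sum_mono) (use cu in force)
    moreover have "T * (crit (rreg \<tau> 0) + 1) \<le> T * (card Z + 1)" using crit by (intro mult_left_mono) auto
    ultimately show ?thesis by linarith
  qed
  ultimately have "wp (Loop (NLess (NLit 0) (NReg 13)) sweep_body)
    (\<lambda>l \<tau>. result \<tau> \<and> nreg \<tau> 7 \<le> card Z + 1 \<and> l + 3 \<le> T * (card Z + 1) + 2 * (\<Sum>k<m. len k - 1) + 4) \<sigma>1"
    by (intro wp_Loop[where I = I and \<mu> = \<mu>]) auto
  then show ?thesis
    unfolding sweep_prog_def wp_Seq wp_SetRReg wp_SetNReg
    by (simp add: \<sigma>1_def result_def rep_def Z_def T_def add.commute)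
qed

end

section \<open>Reading the input\<close>

text \<open>Repeated addition replaces multiplication, which the machine lacks for natural
  numbers.\<close>

definition square_prog :: com where
  "square_prog =
     Seq (SetNReg 10 (NLit 0)) (Seq (SetNReg 9 (NLit 0))
    (Loop (NLess (NReg 10) (NReg 3))
      (Seq (SetNReg 9 (NAdd (NReg 9) (NReg 3))) (SetNReg 10 (NAdd (NReg 10) (NLit 1))))))"

text \<open>A first pass over the matrix only measures the input. The two end addresses become the
  bases of the arrays, so that no array cell overlaps the input.\<close>

definition size_prog :: com where
  "size_prog =
     Seq (SetNReg 8 (NLit 3)) (Seq (SetNReg 11 (NLit 0))
    (Loop (NLess (NLit 0) (NReg 9))
      (Seq (SetNReg 12 (NMem (NReg 8)))
      (Seq (SetNReg 11 (NAdd (NReg 11) (NAdd (NReg 12) (NAdd (NReg 12) (NReg 12)))))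
      (Seq (SetNReg 8 (NAdd (NReg 8) (NAdd (NLit 1) (NReg 12))))
        (SetNReg 9 (NSub (NReg 9) (NLit 1))))))))"

definition store_prog :: com where
  "store_prog =
     Seq (SetNArr 0 (NReg 6) (NReg 9)) (Seq (SetNArr 2 (NReg 6) (NReg 10))
    (Seq (SetNArr 3 (NReg 6) (NReg 11))
    (Seq (SetNArr 4 (NReg 6) (NAdd (NReg 11) (NAdd (NReg 12) (NAdd (NReg 12) (NReg 12)))))
      (SetNReg 6 (NAdd (NReg 6) (NLit 1))))))"

text \<open>Row and column are advanced with a carry in a single loop, because the machine has no
  division. The test looks at the cell after the length, which tells whether the first piece is
  linear; all other entries are not traversable and yield no edge.\<close>

definition compile_prog :: com where
  "compile_prog =
     Seq (SetNReg 8 (NLit 3)) (Seq (SetNReg 11 (NLit 0)) (Seq (SetNReg 6 (NLit 0))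
    (Seq (SetNReg 9 (NLit 0)) (Seq (SetNReg 10 (NLit 0))
    (Loop (NLess (NReg 9) (NReg 3))
      (Seq (SetNReg 12 (NMem (NReg 8)))
      (Seq (Cond (BAnd (NLess (NLit 0) (NReg 12)) (NLess (NLit 0) (NMem (NAdd (NReg 8) (NLit 1))))) store_prog Skip)
      (Seq (SetNReg 11 (NAdd (NReg 11) (NAdd (NReg 12) (NAdd (NReg 12) (NReg 12)))))
      (Seq (SetNReg 8 (NAdd (NReg 8) (NAdd (NLit 1) (NReg 12))))
      (Seq (SetNReg 10 (NAdd (NReg 10) (NLit 1)))
      (Cond (NLess (NReg 10) (NReg 3)) Skip
        (Seq (SetNReg 10 (NLit 0)) (SetNReg 9 (NAdd (NReg 9) (NLit 1)))))))))))))))"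

definition parse_prog :: com where
  "parse_prog =
     Seq (SetNReg 3 (NMem (NLit 0))) (Seq (SetNReg 4 (NMem (NLit 1))) (Seq (SetNReg 5 (NMem (NLit 2)))
    (Seq square_prog (Seq size_prog (Seq (SetNReg 0 (NReg 8)) (Seq (SetNReg 2 (NReg 11)) compile_prog))))))"

text \<open>The default \<open>0\<close> agrees with the padding of infinite pieces in
  \<open>real_code\<close>.\<close>

definition slope :: "piece \<Rightarrow> real" where
  "slope p = (case snd p of None \<Rightarrow> 0 | Some (a, b) \<Rightarrow> a)"

definition intercept :: "piece \<Rightarrow> real" where
  "intercept p = (case snd p of None \<Rightarrow> 0 | Some (a, b) \<Rightarrow> b)"

lemma real_code_Cons: "real_code (p # ps) = [fst p, slope p, intercept p] @ real_code ps"
  by (cases p) (auto simp: real_code_def slope_def intercept_def split: option.splits)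

lemma length_real_code: "length (real_code ps) = 3 * length ps"
  by (induction ps) (simp_all add: real_code_Cons, simp add: real_code_def)

lemma nth_real_code:
  assumes "i < length ps"
  shows "real_code ps ! (3 * i) = fst (ps ! i) \<and> real_code ps ! (3 * i + 1) = slope (ps ! i) \<and>
    real_code ps ! (3 * i + 2) = intercept (ps ! i)"
  using assms
proof (induction ps arbitrary: i)
  case (Cons p ps)
  show ?case
  proof (cases i)
    case (Suc j)
    have "3 * i = 3 + 3 * j" "3 * i + 1 = 3 + (3 * j + 1)" "3 * i + 2 = 3 + (3 * j + 2)" using Suc by simp_all
    then show ?thesis using Cons.IH[of j] Cons.prems Suc by (simp add: real_code_Cons nth_append)
  qed (simp add: real_code_Cons)
qed simp

lemma nth_concat:
  assumes "q < length xss" "i < length (xss ! q)"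
  shows "length (concat (take q xss)) + i < length (concat xss) \<and>
    concat xss ! (length (concat (take q xss)) + i) = xss ! q ! i"
proof -
  have "concat xss = concat (take q xss @ xss ! q # drop (Suc q) xss)"
    using id_take_nth_drop[OF assms(1)] by simp
  then have "concat xss = concat (take q xss) @ xss ! q @ concat (drop (Suc q) xss)" by simp
  then show ?thesis using assms(2) by (simp add: nth_append)
qed

definition nat_offset :: "piece list list \<Rightarrow> nat \<Rightarrow> nat" where
  "nat_offset es q = 3 + length (concat (map nat_code (take q es)))"

definition real_offset :: "piece list list \<Rightarrow> nat \<Rightarrow> nat" where
  "real_offset es q = length (concat (map real_code (take q es)))"

lemma offset_Suc:
  assumes "q < length es"
  shows "nat_offset es (Suc q) = nat_offset es q + Suc (length (es ! q))"
    "real_offset es (Suc q) = real_offset es q + 3 * length (es ! q)"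
  using assms by (simp_all add: nat_offset_def real_offset_def take_Suc_conv_app_nth nat_code_def length_real_code)

lemma offset_0: "nat_offset es 0 = 3" "real_offset es 0 = 0"
  by (simp_all add: nat_offset_def real_offset_def)

lemma offset_mono:
  assumes "q \<le> q'"
  shows "nat_offset es q \<le> nat_offset es q'" "real_offset es q \<le> real_offset es q'"
proof -
  have "take q' es = take q es @ take (q' - q) (drop q es)"
    using assms by (metis le_add_diff_inverse take_add)
  then show "nat_offset es q \<le> nat_offset es q'" "real_offset es q \<le> real_offset es q'"
    by (simp_all add: nat_offset_def real_offset_def)
qed

text \<open>For continuous arrival functions the first piece decides about all of them, as
  \<open>pl_usable_or_top\<close> shows, so a single cell has to be tested.\<close>

definition usable :: "piece list \<Rightarrow> bool" where
  "usable ps \<longleftrightarrow> ps \<noteq> [] \<and> snd (hd ps) \<noteq> None"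

definition usable_entries :: "piece list list \<Rightarrow> nat \<Rightarrow> nat list" where
  "usable_entries es q = filter (\<lambda>q. usable (es ! q)) [0..<q]"

lemma nmem_input:
  assumes "q < length es"
  shows "memory_of ([n, s, d] @ concat (map nat_code es)) (nat_offset es q) = length (es ! q)"
    "es ! q \<noteq> [] \<Longrightarrow> 0 < memory_of ([n, s, d] @ concat (map nat_code es)) (Suc (nat_offset es q)) \<longleftrightarrow> usable (es ! q)"
proof -
  have q: "q < length (map nat_code es)" using assms by simp
  have 0: "0 < length (map nat_code es ! q)" using assms by (simp add: nat_code_def)
  from nth_concat[OF q 0] assms
  show "memory_of ([n, s, d] @ concat (map nat_code es)) (nat_offset es q) = length (es ! q)"
    by (simp add: memory_of_def nat_offset_def take_map nat_code_def)
  assume ne: "es ! q \<noteq> []"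
  then have 1: "1 < length (map nat_code es ! q)" using assms by (simp add: nat_code_def)
  have "memory_of ([n, s, d] @ concat (map nat_code es)) (Suc (nat_offset es q)) = nat_code (es ! q) ! 1"
    using nth_concat[OF q 1] assms by (simp add: memory_of_def nat_offset_def take_map)
  then show "0 < memory_of ([n, s, d] @ concat (map nat_code es)) (Suc (nat_offset es q)) \<longleftrightarrow> usable (es ! q)"
    using ne by (cases "es ! q") (auto simp: nat_code_def usable_def split: option.splits)
qed

lemma rmem_input:
  assumes "q < length es" "i < length (es ! q)"
  shows "memory_of (concat (map real_code es)) (real_offset es q + 3 * i) = fst (es ! q ! i)"
    "memory_of (concat (map real_code es)) (real_offset es q + 3 * i + 1) = slope (es ! q ! i)"
    "memory_of (concat (map real_code es)) (real_offset es q + 3 * i + 2) = intercept (es ! q ! i)"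
proof -
  have mem: "memory_of (concat (map real_code es)) (real_offset es q + j) = real_code (es ! q) ! j"
    if "j < 3 * length (es ! q)" for j
    using nth_concat[of q "map real_code es" j] assms(1) that
    by (simp add: memory_of_def real_offset_def take_map length_real_code)
  show "memory_of (concat (map real_code es)) (real_offset es q + 3 * i) = fst (es ! q ! i)"
    "memory_of (concat (map real_code es)) (real_offset es q + 3 * i + 1) = slope (es ! q ! i)"
    "memory_of (concat (map real_code es)) (real_offset es q + 3 * i + 2) = intercept (es ! q ! i)"
    using mem[of "3 * i"] mem[of "3 * i + 1"] mem[of "3 * i + 2"] nth_real_code[OF assms(2)] assms(2)
    by (simp_all only: add.assoc)
qed

lemma nmem_set_narr: "a < nreg \<sigma> 0 \<Longrightarrow> nmem (set_narr j i v \<sigma>) a = nmem \<sigma> a"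
  by (simp add: set_narr_def)

lemma wp_square:
  "wp square_prog (\<lambda>l \<tau>. nreg \<tau> 9 = nreg \<sigma> 3 * nreg \<sigma> 3 \<and> (\<forall>r<6. nreg \<tau> r = nreg \<sigma> r) \<and>
     nmem \<tau> = nmem \<sigma> \<and> rmem \<tau> = rmem \<sigma> \<and> l \<le> 3 * nreg \<sigma> 3 + 3) \<sigma>"
  unfolding square_prog_def wp_Seq[of "SetNReg 10 (NLit 0)"] wp_Seq[of "SetNReg 9 (NLit 0)"] wp_SetNReg
proof (rule wp_Loop[where \<mu> = "\<lambda>\<tau>. nreg \<sigma> 3 - nreg \<tau> 10" and
    I = "\<lambda>l \<tau>. nreg \<tau> 10 \<le> nreg \<sigma> 3 \<and> nreg \<tau> 9 = nreg \<sigma> 3 * nreg \<tau> 10 \<and> (\<forall>r<6. nreg \<tau> r = nreg \<sigma> r) \<and>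
     nmem \<tau> = nmem \<sigma> \<and> rmem \<tau> = rmem \<sigma> \<and> l \<le> 3 * nreg \<tau> 10"], goal_cases)
  case (3 l \<tau>)
  have "nreg \<tau> 3 = nreg \<sigma> 3" using 3(1) by auto
  then have "nreg \<tau> 10 = nreg \<sigma> 3" using 3 by auto
  then show ?case using 3(1) by simp
next
  case (2 l \<tau>)
  have "nreg \<tau> 3 = nreg \<sigma> 3" using 2(1) by auto
  then show ?case using 2 by (simp add: wp_simps)
qed simp

lemma wp_size:
  assumes len: "nreg \<sigma> 9 = length es"
    and mem: "nmem \<sigma> = memory_of ([n, s, d] @ concat (map nat_code es))"
  shows "wp size_prog (\<lambda>l \<tau>. nreg \<tau> 8 = nat_offset es (length es) \<and> nreg \<tau> 11 = real_offset es (length es) \<and>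
      (\<forall>r<6. nreg \<tau> r = nreg \<sigma> r) \<and> nmem \<tau> = nmem \<sigma> \<and> rmem \<tau> = rmem \<sigma> \<and> l \<le> 5 * length es + 3) \<sigma>"
  unfolding size_prog_def wp_Seq[of "SetNReg 8 (NLit 3)"] wp_Seq[of "SetNReg 11 (NLit 0)"] wp_SetNReg
proof (rule wp_Loop[where \<mu> = "\<lambda>\<tau>. nreg \<tau> 9" and
    I = "\<lambda>l \<tau>. nreg \<tau> 9 \<le> length es \<and> nreg \<tau> 8 = nat_offset es (length es - nreg \<tau> 9) \<and>
      nreg \<tau> 11 = real_offset es (length es - nreg \<tau> 9) \<and> (\<forall>r<6. nreg \<tau> r = nreg \<sigma> r) \<and>
      nmem \<tau> = nmem \<sigma> \<and> rmem \<tau> = rmem \<sigma> \<and> l \<le> 5 * (length es - nreg \<tau> 9)"], goal_cases)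
  case 1
  then show ?case using len by (simp add: offset_0)
next
  case (2 l \<tau>)
  define q where "q = length es - nreg \<tau> 9"
  have q: "q < length es" "nreg \<tau> 9 = length es - q" "nreg \<tau> 8 = nat_offset es q" "nreg \<tau> 11 = real_offset es q"
    using 2 by (auto simp: q_def)
  have "length es - (nreg \<tau> 9 - 1) = Suc q" using q by simp
  moreover have "nmem \<tau> (nreg \<tau> 8) = length (es ! q)" using 2(1) mem nmem_input(1)[OF q(1)] q(3) by simp
  ultimately show ?case using 2 q offset_Suc[OF q(1)] by (simp add: wp_simps)
next
  case (3 l \<tau>)
  then show ?case by auto
qed

lemma usable_entries_Suc:
  "usable_entries es (Suc q) = usable_entries es q @ (if usable (es ! q) then [q] else [])"
  by (simp add: usable_entries_def)

definition compiled :: "nat \<Rightarrow> piece list list \<Rightarrow> nat \<Rightarrow> ram_state \<Rightarrow> bool" where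
  "compiled n es q \<tau> \<longleftrightarrow> nreg \<tau> 6 = length (usable_entries es q) \<and>
     (\<forall>k<length (usable_entries es q). let p = usable_entries es q ! k in
        narr \<tau> 0 k = p div n \<and> narr \<tau> 2 k = p mod n \<and> narr \<tau> 3 k = real_offset es p \<and>
        narr \<tau> 4 k = real_offset es p + 3 * length (es ! p))"

lemma compiled_cong:
  "nreg \<tau> 6 = nreg \<sigma> 6 \<Longrightarrow> narr \<tau> = narr \<sigma> \<Longrightarrow> compiled n es q \<tau> \<longleftrightarrow> compiled n es q \<sigma>"
  by (simp add: compiled_def)

lemma wp_store:
  assumes c: "compiled n es q \<sigma>" and use: "usable (es ! q)"
    and regs: "nreg \<sigma> 9 = q div n" "nreg \<sigma> 10 = q mod n" "nreg \<sigma> 11 = real_offset es q" "nreg \<sigma> 12 = length (es ! q)"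
  shows "wp store_prog (\<lambda>l \<tau>. l \<le> 5 \<and> compiled n es (Suc q) \<tau> \<and> (\<forall>r. r \<noteq> 6 \<longrightarrow> nreg \<tau> r = nreg \<sigma> r) \<and>
      (\<forall>a<nreg \<sigma> 0. nmem \<tau> a = nmem \<sigma> a) \<and> rmem \<tau> = rmem \<sigma>) \<sigma>"
proof -
  let ?m = "length (usable_entries es q)"
  have m: "nreg \<sigma> 6 = ?m" using c by (simp add: compiled_def)
  define \<tau> where "\<tau> = set_nreg 6 (Suc ?m) (set_narr 4 ?m (real_offset es q + 3 * length (es ! q))
    (set_narr 3 ?m (real_offset es q) (set_narr 2 ?m (q mod n) (set_narr 0 ?m (q div n) \<sigma>))))"
  have three: "x + (x + x) = 3 * x" for x :: nat by simp
  have wp: "wp store_prog Q \<sigma>" if Q: "\<And>x. x \<le> 5 \<Longrightarrow> Q x \<tau>" for Q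
    by (simp add: store_prog_def wp_simps m regs three Q[unfolded \<tau>_def])
  have arr: "narr \<tau> 0 = (narr \<sigma> 0)(?m := q div n)" "narr \<tau> 2 = (narr \<sigma> 2)(?m := q mod n)"
    "narr \<tau> 3 = (narr \<sigma> 3)(?m := real_offset es q)"
    "narr \<tau> 4 = (narr \<sigma> 4)(?m := real_offset es q + 3 * length (es ! q))"
    by (simp_all add: \<tau>_def)
  have "compiled n es (Suc q) \<tau>"
    unfolding compiled_def Let_def
  proof (intro conjI allI impI)
    show "nreg \<tau> 6 = length (usable_entries es (Suc q))" using use by (simp add: \<tau>_def usable_entries_Suc)
    fix k assume "k < length (usable_entries es (Suc q))"
    then have k: "k < ?m \<or> k = ?m" using use by (auto simp: usable_entries_Suc)
    have "narr \<tau> 0 k = usable_entries es (Suc q) ! k div n \<and> narr \<tau> 2 k = usable_entries es (Suc q) ! k mod n \<and>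
      narr \<tau> 3 k = real_offset es (usable_entries es (Suc q) ! k) \<and>
      narr \<tau> 4 k = real_offset es (usable_entries es (Suc q) ! k) + 3 * length (es ! (usable_entries es (Suc q) ! k))"
      using k c use by (auto simp: arr usable_entries_Suc nth_append compiled_def Let_def)
    then show "narr \<tau> 0 k = usable_entries es (Suc q) ! k div n" "narr \<tau> 2 k = usable_entries es (Suc q) ! k mod n"
      "narr \<tau> 3 k = real_offset es (usable_entries es (Suc q) ! k)"
      "narr \<tau> 4 k = real_offset es (usable_entries es (Suc q) ! k) + 3 * length (es ! (usable_entries es (Suc q) ! k))"
      by blast+
  qed
  moreover have "nmem \<tau> a = nmem \<sigma> a" if "a < nreg \<sigma> 0" for a
    using that by (simp add: \<tau>_def nmem_set_narr)
  ultimately show ?thesis by (intro wp) (simp add: \<tau>_def)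
qed

lemma wp_compile:
  assumes n: "0 < n" "nreg \<sigma> 3 = n" and len: "length es = n * n"
    and base: "nreg \<sigma> 0 = nat_offset es (n * n)"
    and mem: "\<And>a. a < nreg \<sigma> 0 \<Longrightarrow> nmem \<sigma> a = memory_of ([n, s, d] @ concat (map nat_code es)) a"
  shows "wp compile_prog (\<lambda>l \<tau>. compiled n es (n * n) \<tau> \<and> (\<forall>r<6. nreg \<tau> r = nreg \<sigma> r) \<and> rmem \<tau> = rmem \<sigma> \<and>
      l \<le> 14 * (n * n) + 6) \<sigma>"
  unfolding compile_prog_def wp_Seq[of "SetNReg 8 (NLit 3)"] wp_Seq[of "SetNReg 11 (NLit 0)"]
    wp_Seq[of "SetNReg 6 (NLit 0)"] wp_Seq[of "SetNReg 9 (NLit 0)"] wp_Seq[of "SetNReg 10 (NLit 0)"] wp_SetNReg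
proof (rule wp_Loop[where \<mu> = "\<lambda>\<tau>. n * n - (nreg \<tau> 9 * n + nreg \<tau> 10)" and
    I = "\<lambda>l \<tau>. \<exists>q\<le>n * n. nreg \<tau> 9 = q div n \<and> nreg \<tau> 10 = q mod n \<and> nreg \<tau> 8 = nat_offset es q \<and>
      nreg \<tau> 11 = real_offset es q \<and> compiled n es q \<tau> \<and> (\<forall>r<6. nreg \<tau> r = nreg \<sigma> r) \<and>
      (\<forall>a<nreg \<sigma> 0. nmem \<tau> a = nmem \<sigma> a) \<and> rmem \<tau> = rmem \<sigma> \<and> l \<le> 14 * q"], goal_cases)
  case 1
  then show ?case by (intro exI[of _ 0]) (simp add: offset_0 compiled_def usable_entries_def)
next
  case (2 l \<tau>)
  then obtain q where q: "q \<le> n * n" "nreg \<tau> 9 = q div n" "nreg \<tau> 10 = q mod n" "nreg \<tau> 8 = nat_offset es q"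
      "nreg \<tau> 11 = real_offset es q" "compiled n es q \<tau>" "l \<le> 14 * q" "rmem \<tau> = rmem \<sigma>"
    and r6: "\<And>r. r < 6 \<Longrightarrow> nreg \<tau> r = nreg \<sigma> r" and memt: "\<And>a. a < nreg \<sigma> 0 \<Longrightarrow> nmem \<tau> a = nmem \<sigma> a"
    by blast
  have r3: "nreg \<tau> 3 = n" "nreg \<tau> 0 = nreg \<sigma> 0" using r6[of 3] r6[of 0] n by simp_all
  have "q div n < n" using 2(2) q r3 by simp
  then have qn: "q < n * n" using n(1) by (simp add: div_less_iff_less_mult)
  have ql: "q < length es" using qn len by simp
  have off: "nat_offset es (Suc q) \<le> nreg \<sigma> 0" unfolding base using offset_mono(1)[of "Suc q" "n * n" es] qn by simp
  \<comment> \<open>The cells that matter for the test lie below the base of the arrays, so they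
    still hold the input although edges have already been stored. The second one matters only for a
    nonempty entry.\<close>
  then have lt: "nat_offset es q < nreg \<sigma> 0" "es ! q \<noteq> [] \<Longrightarrow> Suc (nat_offset es q) < nreg \<sigma> 0"
    using offset_Suc(1)[OF ql] by (auto simp: Suc_le_eq neq_Nil_conv)
  define \<rho> where "\<rho> = set_nreg 12 (length (es ! q)) \<tau>"
  have m0: "nmem \<tau> (nat_offset es q) = length (es ! q)"
    using memt[OF lt(1)] mem[OF lt(1)] nmem_input(1)[OF ql] by simp
  have m1: "0 < nmem \<tau> (Suc (nat_offset es q)) \<longleftrightarrow> usable (es ! q)" if "es ! q \<noteq> []"
    using memt[OF lt(2)[OF that]] mem[OF lt(2)[OF that]] nmem_input(2)[OF ql that] by simp
  have val: "nval (NMem (NReg 8)) \<tau> = length (es ! q)" using q(4) m0 by simp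
  have b: "bval (BAnd (NLess (NLit 0) (NReg 12)) (NLess (NLit 0) (NMem (NAdd (NReg 8) (NLit 1))))) \<rho> \<longleftrightarrow> usable (es ! q)"
    using m1 q(4) by (cases "es ! q = []") (auto simp: \<rho>_def usable_def)
  have \<rho>: "nreg \<rho> 9 = q div n" "nreg \<rho> 10 = q mod n" "nreg \<rho> 11 = real_offset es q" "nreg \<rho> 12 = length (es ! q)"
    "nreg \<rho> 8 = nat_offset es q" "nreg \<rho> 0 = nreg \<sigma> 0" "nmem \<rho> = nmem \<tau>" "rmem \<rho> = rmem \<sigma>" "nreg \<rho> 6 = nreg \<tau> 6" "narr \<rho> = narr \<tau>"
    using q r3 by (simp_all add: \<rho>_def)
  have \<rho>6: "nreg \<rho> r = nreg \<sigma> r" if "r < 6" for r using r6[OF that] that by (simp add: \<rho>_def)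
  have comp: "compiled n es q \<rho>" using q(6) compiled_cong[OF \<rho>(9,10)] by simp
  have step: "wp (Cond (BAnd (NLess (NLit 0) (NReg 12)) (NLess (NLit 0) (NMem (NAdd (NReg 8) (NLit 1))))) store_prog Skip)
     (\<lambda>l \<tau>'. l \<le> 6 \<and> compiled n es (Suc q) \<tau>' \<and> (\<forall>r. r \<noteq> 6 \<longrightarrow> nreg \<tau>' r = nreg \<rho> r) \<and>
      (\<forall>a<nreg \<rho> 0. nmem \<tau>' a = nmem \<rho> a) \<and> rmem \<tau>' = rmem \<rho>) \<rho>"
  proof (cases "usable (es ! q)")
    case True
    show ?thesis unfolding wp_Cond b if_P[OF True]
      by (rule wp_mono[OF wp_store[OF comp True \<rho>(1-4)]]) auto
  next
    case False
    then have "usable_entries es (Suc q) = usable_entries es q" by (simp add: usable_entries_Suc)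
    then have "compiled n es (Suc q) \<rho>" using comp by (simp add: compiled_def)
    then show ?thesis unfolding wp_Cond b if_not_P[OF False] wp_Skip by simp
  qed
  show ?case
    unfolding wp_Seq[of "SetNReg 12 _"] wp_SetNReg[of 12] val \<rho>_def[symmetric] wp_Seq[of "Cond _ store_prog _"]
  proof (rule wp_mono[OF step])
    fix l' :: nat and \<tau>' :: ram_state
    assume s: "l' \<le> 6 \<and> compiled n es (Suc q) \<tau>' \<and> (\<forall>r. r \<noteq> 6 \<longrightarrow> nreg \<tau>' r = nreg \<rho> r) \<and>
      (\<forall>a<nreg \<rho> 0. nmem \<tau>' a = nmem \<rho> a) \<and> rmem \<tau>' = rmem \<rho>"
    have reg: "nreg \<tau>' r = nreg \<rho> r" if "r \<noteq> 6" for r using s that by blast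
    have regs: "nreg \<tau>' 3 = n" "nreg \<tau>' 9 = q div n" "nreg \<tau>' 10 = q mod n" "nreg \<tau>' 8 = nat_offset es q"
      "nreg \<tau>' 11 = real_offset es q" "nreg \<tau>' 12 = length (es ! q)"
      using reg[of 3] reg[of 9] reg[of 10] reg[of 8] reg[of 11] reg[of 12] \<rho> \<rho>6[of 3] n by simp_all
    have reg6: "nreg \<tau>' r = nreg \<sigma> r" if "r < 6" for r using reg[of r] \<rho>6[OF that] that by simp
    have mem': "nmem \<tau>' a = nmem \<sigma> a" if "a < nreg \<sigma> 0" for a using s \<rho>(6,7) memt[OF that] that by simp
    define \<tau>1 where "\<tau>1 = set_nreg 10 (Suc (q mod n)) (set_nreg 8 (nat_offset es (Suc q)) (set_nreg 11 (real_offset es (Suc q)) \<tau>'))"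
    define \<tau>2 where "\<tau>2 = (if Suc (q mod n) < n then \<tau>1 else set_nreg 9 (Suc (q div n)) (set_nreg 10 0 \<tau>1))"
    have nn: "n * n - (q div n * n + q mod n) = n * n - q" by simp
    have dm: "nreg \<tau>2 9 = Suc q div n \<and> nreg \<tau>2 10 = Suc q mod n"
    proof (cases "Suc (q mod n) < n")
      case True
      then have "Suc q mod n = Suc (q mod n)" "Suc q div n = q div n" by (simp_all add: mod_Suc div_Suc)
      then show ?thesis using True regs by (simp add: \<tau>2_def \<tau>1_def)
    next
      case False
      then have "Suc (q mod n) = n" using mod_less_divisor[OF n(1), of q] by simp
      then have "Suc q mod n = 0" "Suc q div n = Suc (q div n)" by (simp_all add: mod_Suc div_Suc)
      then show ?thesis using False by (simp add: \<tau>2_def \<tau>1_def)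
    qed
    have "narr \<tau>2 = narr \<tau>'" "nreg \<tau>2 6 = nreg \<tau>' 6" by (simp_all add: \<tau>2_def \<tau>1_def)
    then have comp2: "compiled n es (Suc q) \<tau>2" using s compiled_cong[of \<tau>2 \<tau>'] by simp
    have fin: "\<exists>q\<le>n * n. nreg \<tau>2 9 = q div n \<and> nreg \<tau>2 10 = q mod n \<and> nreg \<tau>2 8 = nat_offset es q \<and>
        nreg \<tau>2 11 = real_offset es q \<and> compiled n es q \<tau>2 \<and> (\<forall>r<6. nreg \<tau>2 r = nreg \<sigma> r) \<and>
        (\<forall>a<nreg \<sigma> 0. nmem \<tau>2 a = nmem \<sigma> a) \<and> rmem \<tau>2 = rmem \<sigma> \<and> x \<le> 14 * q" if "x \<le> 14 * Suc q" for x
    proof (intro exI[of _ "Suc q"] conjI)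
      show "rmem \<tau>2 = rmem \<sigma>" using s \<rho>(8) by (simp add: \<tau>2_def \<tau>1_def)
      show "\<forall>r<6. nreg \<tau>2 r = nreg \<sigma> r" using reg6 by (simp add: \<tau>2_def \<tau>1_def)
      show "\<forall>a<nreg \<sigma> 0. nmem \<tau>2 a = nmem \<sigma> a" using mem' by (simp add: \<tau>2_def \<tau>1_def)
    qed (use qn dm comp2 that in \<open>auto simp: \<tau>2_def \<tau>1_def\<close>)
    have \<mu>: "n * n - (nreg \<tau>2 9 * n + nreg \<tau>2 10) < n * n - (nreg \<tau> 9 * n + nreg \<tau> 10)"
    proof -
      have "nreg \<tau>2 9 * n + nreg \<tau>2 10 = Suc q" using dm div_mult_mod_eq[of "Suc q" n] by simp
      moreover have "nreg \<tau> 9 * n + nreg \<tau> 10 = q" using q(2,3) div_mult_mod_eq[of q n] by simp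
      ultimately show ?thesis using qn by linarith
    qed
    have e8: "nat_offset es q + (1 + length (es ! q)) = nat_offset es (Suc q)"
      "real_offset es q + (length (es ! q) + (length (es ! q) + length (es ! q))) = real_offset es (Suc q)"
      using offset_Suc[OF ql] by simp_all
    have wp: "wp (Seq (SetNReg 11 (NAdd (NReg 11) (NAdd (NReg 12) (NAdd (NReg 12) (NReg 12)))))
      (Seq (SetNReg 8 (NAdd (NReg 8) (NAdd (NLit 1) (NReg 12))))
      (Seq (SetNReg 10 (NAdd (NReg 10) (NLit 1)))
      (Cond (NLess (NReg 10) (NReg 3)) Skip
        (Seq (SetNReg 10 (NLit 0)) (SetNReg 9 (NAdd (NReg 9) (NLit 1)))))))) Q \<tau>'" if Q: "\<And>x. x \<le> 6 \<Longrightarrow> Q x \<tau>2" for Q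
      by (cases "Suc (q mod n) < n")
        (use Q regs e8 in \<open>simp_all add: wp_simps \<tau>2_def \<tau>1_def\<close>)
    show "wp (Seq (SetNReg 11 (NAdd (NReg 11) (NAdd (NReg 12) (NAdd (NReg 12) (NReg 12)))))
      (Seq (SetNReg 8 (NAdd (NReg 8) (NAdd (NLit 1) (NReg 12))))
      (Seq (SetNReg 10 (NAdd (NReg 10) (NLit 1)))
      (Cond (NLess (NReg 10) (NReg 3)) Skip
        (Seq (SetNReg 10 (NLit 0)) (SetNReg 9 (NAdd (NReg 9) (NLit 1))))))))
      (\<lambda>l''. (\<lambda>l' \<tau>'. (\<exists>q\<le>n * n. nreg \<tau>' 9 = q div n \<and> nreg \<tau>' 10 = q mod n \<and> nreg \<tau>' 8 = nat_offset es q \<and>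
        nreg \<tau>' 11 = real_offset es q \<and> compiled n es q \<tau>' \<and> (\<forall>r<6. nreg \<tau>' r = nreg \<sigma> r) \<and>
        (\<forall>a<nreg \<sigma> 0. nmem \<tau>' a = nmem \<sigma> a) \<and> rmem \<tau>' = rmem \<sigma> \<and> Suc (l + l') \<le> 14 * q) \<and>
        n * n - (nreg \<tau>' 9 * n + nreg \<tau>' 10) < n * n - (nreg \<tau> 9 * n + nreg \<tau> 10)) (1 + (l' + l''))) \<tau>'"
    proof (rule wp)
      fix x :: nat assume "x \<le> 6"
      then have "Suc (l + (1 + (l' + x))) \<le> 14 * Suc q" using s q(7) by simp
      from fin[OF this] \<mu> show "(\<lambda>l' \<tau>'. (\<exists>q\<le>n * n. nreg \<tau>' 9 = q div n \<and> nreg \<tau>' 10 = q mod n \<and> nreg \<tau>' 8 = nat_offset es q \<and>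
        nreg \<tau>' 11 = real_offset es q \<and> compiled n es q \<tau>' \<and> (\<forall>r<6. nreg \<tau>' r = nreg \<sigma> r) \<and>
        (\<forall>a<nreg \<sigma> 0. nmem \<tau>' a = nmem \<sigma> a) \<and> rmem \<tau>' = rmem \<sigma> \<and> Suc (l + l') \<le> 14 * q) \<and>
        n * n - (nreg \<tau>' 9 * n + nreg \<tau>' 10) < n * n - (nreg \<tau> 9 * n + nreg \<tau> 10)) (1 + (l' + x)) \<tau>2" by blast
    qed
  qed
next
  case (3 l \<tau>)
  then obtain q where q: "q \<le> n * n" "nreg \<tau> 9 = q div n" "compiled n es q \<tau>" "l \<le> 14 * q" "rmem \<tau> = rmem \<sigma>"
    "\<forall>r<6. nreg \<tau> r = nreg \<sigma> r" by blast
  then have "nreg \<tau> 3 = n" using n by simp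
  then have "n \<le> q div n" using 3(2) q(2) by simp
  then have "n * n \<le> q" using n(1) by (simp add: less_eq_div_iff_mult_less_eq)
  then show ?case using q by simp
qed

lemma wp_parse:
  assumes n: "0 < n" and len: "length es = n * n"
    and mem: "nmem \<sigma> = memory_of ([n, s, d] @ concat (map nat_code es))"
  shows "wp parse_prog (\<lambda>l \<tau>. compiled n es (n * n) \<tau> \<and> nreg \<tau> 3 = n \<and> nreg \<tau> 4 = s \<and> nreg \<tau> 5 = d \<and>
      nreg \<tau> 2 = real_offset es (n * n) \<and> rmem \<tau> = rmem \<sigma> \<and> l \<le> 19 * (n * n) + 3 * n + 17) \<sigma>"
proof -
  define \<sigma>1 where "\<sigma>1 = set_nreg 5 d (set_nreg 4 s (set_nreg 3 n \<sigma>))"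
  have m: "nmem \<sigma> 0 = n" "nmem \<sigma> 1 = s" "nmem \<sigma> 2 = d"
    by (simp_all add: mem memory_of_def)
  have r1: "nreg \<sigma>1 3 = n" "nreg \<sigma>1 4 = s" "nreg \<sigma>1 5 = d" "nmem \<sigma>1 = nmem \<sigma>" "rmem \<sigma>1 = rmem \<sigma>"
    by (simp_all add: \<sigma>1_def)
  have "wp (Seq square_prog (Seq size_prog (Seq (SetNReg 0 (NReg 8)) (Seq (SetNReg 2 (NReg 11)) compile_prog))))
     (\<lambda>l \<tau>. compiled n es (n * n) \<tau> \<and> nreg \<tau> 3 = n \<and> nreg \<tau> 4 = s \<and> nreg \<tau> 5 = d \<and>
      nreg \<tau> 2 = real_offset es (n * n) \<and> rmem \<tau> = rmem \<sigma> \<and> l + 3 \<le> 19 * (n * n) + 3 * n + 17) \<sigma>1"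
    unfolding wp_Seq
  proof (rule wp_mono[OF wp_square])
    fix l1 :: nat and \<sigma>2 :: ram_state
    assume "nreg \<sigma>2 9 = nreg \<sigma>1 3 * nreg \<sigma>1 3 \<and> (\<forall>r<6. nreg \<sigma>2 r = nreg \<sigma>1 r) \<and>
      nmem \<sigma>2 = nmem \<sigma>1 \<and> rmem \<sigma>2 = rmem \<sigma>1 \<and> l1 \<le> 3 * nreg \<sigma>1 3 + 3"
    then have r2: "nreg \<sigma>2 9 = length es" "nreg \<sigma>2 3 = n" "nreg \<sigma>2 4 = s" "nreg \<sigma>2 5 = d"
      "nmem \<sigma>2 = memory_of ([n, s, d] @ concat (map nat_code es))" "rmem \<sigma>2 = rmem \<sigma>" "l1 \<le> 3 * n + 3"
      using r1 len mem by simp_all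
    show "wp size_prog (\<lambda>k. wp (SetNReg 0 (NReg 8)) (\<lambda>ka. wp (SetNReg 2 (NReg 11)) (\<lambda>kb. wp compile_prog
        (\<lambda>l \<tau>. compiled n es (n * n) \<tau> \<and> nreg \<tau> 3 = n \<and> nreg \<tau> 4 = s \<and> nreg \<tau> 5 = d \<and>
         nreg \<tau> 2 = real_offset es (n * n) \<and> rmem \<tau> = rmem \<sigma> \<and> l1 + (k + (ka + (kb + l))) + 3 \<le> 19 * (n * n) + 3 * n + 17)))) \<sigma>2"
    proof (rule wp_mono[OF wp_size[OF r2(1,5)]])
      fix l2 :: nat and \<sigma>3 :: ram_state
      assume s3: "nreg \<sigma>3 8 = nat_offset es (length es) \<and> nreg \<sigma>3 11 = real_offset es (length es) \<and>
        (\<forall>r<6. nreg \<sigma>3 r = nreg \<sigma>2 r) \<and> nmem \<sigma>3 = nmem \<sigma>2 \<and> rmem \<sigma>3 = rmem \<sigma>2 \<and> l2 \<le> 5 * length es + 3"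
      define \<sigma>4 where "\<sigma>4 = set_nreg 2 (nreg \<sigma>3 11) (set_nreg 0 (nreg \<sigma>3 8) \<sigma>3)"
      have r4: "nreg \<sigma>4 3 = n" "nreg \<sigma>4 0 = nat_offset es (n * n)" "nreg \<sigma>4 4 = s" "nreg \<sigma>4 5 = d"
        "nreg \<sigma>4 2 = real_offset es (n * n)" "rmem \<sigma>4 = rmem \<sigma>"
        "nmem \<sigma>4 = memory_of ([n, s, d] @ concat (map nat_code es))"
        using s3 r2 len by (simp_all add: \<sigma>4_def)
      have "wp compile_prog (\<lambda>l \<tau>. compiled n es (n * n) \<tau> \<and> nreg \<tau> 3 = n \<and> nreg \<tau> 4 = s \<and> nreg \<tau> 5 = d \<and>
         nreg \<tau> 2 = real_offset es (n * n) \<and> rmem \<tau> = rmem \<sigma> \<and> l1 + (l2 + (1 + (1 + l))) + 3 \<le> 19 * (n * n) + 3 * n + 17) \<sigma>4"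
        by (rule wp_mono[OF wp_compile[OF n r4(1) len r4(2)]])
          (use r4 s3 r2(7) len in auto)
      then show "wp (SetNReg 0 (NReg 8)) (\<lambda>ka. wp (SetNReg 2 (NReg 11)) (\<lambda>kb. wp compile_prog
        (\<lambda>l \<tau>. compiled n es (n * n) \<tau> \<and> nreg \<tau> 3 = n \<and> nreg \<tau> 4 = s \<and> nreg \<tau> 5 = d \<and>
         nreg \<tau> 2 = real_offset es (n * n) \<and> rmem \<tau> = rmem \<sigma> \<and> l1 + (l2 + (ka + (kb + l))) + 3 \<le> 19 * (n * n) + 3 * n + 17))) \<sigma>3"
        unfolding wp_SetNReg by (simp add: \<sigma>4_def)
    qed
  qed
  then show ?thesis
    unfolding parse_prog_def wp_Seq[of "SetNReg 3 _"] wp_Seq[of "SetNReg 4 _"] wp_Seq[of "SetNReg 5 _"] wp_SetNReg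
    using m by (simp add: \<sigma>1_def add.commute)
qed

section \<open>Correctness and running time\<close>

lemma pl_representationD:
  assumes "pl_representation f ps"
  shows "ps \<noteq> []" "fst (ps ! 0) = 0" "i < j \<Longrightarrow> j < length ps \<Longrightarrow> fst (ps ! i) < fst (ps ! j)"
    "i < length ps \<Longrightarrow> fst (ps ! i) \<le> t \<Longrightarrow> (Suc i < length ps \<longrightarrow> t < fst (ps ! Suc i)) \<Longrightarrow>
      enn2ereal (f (ennreal t)) = linear_value (snd (ps ! i)) t"
  using assms unfolding pl_representation_def
  by (auto simp: hd_conv_nth sorted_wrt_iff_nth_less)

lemma piece_exists:
  assumes ps: "pl_representation f ps" and t: "0 \<le> t"
  obtains i where "i < length ps" "fst (ps ! i) \<le> t" "Suc i < length ps \<longrightarrow> t < fst (ps ! Suc i)"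
proof -
  define i where "i = Max {i. i < length ps \<and> fst (ps ! i) \<le> t}"
  have fin: "finite {i. i < length ps \<and> fst (ps ! i) \<le> t}" by simp
  have "0 \<in> {i. i < length ps \<and> fst (ps ! i) \<le> t}" using pl_representationD(1,2)[OF ps] t by simp
  then have "i \<in> {i. i < length ps \<and> fst (ps ! i) \<le> t}" unfolding i_def by (intro Max_in[OF fin]) auto
  moreover have "t < fst (ps ! Suc i)" if "Suc i < length ps"
  proof (rule ccontr)
    assume "\<not> t < fst (ps ! Suc i)"
    then have "Suc i \<le> Max {i. i < length ps \<and> fst (ps ! i) \<le> t}" using that by (intro Max_ge[OF fin]) auto
    then show False unfolding i_def[symmetric] by simp
  qed
  ultimately show ?thesis by (intro that[of i]) auto
qed

lemma linear_value_slope: "snd p \<noteq> None \<Longrightarrow> linear_value (snd p) t = ereal (slope p * t + intercept p)"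
  by (auto simp: slope_def intercept_def)

lemma enn2ereal_eq_ereal:
  assumes "enn2ereal x = ereal r"
  shows "x = ennreal r" "0 \<le> r"
proof -
  have "0 \<le> enn2ereal x" by (rule enn2ereal_nonneg)
  then show r: "0 \<le> r" unfolding assms by simp
  then have "enn2ereal (ennreal r) = enn2ereal x" unfolding assms by (rule enn2ereal_ennreal)
  then show "x = ennreal r" by (simp add: enn2ereal_inject)
qed

text \<open>
  A continuous arrival function has no jump to infinity, and a monotone one does not come back from
  infinity, so that finite and infinite pieces do not occur together.
\<close>

lemma pl_usable_or_top:
  assumes ps: "pl_representation f ps" and f: "arrival_function f" and cont: "continuous_on UNIV f"
  shows "(\<forall>i<length ps. snd (ps ! i) \<noteq> None) \<and> usable ps \<or> (\<forall>t. f t = \<infinity>) \<and> \<not> usable ps"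
proof (cases "snd (ps ! 0)")
  case None
  obtain i where "i < length ps" "fst (ps ! i) \<le> 0" "Suc i < length ps \<longrightarrow> 0 < fst (ps ! Suc i)"
    by (rule piece_exists[OF ps order_refl])
  moreover then have "i = 0" using pl_representationD(2)[OF ps] pl_representationD(3)[OF ps, of 0 i] by (cases i) auto
  ultimately have "enn2ereal (f (ennreal 0)) = \<infinity>"
    using pl_representationD(4)[OF ps, of 0 0] None by simp
  then have "enn2ereal (f 0) = enn2ereal top" by (simp add: top_ereal_def)
  then have "f 0 = top" by (simp only: enn2ereal_inject)
  then have "f t = \<infinity>" for t using arrival_mono[OF f, of 0 t] by (simp add: top_unique)
  then show ?thesis using None pl_representationD(1)[OF ps] by (simp add: usable_def hd_conv_nth)
next
  case (Some ab)
  have "snd (ps ! i) \<noteq> None" if "i < length ps" for i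
    using that
  proof (induction i)
    case 0
    then show ?case using Some by simp
  next
    case (Suc i)
    then have i: "snd (ps ! i) \<noteq> None" by simp
    define x where "x = fst (ps ! Suc i)"
    define y where "y = fst (ps ! i)"
    have yx: "y < x" unfolding x_def y_def using pl_representationD(3)[OF ps, of i "Suc i"] Suc.prems by simp
    \<comment> \<open>Any finite bound for the affine piece on the bounded interval would do. By
      continuity it carries over to the left limit at \<open>x\<close>, where the next piece starts,
      so that piece cannot be infinite.\<close>
    let ?M = "\<bar>slope (ps ! i)\<bar> * (\<bar>y\<bar> + \<bar>x\<bar>) + \<bar>intercept (ps ! i)\<bar>"
    have le: "f (ennreal t) \<le> ennreal ?M" if t: "y \<le> t" "t < x" for t
    proof -
      have "enn2ereal (f (ennreal t)) = ereal (slope (ps ! i) * t + intercept (ps ! i))"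
        using pl_representationD(4)[OF ps, of i t] Suc.prems t linear_value_slope[OF i]
        by (simp add: x_def y_def)
      then have "f (ennreal t) = ennreal (slope (ps ! i) * t + intercept (ps ! i))" by (rule enn2ereal_eq_ereal)
      also have "\<dots> \<le> ennreal ?M"
      proof (rule ennreal_leI)
        have "slope (ps ! i) * t \<le> \<bar>slope (ps ! i)\<bar> * \<bar>t\<bar>" by (metis abs_ge_self abs_mult)
        also have "\<dots> \<le> \<bar>slope (ps ! i)\<bar> * (\<bar>y\<bar> + \<bar>x\<bar>)" using t by (intro mult_left_mono) auto
        finally show "slope (ps ! i) * t + intercept (ps ! i) \<le> ?M" by simp
      qed
      finally show ?thesis .
    qed
    have "continuous_on UNIV (\<lambda>t. f (ennreal t))"
      by (rule continuous_on_compose2[OF cont]) (auto intro!: continuous_on_ennreal continuous_on_id)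
    then have "isCont (\<lambda>t. f (ennreal t)) x" by (simp add: continuous_on_eq_continuous_at)
    then have "((\<lambda>t. f (ennreal t)) \<longlongrightarrow> f (ennreal x)) (at_left x)"
      unfolding isCont_def by (rule tendsto_within_subset) simp
    moreover have "eventually (\<lambda>t. f (ennreal t) \<le> ennreal ?M) (at_left x)"
      unfolding eventually_at_left_field using yx le by (intro exI[of _ y]) auto
    ultimately have bound: "f (ennreal x) \<le> ennreal ?M" by (intro tendsto_upperbound) auto
    show ?case
    proof
      assume none: "snd (ps ! Suc i) = None"
      have "enn2ereal (f (ennreal x)) = linear_value (snd (ps ! Suc i)) x"
        by (rule pl_representationD(4)[OF ps Suc.prems])
          (use pl_representationD(3)[OF ps, of "Suc i" "Suc (Suc i)"] in \<open>auto simp: x_def\<close>)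
      then have "enn2ereal (f (ennreal x)) = enn2ereal top" using none by (simp add: top_ereal_def)
      then have "f (ennreal x) = top" by (simp only: enn2ereal_inject)
      with bound show False by (simp add: top_unique)
    qed
  qed
  then show ?thesis using Some pl_representationD(1)[OF ps] by (simp add: usable_def hd_conv_nth)
qed

lemma pl_value:
  assumes ps: "pl_representation f ps" and some: "\<forall>i<length ps. snd (ps ! i) \<noteq> None"
    and i: "i < length ps" "fst (ps ! i) \<le> t" "Suc i < length ps \<longrightarrow> t < fst (ps ! Suc i)"
  shows "f (ennreal t) = ennreal (slope (ps ! i) * t + intercept (ps ! i))"
    "0 \<le> slope (ps ! i) * t + intercept (ps ! i)"
proof -
  have "enn2ereal (f (ennreal t)) = ereal (slope (ps ! i) * t + intercept (ps ! i))"
    using pl_representationD(4)[OF ps i] linear_value_slope[of "ps ! i"] some i(1) by simp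
  then show "f (ennreal t) = ennreal (slope (ps ! i) * t + intercept (ps ! i))"
    "0 \<le> slope (ps ! i) * t + intercept (ps ! i)" by (rule enn2ereal_eq_ereal)+
qed

lemma pl_finite:
  assumes ps: "pl_representation f ps" and some: "\<forall>i<length ps. snd (ps ! i) \<noteq> None" and t: "0 \<le> t"
  shows "f (ennreal t) < top"
proof -
  obtain i where i: "i < length ps" "fst (ps ! i) \<le> t" "Suc i < length ps \<longrightarrow> t < fst (ps ! Suc i)"
    by (rule piece_exists[OF ps t])
  show ?thesis unfolding pl_value(1)[OF ps some i] by simp
qed

lemma pieces_pl:
  assumes ps: "pl_representation f ps" and f: "arrival_function f" and cont: "continuous_on UNIV f"
  shows "pieces (length ps) f"
proof -
  consider "\<forall>t. f t = \<infinity>" | "\<forall>i<length ps. snd (ps ! i) \<noteq> None" using pl_usable_or_top[OF assms] by blast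
  then show ?thesis
  proof cases
    case 2
    define S where "S = (\<lambda>i. fst (ps ! i)) ` {1..<length ps}"
    have "card S \<le> card {1..<length ps}" unfolding S_def by (rule card_image_le) simp
    also have "\<dots> < length ps" using pl_representationD(1)[OF ps] by (cases ps) auto
    finally have card: "card S < length ps" .
    have "\<exists>\<alpha> \<beta>. \<forall>t\<in>{a<..<b}. enn2real (f (ennreal t)) = \<alpha> * t + \<beta>"
      if a: "0 \<le> a" and disj: "{a<..<b} \<inter> S = {}" for a b
    proof -
      obtain i where i: "i < length ps" "fst (ps ! i) \<le> a" "Suc i < length ps \<longrightarrow> a < fst (ps ! Suc i)"
        by (rule piece_exists[OF ps a])
      have "enn2real (f (ennreal t)) = slope (ps ! i) * t + intercept (ps ! i)" if t: "t \<in> {a<..<b}" for t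
      proof -
        have ti: "Suc i < length ps \<longrightarrow> t < fst (ps ! Suc i)"
        proof (intro impI, rule ccontr)
          assume "Suc i < length ps" "\<not> t < fst (ps ! Suc i)"
          then have "fst (ps ! Suc i) \<in> {a<..<b} \<inter> S" using i(3) t by (auto simp: S_def)
          with disj show False by simp
        qed
        have "fst (ps ! i) \<le> t" using i(2) t by simp
        from pl_value[OF ps 2 i(1) this ti] show ?thesis by simp
      qed
      then show ?thesis by blast
    qed
    then have "affine_off S (\<lambda>t. enn2real (f (ennreal t)))" by (simp add: affine_off_def)
    moreover have "f t < \<infinity>" if "t < \<infinity>" for t
      using pl_finite[OF ps 2, of "enn2real t"] that by (simp add: less_top)
    moreover have "finite S" by (simp add: S_def)
    ultimately show ?thesis unfolding pieces_def using f card by blast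
  qed (simp add: pieces_def)
qed

text \<open>\<open>apath\<close> demands that all vertices differ, including the end, whereas
  \<open>shortcut\<close> only separates the tails. Cutting at the first visit of \<open>d\<close>
  repairs this, and the omitted rest could only have delayed the arrival.\<close>

lemma end_to_end_earliest:
  assumes "pair_graph G" and A: "\<And>e. e \<in> parcs G \<Longrightarrow> arrival_function (A e)" and s: "s \<in> pverts G"
  shows "end_to_end G A s d = earliest (parcs G) A s d"
proof
  fix t
  interpret pair_graph G by fact
  interpret fifo "parcs G" A by unfold_locales (use A pair_finite_arcs in auto)
  have apath: "pre_digraph.apath (with_proj G) s p d \<longleftrightarrow> walk (parcs G) s p d \<and> distinct (map fst p @ [d])" for p
  proof -
    have "walk (parcs G) u p v" if "pcas u p v" "set p \<subseteq> parcs G" for u v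
      using that by (induction p arbitrary: u) auto
    from this[of s d] have "pre_digraph.awalk (with_proj G) s p d \<longleftrightarrow> walk (parcs G) s p d"
      unfolding pre_digraph.awalk_def cas_with_proj_eq with_proj_simps
      using s pcas_walk[of "parcs G" s p d] walk_set[of "parcs G" s p d] by blast
    then show ?thesis
      unfolding pre_digraph.apath_def awalk_verts_with_proj_eq
      using pawalk_verts_walk[of "parcs G" s p d] by metis
  qed
  show "end_to_end G A s d t = earliest (parcs G) A s d t"
  proof (rule antisym)
    show "earliest (parcs G) A s d t \<le> end_to_end G A s d t"
      unfolding end_to_end_def earliest_def apath by (rule INF_superset_mono) auto
    show "end_to_end G A s d t \<le> earliest (parcs G) A s d t"
      unfolding earliest_def
    proof (rule INF_greatest)
      fix p assume "p \<in> {p. walk (parcs G) s p d}"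
      then obtain q where q: "walk (parcs G) s q d" "distinct (map fst q)" "fold A q t \<le> fold A p t"
        using shortcut by blast
      define r where "r = takeWhile (\<lambda>e. fst e \<noteq> d) q"
      define r' where "r' = dropWhile (\<lambda>e. fst e \<noteq> d) q"
      have qr: "q = r @ r'" by (simp add: r_def r'_def)
      have r: "walk (parcs G) s r d" unfolding r_def by (rule walk_takeWhile[OF q(1)])
      moreover have "d \<notin> set (map fst r)" by (auto simp: r_def dest: set_takeWhileD)
      moreover have "distinct (map fst r)" using q(2) by (simp add: qr)
      ultimately have "pre_digraph.apath (with_proj G) s r d" unfolding apath by simp
      then have "end_to_end G A s d t \<le> fold A r t" unfolding end_to_end_def by (intro INF_lower) simp
      also have "\<dots> \<le> fold A r' (fold A r t)" using walk_set[OF q(1)] by (intro fold_ge) (simp add: qr)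
      also have "\<dots> \<le> fold A p t" using q(3) by (simp add: qr)
      finally show "end_to_end G A s d t \<le> fold A p t" .
    qed
  qed
qed

section \<open>The complete program and its running time\<close>

definition main_prog :: com where
  "main_prog = Seq parse_prog (Seq sweep_prog copy_prog)"

lemma length_matrix_entries: "length (matrix_entries n G P) = n * n"
  by (simp add: matrix_entries_def)

lemma nth_matrix_entries:
  assumes "q < n * n"
  shows "matrix_entries n G P ! q = (if (q div n, q mod n) \<in> parcs G then P (q div n, q mod n) else [])"
proof -
  have "0 < n" using assms by (cases n) auto
  moreover have "q div n < n" using assms \<open>0 < n\<close> by (simp add: div_less_iff_less_mult)
  ultimately show ?thesis using assms
    by (simp add: matrix_entries_def product_nth)
qed

lemma (in ram_network) pl_representation_output:
  assumes "(oc = 0 \<and> (\<forall>x\<ge>0. D d x = \<infinity>)) \<or> represents oc ox oa ob UNIV"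
    and F: "\<And>t. 0 \<le> t \<Longrightarrow> F (ennreal t) = D d t"
  shows "pl_representation F (output_pieces oc ox oa ob)"
  using assms(1)
proof
  assume "oc = 0 \<and> (\<forall>x\<ge>0. D d x = \<infinity>)"
  then show ?thesis using F by (simp add: pl_representation_def output_pieces_def top_ereal_def)
next
  assume r: "represents oc ox oa ob UNIV"
  then have oc: "0 < oc" "ox 0 = 0" by (auto simp: represents_def)
  have less: "ox i < ox j" if "i < j" "j < oc" for i j
    using that
  proof (induction j)
    case (Suc j)
    have "ox j < ox (Suc j)" using r Suc.prems by (auto simp: represents_def)
    then show ?case using Suc by (cases "i = j") (auto intro: less_trans)
  qed simp
  let ?ps = "map (\<lambda>i. (ox i, Some (oa i, ob i))) [0..<oc]"
  have "enn2ereal (F (ennreal t)) = linear_value (snd (?ps ! i)) t"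
    if i: "i < length ?ps" and t: "fst (?ps ! i) \<le> t" "Suc i < length ?ps \<longrightarrow> t < fst (?ps ! Suc i)" for i t
  proof -
    have io: "i < oc" using i by simp
    have t': "ox i \<le> t" "Suc i < oc \<longrightarrow> t < ox (Suc i)" using t i by (auto simp del: upt_Suc)
    have "0 \<le> ox i" using less[of 0 i] io oc by (cases i) auto
    then have "F (ennreal t) = D d t" using F t' by simp
    also have "D d t = ennreal (oa i * t + ob i) \<and> 0 \<le> oa i * t + ob i"
      using r io t' by (auto simp: represents_def)
    finally show ?thesis using io by (auto simp: enn2ereal_ennreal simp del: upt_Suc)
  qed
  moreover have "sorted_wrt (<) (map fst ?ps)"
    using less by (auto simp: sorted_wrt_iff_nth_less)
  moreover have "distinct_adj (map snd ?ps)"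
    using r by (auto simp: distinct_adj_conv_nth represents_def)
  moreover have "fst (hd ?ps) = 0" using oc by (simp add: hd_conv_nth)
  ultimately show ?thesis using oc by (simp add: pl_representation_def output_pieces_def)
qed

text \<open>The abstract network consists of the usable matrix entries, and \<open>D v\<close> is
  the earliest arrival at \<open>v\<close> from \<open>s\<close>. At most \<open>p\<close>
  breakpoints for each of \<open>n\<close> vertices and \<open>K\<close> starts of input pieces
  bound the critical times by \<open>n * p + K\<close>. The constants add up as
  \<open>22 = 15 + 7\<close> and \<open>27 = 17 + 4 + 6\<close>, from parsing, sweeping and
  copying.\<close>

lemma main_correct:
  fixes n s d :: nat and G :: "nat pair_pre_digraph" and A :: "nat \<times> nat \<Rightarrow> ennreal \<Rightarrow> ennreal"
    and P :: "nat \<times> nat \<Rightarrow> piece list"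
  assumes G: "pair_graph G" "pverts G = {..<n}" and sd: "s < n" "d < n"
    and A: "\<And>e. e \<in> parcs G \<Longrightarrow> arrival_function (A e)" "\<And>e. e \<in> parcs G \<Longrightarrow> continuous_on UNIV (A e)"
    and P: "\<And>e. e \<in> parcs G \<Longrightarrow> pl_representation (A e) (P e)"
    and p: "\<And>v. v < n \<Longrightarrow> pieces (Suc p) (earliest (parcs G) A s v)"
  defines "K \<equiv> \<Sum>e\<in>parcs G. num_breakpoints (P e)"
  shows "\<exists>k \<tau> ps. exec main_prog (input_state n G P s d) k \<tau> \<and> outputs \<tau> ps \<and>
    pl_representation (end_to_end G A s d) ps \<and>
    k \<le> 19 * (n * n) + 3 * n + 27 + (13 * (n + 1) * (n + n * n + 1) + 17 * (n * n) + 22) * (n * p + K + 1) + 2 * K"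
proof -
  interpret G: pair_graph G by (rule G(1))
  interpret F: fifo "parcs G" A by unfold_locales (use A G.pair_finite_arcs in auto)
  define es where "es = matrix_entries n G P"
  have n: "0 < n" using sd by simp
  have len_es: "length es = n * n" by (simp add: es_def length_matrix_entries)
  define us where "us = usable_entries es (n * n)"
  define m where "m = length us"
  define eu where "eu k = us ! k div n" for k
  define ev where "ev k = us ! k mod n" for k
  define ps where "ps k = es ! (us ! k)" for k
  define len where "len k = length (ps k)" for k
  define px where "px k i = fst (ps k ! i)" for k i
  define pa where "pa k i = slope (ps k ! i)" for k i
  define pb where "pb k i = intercept (ps k ! i)" for k i
  define off where "off k = real_offset es (us ! k)" for k
  define f where "f k y = enn2real (A (eu k, ev k) (ennreal y))" for k y
  define D where "D v t = earliest (parcs G) A s v (ennreal t)" for v t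
  have us_in: "us ! k < n * n \<and> usable (ps k)" if "k < m" for k
    using nth_mem[of k us] that by (simp add: m_def us_def usable_entries_def ps_def)
  have arc: "(eu k, ev k) \<in> parcs G" "ps k = P (eu k, ev k)" if "k < m" for k
    using us_in[OF that] nth_matrix_entries[of "us ! k" n G P]
    by (auto simp: ps_def es_def eu_def ev_def usable_def split: if_splits)
  have some: "\<forall>i<length (ps k). snd (ps k ! i) \<noteq> None" if "k < m" for k
    using pl_usable_or_top[OF P[OF arc(1)[OF that]] A[OF arc(1)[OF that]]] us_in[OF that] arc(2)[OF that] by simp
  have rep: "pl_representation (A (eu k, ev k)) (ps k)" if "k < m" for k using P[OF arc(1)[OF that]] arc(2)[OF that] by simp
  have fin: "A (eu k, ev k) (ennreal t) < top" if "k < m" "0 \<le> t" for k t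
    by (rule pl_finite[OF rep[OF that(1)] some[OF that(1)] that(2)])
  have f: "ennreal (f k t) = A (eu k, ev k) (ennreal t)" if "k < m" "0 \<le> t" for k t
    using fin[OF that] by (simp add: f_def)
  \<comment> \<open>Arcs that were not stored are constantly infinite, so they impose no condition
    on potentials; this is what the lower bound of the network requires.\<close>
  have not_usable: "A (u, v) t = \<infinity>" if uv: "(u, v) \<in> parcs G" "\<And>k. k < m \<Longrightarrow> (eu k, ev k) \<noteq> (u, v)" for u v t
  proof -
    have un: "u < n" "v < n" using G.arc_fst_in_verts[OF uv(1)] G.arc_snd_in_verts[OF uv(1)] G(2) by auto
    define q where "q = u * n + v"
    have q: "q div n = u" "q mod n = v" using un by (simp_all add: q_def)
    have "u * n + v < u * n + n" using un by simp
    also have "\<dots> = Suc u * n" by simp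
    also have "\<dots> \<le> n * n" using un by (intro mult_le_mono1) simp
    finally have qn: "q < n * n" by (simp add: q_def)
    have "\<not> usable (P (u, v))"
    proof
      assume "usable (P (u, v))"
      then have "q \<in> set us" using nth_matrix_entries[OF qn, of G P] uv(1) qn
        by (simp add: us_def usable_entries_def es_def q)
      then obtain k where "k < m" "us ! k = q" by (auto simp: m_def in_set_conv_nth)
      then show False using uv(2)[of k] q by (simp add: eu_def ev_def)
    qed
    then show ?thesis using pl_usable_or_top[OF P[OF uv(1)] A[OF uv(1)]] by blast
  qed
  interpret ram_network n m s eu ev len px pa pb f D d off
  proof unfold_locales
    show "s < n" "d < n" using sd by simp_all
    fix k assume k: "k < m"
    show "eu k < n" "ev k < n" using us_in[OF k] n by (simp_all add: eu_def ev_def div_less_iff_less_mult)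
    show "0 < len k" using us_in[OF k] by (auto simp: len_def usable_def)
    show "px k 0 = 0" unfolding px_def by (rule pl_representationD(2)[OF rep[OF k]])
    show "px k i < px k j" if "i < j" "j < len k" for i j
      using pl_representationD(3)[OF rep[OF k] that(1)] that(2) by (simp add: px_def len_def)
    show "f k y = pa k i * y + pb k i"
      if i: "i < len k" "px k i \<le> y" "Suc i < len k \<Longrightarrow> y < px k (Suc i)" for i y
      using pl_value[OF rep[OF k] some[OF k], of i y] i by (simp add: f_def pa_def pb_def px_def len_def)
    show "f k x \<le> f k y" if "0 \<le> x" "x \<le> y" for x y
      unfolding f_def using that fin[OF k, of y] by (intro enn2real_mono arrival_mono[OF A(1)[OF arc(1)[OF k]]] ennreal_leI) auto
    show "x \<le> f k x" if "0 \<le> x" for x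
    proof -
      have "ennreal x \<le> ennreal (f k x)" unfolding f[OF k that] by (rule arrival_ge[OF A(1)[OF arc(1)[OF k]]])
      then show ?thesis using that by (simp add: f_def)
    qed
    show "D (ev k) t \<le> ennreal (f k x)" if "0 \<le> t" "0 \<le> x" "D (eu k) t \<le> ennreal x" for t x
    proof -
      have "D (ev k) t \<le> earliest (parcs G) A (eu k) (ev k) (D (eu k) t)"
        unfolding D_def by (rule F.earliest_triangle)
      also have "\<dots> \<le> A (eu k, ev k) (D (eu k) t)" by (rule F.earliest_edge[OF arc(1)[OF k]])
      also have "\<dots> \<le> A (eu k, ev k) (ennreal x)" by (rule arrival_mono[OF A(1)[OF arc(1)[OF k]] that(3)])
      finally show ?thesis unfolding f[OF k that(2)] .
    qed
  next
    fix t :: real assume "0 \<le> t"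
    show "D s t = ennreal t" by (simp add: D_def F.earliest_self)
  next
    fix t :: real and R :: "nat set" and g :: "nat \<Rightarrow> real" and v
    assume t: "0 \<le> t" and R: "s \<in> R" "g s \<le> t" "\<And>v. v \<in> R \<Longrightarrow> 0 \<le> g v"
      and feas: "\<And>k. k < m \<Longrightarrow> eu k \<in> R \<Longrightarrow> ev k \<in> R \<and> g (ev k) \<le> f k (g (eu k))"
    show "(if v \<in> R then ennreal (g v) else \<infinity>) \<le> D v t"
      unfolding D_def
    proof (rule F.potential_le_earliest)
      fix u v assume uv: "(u, v) \<in> parcs G"
      show "(if v \<in> R then ennreal (g v) else \<infinity>) \<le> A (u, v) (if u \<in> R then ennreal (g u) else \<infinity>)"
      proof (cases "u \<in> R")
        case False
        then show ?thesis using arrival_inf[OF A(1)[OF uv]] by simp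
      next
        case True
        show ?thesis
        proof (cases "\<exists>k<m. (eu k, ev k) = (u, v)")
          case ex: True
          then obtain k where k: "k < m" "eu k = u" "ev k = v" by auto
          have "v \<in> R" "g v \<le> f k (g u)" using feas[OF k(1)] k True by auto
          then have "ennreal (g v) \<le> A (u, v) (ennreal (g u))"
            using f[OF k(1) R(3)[OF True]] k ennreal_leI by metis
          then show ?thesis using True \<open>v \<in> R\<close> by simp
        next
          case False
          then have "A (u, v) x = \<infinity>" for x by (intro not_usable[OF uv]) auto
          then show ?thesis by simp
        qed
      qed
    qed (use R in \<open>simp add: ennreal_leI\<close>)
  next
    fix t t' :: real and v assume "0 \<le> t" "t \<le> t'"
    then show "D v t \<le> D v t'" unfolding D_def by (intro arrival_mono[OF F.arrival_earliest] ennreal_leI)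
  qed
  have "\<exists>S. finite S \<and> card S \<le> p \<and>
      (D v 0 < \<infinity> \<longrightarrow> affine_off S (\<lambda>\<tau>. enn2real (D v \<tau>)) \<and> (\<forall>\<tau>. D v \<tau> < \<infinity>))" if v: "v < n" for v
  proof (cases "\<forall>t. earliest (parcs G) A s v t = \<infinity>")
    case True
    then show ?thesis by (intro exI[of _ "{}"]) (simp add: D_def)
  next
    case False
    with p[OF v] obtain S where "finite S" "card S < Suc p" "affine_off S (\<lambda>t. enn2real (earliest (parcs G) A s v (ennreal t)))"
      "\<forall>t<\<infinity>. earliest (parcs G) A s v t < \<infinity>" unfolding pieces_def by blast
    then show ?thesis by (intro exI[of _ S]) (auto simp: D_def)
  qed
  then have "\<forall>v\<in>{..<n}. \<exists>S. finite S \<and> card S \<le> p \<and>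
      (D v 0 < \<infinity> \<longrightarrow> affine_off S (\<lambda>\<tau>. enn2real (D v \<tau>)) \<and> (\<forall>\<tau>. D v \<tau> < \<infinity>))" by simp
  then obtain BP where "\<forall>v\<in>{..<n}. finite (BP v) \<and> card (BP v) \<le> p \<and>
      (D v 0 < \<infinity> \<longrightarrow> affine_off (BP v) (\<lambda>\<tau>. enn2real (D v \<tau>)) \<and> (\<forall>\<tau>. D v \<tau> < \<infinity>))"
    by (rule bchoice[THEN exE])
  then have BP: "\<And>v. v < n \<Longrightarrow> finite (BP v)" "\<And>v. v < n \<Longrightarrow> card (BP v) \<le> p"
    "\<And>v. v < n \<Longrightarrow> D v 0 < \<infinity> \<Longrightarrow> affine_off (BP v) (\<lambda>\<tau>. enn2real (D v \<tau>))"
    "\<And>v \<tau>. v < n \<Longrightarrow> 0 \<le> \<tau> \<Longrightarrow> D v 0 < \<infinity> \<Longrightarrow> D v \<tau> < \<infinity>" by auto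
  \<comment> \<open>Different indices belong to different arcs, so every breakpoint of the input is
    counted at most once.\<close>
  have sumK: "(\<Sum>k<m. len k - 1) \<le> K"
  proof -
    have dist: "distinct us" by (simp add: us_def usable_entries_def)
    have inj: "inj_on (\<lambda>k. (eu k, ev k)) {..<m}"
    proof (rule inj_onI)
      fix k l assume kl: "k \<in> {..<m}" "l \<in> {..<m}" "(eu k, ev k) = (eu l, ev l)"
      then have "us ! k = us ! l" unfolding eu_def ev_def by (metis div_mult_mod_eq prod.inject)
      then show "k = l" using dist kl by (simp add: m_def nth_eq_iff_index_eq)
    qed
    have "(\<Sum>k<m. len k - 1) = (\<Sum>k<m. num_breakpoints (P (eu k, ev k)))"
      by (rule sum.cong) (auto simp: len_def num_breakpoints_def arc(2))
    also have "\<dots> = (\<Sum>e\<in>(\<lambda>k. (eu k, ev k)) ` {..<m}. num_breakpoints (P e))" by (simp add: sum.reindex[OF inj])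
    also have "\<dots> \<le> K" unfolding K_def by (rule sum_mono2) (use arc(1) G.pair_finite_arcs in auto)
    finally show ?thesis .
  qed
  have ee: "end_to_end G A s d = earliest (parcs G) A s d"
    by (rule end_to_end_earliest) (use G A sd in auto)
  have mn: "m \<le> n * n"
    using length_filter_le[of "\<lambda>q. usable (es ! q)" "[0..<n * n]"] by (simp add: m_def us_def usable_entries_def)
  have crit: "card (critical BP) \<le> n * p + K"
    using card_critical(2)[of BP p] BP(1,2) sumK by (meson add_left_mono order_trans)
  let ?T = "13 * (n + 1) * (n + m + 1) + 17 * m + 15"
  let ?Z = "card (critical BP) + 1"
  let ?\<sigma> = "input_state n G P s d"
  have in_mem: "nmem ?\<sigma> = memory_of ([n, s, d] @ concat (map nat_code es))"
    "rmem ?\<sigma> = memory_of (concat (map real_code es))"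
    by (simp_all add: input_state_def es_def)
  have "wp main_prog (\<lambda>k \<tau>. (\<exists>ps. outputs \<tau> ps \<and> pl_representation (end_to_end G A s d) ps) \<and>
      k \<le> (19 * (n * n) + 3 * n + 17) + (?T * ?Z + 2 * K + 4) + (7 * ?Z + 6)) ?\<sigma>"
    unfolding main_prog_def wp_Seq
  proof (rule wp_mono[OF wp_parse[OF n len_es in_mem(1)]])
    fix l1 :: nat and \<sigma>1
    assume 1: "compiled n es (n * n) \<sigma>1 \<and> nreg \<sigma>1 3 = n \<and> nreg \<sigma>1 4 = s \<and> nreg \<sigma>1 5 = d \<and>
      nreg \<sigma>1 2 = real_offset es (n * n) \<and> rmem \<sigma>1 = rmem ?\<sigma> \<and> l1 \<le> 19 * (n * n) + 3 * n + 17"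
    have comp: "nreg \<sigma>1 6 = m" "\<And>k. k < m \<Longrightarrow> narr \<sigma>1 0 k = eu k \<and> narr \<sigma>1 2 k = ev k \<and> narr \<sigma>1 3 k = off k \<and>
        narr \<sigma>1 4 k = off k + 3 * len k"
      using 1 by (auto simp: compiled_def Let_def m_def us_def eu_def ev_def off_def len_def ps_def)
    have "network \<sigma>1"
      unfolding network_def
    proof (intro conjI allI impI)
      fix k assume k: "k < m"
      have q: "us ! k < length es" using us_in[OF k] len_es by simp
      show "off k + 3 * len k \<le> nreg \<sigma>1 2"
        using offset_Suc(2)[OF q] offset_mono(2)[of "Suc (us ! k)" "n * n" es] us_in[OF k] 1
        by (simp add: off_def len_def ps_def)
      fix i assume i: "i < len k"
      have "i < length (es ! (us ! k))" using i by (simp add: len_def ps_def)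
      from rmem_input[OF q this] 1 in_mem(2)
      show "rmem \<sigma>1 (off k + 3 * i) = px k i" "rmem \<sigma>1 (off k + 3 * i + 1) = pa k i" "rmem \<sigma>1 (off k + 3 * i + 2) = pb k i"
        by (simp_all only: off_def px_def pa_def pb_def ps_def)
    qed (use 1 comp in auto)
    moreover have "cursors \<sigma>1 (\<lambda>_. 0)" using comp(2) by (simp add: cursors_def)
    ultimately have sweep: "wp sweep_prog (\<lambda>l \<tau>.
      ((nreg \<tau> 7 = 0 \<and> (\<forall>x\<ge>0. D d x = \<infinity>)) \<or> represents (nreg \<tau> 7) (rarr \<tau> 3) (rarr \<tau> 4) (rarr \<tau> 5) UNIV) \<and>
      nreg \<tau> 7 \<le> ?Z \<and> l \<le> ?T * ?Z + 2 * (\<Sum>k<m. len k - 1) + 4) \<sigma>1"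
      by (rule wp_sweep[OF _ _ BP(1,3,4)])
    show "wp sweep_prog (\<lambda>l2. wp copy_prog (\<lambda>l3 \<tau>. (\<exists>ps. outputs \<tau> ps \<and> pl_representation (end_to_end G A s d) ps) \<and>
      l1 + (l2 + l3) \<le> (19 * (n * n) + 3 * n + 17) + (?T * ?Z + 2 * K + 4) + (7 * ?Z + 6))) \<sigma>1"
    proof (rule wp_mono[OF sweep])
      fix l2 :: nat and \<sigma>2
      assume 2: "((nreg \<sigma>2 7 = 0 \<and> (\<forall>x\<ge>0. D d x = \<infinity>)) \<or> represents (nreg \<sigma>2 7) (rarr \<sigma>2 3) (rarr \<sigma>2 4) (rarr \<sigma>2 5) UNIV) \<and>
        nreg \<sigma>2 7 \<le> ?Z \<and> l2 \<le> ?T * ?Z + 2 * (\<Sum>k<m. len k - 1) + 4"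
      have out: "pl_representation (end_to_end G A s d) (output_pieces (nreg \<sigma>2 7) (rarr \<sigma>2 3) (rarr \<sigma>2 4) (rarr \<sigma>2 5))"
        unfolding ee by (rule pl_representation_output) (use 2 in \<open>auto simp: D_def\<close>)
      show "wp copy_prog (\<lambda>l3 \<tau>. (\<exists>ps. outputs \<tau> ps \<and> pl_representation (end_to_end G A s d) ps) \<and>
        l1 + (l2 + l3) \<le> (19 * (n * n) + 3 * n + 17) + (?T * ?Z + 2 * K + 4) + (7 * ?Z + 6)) \<sigma>2"
      proof (rule wp_mono[OF wp_copy])
        fix l3 :: nat and \<tau>
        assume 3: "l3 \<le> 7 * nreg \<sigma>2 7 + 6 \<and>
          outputs \<tau> (output_pieces (nreg \<sigma>2 7) (rarr \<sigma>2 3) (rarr \<sigma>2 4) (rarr \<sigma>2 5))"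
        have "7 * nreg \<sigma>2 7 \<le> 7 * ?Z" using 2 by simp
        then have "l1 + (l2 + l3) \<le> (19 * (n * n) + 3 * n + 17) + (?T * ?Z + 2 * K + 4) + (7 * ?Z + 6)"
          using 1 2 3 sumK by linarith
        with 3 out show "(\<exists>ps. outputs \<tau> ps \<and> pl_representation (end_to_end G A s d) ps) \<and>
          l1 + (l2 + l3) \<le> (19 * (n * n) + 3 * n + 17) + (?T * ?Z + 2 * K + 4) + (7 * ?Z + 6)" by blast
      qed
    qed
  qed
  then obtain k \<tau> ps where run: "exec main_prog ?\<sigma> k \<tau>" "outputs \<tau> ps" "pl_representation (end_to_end G A s d) ps"
    and k: "k \<le> (19 * (n * n) + 3 * n + 17) + (?T * ?Z + 2 * K + 4) + (7 * ?Z + 6)"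
    unfolding wp_def by blast
  have "13 * (n + 1) * (n + m + 1) \<le> 13 * (n + 1) * (n + n * n + 1)"
    using mn by (intro mult_le_mono2) simp
  then have "?T + 7 \<le> 13 * (n + 1) * (n + n * n + 1) + 17 * (n * n) + 22"
    using mn by linarith
  then have "(?T + 7) * ?Z \<le> (13 * (n + 1) * (n + n * n + 1) + 17 * (n * n) + 22) * (n * p + K + 1)"
    using crit by (intro mult_mono) auto
  moreover have "?T * ?Z + 7 * ?Z = (?T + 7) * ?Z" by (rule distrib_right[symmetric])
  ultimately have "k \<le> 19 * (n * n) + 3 * n + 27 + (13 * (n + 1) * (n + n * n + 1) + 17 * (n * n) + 22) * (n * p + K + 1) + 2 * K"
    using k by linarith
  with run show ?thesis by blast
qed

text \<open>A round costs at most \<open>117 * n ^ 3\<close>, and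
  \<open>n * p + K + 1 \<le> 2 * n * (1 + K) * X\<close>. The three contributions
  \<open>20 + 234 + 2 = 256\<close> are multiples of \<open>n ^ 4 * (1 + K) * X\<close>, and
  \<open>256 = 2 ^ 8 \<le> n ^ 8\<close> leads to the exponent \<open>12\<close>.\<close>

lemma time_polynomial:
  fixes n :: nat and p K X :: real
  assumes n: "2 \<le> n" and X: "1 \<le> X" and K: "0 \<le> K" and p: "p \<le> (1 + K) * X"
  shows "19 * (real n * real n) + 3 * real n + 27 +
      (13 * (real n + 1) * (real n + real n * real n + 1) + 17 * (real n * real n) + 22) * (real n * p + K + 1) + 2 * K
    \<le> (1 + K) * (real n ^ 12 * X)"
proof -
  let ?n = "real n"
  have n2: "2 \<le> ?n" using n by simp
  have pow: "1 \<le> ?n" "?n \<le> ?n ^ 2" "?n ^ 2 \<le> ?n ^ 3" "?n ^ 3 \<le> ?n ^ 4"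
    using n2 power_increasing[of 1 2 ?n] power_increasing[of 2 3 ?n] power_increasing[of 3 4 ?n] by auto
  have T: "13 * (?n + 1) * (?n + ?n * ?n + 1) + 17 * (?n * ?n) + 22 \<le> 117 * ?n ^ 3"
  proof -
    have "13 * (?n + 1) * (?n + ?n * ?n + 1) + 17 * (?n * ?n) + 22 = 13 * ?n ^ 3 + 43 * ?n ^ 2 + 26 * ?n + 35"
      by (simp add: power2_eq_square power3_eq_cube algebra_simps)
    then show ?thesis using pow by linarith
  qed
  have KX: "1 + K \<le> (1 + K) * X" using X K mult_left_mono[of 1 X "1 + K"] by simp
  have "?n * p \<le> ?n * ((1 + K) * X)" using p n2 by (intro mult_left_mono) auto
  moreover have "1 * ((1 + K) * X) \<le> ?n * ((1 + K) * X)" using n2 K X by (intro mult_right_mono) auto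
  ultimately have "?n * p + K + 1 \<le> 2 * (?n * ((1 + K) * X))" using KX by linarith
  then have "(13 * (?n + 1) * (?n + ?n * ?n + 1) + 17 * (?n * ?n) + 22) * (?n * p + K + 1)
      \<le> (13 * (?n + 1) * (?n + ?n * ?n + 1) + 17 * (?n * ?n) + 22) * (2 * (?n * ((1 + K) * X)))"
    using n2 by (intro mult_left_mono) auto
  also have "\<dots> \<le> (117 * ?n ^ 3) * (2 * (?n * ((1 + K) * X)))"
    using T n2 K X by (intro mult_right_mono) auto
  also have "\<dots> = 234 * (?n ^ 4 * ((1 + K) * X))" by (simp add: power4_eq_xxxx power3_eq_cube)
  finally have main: "(13 * (?n + 1) * (?n + ?n * ?n + 1) + 17 * (?n * ?n) + 22) * (?n * p + K + 1)
      \<le> 234 * (?n ^ 4 * ((1 + K) * X))" .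
  have n4: "16 \<le> ?n ^ 4" using power_mono[OF n2, of 4] by simp
  have "1 * 1 \<le> (1 + K) * X" using K X by (intro mult_mono) auto
  then have "?n ^ 4 * 1 \<le> ?n ^ 4 * ((1 + K) * X)" by (intro mult_left_mono) auto
  moreover have "19 * (?n * ?n) + 3 * ?n + 27 \<le> 20 * ?n ^ 4"
  proof -
    have "4 * ?n ^ 2 \<le> ?n ^ 2 * ?n ^ 2" using power_mono[OF n2, of 2] by (intro mult_right_mono) auto
    then have "4 * ?n ^ 2 \<le> ?n ^ 4" by (simp add: power4_eq_xxxx power2_eq_square)
    then show ?thesis using pow n4 unfolding power2_eq_square[symmetric] by linarith
  qed
  moreover have "2 * K \<le> 2 * (?n ^ 4 * ((1 + K) * X))"
  proof -
    have "1 * ((1 + K) * X) \<le> ?n ^ 4 * ((1 + K) * X)" using n4 K X by (intro mult_right_mono) auto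
    then show ?thesis using KX by linarith
  qed
  moreover have "256 * (?n ^ 4 * ((1 + K) * X)) \<le> ?n ^ 8 * (?n ^ 4 * ((1 + K) * X))"
    using power_mono[OF n2, of 8] K X by (intro mult_right_mono) auto
  moreover have "?n ^ 8 * (?n ^ 4 * ((1 + K) * X)) = (1 + K) * (?n ^ 12 * X)"
    by (simp add: power_add[of ?n 8 4, simplified])
  ultimately show ?thesis using main by linarith
qed

text \<open>The factor in front counts the breakpoints of the input, whose number is not bounded in
  terms of \<open>n\<close> and \<open>w\<close>. The maximum with \<open>2\<close> keeps the
  exponent positive for \<open>w \<le> 1\<close>.\<close>

theorem theorem8:
  shows "\<exists>(prog :: com) (c :: real).
    \<forall>(n :: nat) (w :: nat) (G :: nat pair_pre_digraph)
      (A :: nat \<times> nat \<Rightarrow> ennreal \<Rightarrow> ennreal) (P :: nat \<times> nat \<Rightarrow> piece list) (s :: nat) (d :: nat).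
      pair_graph G \<and> pverts G = {..<n} \<and> treewidth G = w \<and>
      (\<forall>e\<in>parcs G. arrival_function (A e) \<and> continuous_on UNIV (A e) \<and>
         pl_representation (A e) (P e)) \<and>
      s \<in> pverts G \<and> d \<in> pverts G \<and> s \<noteq> d
      \<longrightarrow>
      (\<exists>k \<tau> ps. exec prog (input_state n G P s d) k \<tau> \<and>
         outputs \<tau> ps \<and> pl_representation (end_to_end G A s d) ps \<and>
         real k \<le> (1 + real (\<Sum>e\<in>parcs G. num_breakpoints (P e))) *
                   real n powr (c * (log 2 (real (max 2 w)))\<^sup>2))"
proof (rule exI[of _ main_prog], rule exI[of _ "2928 :: real"], intro allI impI, elim conjE)
  fix n w :: nat and G :: "nat pair_pre_digraph" and A :: "nat \<times> nat \<Rightarrow> ennreal \<Rightarrow> ennreal"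
    and P :: "nat \<times> nat \<Rightarrow> piece list" and s d :: nat
  assume G: "pair_graph G" "pverts G = {..<n}" and w: "treewidth G = w"
    and AP: "\<forall>e\<in>parcs G. arrival_function (A e) \<and> continuous_on UNIV (A e) \<and> pl_representation (A e) (P e)"
    and sd: "s \<in> pverts G" "d \<in> pverts G" "s \<noteq> d"
  interpret G: pair_graph G by (rule G(1))
  define K where "K = (\<Sum>e\<in>parcs G. num_breakpoints (P e))"
  define L where "L = log 2 (real (max 2 w))"
  define X where "X = real n powr (2916 * L\<^sup>2)"
  \<comment> \<open>Two distinct terminals give \<open>2 \<le> n\<close>, which is what allows
    constant factors to be absorbed by powers of \<open>n\<close>.\<close>
  have n: "2 \<le> n" "n = card (pverts G)" using sd G(2) by auto
  have L: "1 \<le> L" unfolding L_def by (subst le_log_iff) auto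
  have X: "1 \<le> X" unfolding X_def using n by (intro ge_one_powr_ge_zero) auto
  \<comment> \<open>The total number of breakpoints serves as a uniform bound for every edge; this
    already gives a factor linear in \<open>1 + K\<close>.\<close>
  have A: "pieces (Suc K) (A e)" if e: "e \<in> parcs G" for e
  proof -
    have "num_breakpoints (P e) \<le> K" unfolding K_def using e G.pair_finite_arcs by (intro member_le_sum) auto
    then have "length (P e) \<le> Suc K" by (simp add: num_breakpoints_def)
    then show ?thesis using AP e by (intro pieces_mono[OF pieces_pl]) auto
  qed
  define p where "p = nat \<lfloor>real (Suc K) * X\<rfloor>"
  have p: "real p \<le> (1 + real K) * X" unfolding p_def using X by (simp add: mult_nonneg_nonneg)
  have pieces: "pieces (Suc p) (earliest (parcs G) A s v)" if v: "v < n" for v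
  proof -
    have "v \<in> pverts G" using v G(2) by simp
    obtain q where q: "pieces q (earliest (parcs G) A s v)"
      "real q \<le> real (Suc K) * real n powr (2916 * (log 2 (real (max 2 (treewidth G))))\<^sup>2)"
      by (rule pieces_earliest_treewidth[OF G(1) n(2,1) zero_less_Suc A sd(1) \<open>v \<in> pverts G\<close>])
    have "real q \<le> real (Suc K) * X" using q(2) by (simp add: X_def L_def w)
    then have "q \<le> p" unfolding p_def by linarith
    then show ?thesis by (intro pieces_mono[OF q(1)]) simp
  qed
  have "s < n" "d < n" using sd G(2) by auto
  from main_correct[OF G this _ _ _ pieces, of P] AP
  obtain k \<tau> ps where run: "exec main_prog (input_state n G P s d) k \<tau>" "outputs \<tau> ps"
      "pl_representation (end_to_end G A s d) ps"
    and k: "k \<le> 19 * (n * n) + 3 * n + 27 + (13 * (n + 1) * (n + n * n + 1) + 17 * (n * n) + 22) * (n * p + K + 1) + 2 * K"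
    unfolding K_def by blast
  have "real k \<le> real (19 * (n * n) + 3 * n + 27 + (13 * (n + 1) * (n + n * n + 1) + 17 * (n * n) + 22) * (n * p + K + 1) + 2 * K)"
    using k by (simp only: of_nat_le_iff)
  also have "\<dots> = 19 * (real n * real n) + 3 * real n + 27 +
      (13 * (real n + 1) * (real n + real n * real n + 1) + 17 * (real n * real n) + 22) * (real n * real p + real K + 1) + 2 * real K"
    by (simp only: of_nat_add of_nat_mult of_nat_numeral of_nat_1)
  also have "\<dots> \<le> (1 + real K) * (real n ^ 12 * X)" by (rule time_polynomial[OF n(1) X _ p]) simp
  also have "real n ^ 12 * X = real n powr (12 + 2916 * L\<^sup>2)"
  proof -
    have "real n ^ 12 = real n powr 12" using powr_realpow[of "real n" 12] n by simp
    then show ?thesis unfolding X_def powr_add by (rule arg_cong2[where f = "(*)", OF _ refl])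
  qed
  also have "(1 + real K) * \<dots> \<le> (1 + real K) * real n powr (2928 * L\<^sup>2)"
  proof (intro mult_left_mono powr_mono)
    \<comment> \<open>The constant is \<open>2928 = 2916 + 12\<close>: since
      \<open>L \<ge> 1\<close>, the polynomial factor \<open>n ^ 12\<close> disappears in the
      exponent.\<close>
    have "1 \<le> L\<^sup>2" using L by (simp add: one_le_power)
    then show "12 + 2916 * L\<^sup>2 \<le> 2928 * L\<^sup>2" by simp
  qed (use n in auto)
  finally show "\<exists>k \<tau> ps. exec main_prog (input_state n G P s d) k \<tau> \<and> outputs \<tau> ps \<and>
      pl_representation (end_to_end G A s d) ps \<and>
      real k \<le> (1 + real (\<Sum>e\<in>parcs G. num_breakpoints (P e))) *
        real n powr (2928 * (log 2 (real (max 2 w)))\<^sup>2)"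
    using run unfolding K_def L_def by blast
qed

end
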